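(* Let $\mathcal G$ be an amenable étale groupoid with locally compact unit space $X$. If $C^*(\mathcal G)$ is RFD, then $X$ admits a dense set of periodic points. Conversely, if $X$ admits a dense set of periodic points with MAP isotropy subgroups, then $C^*(\mathcal G)$ is RFD.
   Context: All topological groupoids are assumed locally compact, étale, Hausdorff and second-countable; "amenable" means topologically amenable. $C^*(\mathcal G)$ is the full groupoid C*-algebra (for amenable $\mathcal G$ it coincides with the reduced one). For $x,y\in X=\mathcal G^{(0)}$ let $\mathcal G_x^y=\{\gamma\in\mathcal G: s(\gamma)=x,\ r(\gamma)=y\}$; $\mathcal G_x^x$ is the isotropy subgroup at $x$ (a discrete group). Write $x\approx y$ if $\mathcal G_x^y\neq\emptyset$; the equivalence classes are called orbits, and $x$ is periodic if its orbit is finite. A C*-algebra is RFD (residually finite-dimensional) if its finite-dimensional representations separate its points. A discrete group is MAP if its finite-dimensional unitary representations separate its points. In the second assertion the hypothesis is that the set of periodic points $x\in X$ for which $\mathcal G_x^x$ is MAP is dense in $X$. *)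

theory Defs
  imports
    "HOL-Analysis.Analysis"
    "HOL-Algebra.Group"
    "Jordan_Normal_Form.Schur_Decomposition"
begin

unbundle no m_inv_syntax

text \<open>
  A groupoid is presented by its arrows, the unit space being the set of identity arrows.
  The composite \<open>gcomp G \<gamma> \<delta>\<close> is meaningful when \<open>gsrc G \<gamma> = grng G \<delta>\<close>. The arrow set is the
  underlying set of the topology; the operations are arbitrary outside of it.
\<close>

record 'g groupoid =
  gtop  :: "'g topology"
  gsrc  :: "'g \<Rightarrow> 'g"
  grng  :: "'g \<Rightarrow> 'g"
  gcomp :: "'g \<Rightarrow> 'g \<Rightarrow> 'g"
  ginv  :: "'g \<Rightarrow> 'g"

definition arrows :: "'g groupoid \<Rightarrow> 'g set" where
  "arrows G = topspace (gtop G)"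

definition units :: "'g groupoid \<Rightarrow> 'g set" where
  "units G = gsrc G ` arrows G"

definition unit_space :: "'g groupoid \<Rightarrow> 'g topology" where
  "unit_space G = subtopology (gtop G) (units G)"

definition composable :: "'g groupoid \<Rightarrow> ('g \<times> 'g) set" where
  "composable G = {(\<gamma>, \<delta>). \<gamma> \<in> arrows G \<and> \<delta> \<in> arrows G \<and> gsrc G \<gamma> = grng G \<delta>}"

definition local_homeomorphism :: "'a topology \<Rightarrow> 'b topology \<Rightarrow> ('a \<Rightarrow> 'b) \<Rightarrow> bool" where
  "local_homeomorphism S T f \<longleftrightarrow>
     (\<forall>x \<in> topspace S. \<exists>U. openin S U \<and> x \<in> U \<and> openin T (f ` U) \<and>
        homeomorphic_map (subtopology S U) (subtopology T (f ` U)) f)"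

locale algebraic_groupoid =
  fixes G :: "'g groupoid"
  assumes src_closed: "\<gamma> \<in> arrows G \<Longrightarrow> gsrc G \<gamma> \<in> arrows G"
    and rng_closed: "\<gamma> \<in> arrows G \<Longrightarrow> grng G \<gamma> \<in> arrows G"
    and inv_closed: "\<gamma> \<in> arrows G \<Longrightarrow> ginv G \<gamma> \<in> arrows G"
    and comp_closed: "(\<gamma>, \<delta>) \<in> composable G \<Longrightarrow> gcomp G \<gamma> \<delta> \<in> arrows G"
    and src_src: "\<gamma> \<in> arrows G \<Longrightarrow> gsrc G (gsrc G \<gamma>) = gsrc G \<gamma>"
    and rng_src: "\<gamma> \<in> arrows G \<Longrightarrow> grng G (gsrc G \<gamma>) = gsrc G \<gamma>"
    and src_rng: "\<gamma> \<in> arrows G \<Longrightarrow> gsrc G (grng G \<gamma>) = grng G \<gamma>"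
    and rng_rng: "\<gamma> \<in> arrows G \<Longrightarrow> grng G (grng G \<gamma>) = grng G \<gamma>"
    and src_comp: "(\<gamma>, \<delta>) \<in> composable G \<Longrightarrow> gsrc G (gcomp G \<gamma> \<delta>) = gsrc G \<delta>"
    and rng_comp: "(\<gamma>, \<delta>) \<in> composable G \<Longrightarrow> grng G (gcomp G \<gamma> \<delta>) = grng G \<gamma>"
    and comp_assoc: "(\<gamma>, \<delta>) \<in> composable G \<Longrightarrow> (\<delta>, \<eta>) \<in> composable G \<Longrightarrow>
          gcomp G (gcomp G \<gamma> \<delta>) \<eta> = gcomp G \<gamma> (gcomp G \<delta> \<eta>)"
    and comp_src: "\<gamma> \<in> arrows G \<Longrightarrow> gcomp G \<gamma> (gsrc G \<gamma>) = \<gamma>"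
    and rng_comp_id: "\<gamma> \<in> arrows G \<Longrightarrow> gcomp G (grng G \<gamma>) \<gamma> = \<gamma>"
    and src_inv: "\<gamma> \<in> arrows G \<Longrightarrow> gsrc G (ginv G \<gamma>) = grng G \<gamma>"
    and rng_inv: "\<gamma> \<in> arrows G \<Longrightarrow> grng G (ginv G \<gamma>) = gsrc G \<gamma>"
    and inv_comp: "\<gamma> \<in> arrows G \<Longrightarrow> gcomp G (ginv G \<gamma>) \<gamma> = gsrc G \<gamma>"
    and comp_inv: "\<gamma> \<in> arrows G \<Longrightarrow> gcomp G \<gamma> (ginv G \<gamma>) = grng G \<gamma>"

locale etale_groupoid = algebraic_groupoid G for G :: "'g groupoid" +
  assumes continuous_comp:
      "continuous_map (subtopology (prod_topology (gtop G) (gtop G)) (composable G)) (gtop G)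
         (\<lambda>(\<gamma>, \<delta>). gcomp G \<gamma> \<delta>)"
    and continuous_inv: "continuous_map (gtop G) (gtop G) (ginv G)"
    and etale_src: "local_homeomorphism (gtop G) (unit_space G) (gsrc G)"
    and etale_rng: "local_homeomorphism (gtop G) (unit_space G) (grng G)"
    and hausdorff: "Hausdorff_space (gtop G)"
    and locally_compact: "locally_compact_space (gtop G)"
    and second_countable: "second_countable (gtop G)"

definition orbit :: "'g groupoid \<Rightarrow> 'g \<Rightarrow> 'g set" where
  "orbit G x = {y \<in> units G. \<exists>\<gamma> \<in> arrows G. gsrc G \<gamma> = x \<and> grng G \<gamma> = y}"

definition periodic :: "'g groupoid \<Rightarrow> 'g \<Rightarrow> bool" where
  "periodic G x \<longleftrightarrow> x \<in> units G \<and> finite (orbit G x)"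

definition isotropy :: "'g groupoid \<Rightarrow> 'g \<Rightarrow> 'g monoid" where
  "isotropy G x =
     \<lparr>carrier = {\<gamma> \<in> arrows G. gsrc G \<gamma> = x \<and> grng G \<gamma> = x}, mult = gcomp G, one = x\<rparr>"

definition range_fibre :: "'g groupoid \<Rightarrow> 'g \<Rightarrow> 'g set" where
  "range_fibre G x = {\<gamma> \<in> arrows G. grng G \<gamma> = x}"

text \<open>Functions on the arrows are extended by \<open>0\<close> to the whole type.\<close>

definition Cc :: "'g groupoid \<Rightarrow> ('g \<Rightarrow> 'b::real_normed_vector) set" where
  "Cc G = {f. continuous_map (gtop G) euclidean f \<and> (\<forall>\<gamma>. \<gamma> \<notin> arrows G \<longrightarrow> f \<gamma> = 0) \<and>
              compactin (gtop G) (gtop G closure_of {\<gamma> \<in> arrows G. f \<gamma> \<noteq> 0})}"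

text \<open>
  Topological amenability of an etale groupoid: there is a net of nonnegative functions in
  \<open>C\<^sub>c(G)\<close> whose sums over the range fibres tend to \<open>1\<close> uniformly on compact sets of units and
  which is asymptotically invariant in \<open>\<ell>\<^sup>1\<close>, uniformly on compact sets of arrows. The net is
  taken to be indexed by the triples \<open>(K, L, \<epsilon>)\<close>. For fixed \<open>g\<close> all the sums have only finitely
  many nonzero terms.
\<close>

definition topologically_amenable :: "'g groupoid \<Rightarrow> bool" where
  "topologically_amenable G \<longleftrightarrow>
     (\<forall>K L. \<forall>\<epsilon>::real. compactin (unit_space G) K \<and> compactin (gtop G) L \<and> 0 < \<epsilon> \<longrightarrow>
       (\<exists>g \<in> Cc G. (\<forall>\<gamma>. 0 \<le> (g \<gamma> :: real)) \<and>
          (\<forall>x \<in> K. \<bar>(\<Sum>\<^sub>\<infinity>\<gamma>\<in>range_fibre G x. g \<gamma>) - 1\<bar> < \<epsilon>) \<and>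
          (\<forall>\<alpha> \<in> L. (\<Sum>\<^sub>\<infinity>\<gamma>\<in>range_fibre G (grng G \<alpha>).
                       \<bar>g (gcomp G (ginv G \<alpha>) \<gamma>) - g \<gamma>\<bar>) < \<epsilon>)))"

text \<open>HOL-Algebra rings are unital, whereas \<open>C\<^sub>c(G)\<close> in general is not.\<close>

record 'a star_algebra =
  acar   :: "'a set"
  azero  :: 'a
  aadd   :: "'a \<Rightarrow> 'a \<Rightarrow> 'a"
  ascale :: "complex \<Rightarrow> 'a \<Rightarrow> 'a"
  amult  :: "'a \<Rightarrow> 'a \<Rightarrow> 'a"
  astar  :: "'a \<Rightarrow> 'a"

record 'a normed_star_algebra = "'a star_algebra" +
  anorm :: "'a \<Rightarrow> real"

definition matrix_representation ::
    "('a, 'm) star_algebra_scheme \<Rightarrow> nat \<Rightarrow> ('a \<Rightarrow> complex mat) \<Rightarrow> bool" where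
  "matrix_representation A n \<pi> \<longleftrightarrow>
     (\<forall>a \<in> acar A. \<pi> a \<in> carrier_mat n n) \<and>
     (\<forall>a \<in> acar A. \<forall>b \<in> acar A. \<pi> (aadd A a b) = \<pi> a + \<pi> b) \<and>
     (\<forall>c. \<forall>a \<in> acar A. \<pi> (ascale A c a) = c \<cdot>\<^sub>m \<pi> a) \<and>
     (\<forall>a \<in> acar A. \<forall>b \<in> acar A. \<pi> (amult A a b) = \<pi> a * \<pi> b) \<and>
     (\<forall>a \<in> acar A. \<pi> (astar A a) = mat_adjoint (\<pi> a))"

definition residually_finite_dimensional :: "('a, 'm) star_algebra_scheme \<Rightarrow> bool" where
  "residually_finite_dimensional A \<longleftrightarrow>
     (\<forall>a \<in> acar A. \<forall>b \<in> acar A. a \<noteq> b \<longrightarrow> (\<exists>n \<pi>. matrix_representation A n \<pi> \<and> \<pi> a \<noteq> \<pi> b))"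

text \<open>
  For \<open>I \<subseteq> \<nat>\<close>, the spaces \<open>\<ell>\<^sup>2(I)\<close> are, up to unitary equivalence, all separable Hilbert spaces.
\<close>

definition ell2 :: "nat set \<Rightarrow> (nat \<Rightarrow> complex) set" where
  "ell2 I = {v. (\<forall>i. i \<notin> I \<longrightarrow> v i = 0) \<and> (\<lambda>i. (cmod (v i))\<^sup>2) summable_on I}"

definition ell2_inner :: "nat set \<Rightarrow> (nat \<Rightarrow> complex) \<Rightarrow> (nat \<Rightarrow> complex) \<Rightarrow> complex" where
  "ell2_inner I v w = (\<Sum>\<^sub>\<infinity>i\<in>I. cnj (v i) * w i)"

definition ell2_norm :: "nat set \<Rightarrow> (nat \<Rightarrow> complex) \<Rightarrow> real" where
  "ell2_norm I v = sqrt (\<Sum>\<^sub>\<infinity>i\<in>I. (cmod (v i))\<^sup>2)"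

definition bounded_operator :: "nat set \<Rightarrow> ((nat \<Rightarrow> complex) \<Rightarrow> (nat \<Rightarrow> complex)) \<Rightarrow> bool" where
  "bounded_operator I T \<longleftrightarrow>
     (\<forall>v \<in> ell2 I. T v \<in> ell2 I) \<and>
     (\<forall>v \<in> ell2 I. \<forall>w \<in> ell2 I. T (\<lambda>i. v i + w i) = (\<lambda>i. T v i + T w i)) \<and>
     (\<forall>c. \<forall>v \<in> ell2 I. T (\<lambda>i. c * v i) = (\<lambda>i. c * T v i)) \<and>
     (\<exists>C. \<forall>v \<in> ell2 I. ell2_norm I (T v) \<le> C * ell2_norm I v)"

definition operator_norm :: "nat set \<Rightarrow> ((nat \<Rightarrow> complex) \<Rightarrow> (nat \<Rightarrow> complex)) \<Rightarrow> real" where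
  "operator_norm I T = (SUP v \<in> {v \<in> ell2 I. ell2_norm I v \<le> 1}. ell2_norm I (T v))"

definition hilbert_representation ::
    "('a, 'm) star_algebra_scheme \<Rightarrow> nat set \<Rightarrow> ('a \<Rightarrow> (nat \<Rightarrow> complex) \<Rightarrow> (nat \<Rightarrow> complex)) \<Rightarrow> bool"
  where
  "hilbert_representation A I \<pi> \<longleftrightarrow>
     (\<forall>a \<in> acar A. bounded_operator I (\<pi> a)) \<and>
     (\<forall>a \<in> acar A. \<forall>b \<in> acar A. \<forall>v \<in> ell2 I. \<pi> (aadd A a b) v = (\<lambda>i. \<pi> a v i + \<pi> b v i)) \<and>
     (\<forall>c. \<forall>a \<in> acar A. \<forall>v \<in> ell2 I. \<pi> (ascale A c a) v = (\<lambda>i. c * \<pi> a v i)) \<and>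
     (\<forall>a \<in> acar A. \<forall>b \<in> acar A. \<forall>v \<in> ell2 I. \<pi> (amult A a b) v = \<pi> a (\<pi> b v)) \<and>
     (\<forall>a \<in> acar A. \<forall>v \<in> ell2 I. \<forall>w \<in> ell2 I.
        ell2_inner I (\<pi> (astar A a) v) w = ell2_inner I v (\<pi> a w))"

text \<open>
  The supremum of \<open>\<parallel>\<pi>(a)\<parallel>\<close> over all representations on separable Hilbert spaces. For \<open>C\<^sub>c(G)\<close>
  with \<open>G\<close> etale it is finite, and for \<open>G\<close> second countable separable spaces suffice: \<open>C\<^sub>c(G)\<close> has
  a countable subset dense for the inductive limit topology, so every cyclic representation is
  separable, and \<open>\<parallel>\<pi>(a)\<parallel>\<close> is the supremum of its values on the cyclic subrepresentations of \<open>\<pi>\<close>.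
\<close>

definition universal_norm :: "('a, 'm) star_algebra_scheme \<Rightarrow> 'a \<Rightarrow> real" where
  "universal_norm A a =
     Sup {operator_norm I (\<pi> a) | I \<pi>. hilbert_representation A I \<pi>}"

definition seminorm_dist :: "('a, 'm) star_algebra_scheme \<Rightarrow> ('a \<Rightarrow> real) \<Rightarrow> 'a \<Rightarrow> 'a \<Rightarrow> real" where
  "seminorm_dist A p a b = p (aadd A a (ascale A (-1) b))"

definition cauchy_sequences ::
    "('a, 'm) star_algebra_scheme \<Rightarrow> ('a \<Rightarrow> real) \<Rightarrow> (nat \<Rightarrow> 'a) set" where
  "cauchy_sequences A p =
     {u. (\<forall>n. u n \<in> acar A) \<and>
         (\<forall>\<epsilon>>0. \<exists>N. \<forall>m\<ge>N. \<forall>n\<ge>N. seminorm_dist A p (u m) (u n) < \<epsilon>)}"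

definition null_difference ::
    "('a, 'm) star_algebra_scheme \<Rightarrow> ('a \<Rightarrow> real) \<Rightarrow> ((nat \<Rightarrow> 'a) \<times> (nat \<Rightarrow> 'a)) set" where
  "null_difference A p =
     {(u, v). u \<in> cauchy_sequences A p \<and> v \<in> cauchy_sequences A p \<and>
              (\<lambda>n. seminorm_dist A p (u n) (v n)) \<longlonglongrightarrow> 0}"

text \<open>
  The Hausdorff completion of \<open>A\<close> for a seminorm \<open>p\<close>: Cauchy sequences modulo null sequences.
\<close>

definition completion ::
    "('a, 'm) star_algebra_scheme \<Rightarrow> ('a \<Rightarrow> real) \<Rightarrow> (nat \<Rightarrow> 'a) set normed_star_algebra" where
  "completion A p =
     (let R = null_difference A p in
      \<lparr>acar = cauchy_sequences A p // R,
       azero = R `` {\<lambda>n. azero A},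
       aadd = (\<lambda>U V. \<Union>u\<in>U. \<Union>v\<in>V. R `` {\<lambda>n. aadd A (u n) (v n)}),
       ascale = (\<lambda>c U. \<Union>u\<in>U. R `` {\<lambda>n. ascale A c (u n)}),
       amult = (\<lambda>U V. \<Union>u\<in>U. \<Union>v\<in>V. R `` {\<lambda>n. amult A (u n) (v n)}),
       astar = (\<lambda>U. \<Union>u\<in>U. R `` {\<lambda>n. astar A (u n)}),
       anorm = (\<lambda>U. THE l. \<forall>u\<in>U. (\<lambda>n. p (u n)) \<longlonglongrightarrow> l)\<rparr>)"

definition convolution ::
    "'g groupoid \<Rightarrow> ('g \<Rightarrow> complex) \<Rightarrow> ('g \<Rightarrow> complex) \<Rightarrow> 'g \<Rightarrow> complex" where
  "convolution G f g \<gamma> =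
     (if \<gamma> \<in> arrows G
      then \<Sum>\<^sub>\<infinity>\<alpha>\<in>range_fibre G (grng G \<gamma>). f \<alpha> * g (gcomp G (ginv G \<alpha>) \<gamma>)
      else 0)"

definition involution :: "'g groupoid \<Rightarrow> ('g \<Rightarrow> complex) \<Rightarrow> 'g \<Rightarrow> complex" where
  "involution G f \<gamma> = (if \<gamma> \<in> arrows G then cnj (f (ginv G \<gamma>)) else 0)"

definition convolution_algebra :: "'g groupoid \<Rightarrow> ('g \<Rightarrow> complex) star_algebra" where
  "convolution_algebra G =
     \<lparr>acar = Cc G, azero = (\<lambda>\<gamma>. 0), aadd = (\<lambda>f g \<gamma>. f \<gamma> + g \<gamma>), ascale = (\<lambda>c f \<gamma>. c * f \<gamma>),
      amult = convolution G, astar = involution G\<rparr>"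

definition full_cstar_algebra ::
    "'g groupoid \<Rightarrow> (nat \<Rightarrow> 'g \<Rightarrow> complex) set normed_star_algebra" where
  "full_cstar_algebra G =
     completion (convolution_algebra G) (universal_norm (convolution_algebra G))"

definition unitary_group :: "nat \<Rightarrow> complex mat monoid" where
  "unitary_group n =
     \<lparr>carrier = {U \<in> carrier_mat n n. U * mat_adjoint U = 1\<^sub>m n \<and> mat_adjoint U * U = 1\<^sub>m n},
      mult = (*), one = 1\<^sub>m n\<rparr>"

definition maximally_almost_periodic :: "('a, 'm) monoid_scheme \<Rightarrow> bool" where
  "maximally_almost_periodic H \<longleftrightarrow>
     (\<forall>g \<in> carrier H. \<forall>h \<in> carrier H. g \<noteq> h \<longrightarrow>
        (\<exists>n. \<exists>\<rho> \<in> hom H (unitary_group n). \<rho> g \<noteq> \<rho> h))"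

definition dense_in :: "'a topology \<Rightarrow> 'a set \<Rightarrow> bool" where
  "dense_in T S \<longleftrightarrow> S \<subseteq> topspace T \<and> T closure_of S = topspace T"

end

theory Submission
  imports Defs
begin

text \<open>
  Suppose first that the full algebra is residually finite-dimensional. A finite-dimensional
  representation \<open>\<pi>\<close> of \<open>C\<^sub>c(G)\<close>, restricted to the functions on the unit space, is a commuting family of
  matrices, so its spectrum is a finite set of units (\<open>finite_spectrum\<close>). This set is invariant:
  conjugation by a function supported in a bisection moves a unit along the bisection
  (\<open>spectrum_invariant\<close>). It therefore consists of periodic points, and \<open>\<pi>\<close> annihilates every function
  supported off it (\<open>vanishing_off_spectrum\<close>). If a nonempty open set of units contained no periodic point,
  then all finite-dimensional representations would annihilate a nonzero function supported there,
  although its norm is positive by the regular representations (\<open>universal_norm_pos\<close>).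

  For the converse it is enough that the finite-dimensional representations compute the universal norm
  of every \<open>f\<close> in \<open>C\<^sub>c(G)\<close> (\<open>residually_finite_dimensional_completionI\<close>). Let \<open>C\<close> bound the norms of \<open>f\<close>
  in them.

  At a periodic point \<open>x\<close> with maximally almost periodic isotropy, the finite corners of the
  regular representation of \<open>f\<close> are bounded by \<open>C\<close> (\<open>regular_form_bound\<close>). Indeed the normalised trace
  of a suitable finite-dimensional unitary representation \<open>U\<close> of the isotropy group is close to \<open>0\<close> on
  any given finite set of elements other than the identity (\<open>small_characters\<close>, by tensor powers). The
  representation induced from \<open>U\<close> acts on a finite-dimensional space because the orbit is finite, and averaged
  over the columns of \<open>U\<close> its coefficients approximate those of the regular representation.

  Amenability passes from the regular representations to an arbitrary representation \<open>\<pi>\<close>. It provides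
  \<open>\<xi> \<ge> 0\<close> in \<open>C\<^sub>c(G)\<close>, almost normalised on the range fibres, such that \<open>h = \<xi> * \<xi>\<^sup>*\<close> is close to \<open>1\<close> on the
  support of \<open>f\<close> (\<open>amenable_weight\<close>). Cutting \<open>\<xi>\<close> into pieces \<open>p\<^sub>i\<close> supported in bisections, the pointwise
  product \<open>h f\<close> becomes the convolution product \<open>\<Sum>\<^sub>i\<^sub>j p\<^sub>i * k\<^sub>i\<^sub>j * p\<^sub>j\<^sup>*\<close>, where the matrix
  \<open>k\<^sub>i\<^sub>j(x)\<close> of functions on the unit space is a compression of the regular representation of \<open>f\<close> at \<open>x\<close>
  (\<open>product_factorisation\<close>). Its norm is at most \<open>C\<close> for the points \<open>x\<close> of the given dense set, hence
  everywhere by continuity, and the row of the \<open>p\<^sub>i\<close> has norm close to \<open>1\<close>. So \<open>\<pi>(h f)\<close> has norm close to at most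
  \<open>C\<close> (\<open>compressed_product_bound\<close>), while \<open>f - h f\<close> is uniformly small with fixed support, hence small
  in every representation (\<open>rep_bound_compact\<close>).
\<close>

section \<open>The Hilbert space of square-summable functions\<close>

lemma ell2_summable: "v \<in> ell2 I \<Longrightarrow> (\<lambda>i. (cmod (v i))\<^sup>2) summable_on I"
  by (simp add: ell2_def)

lemma ell2_outside: "v \<in> ell2 I \<Longrightarrow> i \<notin> I \<Longrightarrow> v i = 0"
  by (simp add: ell2_def)

lemma ell2_abs_summable_inner:
  assumes "v \<in> ell2 I" "w \<in> ell2 I"
  shows "(\<lambda>i. cmod (cnj (v i) * w i)) summable_on I"
proof (rule summable_on_comparison_test)
  show "(\<lambda>i. (cmod (v i))\<^sup>2 + (cmod (w i))\<^sup>2) summable_on I"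
    using assms by (intro summable_on_add) (simp_all add: ell2_summable)
  show "cmod (cnj (v i) * w i) \<le> (cmod (v i))\<^sup>2 + (cmod (w i))\<^sup>2" for i
    using sum_squares_bound[of "cmod (v i)" "cmod (w i)"]
      mult_nonneg_nonneg[OF norm_ge_zero norm_ge_zero, of "v i" "w i"]
    unfolding norm_mult complex_mod_cnj by linarith
qed simp

lemma ell2_summable_inner:
  assumes "v \<in> ell2 I" "w \<in> ell2 I"
  shows "(\<lambda>i. cnj (v i) * w i) summable_on I"
  by (rule Infinite_Sum.abs_summable_summable) (rule ell2_abs_summable_inner[OF assms])

lemma ell2_zero [simp]: "(\<lambda>i. 0) \<in> ell2 I"
  by (simp add: ell2_def)

lemma ell2_add:
  assumes "v \<in> ell2 I" "w \<in> ell2 I"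
  shows "(\<lambda>i. v i + w i) \<in> ell2 I"
proof -
  have "(\<lambda>i. (cmod (v i + w i))\<^sup>2) summable_on I"
  proof (rule summable_on_comparison_test)
    show "(\<lambda>i. 2 * (cmod (v i))\<^sup>2 + 2 * (cmod (w i))\<^sup>2) summable_on I"
      using assms by (intro summable_on_add summable_on_cmult_right) (simp_all add: ell2_summable)
    show "(cmod (v i + w i))\<^sup>2 \<le> 2 * (cmod (v i))\<^sup>2 + 2 * (cmod (w i))\<^sup>2" for i
    proof -
      have "(cmod (v i + w i))\<^sup>2 \<le> (cmod (v i) + cmod (w i))\<^sup>2"
        by (simp add: norm_triangle_ineq power_mono)
      also have "\<dots> \<le> 2 * (cmod (v i))\<^sup>2 + 2 * (cmod (w i))\<^sup>2"
        using sum_squares_bound[of "cmod (v i)" "cmod (w i)"] by (simp add: power2_sum)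
      finally show ?thesis .
    qed
  qed auto
  then show ?thesis using assms by (auto simp: ell2_def)
qed

lemma ell2_scale:
  assumes "v \<in> ell2 I"
  shows "(\<lambda>i. c * v i) \<in> ell2 I"
  using assms by (auto simp: ell2_def norm_mult power_mult_distrib intro!: summable_on_cmult_right)

lemma ell2_sum:
  assumes "\<And>k. k \<in> S \<Longrightarrow> v k \<in> ell2 I"
  shows "(\<lambda>i. \<Sum>k\<in>S. v k i) \<in> ell2 I"
  using assms by (induction S rule: infinite_finite_induct) (auto intro: ell2_add)

lemma ell2_inner_commute: "cnj (ell2_inner I v w) = ell2_inner I w v"
  unfolding ell2_inner_def by (simp flip: infsum_cnj add: mult.commute)

lemma ell2_inner_add_right:
  assumes "u \<in> ell2 I" "v \<in> ell2 I" "w \<in> ell2 I"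
  shows "ell2_inner I u (\<lambda>i. v i + w i) = ell2_inner I u v + ell2_inner I u w"
  unfolding ell2_inner_def
  using infsum_add[OF ell2_summable_inner[OF assms(1,2)] ell2_summable_inner[OF assms(1,3)]]
  by (simp add: distrib_left)

lemma ell2_inner_scale_right: "ell2_inner I v (\<lambda>i. c * w i) = c * ell2_inner I v w"
  unfolding ell2_inner_def by (simp add: mult.left_commute infsum_cmult_right')

lemma ell2_inner_zero_right [simp]: "ell2_inner I v (\<lambda>i. 0) = 0"
  by (simp add: ell2_inner_def)

lemma ell2_inner_sum_right:
  assumes "u \<in> ell2 I" "\<And>k. k \<in> S \<Longrightarrow> v k \<in> ell2 I"
  shows "ell2_inner I u (\<lambda>i. \<Sum>k\<in>S. v k i) = (\<Sum>k\<in>S. ell2_inner I u (v k))"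
  using assms(2)
proof (induction S rule: infinite_finite_induct)
  case (insert x F)
  then show ?case
    using ell2_inner_add_right[OF assms(1), of "v x" "\<lambda>i. \<Sum>k\<in>F. v k i"] ell2_sum[of F v I] by simp
qed auto

lemma ell2_inner_add_left:
  assumes "u \<in> ell2 I" "v \<in> ell2 I" "w \<in> ell2 I"
  shows "ell2_inner I (\<lambda>i. v i + w i) u = ell2_inner I v u + ell2_inner I w u"
  using ell2_inner_add_right[OF assms] by (metis complex_cnj_add ell2_inner_commute)

lemma ell2_inner_scale_left: "ell2_inner I (\<lambda>i. c * v i) w = cnj c * ell2_inner I v w"
  using ell2_inner_scale_right[of I w c v] by (metis complex_cnj_mult ell2_inner_commute)

lemma ell2_norm_nonneg [simp]: "0 \<le> ell2_norm I v"
  by (simp add: ell2_norm_def infsum_nonneg)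

lemma ell2_norm_power2: "(ell2_norm I v)\<^sup>2 = (\<Sum>\<^sub>\<infinity>i\<in>I. (cmod (v i))\<^sup>2)"
  by (simp add: ell2_norm_def infsum_nonneg)

lemma ell2_norm_zero [simp]: "ell2_norm I (\<lambda>i. 0) = 0"
  by (simp add: ell2_norm_def)

lemma ell2_inner_self:
  assumes "v \<in> ell2 I"
  shows "ell2_inner I v v = of_real ((ell2_norm I v)\<^sup>2)"
proof -
  have "ell2_inner I v v = (\<Sum>\<^sub>\<infinity>i\<in>I. complex_of_real ((cmod (v i))\<^sup>2))"
    unfolding ell2_inner_def complex_norm_square by (simp add: mult.commute)
  also have "\<dots> = of_real (\<Sum>\<^sub>\<infinity>i\<in>I. (cmod (v i))\<^sup>2)"
    using has_sum_of_real[OF has_sum_infsum[OF ell2_summable[OF assms]]] infsumI by blast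
  finally show ?thesis by (simp only: ell2_norm_power2)
qed

lemma ell2_norm_scale: "ell2_norm I (\<lambda>i. c * v i) = cmod c * ell2_norm I v"
  unfolding ell2_norm_def
  by (simp add: norm_mult power_mult_distrib infsum_cmult_right' real_sqrt_mult)

lemma ell2_norm_eq_0_imp:
  assumes "v \<in> ell2 I" "ell2_norm I v = 0"
  shows "v = (\<lambda>i. 0)"
proof
  fix i
  have "(\<Sum>\<^sub>\<infinity>i\<in>I. (cmod (v i))\<^sup>2) \<le> 0"
    using assms(2) ell2_norm_power2[of I v] by simp
  then show "v i = 0"
    using nonneg_infsum_le_0D[of "\<lambda>i. (cmod (v i))\<^sup>2" I i] ell2_summable[OF assms(1)]
      ell2_outside[OF assms(1)] by (cases "i \<in> I") auto
qed

lemma ell2_inner_le_squares: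
  assumes "v \<in> ell2 I" "w \<in> ell2 I"
  shows "cmod (ell2_inner I v w) \<le> ((ell2_norm I v)\<^sup>2 + (ell2_norm I w)\<^sup>2) / 2"
proof -
  have "cmod (ell2_inner I v w) \<le> (\<Sum>\<^sub>\<infinity>i\<in>I. cmod (cnj (v i) * w i))"
    unfolding ell2_inner_def by (rule norm_infsum_bound) (rule ell2_abs_summable_inner[OF assms])
  also have "\<dots> \<le> (\<Sum>\<^sub>\<infinity>i\<in>I. ((cmod (v i))\<^sup>2 + (cmod (w i))\<^sup>2) * (1/2))"
  proof (rule infsum_mono)
    show "(\<lambda>i. ((cmod (v i))\<^sup>2 + (cmod (w i))\<^sup>2) * (1/2)) summable_on I"
      using assms by (intro summable_on_cmult_left summable_on_add) (simp_all add: ell2_summable)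
    show "cmod (cnj (v i) * w i) \<le> ((cmod (v i))\<^sup>2 + (cmod (w i))\<^sup>2) * (1/2)" for i
      using sum_squares_bound[of "cmod (v i)" "cmod (w i)"] by (simp add: norm_mult)
  qed (use ell2_abs_summable_inner[OF assms] in auto)
  also have "\<dots> = ((ell2_norm I v)\<^sup>2 + (ell2_norm I w)\<^sup>2) / 2"
    unfolding ell2_norm_power2 infsum_cmult_left'
    using infsum_add[OF ell2_summable[OF assms(1)] ell2_summable[OF assms(2)]] by simp
  finally show ?thesis .
qed

lemma ell2_Cauchy_Schwarz:
  assumes "v \<in> ell2 I" "w \<in> ell2 I"
  shows "cmod (ell2_inner I v w) \<le> ell2_norm I v * ell2_norm I w"
proof (cases "ell2_norm I v = 0 \<or> ell2_norm I w = 0")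
  case True
  then have "v = (\<lambda>i. 0) \<or> w = (\<lambda>i. 0)"
    using assms ell2_norm_eq_0_imp by blast
  then have "ell2_inner I v w = 0" by (auto simp: ell2_inner_def)
  then show ?thesis by simp
next
  case False
  define a where "a = ell2_norm I v"
  define b where "b = ell2_norm I w"
  have ab: "a > 0" "b > 0"
    using False ell2_norm_nonneg[of I v] ell2_norm_nonneg[of I w] by (auto simp: a_def b_def less_le)
  \<comment> \<open>Normalising both vectors reduces the claim to the inequality between the means.\<close>
  have "cmod (ell2_inner I (\<lambda>i. of_real (1/a) * v i) (\<lambda>i. of_real (1/b) * w i))
     \<le> ((ell2_norm I (\<lambda>i. of_real (1/a) * v i))\<^sup>2 + (ell2_norm I (\<lambda>i. of_real (1/b) * w i))\<^sup>2) / 2"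
    by (intro ell2_inner_le_squares ell2_scale assms)
  also have "\<dots> = 1"
    using ab by (simp only: ell2_norm_scale) (simp add: norm_divide flip: a_def b_def)
  finally have "cmod (ell2_inner I v w) / (a * b) \<le> 1"
    using ab by (simp only: ell2_inner_scale_left ell2_inner_scale_right)
      (simp add: norm_mult norm_divide field_simps)
  then show ?thesis using ab by (simp add: a_def b_def field_simps)
qed

lemma ell2_norm_add_power2:
  assumes "v \<in> ell2 I" "w \<in> ell2 I"
  shows "(ell2_norm I (\<lambda>i. v i + w i))\<^sup>2 = (ell2_norm I v)\<^sup>2 + 2 * Re (ell2_inner I v w) + (ell2_norm I w)\<^sup>2"
proof -
  have "complex_of_real ((ell2_norm I (\<lambda>i. v i + w i))\<^sup>2)
      = of_real ((ell2_norm I v)\<^sup>2) + ell2_inner I v w + cnj (ell2_inner I v w) + of_real ((ell2_norm I w)\<^sup>2)"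
    using assms by (simp only: ell2_inner_self[symmetric] ell2_inner_add_left ell2_inner_add_right
        ell2_inner_commute ell2_add) simp
  then have "Re (complex_of_real ((ell2_norm I (\<lambda>i. v i + w i))\<^sup>2))
      = Re (of_real ((ell2_norm I v)\<^sup>2) + ell2_inner I v w + cnj (ell2_inner I v w) + of_real ((ell2_norm I w)\<^sup>2))"
    by (rule arg_cong)
  then show ?thesis by (simp del: of_real_power)
qed

lemma ell2_norm_triangle:
  assumes "v \<in> ell2 I" "w \<in> ell2 I"
  shows "ell2_norm I (\<lambda>i. v i + w i) \<le> ell2_norm I v + ell2_norm I w"
proof (rule power2_le_imp_le)
  have "Re (ell2_inner I v w) \<le> ell2_norm I v * ell2_norm I w"
    using complex_Re_le_cmod ell2_Cauchy_Schwarz[OF assms] order_trans by blast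
  then show "(ell2_norm I (\<lambda>i. v i + w i))\<^sup>2 \<le> (ell2_norm I v + ell2_norm I w)\<^sup>2"
    by (simp add: ell2_norm_add_power2[OF assms] power2_sum)
qed simp

lemma ell2_norm_sum_le:
  assumes "\<And>k. k \<in> S \<Longrightarrow> v k \<in> ell2 I"
  shows "ell2_norm I (\<lambda>i. \<Sum>k\<in>S. v k i) \<le> (\<Sum>k\<in>S. ell2_norm I (v k))"
  using assms
proof (induction S rule: infinite_finite_induct)
  case (insert x F)
  then show ?case
    using ell2_norm_triangle[of "v x" I "\<lambda>i. \<Sum>k\<in>F. v k i"] ell2_sum[of F v I] by simp
qed auto

lemma ell2_norm_le_by_duality:
  assumes "v \<in> ell2 I" "0 \<le> C"
    and "\<And>w. w \<in> ell2 I \<Longrightarrow> ell2_norm I w \<le> 1 \<Longrightarrow> cmod (ell2_inner I w v) \<le> C"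
  shows "ell2_norm I v \<le> C"
proof (cases "ell2_norm I v = 0")
  case False
  define a where "a = ell2_norm I v"
  have a: "a > 0" using False ell2_norm_nonneg[of I v] by (auto simp: a_def less_le)
  have "cmod (ell2_inner I (\<lambda>i. of_real (1/a) * v i) v) \<le> C"
    using a by (intro assms(3) ell2_scale assms(1)) (simp only: ell2_norm_scale, simp add: norm_divide flip: a_def)
  then show ?thesis
    using a by (simp only: ell2_inner_scale_left ell2_inner_self[OF assms(1)] flip: a_def)
      (simp add: norm_divide norm_mult power2_eq_square)
qed (use assms(2) in simp)

section \<open>Bounded operators\<close>

lemma bounded_operatorD:
  assumes "bounded_operator I T"
  shows "v \<in> ell2 I \<Longrightarrow> T v \<in> ell2 I"
    and "v \<in> ell2 I \<Longrightarrow> w \<in> ell2 I \<Longrightarrow> T (\<lambda>i. v i + w i) = (\<lambda>i. T v i + T w i)"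
    and "v \<in> ell2 I \<Longrightarrow> T (\<lambda>i. c * v i) = (\<lambda>i. c * T v i)"
  using assms by (auto simp: bounded_operator_def)

lemma operator_norm_bdd:
  assumes "bounded_operator I T"
  shows "bdd_above ((\<lambda>v. ell2_norm I (T v)) ` {v \<in> ell2 I. ell2_norm I v \<le> 1})"
proof -
  obtain C where C: "\<And>v. v \<in> ell2 I \<Longrightarrow> ell2_norm I (T v) \<le> C * ell2_norm I v"
    using assms unfolding bounded_operator_def by blast
  have "ell2_norm I (T v) \<le> \<bar>C\<bar>" if "v \<in> ell2 I" "ell2_norm I v \<le> 1" for v
  proof -
    have "C * ell2_norm I v \<le> \<bar>C\<bar> * 1"
      using that by (intro mult_mono) auto
    then show ?thesis using C[OF that(1)] by simp
  qed
  then show ?thesis by (auto intro!: bdd_aboveI)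
qed

lemma operator_norm_bound:
  assumes "bounded_operator I T" "v \<in> ell2 I"
  shows "ell2_norm I (T v) \<le> operator_norm I T * ell2_norm I v"
proof (cases "ell2_norm I v = 0")
  case True
  then have "T v = T (\<lambda>i. 0 * v i)" using ell2_norm_eq_0_imp[OF assms(2)] by simp
  also have "\<dots> = (\<lambda>i. 0)" using bounded_operatorD(3)[OF assms, of 0] by simp
  finally show ?thesis using True by simp
next
  case False
  define a where "a = ell2_norm I v"
  have a: "a > 0" using False ell2_norm_nonneg[of I v] by (auto simp: a_def less_le)
  let ?u = "\<lambda>i. of_real (1/a) * v i"
  have "ell2_norm I (T ?u) \<le> operator_norm I T"
    unfolding operator_norm_def
  proof (rule cSUP_upper)
    show "?u \<in> {v \<in> ell2 I. ell2_norm I v \<le> 1}"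
      using a ell2_scale[OF assms(2)] by (simp only: mem_Collect_eq ell2_norm_scale, simp add: norm_divide flip: a_def)
  qed (rule operator_norm_bdd[OF assms(1)])
  then show ?thesis
    using a by (simp only: bounded_operatorD(3)[OF assms] ell2_norm_scale)
      (simp add: norm_divide field_simps flip: a_def)
qed

lemma operator_norm_le:
  assumes "\<And>v. v \<in> ell2 I \<Longrightarrow> ell2_norm I v \<le> 1 \<Longrightarrow> ell2_norm I (T v) \<le> C"
  shows "operator_norm I T \<le> C"
  unfolding operator_norm_def
  by (rule cSUP_least) (use assms in \<open>auto intro!: exI[of _ "\<lambda>i. 0"]\<close>)

lemma operator_norm_nonneg:
  assumes "bounded_operator I T"
  shows "0 \<le> operator_norm I T"
proof -
  have "ell2_norm I (T (\<lambda>i. 0)) \<le> operator_norm I T"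
    unfolding operator_norm_def by (rule cSUP_upper[OF _ operator_norm_bdd[OF assms]]) auto
  then show ?thesis using ell2_norm_nonneg order_trans by blast
qed

section \<open>Operators given by row- and column-finite matrices\<close>

text \<open>
  The matrices of compactly supported functions in regular representations have this shape: the
  number of nonzero entries of a row or column is bounded because compact sets of arrows meet
  the fibres in boundedly many points.
\<close>

definition row_col_finite :: "'i set \<Rightarrow> nat \<Rightarrow> real \<Rightarrow> ('i \<Rightarrow> 'i \<Rightarrow> complex) \<Rightarrow> bool" where
  "row_col_finite I N C m \<longleftrightarrow>
     (\<forall>i\<in>I. finite {j\<in>I. m i j \<noteq> 0} \<and> card {j\<in>I. m i j \<noteq> 0} \<le> N) \<and>
     (\<forall>j\<in>I. finite {i\<in>I. m i j \<noteq> 0} \<and> card {i\<in>I. m i j \<noteq> 0} \<le> N) \<and>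
     (\<forall>i\<in>I. \<forall>j\<in>I. cmod (m i j) \<le> C)"

definition matrix_operator :: "nat set \<Rightarrow> (nat \<Rightarrow> nat \<Rightarrow> complex) \<Rightarrow> (nat \<Rightarrow> complex) \<Rightarrow> nat \<Rightarrow> complex" where
  "matrix_operator I m v i = (if i \<in> I then \<Sum>\<^sub>\<infinity>j\<in>I. m i j * v j else 0)"

lemma infsum_eq_sum_support:
  fixes f :: "'a \<Rightarrow> 'b::{topological_comm_monoid_add, t2_space}"
  assumes "finite F" "F \<subseteq> S" "\<And>x. x \<in> S - F \<Longrightarrow> f x = 0"
  shows "infsum f S = sum f F"
proof -
  have "infsum f S = infsum f F"
    by (rule infsum_cong_neutral) (use assms in auto)
  then show ?thesis using assms(1) by simp
qed

lemma summable_on_finite_support: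
  fixes f :: "'a \<Rightarrow> 'b::{topological_comm_monoid_add, t2_space}"
  assumes "finite F" "F \<subseteq> S" "\<And>x. x \<in> S - F \<Longrightarrow> f x = 0"
  shows "f summable_on S"
proof -
  have "f summable_on S \<longleftrightarrow> f summable_on F"
    by (rule summable_on_cong_neutral) (use assms in auto)
  then show ?thesis using assms(1) by simp
qed

lemma matrix_operator_eq_sum:
  assumes "i \<in> I" "finite F" "F \<subseteq> I" "\<And>j. j \<in> I - F \<Longrightarrow> m i j = 0"
  shows "matrix_operator I m v i = (\<Sum>j\<in>F. m i j * v j)"
proof -
  have "(\<Sum>\<^sub>\<infinity>j\<in>I. m i j * v j) = (\<Sum>j\<in>F. m i j * v j)"
    by (rule infsum_eq_sum_support) (use assms in auto)
  then show ?thesis using assms(1) by (simp add: matrix_operator_def)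
qed

lemma matrix_operator_finite:
  assumes "finite I"
  shows "matrix_operator I m v i = (if i \<in> I then \<Sum>j\<in>I. m i j * v j else 0)"
  using assms by (simp add: matrix_operator_def)

lemma row_col_finite_row:
  assumes "row_col_finite I N C m" "i \<in> I"
  shows "matrix_operator I m v i = (\<Sum>j\<in>{j\<in>I. m i j \<noteq> 0}. m i j * v j)"
  using assms by (intro matrix_operator_eq_sum) (auto simp: row_col_finite_def)

text \<open>
  A matrix with at most \<open>N\<close> nonzero entries in each row and column, all of modulus at most \<open>C\<close>,
  has norm at most \<open>N C\<close>: apply the Cauchy-Schwarz inequality in each row, and count each
  coordinate of the vector once for each nonzero entry of its column.
\<close>

lemma row_col_finite_partial_sum:
  assumes m: "row_col_finite I N C m" and v: "v \<in> ell2 I" and F: "finite F" "F \<subseteq> I" and C: "0 \<le> C"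
  shows "(\<Sum>i\<in>F. (cmod (matrix_operator I m v i))\<^sup>2) \<le> (real N * C * ell2_norm I v)\<^sup>2"
proof -
  define R where "R i = {j\<in>I. m i j \<noteq> 0}" for i
  have R: "finite (R i)" "card (R i) \<le> N" if "i \<in> I" for i
    using m that by (auto simp: row_col_finite_def R_def)
  define J where "J = (\<Union>i\<in>F. R i)"
  have J: "finite J" "J \<subseteq> I" using F R by (auto simp: J_def R_def)
  have row: "(cmod (matrix_operator I m v i))\<^sup>2 \<le> real N * C\<^sup>2 * (\<Sum>j\<in>R i. (cmod (v j))\<^sup>2)" if i: "i \<in> I" for i
  proof -
    have "cmod (matrix_operator I m v i) \<le> (\<Sum>j\<in>R i. 1 * (C * cmod (v j)))"
      unfolding row_col_finite_row[OF m i] R_def[symmetric] mult_1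
    proof (rule sum_norm_le)
      show "cmod (m i j * v j) \<le> C * cmod (v j)" if "j \<in> R i" for j
        using m i that by (auto simp: norm_mult row_col_finite_def R_def intro!: mult_right_mono)
    qed
    then have "(cmod (matrix_operator I m v i))\<^sup>2 \<le> (\<Sum>j\<in>R i. 1 * (C * cmod (v j)))\<^sup>2"
      by (simp add: power_mono)
    also have "\<dots> \<le> (\<Sum>j\<in>R i. 1\<^sup>2) * (\<Sum>j\<in>R i. (C * cmod (v j))\<^sup>2)"
      by (rule Cauchy_Schwarz_ineq_sum)
    also have "\<dots> \<le> real N * (\<Sum>j\<in>R i. (C * cmod (v j))\<^sup>2)"
      using R(2)[OF i] by (intro mult_right_mono sum_nonneg) auto
    also have "\<dots> = real N * C\<^sup>2 * (\<Sum>j\<in>R i. (cmod (v j))\<^sup>2)"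
      by (simp add: power_mult_distrib sum_distrib_left mult.assoc)
    finally show ?thesis .
  qed
  have "(\<Sum>i\<in>F. (cmod (matrix_operator I m v i))\<^sup>2) \<le> (\<Sum>i\<in>F. real N * C\<^sup>2 * (\<Sum>j\<in>R i. (cmod (v j))\<^sup>2))"
    using F row by (intro sum_mono) auto
  also have "\<dots> = real N * C\<^sup>2 * (\<Sum>i\<in>F. \<Sum>j\<in>R i. (cmod (v j))\<^sup>2)"
    by (simp add: sum_distrib_left)
  also have "(\<Sum>i\<in>F. \<Sum>j\<in>R i. (cmod (v j))\<^sup>2) = (\<Sum>i\<in>F. \<Sum>j\<in>{j\<in>J. m i j \<noteq> 0}. (cmod (v j))\<^sup>2)"
    by (intro sum.cong refl) (auto simp: J_def R_def)
  also have "\<dots> = (\<Sum>j\<in>J. \<Sum>i\<in>{i\<in>F. m i j \<noteq> 0}. (cmod (v j))\<^sup>2)"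
    by (rule sum.swap_restrict) (use F J in auto)
  also have "\<dots> \<le> (\<Sum>j\<in>J. real N * (cmod (v j))\<^sup>2)"
  proof (rule sum_mono)
    fix j assume "j \<in> J"
    then have j: "j \<in> I" using J by auto
    have "card {i\<in>F. m i j \<noteq> 0} \<le> card {i\<in>I. m i j \<noteq> 0}"
      using m j F by (intro card_mono) (auto simp: row_col_finite_def)
    also have "\<dots> \<le> N" using m j by (auto simp: row_col_finite_def)
    finally show "(\<Sum>i\<in>{i\<in>F. m i j \<noteq> 0}. (cmod (v j))\<^sup>2) \<le> real N * (cmod (v j))\<^sup>2"
      by (simp add: mult_right_mono)
  qed
  also have "(\<Sum>j\<in>J. real N * (cmod (v j))\<^sup>2) = real N * (\<Sum>j\<in>J. (cmod (v j))\<^sup>2)"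
    by (simp add: sum_distrib_left)
  finally have "(\<Sum>i\<in>F. (cmod (matrix_operator I m v i))\<^sup>2) \<le> real N * C\<^sup>2 * (real N * (\<Sum>j\<in>J. (cmod (v j))\<^sup>2))"
    by (simp add: mult_left_mono)
  also have "\<dots> \<le> real N * C\<^sup>2 * (real N * (ell2_norm I v)\<^sup>2)"
    unfolding ell2_norm_power2 using J by (intro mult_left_mono finite_sum_le_infsum ell2_summable v) auto
  finally show ?thesis
    by (simp add: power_mult_distrib power2_eq_square mult_ac)
qed

lemma matrix_operator_ell2:
  assumes "row_col_finite I N C m" "v \<in> ell2 I" "0 \<le> C"
  shows "matrix_operator I m v \<in> ell2 I"
    and "ell2_norm I (matrix_operator I m v) \<le> real N * C * ell2_norm I v"
proof -
  note bound = row_col_finite_partial_sum[OF assms(1,2) _ _ assms(3)]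
  have s: "(\<lambda>i. (cmod (matrix_operator I m v i))\<^sup>2) summable_on I"
    by (rule nonneg_bdd_above_summable_on)
      (use bound in \<open>auto intro!: bdd_aboveI2\<close>)
  then show "matrix_operator I m v \<in> ell2 I"
    by (auto simp: ell2_def matrix_operator_def)
  have "(ell2_norm I (matrix_operator I m v))\<^sup>2 \<le> (real N * C * ell2_norm I v)\<^sup>2"
    unfolding ell2_norm_power2[of I "matrix_operator I m v"]
    by (rule infsum_le_finite_sums[OF s bound])
  then show "ell2_norm I (matrix_operator I m v) \<le> real N * C * ell2_norm I v"
    by (rule power2_le_imp_le) (use assms(3) in simp)
qed

lemma matrix_operator_add_right:
  assumes "row_col_finite I N C m"
  shows "matrix_operator I m (\<lambda>i. v i + w i) = (\<lambda>i. matrix_operator I m v i + matrix_operator I m w i)"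
proof
  fix i show "matrix_operator I m (\<lambda>i. v i + w i) i = matrix_operator I m v i + matrix_operator I m w i"
    by (cases "i \<in> I") (simp_all add: row_col_finite_row[OF assms] distrib_left sum.distrib, simp add: matrix_operator_def)
qed

lemma matrix_operator_scale_right:
  "matrix_operator I m (\<lambda>i. c * v i) = (\<lambda>i. c * matrix_operator I m v i)"
  by (auto simp: matrix_operator_def mult.left_commute infsum_cmult_right' fun_eq_iff)

lemma bounded_operator_matrix_operator:
  assumes "row_col_finite I N C m" "0 \<le> C"
  shows "bounded_operator I (matrix_operator I m)"
  unfolding bounded_operator_def
  using matrix_operator_ell2[OF assms(1) _ assms(2)] matrix_operator_add_right[OF assms(1)]
    matrix_operator_scale_right by blast

lemma ell2_inner_matrix_operator:
  assumes m: "row_col_finite I N C m" and C: "0 \<le> C" and v: "v \<in> ell2 I" and w: "w \<in> ell2 I"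
  shows "ell2_inner I (matrix_operator I (\<lambda>i j. cnj (m j i)) v) w = ell2_inner I v (matrix_operator I m w)"
proof -
  let ?f = "\<lambda>i j. m j i * cnj (v j) * w i"
  have m': "row_col_finite I N C (\<lambda>i j. cnj (m j i))"
    using m by (simp add: row_col_finite_def)
  have r: "finite {j\<in>I. m i j \<noteq> 0}" "finite {j\<in>I. m j i \<noteq> 0}" if "i \<in> I" for i
    using m that by (auto simp: row_col_finite_def)
  have summ: "(\<lambda>(i,j). ?f i j) summable_on (I \<times> I)"
  proof (rule Infinite_Sum.abs_summable_summable, rule nonneg_bdd_above_summable_on)
    let ?B = "real N * C * (ell2_norm I v)\<^sup>2 + real N * C * (ell2_norm I w)\<^sup>2"
    have "(\<Sum>p\<in>F. norm ((\<lambda>(i,j). ?f i j) p)) \<le> ?B" if F: "F \<subseteq> I \<times> I" "finite F" for F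
    proof -
      define X where "X = fst ` F" define Y where "Y = snd ` F"
      have XY: "finite X" "finite Y" "X \<subseteq> I" "Y \<subseteq> I" "F \<subseteq> X \<times> Y"
        using F by (force simp: X_def Y_def)+
      have "(\<Sum>p\<in>F. norm ((\<lambda>(i,j). ?f i j) p)) \<le> (\<Sum>p\<in>X\<times>Y. norm ((\<lambda>(i,j). ?f i j) p))"
        using XY by (intro sum_mono2) auto
      also have "\<dots> = (\<Sum>i\<in>X. \<Sum>j\<in>Y. norm (?f i j))"
        by (simp add: sum.cartesian_product split_beta)
      also have "\<dots> \<le> (\<Sum>i\<in>X. \<Sum>j\<in>Y. if m j i \<noteq> 0 then C * (cmod (v j))\<^sup>2 + C * (cmod (w i))\<^sup>2 else 0)"
      proof (intro sum_mono)
        fix i j assume ij: "i \<in> X" "j \<in> Y"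
        have "cmod (v j) * cmod (w i) \<le> (cmod (v j))\<^sup>2 + (cmod (w i))\<^sup>2"
          using sum_squares_bound[of "cmod (v j)" "cmod (w i)"]
            mult_nonneg_nonneg[OF norm_ge_zero norm_ge_zero, of "v j" "w i"] by linarith
        moreover have "cmod (m j i) \<le> C"
          using ij XY(3,4) m[unfolded row_col_finite_def] by blast
        ultimately have "cmod (m j i) * (cmod (v j) * cmod (w i)) \<le> C * ((cmod (v j))\<^sup>2 + (cmod (w i))\<^sup>2)"
          by (intro mult_mono C) auto
        then show "norm (?f i j) \<le> (if m j i \<noteq> 0 then C * (cmod (v j))\<^sup>2 + C * (cmod (w i))\<^sup>2 else 0)"
          by (auto simp: norm_mult algebra_simps)
      qed
      also have "\<dots> = (\<Sum>i\<in>X. \<Sum>j\<in>{j\<in>Y. m j i \<noteq> 0}. C * (cmod (v j))\<^sup>2) + (\<Sum>i\<in>X. \<Sum>j\<in>{j\<in>Y. m j i \<noteq> 0}. C * (cmod (w i))\<^sup>2)"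
        using XY by (simp add: sum.inter_filter[symmetric] sum.distrib)
      also have "(\<Sum>i\<in>X. \<Sum>j\<in>{j\<in>Y. m j i \<noteq> 0}. C * (cmod (v j))\<^sup>2) = (\<Sum>j\<in>Y. \<Sum>i\<in>{i\<in>X. m j i \<noteq> 0}. C * (cmod (v j))\<^sup>2)"
        by (rule sum.swap_restrict) (use XY in auto)
      also have "\<dots> \<le> (\<Sum>j\<in>Y. real N * (C * (cmod (v j))\<^sup>2))"
      proof (rule sum_mono)
        fix j assume "j \<in> Y" then have j: "j \<in> I" using XY by auto
        have "card {i\<in>X. m j i \<noteq> 0} \<le> card {i\<in>I. m j i \<noteq> 0}"
          using r[OF j] XY by (intro card_mono) auto
        also have "\<dots> \<le> N" using m j by (auto simp: row_col_finite_def)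
        finally show "(\<Sum>i\<in>{i\<in>X. m j i \<noteq> 0}. C * (cmod (v j))\<^sup>2) \<le> real N * (C * (cmod (v j))\<^sup>2)"
          using C by (simp add: mult_right_mono)
      qed
      also have "\<dots> = real N * C * (\<Sum>j\<in>Y. (cmod (v j))\<^sup>2)" by (simp add: sum_distrib_left mult.assoc)
      also have "\<dots> \<le> real N * C * (ell2_norm I v)\<^sup>2"
        unfolding ell2_norm_power2 using XY C by (intro mult_left_mono finite_sum_le_infsum ell2_summable v) auto
      also have "(\<Sum>i\<in>X. \<Sum>j\<in>{j\<in>Y. m j i \<noteq> 0}. C * (cmod (w i))\<^sup>2) \<le> (\<Sum>i\<in>X. real N * (C * (cmod (w i))\<^sup>2))"
      proof (rule sum_mono)
        fix i assume "i \<in> X" then have i: "i \<in> I" using XY by auto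
        have "card {j\<in>Y. m j i \<noteq> 0} \<le> card {j\<in>I. m j i \<noteq> 0}"
          using r[OF i] XY by (intro card_mono) auto
        also have "\<dots> \<le> N" using m i by (auto simp: row_col_finite_def)
        finally show "(\<Sum>j\<in>{j\<in>Y. m j i \<noteq> 0}. C * (cmod (w i))\<^sup>2) \<le> real N * (C * (cmod (w i))\<^sup>2)"
          using C by (simp add: mult_right_mono)
      qed
      also have "\<dots> = real N * C * (\<Sum>i\<in>X. (cmod (w i))\<^sup>2)" by (simp add: sum_distrib_left mult.assoc)
      also have "\<dots> \<le> real N * C * (ell2_norm I w)\<^sup>2"
        unfolding ell2_norm_power2 using XY C by (intro mult_left_mono finite_sum_le_infsum ell2_summable w) auto
      finally show ?thesis by simp
    qed
    then show "bdd_above (sum (\<lambda>p. norm ((\<lambda>(i,j). ?f i j) p)) ` {F. F \<subseteq> I \<times> I \<and> finite F})"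
      by (intro bdd_aboveI2[of _ _ ?B]) auto
  qed auto
  have "ell2_inner I (matrix_operator I (\<lambda>i j. cnj (m j i)) v) w = (\<Sum>\<^sub>\<infinity>i\<in>I. \<Sum>\<^sub>\<infinity>j\<in>I. ?f i j)"
    unfolding ell2_inner_def
  proof (rule infsum_cong)
    fix i assume i: "i \<in> I"
    have "(\<Sum>\<^sub>\<infinity>j\<in>I. ?f i j) = (\<Sum>j\<in>{j\<in>I. m j i \<noteq> 0}. ?f i j)"
      by (rule infsum_eq_sum_support) (use r i in auto)
    then show "cnj (matrix_operator I (\<lambda>i j. cnj (m j i)) v i) * w i = (\<Sum>\<^sub>\<infinity>j\<in>I. ?f i j)"
      using row_col_finite_row[OF m' i, of v] by (simp add: sum_distrib_right)
  qed
  also have "\<dots> = (\<Sum>\<^sub>\<infinity>j\<in>I. \<Sum>\<^sub>\<infinity>i\<in>I. ?f i j)"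
    by (rule infsum_swap_banach[OF summ])
  also have "\<dots> = ell2_inner I v (matrix_operator I m w)"
    unfolding ell2_inner_def
  proof (rule infsum_cong)
    fix j assume j: "j \<in> I"
    have "(\<Sum>\<^sub>\<infinity>i\<in>I. ?f i j) = (\<Sum>i\<in>{i\<in>I. m j i \<noteq> 0}. ?f i j)"
      by (rule infsum_eq_sum_support) (use r j in auto)
    then show "(\<Sum>\<^sub>\<infinity>i\<in>I. ?f i j) = cnj (v j) * matrix_operator I m w j"
      using row_col_finite_row[OF m j, of w] by (simp add: sum_distrib_left mult_ac)
  qed
  finally show ?thesis .
qed

lemma matrix_operator_compose:
  assumes a: "row_col_finite I N C m" and b: "row_col_finite I N' C' m'"
    and ab: "\<And>i j. i \<in> I \<Longrightarrow> j \<in> I \<Longrightarrow> l i j = (\<Sum>\<^sub>\<infinity>k\<in>I. m i k * m' k j)"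
  shows "matrix_operator I l v = matrix_operator I m (matrix_operator I m' v)"
proof
  fix i
  show "matrix_operator I l v i = matrix_operator I m (matrix_operator I m' v) i"
  proof (cases "i \<in> I")
    case i: True
    define K where "K = {k\<in>I. m i k \<noteq> 0}"
    define J where "J = (\<Union>k\<in>K. {j\<in>I. m' k j \<noteq> 0})"
    have K: "finite K" "K \<subseteq> I" using a i by (auto simp: K_def row_col_finite_def)
    have J: "finite J" "J \<subseteq> I" using b K by (auto simp: J_def row_col_finite_def)
    have l: "l i j = (\<Sum>k\<in>K. m i k * m' k j)" if "j \<in> I" for j
      unfolding ab[OF i that] by (rule infsum_eq_sum_support) (use K in \<open>auto simp: K_def\<close>)
    have "matrix_operator I l v i = (\<Sum>j\<in>J. l i j * v j)"
      by (rule matrix_operator_eq_sum[OF i J]) (auto simp: l J_def intro!: sum.neutral)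
    also have "\<dots> = (\<Sum>j\<in>J. \<Sum>k\<in>K. m i k * (m' k j * v j))"
      using J by (intro sum.cong refl) (auto simp: l sum_distrib_right mult.assoc)
    also have "\<dots> = (\<Sum>k\<in>K. m i k * (\<Sum>j\<in>J. m' k j * v j))"
      unfolding sum_distrib_left by (rule sum.swap)
    also have "\<dots> = (\<Sum>k\<in>K. m i k * matrix_operator I m' v k)"
      using K by (intro sum.cong refl arg_cong2[where f="(*)"] matrix_operator_eq_sum[symmetric] J)
        (auto simp: J_def)
    also have "\<dots> = matrix_operator I m (matrix_operator I m' v) i"
      using row_col_finite_row[OF a i] by (simp add: K_def)
    finally show ?thesis .
  qed (simp add: matrix_operator_def)
qed

text \<open>
  Representations are built from matrix entries: row- and column-finiteness turns all the sums into
  finite ones, so that the algebraic identities of the entries carry over to the operators.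
\<close>

lemma hilbert_representation_of_entries:
  assumes fin: "\<And>a. a \<in> acar A \<Longrightarrow> \<exists>N C. 0 \<le> C \<and> row_col_finite I N C (M a)"
    and add: "\<And>a b i j. a \<in> acar A \<Longrightarrow> b \<in> acar A \<Longrightarrow> i \<in> I \<Longrightarrow> j \<in> I \<Longrightarrow> M (aadd A a b) i j = M a i j + M b i j"
    and scale: "\<And>a c i j. a \<in> acar A \<Longrightarrow> i \<in> I \<Longrightarrow> j \<in> I \<Longrightarrow> M (ascale A c a) i j = c * M a i j"
    and mult: "\<And>a b i j. a \<in> acar A \<Longrightarrow> b \<in> acar A \<Longrightarrow> i \<in> I \<Longrightarrow> j \<in> I \<Longrightarrow>
                 M (amult A a b) i j = (\<Sum>\<^sub>\<infinity>k\<in>I. M a i k * M b k j)"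
    and star: "\<And>a i j. a \<in> acar A \<Longrightarrow> i \<in> I \<Longrightarrow> j \<in> I \<Longrightarrow> M (astar A a) i j = cnj (M a j i)"
  shows "hilbert_representation A I (\<lambda>a. matrix_operator I (M a))"
  unfolding hilbert_representation_def
proof (intro conjI ballI allI)
  show "bounded_operator I (matrix_operator I (M a))" if "a \<in> acar A" for a
    using fin[OF that] bounded_operator_matrix_operator by blast
  show "matrix_operator I (M (aadd A a b)) v = (\<lambda>i. matrix_operator I (M a) v i + matrix_operator I (M b) v i)"
    if ab: "a \<in> acar A" "b \<in> acar A" for a b v
  proof
    fix i
    obtain N C N' C' where r: "row_col_finite I N C (M a)" "row_col_finite I N' C' (M b)"
      using fin ab by blast
    show "matrix_operator I (M (aadd A a b)) v i = matrix_operator I (M a) v i + matrix_operator I (M b) v i"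
    proof (cases "i \<in> I")
      case i: True
      let ?F = "{j\<in>I. M a i j \<noteq> 0} \<union> {j\<in>I. M b i j \<noteq> 0}"
      have F: "finite ?F" "?F \<subseteq> I" using r i by (auto simp: row_col_finite_def)
      have eq: "matrix_operator I m v i = (\<Sum>j\<in>?F. m i j * v j)" if "\<And>j. j \<in> I - ?F \<Longrightarrow> m i j = 0" for m
        by (rule matrix_operator_eq_sum[OF i F]) (rule that)
      have "(\<Sum>j\<in>?F. M (aadd A a b) i j * v j) = (\<Sum>j\<in>?F. M a i j * v j) + (\<Sum>j\<in>?F. M b i j * v j)"
        unfolding sum.distrib[symmetric] using F(2) by (intro sum.cong refl) (auto simp: add ab i distrib_right)
      then show ?thesis by (subst (1 2 3) eq) (auto simp: add ab i)
    qed (simp add: matrix_operator_def)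
  qed
  show "matrix_operator I (M (ascale A c a)) v = (\<lambda>i. c * matrix_operator I (M a) v i)" if a: "a \<in> acar A" for a c v
    by (auto simp: matrix_operator_def fun_eq_iff scale[OF a] mult.assoc infsum_cmult_right' cong: infsum_cong)
  show "matrix_operator I (M (amult A a b)) v = matrix_operator I (M a) (matrix_operator I (M b) v)"
    if ab: "a \<in> acar A" "b \<in> acar A" for a b v
  proof -
    obtain N C N' C' where r: "row_col_finite I N C (M a)" "row_col_finite I N' C' (M b)"
      using fin ab by blast
    show ?thesis by (rule matrix_operator_compose[OF r]) (rule mult[OF ab])
  qed
  show "ell2_inner I (matrix_operator I (M (astar A a)) v) w = ell2_inner I v (matrix_operator I (M a) w)"
    if a: "a \<in> acar A" and vw: "v \<in> ell2 I" "w \<in> ell2 I" for a v w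
  proof -
    have "matrix_operator I (M (astar A a)) v = matrix_operator I (\<lambda>i j. cnj (M a j i)) v"
      by (auto simp: matrix_operator_def fun_eq_iff star[OF a] cong: infsum_cong)
    then show ?thesis using fin[OF a] ell2_inner_matrix_operator vw by metis
  qed
qed

lemma mat_adjoint_index:
  fixes m :: "complex mat"
  assumes "m \<in> carrier_mat n n" "i < n" "j < n"
  shows "mat_adjoint m $$ (i, j) = cnj (m $$ (j, i))"
  using assms by (auto simp: mat_adjoint_def mat_of_rows_index conjugate_complex_def)

lemma mat_adjoint_carrier:
  fixes m :: "complex mat"
  assumes "m \<in> carrier_mat n n"
  shows "mat_adjoint m \<in> carrier_mat n n"
  using assms by (auto simp: mat_adjoint_def)

lemma mat_mult_index:
  fixes a :: "complex mat"
  assumes "a \<in> carrier_mat n n" "b \<in> carrier_mat n n" "i < n" "j < n"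
  shows "(a * b) $$ (i, j) = (\<Sum>k<n. a $$ (i, k) * b $$ (k, j))"
  using assms by (auto simp: scalar_prod_def lessThan_atLeast0)

text \<open>A finite-dimensional representation is a representation on \<open>\<ell>\<^sup>2({..<n})\<close>.\<close>

lemma hilbert_representation_of_matrix_representation:
  assumes \<pi>: "matrix_representation A n \<pi>"
  shows "hilbert_representation A {..<n} (\<lambda>a. matrix_operator {..<n} (\<lambda>i j. \<pi> a $$ (i, j)))"
proof (rule hilbert_representation_of_entries)
  note carr = \<pi>[unfolded matrix_representation_def, THEN conjunct1, rule_format]
  note rep = \<pi>[unfolded matrix_representation_def]
  show "\<exists>N C. 0 \<le> C \<and> row_col_finite {..<n} N C (\<lambda>i j. \<pi> a $$ (i, j))" for a
  proof (intro exI conjI)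
    let ?C = "\<Sum>i<n. \<Sum>j<n. cmod (\<pi> a $$ (i, j))"
    show "0 \<le> ?C" by (intro sum_nonneg) auto
    have "cmod (\<pi> a $$ (i, j)) \<le> ?C" if "i < n" "j < n" for i j
    proof -
      have "cmod (\<pi> a $$ (i, j)) \<le> (\<Sum>j<n. cmod (\<pi> a $$ (i, j)))"
        using that by (intro member_le_sum) auto
      also have "\<dots> \<le> ?C"
        by (rule member_le_sum) (use that in \<open>auto intro: sum_nonneg\<close>)
      finally show ?thesis .
    qed
    moreover have "card {j \<in> {..<n}. P j} \<le> n" for P
      using card_mono[of "{..<n}" "{j \<in> {..<n}. P j}"] by auto
    ultimately show "row_col_finite {..<n} n ?C (\<lambda>i j. \<pi> a $$ (i, j))"
      by (auto simp: row_col_finite_def)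
  qed
  fix i j assume ij: "i \<in> {..<n}" "j \<in> {..<n}"
  show "\<pi> (aadd A a b) $$ (i, j) = \<pi> a $$ (i, j) + \<pi> b $$ (i, j)" if "a \<in> acar A" "b \<in> acar A" for a b
    using rep carr[of a] carr[of b] ij that by auto
  show "\<pi> (ascale A c a) $$ (i, j) = c * \<pi> a $$ (i, j)" if "a \<in> acar A" for a c
    using rep carr[of a] ij that by auto
  show "\<pi> (amult A a b) $$ (i, j) = (\<Sum>\<^sub>\<infinity>k\<in>{..<n}. \<pi> a $$ (i, k) * \<pi> b $$ (k, j))"
    if "a \<in> acar A" "b \<in> acar A" for a b
    using rep mat_mult_index[of "\<pi> a" n "\<pi> b" i j] carr[of a] carr[of b] ij that by auto
  show "\<pi> (astar A a) $$ (i, j) = cnj (\<pi> a $$ (j, i))" if "a \<in> acar A" for a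
    using rep mat_adjoint_index[of "\<pi> a" n i j] carr[of a] ij that by auto
qed

section \<open>The universal norm and the completion\<close>

lemma hilbert_representationD:
  assumes "hilbert_representation A I \<pi>"
  shows "a \<in> acar A \<Longrightarrow> bounded_operator I (\<pi> a)"
    and "a \<in> acar A \<Longrightarrow> b \<in> acar A \<Longrightarrow> v \<in> ell2 I \<Longrightarrow> \<pi> (aadd A a b) v = (\<lambda>i. \<pi> a v i + \<pi> b v i)"
    and "a \<in> acar A \<Longrightarrow> v \<in> ell2 I \<Longrightarrow> \<pi> (ascale A c a) v = (\<lambda>i. c * \<pi> a v i)"
    and "a \<in> acar A \<Longrightarrow> b \<in> acar A \<Longrightarrow> v \<in> ell2 I \<Longrightarrow> \<pi> (amult A a b) v = \<pi> a (\<pi> b v)"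
    and "a \<in> acar A \<Longrightarrow> v \<in> ell2 I \<Longrightarrow> w \<in> ell2 I \<Longrightarrow>
           ell2_inner I (\<pi> (astar A a) v) w = ell2_inner I v (\<pi> a w)"
    and "a \<in> acar A \<Longrightarrow> v \<in> ell2 I \<Longrightarrow> \<pi> a v \<in> ell2 I"
  using assms by (auto simp: hilbert_representation_def bounded_operator_def)

text \<open>
  The universal norm is a supremum of real numbers, which has its meaning only for a set that is
  bounded above.
\<close>

locale bounded_star_algebra =
  fixes A :: "('a, 'm) star_algebra_scheme"
  assumes add_closed: "a \<in> acar A \<Longrightarrow> b \<in> acar A \<Longrightarrow> aadd A a b \<in> acar A"
    and scale_closed: "a \<in> acar A \<Longrightarrow> ascale A c a \<in> acar A"
    and mult_closed: "a \<in> acar A \<Longrightarrow> b \<in> acar A \<Longrightarrow> amult A a b \<in> acar A"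
    and star_closed: "a \<in> acar A \<Longrightarrow> astar A a \<in> acar A"
    and representations_bounded: "a \<in> acar A \<Longrightarrow>
          \<exists>C. \<forall>I \<pi>. \<forall>v\<in>ell2 I. hilbert_representation A I \<pi> \<longrightarrow> ell2_norm I (\<pi> a v) \<le> C * ell2_norm I v"
begin

abbreviation unorm :: "'a \<Rightarrow> real" where "unorm \<equiv> universal_norm A"
abbreviation udist :: "'a \<Rightarrow> 'a \<Rightarrow> real" where "udist \<equiv> seminorm_dist A unorm"

lemma universal_norm_bdd_above:
  assumes a: "a \<in> acar A"
  shows "bdd_above {operator_norm I (\<pi> a) | I \<pi>. hilbert_representation A I \<pi>}"
proof -
  obtain C where C: "\<And>I \<pi> v. v \<in> ell2 I \<Longrightarrow> hilbert_representation A I \<pi> \<Longrightarrow>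
      ell2_norm I (\<pi> a v) \<le> C * ell2_norm I v"
    using representations_bounded[OF a] by blast
  have "operator_norm I \<pi>' \<le> \<bar>C\<bar>" if "hilbert_representation A I \<rho>" "\<pi>' = \<rho> a" for I \<pi>' \<rho>
  proof (rule operator_norm_le)
    fix v assume v: "v \<in> ell2 I" "ell2_norm I v \<le> 1"
    have "C * ell2_norm I v \<le> \<bar>C\<bar> * 1" using v by (intro mult_mono) auto
    then show "ell2_norm I (\<pi>' v) \<le> \<bar>C\<bar>" using C[OF v(1) that(1)] that(2) by simp
  qed
  then show ?thesis
    by (intro bdd_aboveI[of _ "\<bar>C\<bar>"]) auto
qed

lemma universal_norm_bound:
  assumes \<pi>: "hilbert_representation A I \<pi>" and a: "a \<in> acar A" and v: "v \<in> ell2 I"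
  shows "ell2_norm I (\<pi> a v) \<le> unorm a * ell2_norm I v"
proof -
  have "operator_norm I (\<pi> a) \<le> unorm a"
    unfolding universal_norm_def using \<pi> by (intro cSup_upper universal_norm_bdd_above a) auto
  then have "operator_norm I (\<pi> a) * ell2_norm I v \<le> unorm a * ell2_norm I v"
    by (rule mult_right_mono) simp
  then show ?thesis
    using operator_norm_bound[OF hilbert_representationD(1)[OF \<pi> a] v] by linarith
qed

lemma hilbert_representation_zero: "hilbert_representation A {} (\<lambda>a v i. 0)"
  by (auto simp: hilbert_representation_def bounded_operator_def ell2_inner_def ell2_norm_def)

lemma universal_norm_le:
  assumes "\<And>I \<pi> v. hilbert_representation A I \<pi> \<Longrightarrow> v \<in> ell2 I \<Longrightarrow> ell2_norm I v \<le> 1 \<Longrightarrow>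
             ell2_norm I (\<pi> a v) \<le> C"
  shows "unorm a \<le> C"
  unfolding universal_norm_def
proof (rule cSup_least)
  show "{operator_norm I (\<pi> a) | I \<pi>. hilbert_representation A I \<pi>} \<noteq> {}"
    using hilbert_representation_zero by blast
qed (use assms in \<open>auto intro: operator_norm_le\<close>)

lemma universal_norm_nonneg: "a \<in> acar A \<Longrightarrow> 0 \<le> unorm a"
proof -
  assume a: "a \<in> acar A"
  have "operator_norm {} ((\<lambda>a v i. 0) a) \<in> {operator_norm I (\<pi> a) | I \<pi>. hilbert_representation A I \<pi>}"
    using hilbert_representation_zero
    by (intro CollectI exI[of _ "{}"] exI[of _ "\<lambda>a v i. 0"] conjI) auto
  then have "operator_norm {} ((\<lambda>a v i. 0) a) \<le> unorm a"
    unfolding universal_norm_def by (rule cSup_upper) (rule universal_norm_bdd_above[OF a])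
  then show ?thesis
    using operator_norm_nonneg[OF hilbert_representationD(1)[OF hilbert_representation_zero a]] by simp
qed

lemma universal_norm_bound':
  assumes \<pi>: "hilbert_representation A I \<pi>" and a: "a \<in> acar A" and v: "v \<in> ell2 I" "ell2_norm I v \<le> c"
  shows "ell2_norm I (\<pi> a v) \<le> unorm a * c"
  using universal_norm_bound[OF \<pi> a v(1)] mult_left_mono[OF v(2) universal_norm_nonneg[OF a]] by linarith

text \<open>
  The inequalities of the universal distance are read off from the operators of each representation.
\<close>

lemma rep_diff:
  assumes "hilbert_representation A I \<pi>" "a \<in> acar A" "b \<in> acar A" "v \<in> ell2 I"
  shows "\<pi> (aadd A a (ascale A (-1) b)) v = (\<lambda>i. \<pi> a v i - \<pi> b v i)"
  using hilbert_representationD(2)[OF assms(1,2) scale_closed[OF assms(3)] assms(4), of "-1"]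
    hilbert_representationD(3)[OF assms(1,3,4), of "-1"] by simp

lemma diff_closed: "a \<in> acar A \<Longrightarrow> b \<in> acar A \<Longrightarrow> aadd A a (ascale A (-1) b) \<in> acar A"
  by (intro add_closed scale_closed)

lemma rep_diff_bound:
  assumes \<pi>: "hilbert_representation A I \<pi>" and ab: "a \<in> acar A" "b \<in> acar A"
    and v: "v \<in> ell2 I" "ell2_norm I v \<le> c"
  shows "ell2_norm I (\<lambda>i. \<pi> a v i - \<pi> b v i) \<le> udist a b * c"
  unfolding seminorm_dist_def using universal_norm_bound'[OF \<pi> diff_closed[OF ab] v]
  by (simp add: rep_diff[OF \<pi> ab v(1)])

lemma udist_le:
  assumes "a \<in> acar A" "b \<in> acar A"
    and "\<And>I \<pi> v. hilbert_representation A I \<pi> \<Longrightarrow> v \<in> ell2 I \<Longrightarrow> ell2_norm I v \<le> 1 \<Longrightarrow>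
           ell2_norm I (\<lambda>i. \<pi> a v i - \<pi> b v i) \<le> C"
  shows "udist a b \<le> C"
  unfolding seminorm_dist_def using assms by (intro universal_norm_le) (simp add: rep_diff)

lemma ell2_diff: "v \<in> ell2 I \<Longrightarrow> w \<in> ell2 I \<Longrightarrow> (\<lambda>i. v i - w i) \<in> ell2 I"
  using ell2_add[of v I "\<lambda>i. -1 * w i"] ell2_scale[of w I "-1"] by simp

lemma udist_nonneg: "a \<in> acar A \<Longrightarrow> b \<in> acar A \<Longrightarrow> 0 \<le> udist a b"
  unfolding seminorm_dist_def by (intro universal_norm_nonneg diff_closed)

lemma udist_refl: "a \<in> acar A \<Longrightarrow> udist a a = 0"
  using udist_le[of a a 0] udist_nonneg[of a a] by simp

lemma udist_commute: "a \<in> acar A \<Longrightarrow> b \<in> acar A \<Longrightarrow> udist a b = udist b a"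
proof -
  have "udist a b \<le> udist b a" if ab: "a \<in> acar A" "b \<in> acar A" for a b
  proof (rule udist_le[OF ab])
    fix I \<pi> v assume \<pi>: "hilbert_representation A I \<pi>" and v: "v \<in> ell2 I" "ell2_norm I v \<le> 1"
    have "ell2_norm I (\<lambda>i. \<pi> a v i - \<pi> b v i) = ell2_norm I (\<lambda>i. -1 * (\<pi> b v i - \<pi> a v i))" by simp
    also have "\<dots> = ell2_norm I (\<lambda>i. \<pi> b v i - \<pi> a v i)" by (simp only: ell2_norm_scale) simp
    finally show "ell2_norm I (\<lambda>i. \<pi> a v i - \<pi> b v i) \<le> udist b a"
      using rep_diff_bound[OF \<pi> ab(2,1) v] by simp
  qed
  then show "a \<in> acar A \<Longrightarrow> b \<in> acar A \<Longrightarrow> udist a b = udist b a" by (simp add: order_antisym)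
qed

lemma udist_triangle:
  assumes abc: "a \<in> acar A" "b \<in> acar A" "c \<in> acar A"
  shows "udist a c \<le> udist a b + udist b c"
proof (rule udist_le[OF abc(1,3)])
  fix I \<pi> v assume \<pi>: "hilbert_representation A I \<pi>" and v: "v \<in> ell2 I" "ell2_norm I v \<le> 1"
  note in_ell2 = hilbert_representationD(6)[OF \<pi> _ v(1)]
  show "ell2_norm I (\<lambda>i. \<pi> a v i - \<pi> c v i) \<le> udist a b + udist b c"
    using ell2_norm_triangle[of "\<lambda>i. \<pi> a v i - \<pi> b v i" I "\<lambda>i. \<pi> b v i - \<pi> c v i"]
      rep_diff_bound[OF \<pi> abc(1,2) v] rep_diff_bound[OF \<pi> abc(2,3) v]
    by (simp add: ell2_diff in_ell2 abc)
qed

lemma udist_add: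
  assumes ab: "a \<in> acar A" "b \<in> acar A" "a' \<in> acar A" "b' \<in> acar A"
  shows "udist (aadd A a b) (aadd A a' b') \<le> udist a a' + udist b b'"
proof (rule udist_le[OF add_closed add_closed])
  fix I \<pi> v assume \<pi>: "hilbert_representation A I \<pi>" and v: "v \<in> ell2 I" "ell2_norm I v \<le> 1"
  note in_ell2 = hilbert_representationD(6)[OF \<pi> _ v(1)]
  show "ell2_norm I (\<lambda>i. \<pi> (aadd A a b) v i - \<pi> (aadd A a' b') v i) \<le> udist a a' + udist b b'"
    using ell2_norm_triangle[of "\<lambda>i. \<pi> a v i - \<pi> a' v i" I "\<lambda>i. \<pi> b v i - \<pi> b' v i"]
      rep_diff_bound[OF \<pi> ab(1,3) v] rep_diff_bound[OF \<pi> ab(2,4) v]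
    by (simp add: ell2_diff in_ell2 ab hilbert_representationD(2)[OF \<pi> _ _ v(1)] algebra_simps)
qed (use ab in auto)

lemma udist_scale:
  assumes ab: "a \<in> acar A" "b \<in> acar A"
  shows "udist (ascale A c a) (ascale A c b) \<le> cmod c * udist a b"
proof (rule udist_le[OF scale_closed[OF ab(1)] scale_closed[OF ab(2)]])
  fix I \<pi> v assume \<pi>: "hilbert_representation A I \<pi>" and v: "v \<in> ell2 I" "ell2_norm I v \<le> 1"
  have "ell2_norm I (\<lambda>i. c * (\<pi> a v i - \<pi> b v i)) \<le> cmod c * udist a b"
    using rep_diff_bound[OF \<pi> ab v] by (simp only: ell2_norm_scale) (simp add: mult_left_mono)
  then show "ell2_norm I (\<lambda>i. \<pi> (ascale A c a) v i - \<pi> (ascale A c b) v i) \<le> cmod c * udist a b"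
    by (simp add: ab hilbert_representationD(3)[OF \<pi> _ v(1)] right_diff_distrib)
qed

lemma udist_mult:
  assumes ab: "a \<in> acar A" "b \<in> acar A" "a' \<in> acar A" "b' \<in> acar A"
  shows "udist (amult A a b) (amult A a' b') \<le> unorm a * udist b b' + udist a a' * unorm b'"
proof (rule udist_le[OF mult_closed mult_closed])
  fix I \<pi> v assume \<pi>: "hilbert_representation A I \<pi>" and v: "v \<in> ell2 I" "ell2_norm I v \<le> 1"
  note in_ell2 = hilbert_representationD(6)[OF \<pi>]
  note bop = bounded_operatorD[OF hilbert_representationD(1)[OF \<pi> ab(1)]]
  have "\<pi> a (\<lambda>i. \<pi> b v i + (-1) * \<pi> b' v i) = (\<lambda>i. \<pi> a (\<pi> b v) i + (-1) * \<pi> a (\<pi> b' v) i)"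
    using bop(2)[of "\<pi> b v" "\<lambda>i. -1 * \<pi> b' v i"] bop(3)[of "\<pi> b' v" "-1"]
    by (simp add: in_ell2 ab v ell2_scale[of _ I "-1", simplified])
  then have eq: "(\<lambda>i. \<pi> (amult A a b) v i - \<pi> (amult A a' b') v i)
      = (\<lambda>i. \<pi> a (\<lambda>i. \<pi> b v i - \<pi> b' v i) i + (\<pi> a (\<pi> b' v) i - \<pi> a' (\<pi> b' v) i))"
    by (simp add: hilbert_representationD(4)[OF \<pi> _ _ v(1)] ab)
  have b': "ell2_norm I (\<pi> b' v) \<le> unorm b'" using universal_norm_bound'[OF \<pi> ab(4) v] by simp
  have 1: "ell2_norm I (\<pi> a (\<lambda>i. \<pi> b v i - \<pi> b' v i)) \<le> unorm a * udist b b'"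
    using rep_diff_bound[OF \<pi> ab(2,4) v] by (intro universal_norm_bound'[OF \<pi>]) (auto simp: ab in_ell2 v ell2_diff)
  have 2: "ell2_norm I (\<lambda>i. \<pi> a (\<pi> b' v) i - \<pi> a' (\<pi> b' v) i) \<le> udist a a' * unorm b'"
    by (rule rep_diff_bound[OF \<pi> ab(1,3) _ b']) (simp add: in_ell2 ab v)
  show "ell2_norm I (\<lambda>i. \<pi> (amult A a b) v i - \<pi> (amult A a' b') v i) \<le> unorm a * udist b b' + udist a a' * unorm b'"
    unfolding eq
    using ell2_norm_triangle[of "\<pi> a (\<lambda>i. \<pi> b v i - \<pi> b' v i)" I "\<lambda>i. \<pi> a (\<pi> b' v) i - \<pi> a' (\<pi> b' v) i"] 1 2
    by (simp add: in_ell2 ab v ell2_diff)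
qed (use ab in auto)

lemma udist_star:
  assumes ab: "a \<in> acar A" "b \<in> acar A"
  shows "udist (astar A a) (astar A b) \<le> udist a b"
proof (rule udist_le[OF star_closed[OF ab(1)] star_closed[OF ab(2)]])
  fix I \<pi> v assume \<pi>: "hilbert_representation A I \<pi>" and v: "v \<in> ell2 I" "ell2_norm I v \<le> 1"
  note in_ell2 = hilbert_representationD(6)[OF \<pi>]
  have inner_diff: "ell2_inner I u (\<lambda>i. x i - y i) = ell2_inner I u x - ell2_inner I u y"
    if "u \<in> ell2 I" "x \<in> ell2 I" "y \<in> ell2 I" for u x y
    using ell2_inner_add_right[of u I x "\<lambda>i. -1 * y i"] ell2_inner_scale_right[of I u "-1" y]
      ell2_scale[of y I "-1"] that by simp
  have adj: "ell2_inner I w (\<pi> (astar A c) v) = ell2_inner I (\<pi> c w) v" if "c \<in> acar A" "w \<in> ell2 I" for c w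
    using hilbert_representationD(5)[OF \<pi> that(1) v(1) that(2)] ell2_inner_commute by metis
  show "ell2_norm I (\<lambda>i. \<pi> (astar A a) v i - \<pi> (astar A b) v i) \<le> udist a b"
  proof (rule ell2_norm_le_by_duality)
    show "(\<lambda>i. \<pi> (astar A a) v i - \<pi> (astar A b) v i) \<in> ell2 I"
      by (intro ell2_diff in_ell2 star_closed ab v)
    show "0 \<le> udist a b" by (rule udist_nonneg[OF ab])
    fix w assume w: "w \<in> ell2 I" "ell2_norm I w \<le> 1"
    have "ell2_inner I w (\<lambda>i. \<pi> (astar A a) v i - \<pi> (astar A b) v i)
        = ell2_inner I (\<pi> a w) v - ell2_inner I (\<pi> b w) v"
      by (simp add: inner_diff in_ell2 star_closed ab v w adj)
    also have "\<dots> = cnj (ell2_inner I v (\<lambda>i. \<pi> a w i - \<pi> b w i))"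
      by (simp add: inner_diff in_ell2 ab v w ell2_inner_commute)
    finally have "cmod (ell2_inner I w (\<lambda>i. \<pi> (astar A a) v i - \<pi> (astar A b) v i))
        = cmod (ell2_inner I v (\<lambda>i. \<pi> a w i - \<pi> b w i))" by simp
    also have "\<dots> \<le> ell2_norm I v * ell2_norm I (\<lambda>i. \<pi> a w i - \<pi> b w i)"
      by (rule ell2_Cauchy_Schwarz) (auto intro!: v ell2_diff in_ell2 ab w)
    also have "\<dots> \<le> 1 * (udist a b * 1)"
      by (intro mult_mono rep_diff_bound[OF \<pi> ab w] v) auto
    finally show "cmod (ell2_inner I w (\<lambda>i. \<pi> (astar A a) v i - \<pi> (astar A b) v i)) \<le> udist a b" by simp
  qed
qed

lemma unorm_diff_le:
  assumes ab: "a \<in> acar A" "b \<in> acar A"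
  shows "unorm a \<le> unorm b + udist a b"
proof (rule universal_norm_le)
  fix I \<pi> v assume \<pi>: "hilbert_representation A I \<pi>" and v: "v \<in> ell2 I" "ell2_norm I v \<le> 1"
  show "ell2_norm I (\<pi> a v) \<le> unorm b + udist a b"
    using ell2_norm_triangle[of "\<pi> b v" I "\<lambda>i. \<pi> a v i - \<pi> b v i"]
      universal_norm_bound'[OF \<pi> ab(2) v] rep_diff_bound[OF \<pi> ab v]
    by (simp add: ab v hilbert_representationD(6)[OF \<pi>] ell2_diff)
qed

subsection \<open>Operations on classes of Cauchy sequences\<close>

abbreviation "CS \<equiv> cauchy_sequences A unorm"
abbreviation "ND \<equiv> null_difference A unorm"

lemma cauchy_in_carrier: "u \<in> CS \<Longrightarrow> u n \<in> acar A"
  by (simp add: cauchy_sequences_def)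

lemma cauchy_const: "a \<in> acar A \<Longrightarrow> (\<lambda>n. a) \<in> CS"
  by (simp add: cauchy_sequences_def udist_refl)

lemma equiv_null_difference: "equiv CS ND"
proof (rule equivI)
  show "ND \<subseteq> CS \<times> CS" by (auto simp: null_difference_def)
  show "refl_on CS ND"
    by (auto simp: refl_on_def null_difference_def udist_refl cauchy_in_carrier)
  show "sym ND"
    by (auto simp: sym_def null_difference_def udist_commute cauchy_in_carrier)
  show "trans ND"
  proof (rule transI)
    fix u v w assume uvw: "(u, v) \<in> ND" "(v, w) \<in> ND"
    then have lim: "(\<lambda>n. udist (u n) (v n) + udist (v n) (w n)) \<longlonglongrightarrow> 0 + 0"
      by (intro tendsto_add) (auto simp: null_difference_def)
    have c: "u \<in> CS" "v \<in> CS" "w \<in> CS" using uvw by (auto simp: null_difference_def)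
    have "(\<lambda>n. udist (u n) (w n)) \<longlonglongrightarrow> 0"
      by (rule tendsto_sandwich[OF _ _ tendsto_const lim[simplified]])
        (use c in \<open>auto intro!: always_eventually udist_nonneg udist_triangle cauchy_in_carrier\<close>)
    then show "(u, w) \<in> ND" using c by (simp add: null_difference_def)
  qed
qed

lemma cauchy_bounded:
  assumes u: "u \<in> CS"
  obtains B where "0 < B" "\<And>n. unorm (u n) \<le> B"
proof -
  obtain N where N: "\<And>m n. m \<ge> N \<Longrightarrow> n \<ge> N \<Longrightarrow> udist (u m) (u n) < 1"
    using u unfolding cauchy_sequences_def by (auto dest!: spec[of _ "1::real"])
  define B where "B = (\<Sum>n\<le>N. unorm (u n)) + 2"
  note nn = universal_norm_nonneg[OF cauchy_in_carrier[OF u]]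
  have mem: "unorm (u n) \<le> (\<Sum>n\<le>N. unorm (u n))" if "n \<le> N" for n
    by (rule member_le_sum) (use that nn in auto)
  have "unorm (u n) \<le> B" for n
  proof (cases "n \<le> N")
    case True then show ?thesis using mem[OF True] by (simp add: B_def)
  next
    case False
    then show ?thesis
      using unorm_diff_le[OF cauchy_in_carrier[OF u] cauchy_in_carrier[OF u], of n N] N[of n N] mem[of N]
      by (simp add: B_def)
  qed
  moreover have "0 < B" unfolding B_def using sum_nonneg[of "{..N}" "\<lambda>n. unorm (u n)"] nn by simp
  ultimately show ?thesis using that by blast
qed

lemma cauchy_of_udist_bound:
  assumes u: "u \<in> CS" and v: "v \<in> CS" and w: "\<And>n. w n \<in> acar A" and K: "0 \<le> K"
    and le: "\<And>m n. udist (w m) (w n) \<le> K * (udist (u m) (u n) + udist (v m) (v n))"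
  shows "w \<in> CS"
  unfolding cauchy_sequences_def
proof (intro CollectI conjI allI impI w)
  fix e :: real assume e: "0 < e"
  define d where "d = e / (2 * (K + 1))"
  have d: "d > 0" using e K by (simp add: d_def)
  obtain N1 where N1: "\<And>m n. m \<ge> N1 \<Longrightarrow> n \<ge> N1 \<Longrightarrow> udist (u m) (u n) < d"
    using u d unfolding cauchy_sequences_def by blast
  obtain N2 where N2: "\<And>m n. m \<ge> N2 \<Longrightarrow> n \<ge> N2 \<Longrightarrow> udist (v m) (v n) < d"
    using v d unfolding cauchy_sequences_def by blast
  have "udist (w m) (w n) < e" if "m \<ge> max N1 N2" "n \<ge> max N1 N2" for m n
  proof -
    have "udist (w m) (w n) \<le> K * (udist (u m) (u n) + udist (v m) (v n))" by (rule le)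
    also have "\<dots> \<le> K * (2 * d)" using N1[of m n] N2[of m n] that K by (intro mult_left_mono) auto
    also have "\<dots> < (K + 1) * (2 * d)" using d by simp
    also have "\<dots> = e" using K by (simp add: d_def field_simps)
    finally show ?thesis .
  qed
  then show "\<exists>N. \<forall>m\<ge>N. \<forall>n\<ge>N. udist (w m) (w n) < e" by blast
qed

lemma null_difference_of_udist_bound:
  assumes uu': "(u, u') \<in> ND" and vv': "(v, v') \<in> ND" and w: "w \<in> CS" "w' \<in> CS"
    and le: "\<And>n. udist (w n) (w' n) \<le> K * (udist (u n) (u' n) + udist (v n) (v' n))"
  shows "(w, w') \<in> ND"
proof -
  have lim: "(\<lambda>n. K * (udist (u n) (u' n) + udist (v n) (v' n))) \<longlonglongrightarrow> K * (0 + 0)"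
    using uu' vv' by (intro tendsto_intros) (auto simp: null_difference_def)
  have "(\<lambda>n. udist (w n) (w' n)) \<longlonglongrightarrow> 0"
    by (rule tendsto_sandwich[OF _ _ tendsto_const lim[simplified]])
      (use w le in \<open>auto intro!: always_eventually udist_nonneg cauchy_in_carrier\<close>)
  then show ?thesis using w by (simp add: null_difference_def)
qed

lemma null_difference_refl: "u \<in> CS \<Longrightarrow> (u, u) \<in> ND"
  using equiv_null_difference by (meson equivE refl_onD)

lemma cauchy_add:
  assumes u: "u \<in> CS" and v: "v \<in> CS"
  shows "(\<lambda>n. aadd A (u n) (v n)) \<in> CS"
  using cauchy_in_carrier[OF u] cauchy_in_carrier[OF v]
  by (intro cauchy_of_udist_bound[OF u v, of _ 1]) (auto intro!: add_closed udist_add)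

lemma cauchy_scale: "u \<in> CS \<Longrightarrow> (\<lambda>n. ascale A c (u n)) \<in> CS"
proof (rule cauchy_of_udist_bound[of u u _ "cmod c"])
  assume u: "u \<in> CS"
  fix m n
  have "udist (ascale A c (u m)) (ascale A c (u n)) \<le> cmod c * udist (u m) (u n)"
    by (intro udist_scale cauchy_in_carrier u)
  also have "\<dots> \<le> cmod c * (udist (u m) (u n) + udist (u m) (u n))"
    using udist_nonneg[OF cauchy_in_carrier[OF u] cauchy_in_carrier[OF u]] by (intro mult_left_mono) auto
  finally show "udist (ascale A c (u m)) (ascale A c (u n)) \<le> cmod c * (udist (u m) (u n) + udist (u m) (u n))" .
qed (use scale_closed cauchy_in_carrier in auto)

lemma cauchy_mult_bound:
  assumes "u \<in> CS" "v' \<in> CS"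
  obtains K where "0 \<le> K" "\<And>m k b x. b \<in> acar A \<Longrightarrow> x \<in> acar A \<Longrightarrow>
      udist (amult A (u m) b) (amult A x (v' k)) \<le> K * (udist (u m) x + udist b (v' k))"
proof -
  obtain B where B: "0 < B" "\<And>n. unorm (u n) \<le> B" by (rule cauchy_bounded[OF assms(1)]) blast
  obtain B' where B': "0 < B'" "\<And>n. unorm (v' n) \<le> B'" by (rule cauchy_bounded[OF assms(2)]) blast
  show ?thesis
  proof (rule that[of "B + B'"])
    fix m k b x assume bx: "b \<in> acar A" "x \<in> acar A"
    have c: "u m \<in> acar A" "v' k \<in> acar A" using assms cauchy_in_carrier by auto
    have "udist (amult A (u m) b) (amult A x (v' k)) \<le> unorm (u m) * udist b (v' k) + udist (u m) x * unorm (v' k)"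
      by (rule udist_mult) (use c bx in auto)
    also have "\<dots> \<le> (B + B') * udist b (v' k) + udist (u m) x * (B + B')"
    proof (intro add_mono mult_right_mono mult_left_mono udist_nonneg bx c)
      show "unorm (u m) \<le> B + B'" "unorm (v' k) \<le> B + B'" using B(2)[of m] B'(2)[of k] B(1) B'(1) by linarith+
    qed
    finally show "udist (amult A (u m) b) (amult A x (v' k)) \<le> (B + B') * (udist (u m) x + udist b (v' k))"
      by (simp add: algebra_simps)
  qed (use B B' in simp)
qed

lemma cauchy_mult: "u \<in> CS \<Longrightarrow> v \<in> CS \<Longrightarrow> (\<lambda>n. amult A (u n) (v n)) \<in> CS"
proof -
  assume uv: "u \<in> CS" "v \<in> CS"
  obtain K where K: "0 \<le> K" "\<And>m k b x. b \<in> acar A \<Longrightarrow> x \<in> acar A \<Longrightarrow>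
      udist (amult A (u m) b) (amult A x (v k)) \<le> K * (udist (u m) x + udist b (v k))"
    by (rule cauchy_mult_bound[OF uv]) blast
  show ?thesis
    using cauchy_in_carrier[OF uv(1)] cauchy_in_carrier[OF uv(2)]
    by (intro cauchy_of_udist_bound[OF uv _ K(1)]) (auto intro!: mult_closed K(2))
qed

lemma cauchy_star: "u \<in> CS \<Longrightarrow> (\<lambda>n. astar A (u n)) \<in> CS"
proof (rule cauchy_of_udist_bound[of u u _ 1])
  assume u: "u \<in> CS"
  fix m n
  show "udist (astar A (u m)) (astar A (u n)) \<le> 1 * (udist (u m) (u n) + udist (u m) (u n))"
    using udist_star[OF cauchy_in_carrier[OF u] cauchy_in_carrier[OF u], of m n]
      udist_nonneg[OF cauchy_in_carrier[OF u] cauchy_in_carrier[OF u], of m n] by simp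
qed (use star_closed cauchy_in_carrier in auto)

abbreviation cls :: "(nat \<Rightarrow> 'a) \<Rightarrow> (nat \<Rightarrow> 'a) set" where "cls u \<equiv> ND `` {u}"
abbreviation "compl \<equiv> completion A unorm"

lemma acar_completion: "acar compl = CS // ND"
  by (simp add: completion_def Let_def)

lemma UN_constant_class:
  assumes "\<And>x. x \<in> X \<Longrightarrow> f x = c" "X \<noteq> {}"
  shows "(\<Union>x\<in>X. f x) = c"
  using assms by auto

lemma class_eqI: "(u, v) \<in> ND \<Longrightarrow> cls u = cls v"
  by (rule equiv_class_eq[OF equiv_null_difference])

lemma class_nonempty: "u \<in> CS \<Longrightarrow> cls u \<noteq> {}"
  using null_difference_refl by blast

lemma in_class_cauchy: "u' \<in> cls u \<Longrightarrow> (u, u') \<in> ND \<and> u' \<in> CS"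
  by (auto simp: null_difference_def)

lemma class_add:
  assumes uv: "u \<in> CS" "v \<in> CS"
  shows "aadd compl (cls u) (cls v) = cls (\<lambda>n. aadd A (u n) (v n))"
proof -
  have "aadd compl (cls u) (cls v) = (\<Union>u'\<in>cls u. \<Union>v'\<in>cls v. cls (\<lambda>n. aadd A (u' n) (v' n)))"
    by (simp add: completion_def Let_def)
  also have "\<dots> = cls (\<lambda>n. aadd A (u n) (v n))"
  proof (intro UN_constant_class class_nonempty uv)
    fix u' v' assume "u' \<in> cls u" "v' \<in> cls v"
    then have u': "(u, u') \<in> ND" "u' \<in> CS" and v': "(v, v') \<in> ND" "v' \<in> CS" using in_class_cauchy by auto
    have "(\<lambda>n. aadd A (u n) (v n), \<lambda>n. aadd A (u' n) (v' n)) \<in> ND"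
      by (rule null_difference_of_udist_bound[OF u'(1) v'(1), of _ _ 1])
        (auto intro!: cauchy_add uv u' v' udist_add cauchy_in_carrier[OF uv(1)] cauchy_in_carrier[OF uv(2)]
          cauchy_in_carrier[OF u'(2)] cauchy_in_carrier[OF v'(2)])
    then show "cls (\<lambda>n. aadd A (u' n) (v' n)) = cls (\<lambda>n. aadd A (u n) (v n))"
      using class_eqI by blast
  qed
  finally show ?thesis .
qed

lemma class_mult:
  assumes uv: "u \<in> CS" "v \<in> CS"
  shows "amult compl (cls u) (cls v) = cls (\<lambda>n. amult A (u n) (v n))"
proof -
  have "amult compl (cls u) (cls v) = (\<Union>u'\<in>cls u. \<Union>v'\<in>cls v. cls (\<lambda>n. amult A (u' n) (v' n)))"
    by (simp add: completion_def Let_def)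
  also have "\<dots> = cls (\<lambda>n. amult A (u n) (v n))"
  proof (intro UN_constant_class class_nonempty uv)
    fix u' v' assume "u' \<in> cls u" "v' \<in> cls v"
    then have u': "(u, u') \<in> ND" "u' \<in> CS" and v': "(v, v') \<in> ND" "v' \<in> CS" using in_class_cauchy by auto
    obtain K where K: "0 \<le> K" "\<And>m k b x. b \<in> acar A \<Longrightarrow> x \<in> acar A \<Longrightarrow>
        udist (amult A (u m) b) (amult A x (v' k)) \<le> K * (udist (u m) x + udist b (v' k))"
      by (rule cauchy_mult_bound[OF uv(1) v'(2)]) blast
    have "(\<lambda>n. amult A (u n) (v n), \<lambda>n. amult A (u' n) (v' n)) \<in> ND"
      by (rule null_difference_of_udist_bound[OF u'(1) v'(1), of _ _ K])
        (auto intro!: cauchy_mult uv u' v' K(2) cauchy_in_carrier[OF uv(2)] cauchy_in_carrier[OF u'(2)])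
    then show "cls (\<lambda>n. amult A (u' n) (v' n)) = cls (\<lambda>n. amult A (u n) (v n))"
      using class_eqI by blast
  qed
  finally show ?thesis .
qed

lemma class_scale:
  assumes u: "u \<in> CS"
  shows "ascale compl c (cls u) = cls (\<lambda>n. ascale A c (u n))"
proof -
  have "ascale compl c (cls u) = (\<Union>u'\<in>cls u. cls (\<lambda>n. ascale A c (u' n)))"
    by (simp add: completion_def Let_def)
  also have "\<dots> = cls (\<lambda>n. ascale A c (u n))"
  proof (intro UN_constant_class class_nonempty u)
    fix u' assume "u' \<in> cls u"
    then have u': "(u, u') \<in> ND" "u' \<in> CS" using in_class_cauchy by auto
    have "(\<lambda>n. ascale A c (u n), \<lambda>n. ascale A c (u' n)) \<in> ND"
    proof (rule null_difference_of_udist_bound[OF u'(1) null_difference_refl[OF u], of _ _ "cmod c"])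
      show "udist (ascale A c (u n)) (ascale A c (u' n)) \<le> cmod c * (udist (u n) (u' n) + udist (u n) (u n))" for n
        using udist_scale[OF cauchy_in_carrier[OF u] cauchy_in_carrier[OF u'(2)], of c n n]
          udist_refl[OF cauchy_in_carrier[OF u]] by simp
    qed (auto intro!: cauchy_scale u u')
    then show "cls (\<lambda>n. ascale A c (u' n)) = cls (\<lambda>n. ascale A c (u n))"
      using class_eqI by blast
  qed
  finally show ?thesis .
qed

lemma class_star:
  assumes u: "u \<in> CS"
  shows "astar compl (cls u) = cls (\<lambda>n. astar A (u n))"
proof -
  have "astar compl (cls u) = (\<Union>u'\<in>cls u. cls (\<lambda>n. astar A (u' n)))"
    by (simp add: completion_def Let_def)
  also have "\<dots> = cls (\<lambda>n. astar A (u n))"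
  proof (intro UN_constant_class class_nonempty u)
    fix u' assume "u' \<in> cls u"
    then have u': "(u, u') \<in> ND" "u' \<in> CS" using in_class_cauchy by auto
    have "(\<lambda>n. astar A (u n), \<lambda>n. astar A (u' n)) \<in> ND"
    proof (rule null_difference_of_udist_bound[OF u'(1) null_difference_refl[OF u], of _ _ 1])
      show "udist (astar A (u n)) (astar A (u' n)) \<le> 1 * (udist (u n) (u' n) + udist (u n) (u n))" for n
        using udist_star[OF cauchy_in_carrier[OF u] cauchy_in_carrier[OF u'(2)], of n n]
          udist_refl[OF cauchy_in_carrier[OF u]] by simp
    qed (auto intro!: cauchy_star u u')
    then show "cls (\<lambda>n. astar A (u' n)) = cls (\<lambda>n. astar A (u n))"
      using class_eqI by blast
  qed
  finally show ?thesis .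
qed

lemma class_in_completion: "u \<in> CS \<Longrightarrow> cls u \<in> acar compl"
  by (simp add: acar_completion quotientI)

lemma completion_cases:
  assumes "U \<in> acar compl"
  obtains u where "u \<in> CS" "U = cls u"
  using assms by (auto simp: acar_completion elim!: quotientE)

subsection \<open>Finite-dimensional representations of the completion\<close>

text \<open>
  The constant sequences map \<open>A\<close> to the completion, so that representations of the completion
  restrict to \<open>A\<close>.
\<close>

lemma residually_finite_dimensional_completionD:
  assumes rfd: "residually_finite_dimensional compl" and a: "a \<in> acar A" and pos: "0 < unorm a"
  shows "\<exists>n \<pi>. matrix_representation A n \<pi> \<and> \<pi> a \<noteq> 0\<^sub>m n n"
proof -
  \<comment> \<open>Every representation sends this element to \<open>0\<close>.\<close>
  let ?z = "ascale A 0 a"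
  have "unorm a \<le> udist a ?z"
  proof (rule universal_norm_le)
    fix I \<pi> v assume \<pi>: "hilbert_representation A I \<pi>" and v: "v \<in> ell2 I" "ell2_norm I v \<le> 1"
    show "ell2_norm I (\<pi> a v) \<le> udist a ?z"
      using rep_diff_bound[OF \<pi> a scale_closed[OF a] v, of 0]
      by (simp add: hilbert_representationD(3)[OF \<pi> a v(1)])
  qed
  have "cls (\<lambda>n. a) \<noteq> cls (\<lambda>n. ?z)"
  proof
    assume "cls (\<lambda>n. a) = cls (\<lambda>n. ?z)"
    then have "(\<lambda>n. a, \<lambda>n. ?z) \<in> ND"
      using null_difference_refl[OF cauchy_const[OF scale_closed[OF a]]] by blast
    then have "udist a ?z = 0" by (simp add: null_difference_def LIMSEQ_const_iff)
    then show False using pos \<open>unorm a \<le> udist a ?z\<close> by simp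
  qed
  then obtain n \<rho> where \<rho>: "matrix_representation compl n \<rho>" and ne: "\<rho> (cls (\<lambda>n. a)) \<noteq> \<rho> (cls (\<lambda>n. ?z))"
    using rfd a class_in_completion cauchy_const scale_closed
    unfolding residually_finite_dimensional_def by metis
  define \<pi> where "\<pi> x = \<rho> (cls (\<lambda>n. x))" for x
  note ops = class_add[OF cauchy_const cauchy_const, symmetric] class_mult[OF cauchy_const cauchy_const, symmetric]
    class_scale[OF cauchy_const, symmetric] class_star[OF cauchy_const, symmetric]
  have "matrix_representation A n \<pi>"
    using \<rho> unfolding matrix_representation_def \<pi>_def
    by (simp add: ops class_in_completion cauchy_const)
  moreover have "\<pi> a \<noteq> 0\<^sub>m n n"
  proof
    assume 0: "\<pi> a = 0\<^sub>m n n"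
    have "\<pi> ?z = 0 \<cdot>\<^sub>m \<pi> a" using \<open>matrix_representation A n \<pi>\<close> a by (simp add: matrix_representation_def)
    also have "\<dots> = 0\<^sub>m n n" using 0 by auto
    finally show False using 0 ne by (simp add: \<pi>_def)
  qed
  ultimately show ?thesis by blast
qed

lemma matrix_entry_bound:
  assumes \<pi>: "matrix_representation A n \<pi>" and a: "a \<in> acar A" and ij: "i < n" "j < n"
  shows "cmod (\<pi> a $$ (i, j)) \<le> unorm a"
proof -
  let ?m = "\<lambda>i j. \<pi> a $$ (i, j)" let ?e = "\<lambda>k. if k = j then 1 else (0::complex)"
  have e: "?e \<in> ell2 {..<n}" using ij by (auto simp: ell2_def)
  have "(ell2_norm {..<n} ?e)\<^sup>2 = 1"
    using ij by (simp add: ell2_norm_power2 if_distrib[of "\<lambda>x. (cmod x)\<^sup>2"] cong: if_cong)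
  then have ne: "ell2_norm {..<n} ?e \<le> 1" by (simp add: power2_eq_1_iff abs_le_iff) (metis ell2_norm_nonneg neg_0_le_iff_le not_one_le_zero order_refl)
  have mv: "matrix_operator {..<n} ?m ?e i = ?m i j"
    using ij by (simp add: matrix_operator_finite if_distrib[of "\<lambda>x. _ * x"] cong: if_cong)
  have "(cmod (matrix_operator {..<n} ?m ?e i))\<^sup>2 \<le> (ell2_norm {..<n} (matrix_operator {..<n} ?m ?e))\<^sup>2"
    unfolding ell2_norm_power2 using ij
    by (simp, intro member_le_sum[of i "{..<n}" "\<lambda>i. (cmod (matrix_operator {..<n} ?m ?e i))\<^sup>2"]) auto
  then have "cmod (?m i j) \<le> ell2_norm {..<n} (matrix_operator {..<n} ?m ?e)"
    unfolding mv by (rule power2_le_imp_le) simp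
  also have "\<dots> \<le> unorm a"
    using universal_norm_bound'[OF hilbert_representation_of_matrix_representation[OF \<pi>] a e ne] by simp
  finally show ?thesis .
qed

lemma matrix_entry_diff:
  assumes \<pi>: "matrix_representation A n \<pi>" and ab: "a \<in> acar A" "b \<in> acar A" and ij: "i < n" "j < n"
  shows "\<pi> (aadd A a (ascale A (-1) b)) $$ (i, j) = \<pi> a $$ (i, j) - \<pi> b $$ (i, j)"
proof -
  have "\<pi> (aadd A a (ascale A (-1) b)) = \<pi> a + (-1) \<cdot>\<^sub>m \<pi> b" "\<pi> a \<in> carrier_mat n n" "\<pi> b \<in> carrier_mat n n"
    using \<pi> ab scale_closed[OF ab(2)] by (auto simp: matrix_representation_def)
  then show ?thesis using ij by simp
qed

lemma matrix_entry_convergent: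
  assumes \<pi>: "matrix_representation A n \<pi>" and u: "u \<in> CS" and ij: "i < n" "j < n"
  shows "convergent (\<lambda>k. \<pi> (u k) $$ (i, j))"
  unfolding Cauchy_convergent_iff[symmetric] Cauchy_def
proof (intro allI impI)
  fix e :: real assume "0 < e"
  then obtain N where "\<forall>m\<ge>N. \<forall>n\<ge>N. udist (u m) (u n) < e" using u unfolding cauchy_sequences_def by blast
  then have "dist (\<pi> (u k) $$ (i, j)) (\<pi> (u l) $$ (i, j)) < e" if "k \<ge> N" "l \<ge> N" for k l
    using matrix_entry_bound[OF \<pi> diff_closed[OF cauchy_in_carrier[OF u] cauchy_in_carrier[OF u]] ij, of k l]
      matrix_entry_diff[OF \<pi> cauchy_in_carrier[OF u] cauchy_in_carrier[OF u] ij, of k l] that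
    by (fastforce simp: dist_norm seminorm_dist_def)
  then show "\<exists>N. \<forall>k\<ge>N. \<forall>l\<ge>N. dist (\<pi> (u k) $$ (i, j)) (\<pi> (u l) $$ (i, j)) < e" by blast
qed

lemma matrix_entry_null_difference:
  assumes \<pi>: "matrix_representation A n \<pi>" and uv: "(u, v) \<in> ND" and ij: "i < n" "j < n"
  shows "(\<lambda>k. \<pi> (u k) $$ (i, j) - \<pi> (v k) $$ (i, j)) \<longlonglongrightarrow> 0"
proof (rule tendsto_0_le[where K=1])
  have c: "u \<in> CS" "v \<in> CS" using uv by (auto simp: null_difference_def)
  show "(\<lambda>k. udist (u k) (v k)) \<longlonglongrightarrow> 0" using uv by (simp add: null_difference_def)
  show "\<forall>\<^sub>F k in sequentially. norm (\<pi> (u k) $$ (i, j) - \<pi> (v k) $$ (i, j)) \<le> norm (udist (u k) (v k)) * 1"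
    using matrix_entry_bound[OF \<pi> diff_closed[OF cauchy_in_carrier[OF c(1)] cauchy_in_carrier[OF c(2)]] ij]
      matrix_entry_diff[OF \<pi> cauchy_in_carrier[OF c(1)] cauchy_in_carrier[OF c(2)] ij]
    by (intro always_eventually) (auto simp: seminorm_dist_def intro: order_trans[OF _ abs_ge_self])
qed

text \<open>
  The matrix entries are bounded by the universal norm, so they converge along a Cauchy sequence, and
  the limit is the same for all representatives of a class.
\<close>

definition completed_rep :: "nat \<Rightarrow> ('a \<Rightarrow> complex mat) \<Rightarrow> (nat \<Rightarrow> 'a) set \<Rightarrow> complex mat" where
  "completed_rep n \<pi> U = mat n n (\<lambda>(i, j). lim (\<lambda>k. \<pi> ((SOME u. u \<in> U) k) $$ (i, j)))"

lemma completed_rep_lim: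
  assumes \<pi>: "matrix_representation A n \<pi>" and u: "u \<in> CS" and ij: "i < n" "j < n"
  shows "(\<lambda>k. \<pi> (u k) $$ (i, j)) \<longlonglongrightarrow> completed_rep n \<pi> (cls u) $$ (i, j)"
proof -
  define u' where "u' = (SOME u'. u' \<in> cls u)"
  have "u' \<in> cls u" unfolding u'_def by (rule someI[of "\<lambda>u'. u' \<in> cls u" u]) (use null_difference_refl[OF u] in blast)
  then have u': "(u, u') \<in> ND" "u' \<in> CS" using in_class_cauchy by auto
  have "(\<lambda>k. \<pi> (u' k) $$ (i, j)) \<longlonglongrightarrow> completed_rep n \<pi> (cls u) $$ (i, j)"
    using matrix_entry_convergent[OF \<pi> u'(2) ij] ij
    by (simp add: completed_rep_def convergent_LIMSEQ_iff u'_def)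
  from tendsto_add[OF matrix_entry_null_difference[OF \<pi> u'(1) ij] this] show ?thesis by simp
qed

lemma matrix_representation_completed_rep:
  assumes \<pi>: "matrix_representation A n \<pi>"
  shows "matrix_representation compl n (completed_rep n \<pi>)"
proof -
  note rep = \<pi>[unfolded matrix_representation_def]
  have carr[simp]: "completed_rep n \<pi> U \<in> carrier_mat n n" for U by (simp add: completed_rep_def)
  have dims[simp]: "dim_row (completed_rep n \<pi> U) = n" "dim_col (completed_rep n \<pi> U) = n" for U
    using carrier_matD[OF carr[of U]] by simp_all
  note carr\<pi> = rep[THEN conjunct1, rule_format]
  note lim = completed_rep_lim[OF \<pi>]
  have "completed_rep n \<pi> (aadd compl U V) = completed_rep n \<pi> U + completed_rep n \<pi> V"
    if UV: "U \<in> acar compl" "V \<in> acar compl" for U V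
  proof (rule eq_matI)
    obtain u v where u: "u \<in> CS" "U = cls u" and v: "v \<in> CS" "V = cls v" using UV completion_cases by metis
    fix i j assume "i < dim_row (completed_rep n \<pi> U + completed_rep n \<pi> V)" "j < dim_col (completed_rep n \<pi> U + completed_rep n \<pi> V)"
    then have ij: "i < n" "j < n" by auto
    have "(\<lambda>k. \<pi> (aadd A (u k) (v k)) $$ (i, j)) \<longlonglongrightarrow> completed_rep n \<pi> U $$ (i, j) + completed_rep n \<pi> V $$ (i, j)"
    proof -
      have "\<pi> (aadd A (u k) (v k)) $$ (i, j) = \<pi> (u k) $$ (i, j) + \<pi> (v k) $$ (i, j)" for k
        using rep carrier_matD[OF carr\<pi>[OF cauchy_in_carrier[OF u(1), of k]]]
          carrier_matD[OF carr\<pi>[OF cauchy_in_carrier[OF v(1), of k]]] ij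
        by (simp add: cauchy_in_carrier u v)
      then show ?thesis using tendsto_add[OF lim[OF u(1) ij] lim[OF v(1) ij]] by (simp add: u v)
    qed
    then show "completed_rep n \<pi> (aadd compl U V) $$ (i, j) = (completed_rep n \<pi> U + completed_rep n \<pi> V) $$ (i, j)"
      using lim[OF cauchy_add[OF u(1) v(1)] ij] LIMSEQ_unique ij by (simp add: u v class_add) blast
  qed auto
  moreover have "completed_rep n \<pi> (ascale compl c U) = c \<cdot>\<^sub>m completed_rep n \<pi> U" if U: "U \<in> acar compl" for U c
  proof (rule eq_matI)
    obtain u where u: "u \<in> CS" "U = cls u" using U completion_cases by metis
    fix i j assume "i < dim_row (c \<cdot>\<^sub>m completed_rep n \<pi> U)" "j < dim_col (c \<cdot>\<^sub>m completed_rep n \<pi> U)"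
    then have ij: "i < n" "j < n" by auto
    have "(\<lambda>k. \<pi> (ascale A c (u k)) $$ (i, j)) \<longlonglongrightarrow> c * completed_rep n \<pi> U $$ (i, j)"
    proof -
      have "\<pi> (ascale A c (u k)) $$ (i, j) = c * \<pi> (u k) $$ (i, j)" for k
        using rep carrier_matD[OF carr\<pi>[OF cauchy_in_carrier[OF u(1), of k]]] ij
        by (simp add: cauchy_in_carrier u)
      then show ?thesis using tendsto_mult[OF tendsto_const lim[OF u(1) ij]] by (simp add: u)
    qed
    then show "completed_rep n \<pi> (ascale compl c U) $$ (i, j) = (c \<cdot>\<^sub>m completed_rep n \<pi> U) $$ (i, j)"
      using lim[OF cauchy_scale[OF u(1)] ij] LIMSEQ_unique ij by (simp add: u class_scale) blast
  qed auto
  moreover have "completed_rep n \<pi> (amult compl U V) = completed_rep n \<pi> U * completed_rep n \<pi> V"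
    if UV: "U \<in> acar compl" "V \<in> acar compl" for U V
  proof (rule eq_matI)
    obtain u v where u: "u \<in> CS" "U = cls u" and v: "v \<in> CS" "V = cls v" using UV completion_cases by metis
    fix i j assume "i < dim_row (completed_rep n \<pi> U * completed_rep n \<pi> V)" "j < dim_col (completed_rep n \<pi> U * completed_rep n \<pi> V)"
    then have ij: "i < n" "j < n" by auto
    have "(\<lambda>k. \<Sum>l<n. \<pi> (u k) $$ (i, l) * \<pi> (v k) $$ (l, j)) \<longlonglongrightarrow>
        (\<Sum>l<n. completed_rep n \<pi> U $$ (i, l) * completed_rep n \<pi> V $$ (l, j))"
      unfolding u v by (intro tendsto_sum tendsto_mult lim ij u v) auto
    moreover have "\<pi> (amult A (u k) (v k)) $$ (i, j) = (\<Sum>l<n. \<pi> (u k) $$ (i, l) * \<pi> (v k) $$ (l, j))" for k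
      using rep mat_mult_index[OF carr\<pi>[OF cauchy_in_carrier[OF u(1)]] carr\<pi>[OF cauchy_in_carrier[OF v(1)]] ij]
      by (simp add: cauchy_in_carrier u v)
    ultimately have "(\<lambda>k. \<pi> (amult A (u k) (v k)) $$ (i, j)) \<longlonglongrightarrow> (completed_rep n \<pi> U * completed_rep n \<pi> V) $$ (i, j)"
      by (simp only: mat_mult_index[OF carr carr ij])
    then show "completed_rep n \<pi> (amult compl U V) $$ (i, j) = (completed_rep n \<pi> U * completed_rep n \<pi> V) $$ (i, j)"
      using lim[OF cauchy_mult[OF u(1) v(1)] ij] LIMSEQ_unique by (simp only: u v class_mult) blast
  qed auto
  moreover have "completed_rep n \<pi> (astar compl U) = mat_adjoint (completed_rep n \<pi> U)" if U: "U \<in> acar compl" for U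
  proof (rule eq_matI)
    obtain u where u: "u \<in> CS" "U = cls u" using U completion_cases by metis
    fix i j assume "i < dim_row (mat_adjoint (completed_rep n \<pi> U))" "j < dim_col (mat_adjoint (completed_rep n \<pi> U))"
    then have ij: "i < n" "j < n" using mat_adjoint_carrier[OF carr[of U]] by auto
    have "(\<lambda>k. cnj (\<pi> (u k) $$ (j, i))) \<longlonglongrightarrow> cnj (completed_rep n \<pi> U $$ (j, i))"
      unfolding u by (intro tendsto_cnj lim u ij)
    moreover have "\<pi> (astar A (u k)) $$ (i, j) = cnj (\<pi> (u k) $$ (j, i))" for k
      using rep mat_adjoint_index[OF carr\<pi>[OF cauchy_in_carrier[OF u(1)]] ij] by (simp add: cauchy_in_carrier u)
    ultimately have "(\<lambda>k. \<pi> (astar A (u k)) $$ (i, j)) \<longlonglongrightarrow> mat_adjoint (completed_rep n \<pi> U) $$ (i, j)"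
      by (simp only: mat_adjoint_index[OF carr ij])
    then show "completed_rep n \<pi> (astar compl U) $$ (i, j) = mat_adjoint (completed_rep n \<pi> U) $$ (i, j)"
      using lim[OF cauchy_star[OF u(1)] ij] LIMSEQ_unique by (simp only: u class_star) blast
  qed (use mat_adjoint_carrier[OF carr[of U]] in auto)
  ultimately show ?thesis by (simp add: matrix_representation_def)
qed

lemma matrix_operator_entries_bound:
  assumes "\<And>i j. i < n \<Longrightarrow> j < n \<Longrightarrow> cmod (m i j) \<le> e" "0 \<le> e" "v \<in> ell2 {..<n}"
  shows "ell2_norm {..<n} (matrix_operator {..<n} m v) \<le> real n * e * ell2_norm {..<n} v"
proof -
  have "row_col_finite {..<n} n e m"
    using assms(1) card_mono[of "{..<n}"] by (auto simp: row_col_finite_def) (metis (no_types, lifting) card_lessThan finite_lessThan lessThan_iff mem_Collect_eq subsetI)+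
  from matrix_operator_ell2(2)[OF this assms(3,2)] show ?thesis .
qed

text \<open>
  If the finite-dimensional representations compute the universal norm, they separate the points
  of the completion: a Cauchy sequence that does not tend to \<open>0\<close> has a late term whose norm
  is almost attained in one of them, and the later terms cannot become small there.
\<close>

lemma residually_finite_dimensional_completionI:
  assumes norming: "\<And>a C. a \<in> acar A \<Longrightarrow> 0 \<le> C \<Longrightarrow>
      (\<And>n \<pi> v. matrix_representation A n \<pi> \<Longrightarrow> v \<in> ell2 {..<n} \<Longrightarrow>
         ell2_norm {..<n} (matrix_operator {..<n} (\<lambda>i j. \<pi> a $$ (i, j)) v) \<le> C * ell2_norm {..<n} v) \<Longrightarrow>
      unorm a \<le> C"
  shows "residually_finite_dimensional compl"
  unfolding residually_finite_dimensional_def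
proof (intro ballI impI, rule ccontr)
  fix U V assume U: "U \<in> acar compl" and V: "V \<in> acar compl" and ne: "U \<noteq> V"
    and "\<not> (\<exists>n \<rho>. matrix_representation compl n \<rho> \<and> \<rho> U \<noteq> \<rho> V)"
  then have same: "completed_rep n \<pi> U = completed_rep n \<pi> V" if "matrix_representation A n \<pi>" for n \<pi>
    using matrix_representation_completed_rep that by blast
  obtain u v where u: "u \<in> CS" "U = cls u" and v: "v \<in> CS" "V = cls v" using U V completion_cases by metis
  define w where "w n = aadd A (u n) (ascale A (-1) (v n))" for n
  have w: "w \<in> CS" unfolding w_def by (intro cauchy_add cauchy_scale u v)
  have w0: "(\<lambda>k. \<pi> (w k) $$ (i, j)) \<longlonglongrightarrow> 0" if "matrix_representation A n \<pi>" "i < n" "j < n" for n \<pi> i j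
  proof -
    have "(\<lambda>k. \<pi> (u k) $$ (i, j) - \<pi> (v k) $$ (i, j)) \<longlonglongrightarrow> 0"
      using tendsto_diff[OF completed_rep_lim[OF that(1) u(1) that(2,3)] completed_rep_lim[OF that(1) v(1) that(2,3)]]
        same[OF that(1)] by (simp add: u v)
    then show ?thesis
      using matrix_entry_diff[OF that(1) cauchy_in_carrier[OF u(1)] cauchy_in_carrier[OF v(1)] that(2,3)]
      by (simp add: w_def)
  qed
  have "\<not> (\<lambda>n. udist (u n) (v n)) \<longlonglongrightarrow> 0"
    using ne class_eqI[of u v] u v by (auto simp: null_difference_def)
  then obtain e where e: "e > 0" and freq: "\<And>N. \<exists>n\<ge>N. unorm (w n) \<ge> e"
    using universal_norm_nonneg[OF cauchy_in_carrier[OF w]]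
    unfolding LIMSEQ_def by (auto simp: not_less seminorm_dist_def w_def)
  obtain N where N: "\<And>m n. m \<ge> N \<Longrightarrow> n \<ge> N \<Longrightarrow> udist (w m) (w n) < e / 4"
    using w e unfolding cauchy_sequences_def by (fastforce dest!: spec[of _ "e/4"])
  obtain k where k: "k \<ge> N" "unorm (w k) \<ge> e" using freq by blast
  \<comment> \<open>The index \<open>k\<close> is late enough for all later terms to be \<open>e/4\<close>-close to \<open>w k\<close>.\<close>
  have "\<not> unorm (w k) \<le> e / 2" using k e by simp
  then obtain n \<pi> x where \<pi>: "matrix_representation A n \<pi>" and x: "x \<in> ell2 {..<n}"
    and big: "ell2_norm {..<n} (matrix_operator {..<n} (\<lambda>i j. \<pi> (w k) $$ (i, j)) x) > e / 2 * ell2_norm {..<n} x"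
    using norming[OF cauchy_in_carrier[OF w], of "e/2" k] e by (meson half_gt_zero less_imp_le not_le)
  let ?T = "\<lambda>a. matrix_operator {..<n} (\<lambda>i j. \<pi> a $$ (i, j))"
  note T = hilbert_representation_of_matrix_representation[OF \<pi>]
  note T_in = hilbert_representationD(6)[OF T _ x]
  define d where "d = e / (4 * (real n + 1))"
  have d: "d > 0" using e by (simp add: d_def)
  have "\<forall>\<^sub>F l in sequentially. \<forall>ij\<in>{..<n}\<times>{..<n}. cmod (\<pi> (w l) $$ ij) < d"
    unfolding eventually_ball_finite_distrib[OF finite_cartesian_product[OF finite_lessThan finite_lessThan]]
    using w0[OF \<pi>] d by (auto simp: tendsto_iff)
  then obtain l where l: "l \<ge> N" and small: "\<And>i j. i < n \<Longrightarrow> j < n \<Longrightarrow> cmod (\<pi> (w l) $$ (i, j)) \<le> d"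
    unfolding eventually_sequentially by (metis SigmaI lessThan_iff less_imp_le nle_le)
  have nd: "real n * d \<le> e / 4" using e by (simp add: d_def field_simps)
  have "ell2_norm {..<n} (?T (w l) x) \<le> e / 4 * ell2_norm {..<n} x"
    using matrix_operator_entries_bound[of n "\<lambda>i j. \<pi> (w l) $$ (i, j)", OF small _ x] d mult_right_mono[OF nd ell2_norm_nonneg[of "{..<n}" x]]
    by linarith
  moreover have "ell2_norm {..<n} (\<lambda>i. ?T (w k) x i - ?T (w l) x i) \<le> e / 4 * ell2_norm {..<n} x"
    using rep_diff_bound[OF T cauchy_in_carrier[OF w] cauchy_in_carrier[OF w] x order_refl, of k l]
      mult_right_mono[OF less_imp_le[OF N[OF k(1) l]] ell2_norm_nonneg[of "{..<n}" x]] by linarith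
  ultimately have "ell2_norm {..<n} (?T (w k) x) \<le> e / 2 * ell2_norm {..<n} x"
    using ell2_norm_triangle[of "?T (w l) x" "{..<n}" "\<lambda>i. ?T (w k) x i - ?T (w l) x i"]
      T_in[OF cauchy_in_carrier[OF w]] ell2_diff by simp
  then show False using big by simp
qed

end

section \<open>Compactly supported functions on locally compact Hausdorff spaces\<close>

lemma continuous_map_euclidean_iff:
  "continuous_map T euclidean f \<longleftrightarrow> (\<forall>x\<in>topspace T. (f \<longlongrightarrow> f x) (atin T x))"
  by (simp add: continuous_map_atin)

text \<open>
  Clipping an Urysohn function at height \<open>1/2\<close> makes its support a closed subset of the given
  open set.
\<close>

lemma Urysohn_compact_support:
  assumes T: "locally_compact_space T" "Hausdorff_space T" and K: "compactin T K" "K \<subseteq> U" and U: "openin T U"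
  shows "\<exists>(f :: 'a \<Rightarrow> real) L. continuous_map T euclidean f \<and> (\<forall>x. 0 \<le> f x \<and> f x \<le> 1) \<and>
    (\<forall>x\<in>K. f x = 1) \<and> compactin T L \<and> L \<subseteq> U \<and> (\<forall>x. x \<notin> L \<longrightarrow> f x = 0)"
proof -
  have cr: "completely_regular_space T"
    using T locally_compact_regular_imp_completely_regular_space by blast
  obtain V M where V: "openin T V" "compactin T M" "closedin T M" "K \<subseteq> V" "V \<subseteq> M"
    using locally_compact_space_compact_closed_compact[of T] T K(1) by blast
  have C: "closedin T (topspace T - (U \<inter> V))" using U V by auto
  have "disjnt K (topspace T - (U \<inter> V))" using K V by (auto simp: disjnt_def)
  then obtain g where g: "continuous_map T (subtopology euclidean {0..1::real}) g"
      "g ` (topspace T - (U \<inter> V)) \<subseteq> {0}" "g ` K \<subseteq> {1}"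
    using Urysohn_completely_regular_compact_closed[OF zero_le_one cr K(1) C] by blast
  have gc: "continuous_map T euclidean g" and g01: "\<And>x. x \<in> topspace T \<Longrightarrow> 0 \<le> g x \<and> g x \<le> 1"
    using g(1) by (auto simp: continuous_map_in_subtopology Pi_iff)
  define L where "L = {x \<in> topspace T. g x \<in> {1/2..}}"
  have Lcl: "closedin T L"
    unfolding L_def by (rule closedin_continuous_map_preimage[OF gc]) simp
  have LUV: "L \<subseteq> U \<inter> V"
  proof
    fix x assume x: "x \<in> L"
    show "x \<in> U \<inter> V"
    proof (rule ccontr)
      assume "x \<notin> U \<inter> V"
      then have "g x = 0" using g(2) x by (auto simp: L_def)
      then show False using x by (simp add: L_def)
    qed
  qed
  define f where "f x = (if x \<in> topspace T then max 0 (2 * g x - 1) else 0)" for x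
  show ?thesis
  proof (intro exI conjI allI ballI impI)
    show "continuous_map T euclidean f"
    proof (rule continuous_map_eq)
      show "continuous_map T euclidean (\<lambda>x. max 0 (2 * g x - 1))"
        using gc unfolding continuous_map_euclidean_iff by (auto intro!: tendsto_intros)
    qed (simp add: f_def)
    show "compactin T L" by (rule closed_compactin[OF V(2) _ Lcl]) (use LUV V in auto)
    show "L \<subseteq> U" using LUV by blast
    show "f x = 0" if "x \<notin> L" for x using that by (auto simp: f_def L_def)
    show "f x = 1" if "x \<in> K" for x
      using that g(3) compactin_subset_topspace[OF K(1)] by (auto simp: f_def)
    show "0 \<le> f x" "f x \<le> 1" for x using g01[of x] by (auto simp: f_def)
  qed
qed

text \<open>
  Squares are used because a term \<open>\<phi>\<^sup>2 f\<close> can then be split into factors \<open>\<phi>\<close> on both sides. The index set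
  consists of points of \<open>K\<close>, the cover \<open>V\<close> being indexed by these points; \<open>L x\<close> is a compact support of
  \<open>\<phi> x\<close> inside of \<open>V x\<close>.
\<close>

definition partition_of_squares ::
    "'a topology \<Rightarrow> 'a set \<Rightarrow> ('a \<Rightarrow> 'a set) \<Rightarrow> 'a set \<Rightarrow> ('a \<Rightarrow> 'a \<Rightarrow> real) \<Rightarrow> ('a \<Rightarrow> 'a set) \<Rightarrow> bool" where
  "partition_of_squares T K V F \<phi> L \<longleftrightarrow> finite F \<and> F \<subseteq> K \<and>
     (\<forall>x\<in>F. continuous_map T euclidean (\<phi> x) \<and> compactin T (L x) \<and> L x \<subseteq> V x \<and> (\<forall>y. y \<notin> L x \<longrightarrow> \<phi> x y = 0)) \<and>
     (\<forall>x y. 0 \<le> \<phi> x y) \<and> (\<forall>y\<in>K. (\<Sum>x\<in>F. (\<phi> x y)\<^sup>2) = 1) \<and> (\<forall>y. (\<Sum>x\<in>F. (\<phi> x y)\<^sup>2) \<le> 1)"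

lemma partition_of_squaresD:
  assumes "partition_of_squares T K V F \<phi> L"
  shows "finite F" "F \<subseteq> K" "x \<in> F \<Longrightarrow> continuous_map T euclidean (\<phi> x)" "x \<in> F \<Longrightarrow> compactin T (L x)"
    "x \<in> F \<Longrightarrow> L x \<subseteq> V x" "x \<in> F \<Longrightarrow> y \<notin> L x \<Longrightarrow> \<phi> x y = 0" "0 \<le> \<phi> x y"
    "y \<in> K \<Longrightarrow> (\<Sum>x\<in>F. (\<phi> x y)\<^sup>2) = 1" "(\<Sum>x\<in>F. (\<phi> x y)\<^sup>2) \<le> 1"
  using assms unfolding partition_of_squares_def by blast+

lemma partition_of_squares_le_1:
  assumes "partition_of_squares T K V F \<phi> L" "x \<in> F"
  shows "(\<phi> x y)\<^sup>2 \<le> 1" "\<phi> x y \<le> 1"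
proof -
  note P = partition_of_squaresD[OF assms(1)]
  have "(\<phi> x y)\<^sup>2 \<le> (\<Sum>x\<in>F. (\<phi> x y)\<^sup>2)" by (rule member_le_sum) (use assms(2) P(1) in auto)
  then show "(\<phi> x y)\<^sup>2 \<le> 1" using P(9)[of y] by linarith
  then show "\<phi> x y \<le> 1" by (simp add: power_le_one_iff P(7))
qed

lemma partition_of_squares_split:
  fixes f :: "'a \<Rightarrow> complex"
  assumes "partition_of_squares T K V F \<phi> L" "\<And>y. y \<notin> K \<Longrightarrow> f y = 0"
  shows "f = (\<lambda>y. \<Sum>x\<in>F. of_real ((\<phi> x y)\<^sup>2) * f y)"
proof
  fix y
  have "(\<Sum>x\<in>F. of_real ((\<phi> x y)\<^sup>2) * f y) = of_real (\<Sum>x\<in>F. (\<phi> x y)\<^sup>2) * f y"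
    by (simp add: sum_distrib_right)
  then show "f y = (\<Sum>x\<in>F. of_real ((\<phi> x y)\<^sup>2) * f y)"
    using partition_of_squaresD(8)[OF assms(1), of y] assms(2)[of y] by (cases "y \<in> K") auto
qed

text \<open>
  Dividing by \<open>max (\<Sum>u\<^sup>2) (1/4)\<close> normalises the sum of squares on \<open>K\<close>, where the
  sum is at least \<open>1/4\<close>, while keeping it at most \<open>1\<close> everywhere.
\<close>

lemma partition_of_unity_squares:
  assumes T: "locally_compact_space T" "Hausdorff_space T" and K: "compactin T K"
    and V: "\<And>x. x \<in> K \<Longrightarrow> openin T (V x) \<and> x \<in> V x"
  shows "\<exists>F \<phi> L. partition_of_squares T K V F \<phi> L"
proof -
  have Ksub: "K \<subseteq> topspace T" using K by (rule compactin_subset_topspace)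
  have "\<exists>u::'a \<Rightarrow> real. \<exists>L. continuous_map T euclidean u \<and> (\<forall>y. 0 \<le> u y) \<and> u x = 1 \<and>
      compactin T L \<and> L \<subseteq> V x \<and> (\<forall>y. y \<notin> L \<longrightarrow> u y = 0)" if x: "x \<in> K" for x
  proof -
    have "compactin T {x}" "{x} \<subseteq> V x" using x Ksub V by auto
    from Urysohn_compact_support[OF T this] V[OF x]
    have "\<exists>(u :: 'a \<Rightarrow> real) L. continuous_map T euclidean u \<and> (\<forall>y. 0 \<le> u y \<and> u y \<le> 1) \<and>
      (\<forall>y\<in>{x}. u y = 1) \<and> compactin T L \<and> L \<subseteq> V x \<and> (\<forall>y. y \<notin> L \<longrightarrow> u y = 0)" by simp
    then obtain u :: "'a \<Rightarrow> real" and L where "continuous_map T euclidean u \<and> (\<forall>y. 0 \<le> u y \<and> u y \<le> 1) \<and>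
      (\<forall>y\<in>{x}. u y = 1) \<and> compactin T L \<and> L \<subseteq> V x \<and> (\<forall>y. y \<notin> L \<longrightarrow> u y = 0)"
      by (elim exE) (rule that)
    then show ?thesis by (intro exI[of _ u] exI[of _ L]) simp
  qed
  then obtain u :: "'a \<Rightarrow> 'a \<Rightarrow> real" and L where
    u: "\<And>x. x \<in> K \<Longrightarrow> continuous_map T euclidean (u x)" "\<And>x y. x \<in> K \<Longrightarrow> 0 \<le> u x y" "\<And>x. x \<in> K \<Longrightarrow> u x x = 1"
    and L: "\<And>x. x \<in> K \<Longrightarrow> compactin T (L x)" "\<And>x. x \<in> K \<Longrightarrow> L x \<subseteq> V x" "\<And>x y. x \<in> K \<Longrightarrow> y \<notin> L x \<Longrightarrow> u x y = 0"
  proof -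
    assume \<section>: "\<And>x. x \<in> K \<Longrightarrow> \<exists>u::'a \<Rightarrow> real. \<exists>L. continuous_map T euclidean u \<and> (\<forall>y. 0 \<le> u y) \<and> u x = 1 \<and>
      compactin T L \<and> L \<subseteq> V x \<and> (\<forall>y. y \<notin> L \<longrightarrow> u y = 0)"
    assume *: "\<And>u L. (\<And>x. x \<in> K \<Longrightarrow> continuous_map T euclideanreal (u x)) \<Longrightarrow>
           (\<And>x y. x \<in> K \<Longrightarrow> 0 \<le> u x y) \<Longrightarrow> (\<And>x. x \<in> K \<Longrightarrow> u x x = 1) \<Longrightarrow>
           (\<And>x. x \<in> K \<Longrightarrow> compactin T (L x)) \<Longrightarrow> (\<And>x. x \<in> K \<Longrightarrow> L x \<subseteq> V x) \<Longrightarrow>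
           (\<And>x y. x \<in> K \<Longrightarrow> y \<notin> L x \<Longrightarrow> u x y = 0) \<Longrightarrow> thesis"
    have "\<forall>x\<in>K. \<exists>u::'a \<Rightarrow> real. \<exists>L. continuous_map T euclidean u \<and> (\<forall>y. 0 \<le> u y) \<and> u x = 1 \<and>
      compactin T L \<and> L \<subseteq> V x \<and> (\<forall>y. y \<notin> L \<longrightarrow> u y = 0)" using \<section> by blast
    then obtain u :: "'a \<Rightarrow> 'a \<Rightarrow> real" where "\<forall>x\<in>K. \<exists>L. continuous_map T euclidean (u x) \<and> (\<forall>y. 0 \<le> u x y) \<and> u x x = 1 \<and>
      compactin T L \<and> L \<subseteq> V x \<and> (\<forall>y. y \<notin> L \<longrightarrow> u x y = 0)" unfolding bchoice_iff by blast
    then obtain L where "\<forall>x\<in>K. continuous_map T euclidean (u x) \<and> (\<forall>y. 0 \<le> u x y) \<and> u x x = 1 \<and>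
      compactin T (L x) \<and> L x \<subseteq> V x \<and> (\<forall>y. y \<notin> L x \<longrightarrow> u x y = 0)" unfolding bchoice_iff by blast
    then show thesis by (intro *[of u L]) auto
  qed
  define W where "W x = {y \<in> topspace T. u x y \<in> {1/2<..}}" for x
  have W: "openin T (W x)" if "x \<in> K" for x
    unfolding W_def by (rule openin_continuous_map_preimage[OF u(1)[OF that]]) simp
  have "(\<forall>U\<in>W ` K. openin T U) \<and> K \<subseteq> \<Union>(W ` K)" using W u(3) Ksub by (force simp: W_def)
  then obtain \<F> where "finite \<F>" "\<F> \<subseteq> W ` K" "K \<subseteq> \<Union>\<F>" using K unfolding compactin_def by meson
  then obtain F where F: "finite F" "F \<subseteq> K" and cov: "K \<subseteq> \<Union>(W ` F)"
    by (metis finite_subset_image)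
  define S where "S y = (\<Sum>x\<in>F. (u x y)\<^sup>2)" for y
  have S: "S y \<ge> 1/4" if "y \<in> K" for y
  proof -
    obtain x where x: "x \<in> F" "y \<in> W x" using cov \<open>y \<in> K\<close> by blast
    then have x: "x \<in> F" "u x y > 1/2" by (auto simp: W_def)
    have "1/4 \<le> (u x y)\<^sup>2" using x power_mono[of "1/2" "u x y" 2] by (simp add: power_divide)
    also have "\<dots> \<le> S y" unfolding S_def by (rule member_le_sum) (use x F in auto)
    finally show ?thesis .
  qed
  define \<phi> where "\<phi> x y = (if x \<in> F then u x y / sqrt (max (S y) (1/4)) else 0)" for x y
  have sq: "(\<Sum>x\<in>F. (\<phi> x y)\<^sup>2) = S y / max (S y) (1/4)" for y
    unfolding \<phi>_def by (simp add: power_divide S_def sum_divide_distrib)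
  show ?thesis
    unfolding partition_of_squares_def
  proof (intro exI conjI ballI allI impI)
    show "finite F" "F \<subseteq> K" by fact+
    fix x assume x: "x \<in> F"
    have "continuous_map T euclidean (u x)" if "x \<in> F" for x using u(1) F that by blast
    then show "continuous_map T euclidean (\<phi> x)"
      unfolding continuous_map_euclidean_iff \<phi>_def[abs_def] S_def
      using x by (auto intro!: tendsto_intros)
    show "compactin T (L x)" "L x \<subseteq> V x" using x F L by auto
    show "\<phi> x y = 0" if "y \<notin> L x" for y using x F L(3)[of x y] that by (auto simp: \<phi>_def)
  next
    show "0 \<le> \<phi> x y" for x y using F u(2) by (auto simp: \<phi>_def intro!: divide_nonneg_nonneg)
    show "(\<Sum>x\<in>F. (\<phi> x y)\<^sup>2) = 1" if "y \<in> K" for y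
      unfolding sq using S[OF that] by (simp add: max_def)
    show "(\<Sum>x\<in>F. (\<phi> x y)\<^sup>2) \<le> 1" for y
      unfolding sq by (auto simp: max_def divide_le_eq)
  qed
qed

lemma continuous_map_extend_by_zero:
  fixes f :: "'a \<Rightarrow> 'b::real_normed_vector"
  assumes f: "continuous_map (subtopology T W) euclidean f" and W: "openin T W" and C: "closedin T C" "C \<subseteq> W"
    and zero: "\<And>x. x \<in> topspace T - C \<Longrightarrow> f x = 0"
  shows "continuous_map T euclidean f"
  unfolding continuous_map
proof (intro conjI allI impI)
  fix U :: "'b set" assume U: "openin euclidean U"
  have "openin (subtopology T W) {x \<in> topspace (subtopology T W). f x \<in> U}"
    by (rule openin_continuous_map_preimage[OF f U])
  then have 1: "openin T {x \<in> W. f x \<in> U}"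
    using openin_subset[OF W] W by (simp add: openin_open_subtopology Int_absorb1)
  have 2: "openin T {x \<in> topspace T - C. f x \<in> U}"
  proof (cases "0 \<in> U")
    case True
    then have "{x \<in> topspace T - C. f x \<in> U} = topspace T - C" using zero by auto
    then show ?thesis using C by auto
  next
    case False
    then have "{x \<in> topspace T - C. f x \<in> U} = {}" using zero by auto
    then show ?thesis by (simp only: openin_empty)
  qed
  have "{x \<in> topspace T. f x \<in> U} = {x \<in> W. f x \<in> U} \<union> {x \<in> topspace T - C. f x \<in> U}"
    using C openin_subset[OF W] by auto
  then show "openin T {x \<in> topspace T. f x \<in> U}" using openin_Un[OF 1 2] by (simp only:)
qed simp

lemma Cc_iff:
  assumes "Hausdorff_space (gtop G)"
  shows "f \<in> Cc G \<longleftrightarrow> continuous_map (gtop G) euclidean f \<and>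
     (\<exists>K. compactin (gtop G) K \<and> (\<forall>\<gamma>. \<gamma> \<notin> K \<longrightarrow> f \<gamma> = 0))"
proof
  assume f: "f \<in> Cc G"
  let ?K = "gtop G closure_of {\<gamma> \<in> arrows G. f \<gamma> \<noteq> 0}"
  have "{\<gamma> \<in> arrows G. f \<gamma> \<noteq> 0} \<subseteq> ?K" by (rule closure_of_subset) (auto simp: arrows_def)
  then have "\<forall>\<gamma>. \<gamma> \<notin> ?K \<longrightarrow> f \<gamma> = 0" using f by (auto simp: Cc_def)
  then show "continuous_map (gtop G) euclidean f \<and>
     (\<exists>K. compactin (gtop G) K \<and> (\<forall>\<gamma>. \<gamma> \<notin> K \<longrightarrow> f \<gamma> = 0))" using f by (auto simp: Cc_def)
next
  assume "continuous_map (gtop G) euclidean f \<and>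
     (\<exists>K. compactin (gtop G) K \<and> (\<forall>\<gamma>. \<gamma> \<notin> K \<longrightarrow> f \<gamma> = 0))"
  then obtain K where f: "continuous_map (gtop G) euclidean f" and K: "compactin (gtop G) K" "\<And>\<gamma>. \<gamma> \<notin> K \<Longrightarrow> f \<gamma> = 0"
    by blast
  have "closedin (gtop G) K" by (rule compactin_imp_closedin[OF assms K(1)])
  then have "gtop G closure_of {\<gamma> \<in> arrows G. f \<gamma> \<noteq> 0} \<subseteq> K"
    by (intro closure_of_minimal) (use K in auto)
  then have "compactin (gtop G) (gtop G closure_of {\<gamma> \<in> arrows G. f \<gamma> \<noteq> 0})"
    by (rule closed_compactin[OF K(1)]) simp
  moreover have "\<forall>\<gamma>. \<gamma> \<notin> arrows G \<longrightarrow> f \<gamma> = 0"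
    using K compactin_subset_topspace[OF K(1)] by (auto simp: arrows_def)
  ultimately show "f \<in> Cc G" using f by (auto simp: Cc_def)
qed

section \<open>Arrows and bisections\<close>

context algebraic_groupoid
begin

lemma units_iff: "x \<in> units G \<longleftrightarrow> x \<in> arrows G \<and> gsrc G x = x"
  unfolding units_def using src_closed src_src by (auto simp: image_iff) metis

lemma unitD: "x \<in> units G \<Longrightarrow> x \<in> arrows G \<and> gsrc G x = x \<and> grng G x = x"
  unfolding units_def using src_closed src_src rng_src by auto

lemma src_unit: "\<gamma> \<in> arrows G \<Longrightarrow> gsrc G \<gamma> \<in> units G"
  by (simp add: units_def)

lemma rng_unit: "\<gamma> \<in> arrows G \<Longrightarrow> grng G \<gamma> \<in> units G"
  using rng_closed src_rng by (simp add: units_iff)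

lemma comp_arrow:
  assumes "\<gamma> \<in> arrows G" "\<delta> \<in> arrows G" "gsrc G \<gamma> = grng G \<delta>"
  shows "gcomp G \<gamma> \<delta> \<in> arrows G" "gsrc G (gcomp G \<gamma> \<delta>) = gsrc G \<delta>" "grng G (gcomp G \<gamma> \<delta>) = grng G \<gamma>"
  using assms comp_closed src_comp rng_comp by (auto simp: composable_def)

lemma comp_assoc':
  assumes "\<gamma> \<in> arrows G" "\<delta> \<in> arrows G" "\<eta> \<in> arrows G" "gsrc G \<gamma> = grng G \<delta>" "gsrc G \<delta> = grng G \<eta>"
  shows "gcomp G (gcomp G \<gamma> \<delta>) \<eta> = gcomp G \<gamma> (gcomp G \<delta> \<eta>)"
  using assms comp_assoc by (auto simp: composable_def)

lemma cancel_left: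
  assumes "\<alpha> \<in> arrows G" "\<gamma> \<in> arrows G" "grng G \<alpha> = grng G \<gamma>"
  shows "gcomp G \<alpha> (gcomp G (ginv G \<alpha>) \<gamma>) = \<gamma>"
  using comp_assoc'[of \<alpha> "ginv G \<alpha>" \<gamma>] assms by (simp add: inv_closed src_inv rng_inv comp_inv rng_comp_id)

lemma cancel_left':
  assumes "\<alpha> \<in> arrows G" "\<gamma> \<in> arrows G" "gsrc G \<alpha> = grng G \<gamma>"
  shows "gcomp G (ginv G \<alpha>) (gcomp G \<alpha> \<gamma>) = \<gamma>"
  using comp_assoc'[of "ginv G \<alpha>" \<alpha> \<gamma>] assms by (simp add: inv_closed src_inv rng_inv inv_comp rng_comp_id)

lemma cancel_right:
  assumes "\<alpha> \<in> arrows G" "\<gamma> \<in> arrows G" "gsrc G \<alpha> = gsrc G \<gamma>"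
  shows "gcomp G (gcomp G \<gamma> (ginv G \<alpha>)) \<alpha> = \<gamma>"
  using comp_assoc'[of \<gamma> "ginv G \<alpha>" \<alpha>] assms comp_src[of \<gamma>] by (simp add: inv_closed src_inv rng_inv inv_comp)

lemma cancel_right':
  assumes "\<alpha> \<in> arrows G" "\<gamma> \<in> arrows G" "grng G \<alpha> = gsrc G \<gamma>"
  shows "gcomp G (gcomp G \<gamma> \<alpha>) (ginv G \<alpha>) = \<gamma>"
  using comp_assoc'[of \<gamma> \<alpha> "ginv G \<alpha>"] assms comp_src[of \<gamma>] by (simp add: inv_closed src_inv rng_inv comp_inv)

lemma inv_inv: "\<alpha> \<in> arrows G \<Longrightarrow> ginv G (ginv G \<alpha>) = \<alpha>"
  using cancel_left[of "ginv G \<alpha>" "gsrc G \<alpha>"] comp_src[of "ginv G (ginv G \<alpha>)"] cancel_right[of "ginv G \<alpha>" "ginv G (ginv G \<alpha>)"]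
    cancel_left'[of "ginv G \<alpha>" \<alpha>] by (simp add: inv_closed src_inv rng_inv inv_comp)

lemma inv_unit: "x \<in> units G \<Longrightarrow> ginv G x = x"
  using inv_comp[of x] comp_src[of "ginv G x"] unitD[of x] src_inv[of x] inv_closed[of x] by simp

lemma comp_unique_left:
  assumes "\<alpha> \<in> arrows G" "\<gamma> \<in> arrows G" "\<beta> \<in> arrows G" "gsrc G \<alpha> = grng G \<gamma>" "gcomp G \<alpha> \<gamma> = \<beta>"
  shows "\<gamma> = gcomp G (ginv G \<alpha>) \<beta>" "\<alpha> = gcomp G \<beta> (ginv G \<gamma>)"
  using cancel_left'[of \<alpha> \<gamma>] cancel_right'[of \<gamma> \<alpha>] assms by auto

lemma inv_comp_arrow:
  assumes "\<alpha> \<in> arrows G" "\<gamma> \<in> arrows G" "grng G \<alpha> = grng G \<gamma>"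
  shows "gcomp G (ginv G \<alpha>) \<gamma> \<in> arrows G" "gsrc G (gcomp G (ginv G \<alpha>) \<gamma>) = gsrc G \<gamma>"
    "grng G (gcomp G (ginv G \<alpha>) \<gamma>) = gsrc G \<alpha>"
  using comp_arrow[of "ginv G \<alpha>" \<gamma>] assms by (auto simp: inv_closed src_inv rng_inv)

lemma comp_inv_arrow:
  assumes "\<alpha> \<in> arrows G" "\<gamma> \<in> arrows G" "gsrc G \<alpha> = gsrc G \<gamma>"
  shows "gcomp G \<alpha> (ginv G \<gamma>) \<in> arrows G" "gsrc G (gcomp G \<alpha> (ginv G \<gamma>)) = grng G \<gamma>"
    "grng G (gcomp G \<alpha> (ginv G \<gamma>)) = grng G \<alpha>"
  using comp_arrow[of \<alpha> "ginv G \<gamma>"] assms by (auto simp: inv_closed src_inv rng_inv)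

lemma inv_of_comp:
  assumes "\<alpha> \<in> arrows G" "\<gamma> \<in> arrows G" "gsrc G \<alpha> = grng G \<gamma>"
  shows "ginv G (gcomp G \<alpha> \<gamma>) = gcomp G (ginv G \<gamma>) (ginv G \<alpha>)"
proof -
  let ?b = "gcomp G \<alpha> \<gamma>" let ?c = "gcomp G (ginv G \<gamma>) (ginv G \<alpha>)"
  note b = comp_arrow[OF assms]
  have c: "?c \<in> arrows G" "gsrc G ?c = grng G \<alpha>" "grng G ?c = gsrc G \<gamma>"
    using comp_arrow[of "ginv G \<gamma>" "ginv G \<alpha>"] assms by (auto simp: inv_closed src_inv rng_inv)
  have "gcomp G ?b ?c = gcomp G \<alpha> (gcomp G \<gamma> ?c)"
    using comp_assoc'[of \<alpha> \<gamma> ?c] assms c by simp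
  also have "gcomp G \<gamma> ?c = ginv G \<alpha>"
    using cancel_left[of \<gamma> "ginv G \<alpha>"] assms by (simp add: inv_closed rng_inv)
  finally have "gcomp G ?b ?c = grng G ?b" using assms b by (simp add: comp_inv)
  then have "?c = gcomp G (ginv G ?b) (grng G ?b)"
    using comp_unique_left(1)[of ?b ?c "grng G ?b"] b c rng_closed[of \<alpha>] assms(1) by simp
  also have "\<dots> = ginv G ?b"
    using comp_src[of "ginv G ?b"] b by (simp add: inv_closed src_inv)
  finally show ?thesis by simp
qed

end

context etale_groupoid
begin

abbreviation "T \<equiv> gtop G"

lemma topspace_T: "topspace T = arrows G" by (simp add: arrows_def)

lemma units_subset: "units G \<subseteq> arrows G" using unitD by blast

lemma topspace_unit_space: "topspace (unit_space G) = units G"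
  using units_subset by (auto simp: unit_space_def topspace_T)

lemma local_homeomorphism_continuous:
  assumes "local_homeomorphism S S' f"
  shows "continuous_map S S' f"
  unfolding continuous_map_eq_topcontinuous_at
proof
  fix x assume "x \<in> topspace S"
  then obtain U where U: "openin S U" "x \<in> U" "openin S' (f ` U)"
    "homeomorphic_map (subtopology S U) (subtopology S' (f ` U)) f"
    using assms unfolding local_homeomorphism_def by blast
  have "continuous_map (subtopology S U) S' f"
    using homeomorphic_imp_continuous_map[OF U(4)] continuous_map_in_subtopology by blast
  then have c: "openin (subtopology S U) {y \<in> topspace (subtopology S U). f y \<in> V}" if "openin S' V" for V
    using that openin_continuous_map_preimage by blast
  show "topcontinuous_at S S' f x"
    unfolding topcontinuous_at_def
  proof (intro conjI allI impI)
    show "x \<in> topspace S" by fact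
    show "f \<in> topspace S \<rightarrow> topspace S'"
      using assms openin_subset unfolding local_homeomorphism_def by fast
    fix V assume V: "openin S' V \<and> f x \<in> V"
    have "openin S {y \<in> U. f y \<in> V}"
      using c[of V] V U openin_subset[OF U(1)] by (simp add: openin_open_subtopology Int_absorb1)
    then show "\<exists>U. openin S U \<and> x \<in> U \<and> (\<forall>y\<in>U. f y \<in> V)" using V U(2) by blast
  qed
qed

lemma continuous_src: "continuous_map T T (gsrc G)"
  using local_homeomorphism_continuous[OF etale_src] continuous_map_in_subtopology unfolding unit_space_def by blast

lemma continuous_rng: "continuous_map T T (grng G)"
  using local_homeomorphism_continuous[OF etale_rng] continuous_map_in_subtopology unfolding unit_space_def by blast

text \<open>
  Near a unit \<open>x\<close> the source map is injective, and it identifies an arrow with its source as soon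
  as both are close to \<open>x\<close>. So all arrows close to \<open>x\<close> are units.
\<close>

lemma open_units: "openin T (units G)"
proof (subst openin_subopen, intro ballI)
  fix x assume x: "x \<in> units G"
  then obtain U where U: "openin T U" "x \<in> U" "homeomorphic_map (subtopology T U) (subtopology (unit_space G) (gsrc G ` U)) (gsrc G)"
    using etale_src unitD[OF x] unfolding local_homeomorphism_def topspace_T by blast
  have inj: "inj_on (gsrc G) U"
    using U(3) openin_subset[OF U(1)] by (simp add: homeomorphic_map_def Int_absorb1)
  let ?V = "U \<inter> {\<gamma> \<in> topspace T. gsrc G \<gamma> \<in> U}"
  have "openin T ?V" by (intro openin_Int U openin_continuous_map_preimage[OF continuous_src])
  moreover have "x \<in> ?V" using U unitD[OF x] by (simp add: topspace_T)
  moreover have "?V \<subseteq> units G"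
  proof
    fix \<gamma> assume \<gamma>: "\<gamma> \<in> ?V"
    then have "gsrc G (gsrc G \<gamma>) = gsrc G \<gamma>" by (simp add: src_src topspace_T)
    then have "gsrc G \<gamma> = \<gamma>" using inj \<gamma> by (auto dest: inj_onD)
    then show "\<gamma> \<in> units G" using \<gamma> by (simp add: units_iff topspace_T)
  qed
  ultimately show "\<exists>V. openin T V \<and> x \<in> V \<and> V \<subseteq> units G" by blast
qed

lemma closed_units: "closedin T (units G)"
proof -
  have "closedin T {\<gamma> \<in> topspace T. gsrc G \<gamma> = id \<gamma>}"
    by (rule closedin_continuous_maps_eq[OF hausdorff continuous_src continuous_map_id])
  moreover have "{\<gamma> \<in> topspace T. gsrc G \<gamma> = id \<gamma>} = units G" by (auto simp: units_iff topspace_T)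
  ultimately show ?thesis by simp
qed

text \<open>
  The continuous inverse \<open>\<sigma>\<close> of the range map on \<open>B\<close> makes the left translation by \<open>B\<close> continuous.
\<close>

definition bisection :: "'g set \<Rightarrow> bool" where
  "bisection B \<longleftrightarrow> openin T B \<and> inj_on (gsrc G) B \<and> inj_on (grng G) B \<and> openin T (grng G ` B) \<and>
     (\<exists>\<sigma>. continuous_map (subtopology T (grng G ` B)) (subtopology T B) \<sigma> \<and> (\<forall>\<beta>\<in>B. \<sigma> (grng G \<beta>) = \<beta>))"

lemma bisection_subset: "bisection B \<Longrightarrow> B \<subseteq> arrows G"
  unfolding bisection_def using openin_subset topspace_T by blast

lemma bisectionD:
  assumes "bisection B" "\<alpha> \<in> B" "\<beta> \<in> B"
  shows "gsrc G \<alpha> = gsrc G \<beta> \<Longrightarrow> \<alpha> = \<beta>" "grng G \<alpha> = grng G \<beta> \<Longrightarrow> \<alpha> = \<beta>"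
  using assms unfolding bisection_def inj_on_def by blast+

lemma exists_bisection:
  assumes U: "openin T U" "\<gamma> \<in> U"
  obtains B where "bisection B" "\<gamma> \<in> B" "B \<subseteq> U"
proof -
  have \<gamma>: "\<gamma> \<in> topspace T" using openin_subset U by blast
  obtain V where V: "openin T V" "\<gamma> \<in> V" "homeomorphic_map (subtopology T V) (subtopology (unit_space G) (gsrc G ` V)) (gsrc G)"
    using etale_src \<gamma> unfolding local_homeomorphism_def by blast
  obtain W where W: "openin T W" "\<gamma> \<in> W" "openin (unit_space G) (grng G ` W)"
    "homeomorphic_map (subtopology T W) (subtopology (unit_space G) (grng G ` W)) (grng G)"
    using etale_rng \<gamma> unfolding local_homeomorphism_def by blast
  define B where "B = U \<inter> V \<inter> W"
  have B: "openin T B" "\<gamma> \<in> B" "B \<subseteq> W" using U V W by (auto simp: B_def)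
  have injs: "inj_on (gsrc G) V" using V(3) openin_subset[OF V(1)] by (simp add: homeomorphic_map_def Int_absorb1)
  have injr: "inj_on (grng G) W" using W(4) openin_subset[OF W(1)] by (simp add: homeomorphic_map_def Int_absorb1)
  have oW: "openin T (grng G ` W)"
    using W(3) open_units unfolding unit_space_def by (rule openin_trans_full)
  have sub: "subtopology (unit_space G) (grng G ` W) = subtopology T (grng G ` W)"
    using openin_subset[OF W(3)] by (simp add: topspace_unit_space unit_space_def subtopology_subtopology Int_absorb1)
  have hom: "homeomorphic_map (subtopology T W) (subtopology T (grng G ` W)) (grng G)" using W(4) sub by simp
  have "openin (subtopology T (grng G ` W)) (grng G ` B)"
    using homeomorphic_imp_open_map[OF hom] B W(1) by (simp add: open_map_def openin_open_subtopology)
  then have oB: "openin T (grng G ` B)" using oW by (rule openin_trans_full)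
  obtain \<sigma> where \<sigma>: "homeomorphic_maps (subtopology T W) (subtopology T (grng G ` W)) (grng G) \<sigma>"
    using hom homeomorphic_map_maps by blast
  have \<sigma>r: "\<sigma> (grng G \<beta>) = \<beta>" if "\<beta> \<in> W" for \<beta>
    using \<sigma> that openin_subset[OF W(1)] by (auto simp: homeomorphic_maps_def)
  have "continuous_map (subtopology T (grng G ` W)) T \<sigma>"
    using \<sigma> continuous_map_in_subtopology unfolding homeomorphic_maps_def by blast
  then have "continuous_map (subtopology T (grng G ` B)) T \<sigma>"
    using B(3) by (meson continuous_map_from_subtopology_mono image_mono)
  then have "continuous_map (subtopology T (grng G ` B)) (subtopology T B) \<sigma>"
    using \<sigma>r B(3) by (auto simp: continuous_map_in_subtopology)
  then have "bisection B"
    unfolding bisection_def using B oB \<sigma>r injs injr by (auto simp: B_def intro: inj_on_subset)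
  then show thesis using B that by (auto simp: B_def)
qed

lemma finite_bisection_cover:
  assumes K: "compactin T K"
  obtains \<B> where "finite \<B>" "\<And>B. B \<in> \<B> \<Longrightarrow> bisection B" "K \<subseteq> \<Union>\<B>"
proof -
  have "\<exists>B. bisection B \<and> \<gamma> \<in> B" if "\<gamma> \<in> K" for \<gamma>
    using exists_bisection[of "topspace T" \<gamma>] compactin_subset_topspace[OF K] that by blast
  then have "(\<forall>U\<in>Collect bisection. openin T U) \<and> K \<subseteq> \<Union>(Collect bisection)"
    by (auto simp: bisection_def)
  then obtain \<B> where "finite \<B>" "\<B> \<subseteq> Collect bisection" "K \<subseteq> \<Union>\<B>"
    using K unfolding compactin_def by meson
  then show thesis using that by blast
qed

text \<open>
  A bisection meets every fibre in at most one arrow, so the number of bisections in a finite cover of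
  \<open>K\<close> is a bound.
\<close>

lemma compact_fibres_finite:
  assumes K: "compactin T K"
  shows "\<exists>N. (\<forall>x. finite {\<gamma> \<in> K. grng G \<gamma> = x} \<and> card {\<gamma> \<in> K. grng G \<gamma> = x} \<le> N) \<and>
    (\<forall>x. finite {\<gamma> \<in> K. gsrc G \<gamma> = x} \<and> card {\<gamma> \<in> K. gsrc G \<gamma> = x} \<le> N)"
proof -
  obtain \<B> where \<B>: "finite \<B>" "\<And>B. B \<in> \<B> \<Longrightarrow> bisection B" "K \<subseteq> \<Union>\<B>"
    using finite_bisection_cover[OF K] by blast
  have *: "finite {\<gamma> \<in> K. h \<gamma> = x} \<and> card {\<gamma> \<in> K. h \<gamma> = x} \<le> card \<B>"
    if h: "\<And>B. B \<in> \<B> \<Longrightarrow> inj_on h B" for x and h :: "'g \<Rightarrow> 'g"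
  proof -
    define pick where "pick \<gamma> = (SOME B. B \<in> \<B> \<and> \<gamma> \<in> B)" for \<gamma>
    have pick: "pick \<gamma> \<in> \<B>" "\<gamma> \<in> pick \<gamma>" if "\<gamma> \<in> K" for \<gamma>
      using someI_ex[of "\<lambda>B. B \<in> \<B> \<and> \<gamma> \<in> B"] that \<B>(3) by (auto simp: pick_def)
    have "inj_on pick {\<gamma> \<in> K. h \<gamma> = x}"
      by (rule inj_onI) (use pick h in \<open>metis (mono_tags, lifting) inj_onD mem_Collect_eq\<close>)
    moreover have "pick ` {\<gamma> \<in> K. h \<gamma> = x} \<subseteq> \<B>" using pick by auto
    ultimately show ?thesis using \<B>(1) by (meson card_inj_on_le finite_imageD finite_subset)
  qed
  have "inj_on (grng G) B" "inj_on (gsrc G) B" if "B \<in> \<B>" for B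
    using \<B>(2)[OF that] by (auto simp: bisection_def)
  then show ?thesis by (intro exI[of _ "card \<B>"] conjI allI *[THEN conjunct1] *[THEN conjunct2]) auto
qed

end

section \<open>The convolution algebra\<close>

context etale_groupoid
begin

lemmas Cc_iff_G = Cc_iff[OF hausdorff]

lemma CcI:
  assumes "continuous_map T euclidean f" "compactin T K" "\<And>\<gamma>. \<gamma> \<notin> K \<Longrightarrow> f \<gamma> = 0"
  shows "f \<in> Cc G"
  using assms Cc_iff_G by blast

lemma Cc_continuous: "f \<in> Cc G \<Longrightarrow> continuous_map T euclidean f"
  using Cc_iff_G by blast

lemma CcE:
  assumes "f \<in> Cc G"
  obtains K where "compactin T K" "\<And>\<gamma>. \<gamma> \<notin> K \<Longrightarrow> f \<gamma> = 0"
  using assms Cc_iff_G by blast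

lemma Cc_outside: "f \<in> Cc G \<Longrightarrow> \<gamma> \<notin> arrows G \<Longrightarrow> f \<gamma> = 0"
  by (simp add: Cc_def)

lemma Cc_bounded:
  assumes "f \<in> Cc G"
  obtains M where "0 < M" "\<And>\<gamma>. norm (f \<gamma>) \<le> M"
proof -
  obtain K where K: "compactin T K" "\<And>\<gamma>. \<gamma> \<notin> K \<Longrightarrow> f \<gamma> = 0" using CcE[OF assms] by blast
  have "compactin euclidean (f ` K)" using image_compactin[OF K(1) Cc_continuous[OF assms]] .
  then have "bounded (f ` K)" by (simp add: compact_imp_bounded)
  then obtain M where M: "M > 0" "\<And>y. y \<in> f ` K \<Longrightarrow> norm y \<le> M" unfolding bounded_pos by blast
  have "norm (f \<gamma>) \<le> M" for \<gamma> using M K(2)[of \<gamma>] by (cases "\<gamma> \<in> K") auto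
  then show thesis using that M(1) by blast
qed

lemma Cc_add: "f \<in> Cc G \<Longrightarrow> g \<in> Cc G \<Longrightarrow> (\<lambda>\<gamma>. f \<gamma> + g \<gamma>) \<in> Cc G"
proof -
  assume f: "f \<in> Cc G" and g: "g \<in> Cc G"
  obtain K where K: "compactin T K" "\<And>\<gamma>. \<gamma> \<notin> K \<Longrightarrow> f \<gamma> = 0" using CcE[OF f] by blast
  obtain L where L: "compactin T L" "\<And>\<gamma>. \<gamma> \<notin> L \<Longrightarrow> g \<gamma> = 0" using CcE[OF g] by blast
  show ?thesis
  proof (rule CcI[OF _ compactin_Un[OF K(1) L(1)]])
    show "continuous_map T euclidean (\<lambda>\<gamma>. f \<gamma> + g \<gamma>)"
      using Cc_continuous[OF f] Cc_continuous[OF g] unfolding continuous_map_euclidean_iff by (auto intro!: tendsto_intros)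
  qed (use K L in auto)
qed

lemma Cc_zero: "(\<lambda>\<gamma>. 0) \<in> Cc G"
  by (rule CcI[of _ "{}"]) auto

lemma Cc_sum: "(\<And>i. i \<in> S \<Longrightarrow> f i \<in> Cc G) \<Longrightarrow> (\<lambda>\<gamma>. \<Sum>i\<in>S. f i \<gamma>) \<in> Cc G"
  by (induction S rule: infinite_finite_induct) (auto intro: Cc_add Cc_zero)

lemma Cc_mult:
  fixes f :: "'g \<Rightarrow> 'b::real_normed_algebra"
  assumes "continuous_map T euclidean h" "f \<in> Cc G"
  shows "(\<lambda>\<gamma>. h \<gamma> * f \<gamma>) \<in> Cc G"
proof -
  obtain K where K: "compactin T K" "\<And>\<gamma>. \<gamma> \<notin> K \<Longrightarrow> f \<gamma> = 0" using CcE[OF assms(2)] by blast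
  show ?thesis
  proof (rule CcI[OF _ K(1)])
    show "continuous_map T euclidean (\<lambda>\<gamma>. h \<gamma> * f \<gamma>)"
      using assms(1) Cc_continuous[OF assms(2)] unfolding continuous_map_euclidean_iff by (auto intro!: tendsto_intros)
  qed (simp add: K)
qed

lemma Cc_scale: "f \<in> Cc G \<Longrightarrow> (\<lambda>\<gamma>. (c::'b::real_normed_algebra) * f \<gamma>) \<in> Cc G"
  by (rule Cc_mult) auto

lemma Cc_compose:
  fixes f :: "'g \<Rightarrow> 'b::real_normed_vector" and h :: "'b \<Rightarrow> 'c::real_normed_vector"
  assumes "continuous_on UNIV h" "h 0 = 0" "f \<in> Cc G"
  shows "(\<lambda>\<gamma>. h (f \<gamma>)) \<in> Cc G"
proof -
  obtain K where K: "compactin T K" "\<And>\<gamma>. \<gamma> \<notin> K \<Longrightarrow> f \<gamma> = 0" using CcE[OF assms(3)] by blast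
  show ?thesis
  proof (rule CcI[OF _ K(1)])
    have "continuous_map T euclidean (h \<circ> f)"
      by (rule continuous_map_compose[OF Cc_continuous[OF assms(3)]]) (use assms(1) in auto)
    then show "continuous_map T euclidean (\<lambda>\<gamma>. h (f \<gamma>))" by (simp add: o_def)
  qed (simp add: K assms(2))
qed

lemma Cc_of_real: "(f :: 'g \<Rightarrow> real) \<in> Cc G \<Longrightarrow> (\<lambda>\<gamma>. complex_of_real (f \<gamma>)) \<in> Cc G"
  by (rule Cc_compose[of complex_of_real]) (auto intro!: continuous_intros)

definition on_units :: "('g \<Rightarrow> complex) \<Rightarrow> 'g \<Rightarrow> complex" where
  "on_units f \<gamma> = (if \<gamma> \<in> units G then f \<gamma> else 0)"

lemma on_units_Cc:
  assumes "f \<in> Cc G"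
  shows "on_units f \<in> Cc G"
proof -
  obtain K where K: "compactin T K" "\<And>\<gamma>. \<gamma> \<notin> K \<Longrightarrow> f \<gamma> = 0" using CcE[OF assms] by blast
  show ?thesis
  proof (rule CcI[OF _ K(1)])
    show "continuous_map T euclidean (on_units f)"
    proof (rule continuous_map_extend_by_zero[OF _ open_units closed_units])
      show "continuous_map (subtopology T (units G)) euclidean (on_units f)"
        by (rule continuous_map_eq[OF continuous_map_from_subtopology[OF Cc_continuous[OF assms]]])
          (simp add: on_units_def)
    qed (auto simp: on_units_def)
  qed (simp add: K on_units_def)
qed

subsection \<open>Convolution\<close>

lemma range_fibre_iff: "\<alpha> \<in> range_fibre G x \<longleftrightarrow> \<alpha> \<in> arrows G \<and> grng G \<alpha> = x"
  by (simp add: range_fibre_def)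

lemma finite_range_fibre_support:
  assumes "f \<in> Cc G"
  shows "finite {\<alpha> \<in> range_fibre G x. f \<alpha> \<noteq> 0}"
proof -
  obtain K where K: "compactin T K" "\<And>\<gamma>. \<gamma> \<notin> K \<Longrightarrow> f \<gamma> = 0" using CcE[OF assms] by blast
  obtain N where N: "\<And>x. finite {\<gamma> \<in> K. grng G \<gamma> = x} \<and> card {\<gamma> \<in> K. grng G \<gamma> = x} \<le> N"
    using compact_fibres_finite[OF K(1)] by blast
  show ?thesis by (rule finite_subset[of _ "{\<gamma> \<in> K. grng G \<gamma> = x}"]) (use N K in \<open>auto simp: range_fibre_iff\<close>)
qed

lemma finite_source_fibre_support:
  assumes "f \<in> Cc G"
  shows "finite {\<alpha> \<in> arrows G. gsrc G \<alpha> = x \<and> f \<alpha> \<noteq> 0}"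
proof -
  obtain K where K: "compactin T K" "\<And>\<gamma>. \<gamma> \<notin> K \<Longrightarrow> f \<gamma> = 0" using CcE[OF assms] by blast
  obtain N where N: "\<And>x. finite {\<gamma> \<in> K. gsrc G \<gamma> = x} \<and> card {\<gamma> \<in> K. gsrc G \<gamma> = x} \<le> N"
    using compact_fibres_finite[OF K(1)] by blast
  show ?thesis by (rule finite_subset[of _ "{\<gamma> \<in> K. gsrc G \<gamma> = x}"]) (use N K in auto)
qed

lemma convolution_eq_sum:
  assumes "\<gamma> \<in> arrows G" "finite F" "F \<subseteq> range_fibre G (grng G \<gamma>)"
    "\<And>\<alpha>. \<alpha> \<in> range_fibre G (grng G \<gamma>) - F \<Longrightarrow> f \<alpha> * g (gcomp G (ginv G \<alpha>) \<gamma>) = 0"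
  shows "convolution G f g \<gamma> = (\<Sum>\<alpha>\<in>F. f \<alpha> * g (gcomp G (ginv G \<alpha>) \<gamma>))"
  unfolding convolution_def using assms(1) infsum_eq_sum_support[OF assms(2-4)] by simp

lemma convolution_support_sum:
  assumes "\<gamma> \<in> arrows G" "f \<in> Cc G"
  shows "convolution G f g \<gamma> =
    (\<Sum>\<alpha>\<in>{\<alpha> \<in> range_fibre G (grng G \<gamma>). f \<alpha> \<noteq> 0}. f \<alpha> * g (gcomp G (ginv G \<alpha>) \<gamma>))"
  by (rule convolution_eq_sum[OF assms(1) finite_range_fibre_support[OF assms(2)]]) auto

lemma convolution_outside: "\<gamma> \<notin> arrows G \<Longrightarrow> convolution G f g \<gamma> = 0"
  by (simp add: convolution_def)

lemma convolution_sum_left: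
  assumes S: "finite S" and f: "\<And>i. i \<in> S \<Longrightarrow> f i \<in> Cc G"
  shows "convolution G (\<lambda>\<gamma>. \<Sum>i\<in>S. f i \<gamma>) g \<gamma> = (\<Sum>i\<in>S. convolution G (f i) g \<gamma>)"
proof (cases "\<gamma> \<in> arrows G")
  case \<gamma>: True
  define F where "F = (\<Union>i\<in>S. {\<alpha> \<in> range_fibre G (grng G \<gamma>). f i \<alpha> \<noteq> 0})"
  have F: "finite F" "F \<subseteq> range_fibre G (grng G \<gamma>)"
    using S finite_range_fibre_support[OF f] by (auto simp: F_def)
  have "convolution G (\<lambda>\<gamma>. \<Sum>i\<in>S. f i \<gamma>) g \<gamma> = (\<Sum>\<alpha>\<in>F. (\<Sum>i\<in>S. f i \<alpha>) * g (gcomp G (ginv G \<alpha>) \<gamma>))"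
    by (rule convolution_eq_sum[OF \<gamma> F]) (auto simp: F_def intro!: disjI1 sum.neutral)
  also have "\<dots> = (\<Sum>i\<in>S. \<Sum>\<alpha>\<in>F. f i \<alpha> * g (gcomp G (ginv G \<alpha>) \<gamma>))"
    unfolding sum_distrib_right by (rule sum.swap)
  also have "\<dots> = (\<Sum>i\<in>S. convolution G (f i) g \<gamma>)"
    by (intro sum.cong refl convolution_eq_sum[symmetric, OF \<gamma> F]) (auto simp: F_def)
  finally show ?thesis .
qed (simp add: convolution_outside)

lemma convolution_bisection:
  assumes B: "bisection B" and a: "\<And>\<alpha>. \<alpha> \<notin> B \<Longrightarrow> a \<alpha> = 0" and \<gamma>: "\<gamma> \<in> arrows G"
  shows "\<beta> \<in> B \<Longrightarrow> grng G \<beta> = grng G \<gamma> \<Longrightarrow> convolution G a g \<gamma> = a \<beta> * g (gcomp G (ginv G \<beta>) \<gamma>)"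
    and "grng G \<gamma> \<notin> grng G ` B \<Longrightarrow> convolution G a g \<gamma> = 0"
proof -
  show "convolution G a g \<gamma> = a \<beta> * g (gcomp G (ginv G \<beta>) \<gamma>)" if \<beta>: "\<beta> \<in> B" "grng G \<beta> = grng G \<gamma>"
  proof -
    have "convolution G a g \<gamma> = (\<Sum>\<alpha>\<in>{\<beta>}. a \<alpha> * g (gcomp G (ginv G \<alpha>) \<gamma>))"
    proof (rule convolution_eq_sum[OF \<gamma>])
      show "{\<beta>} \<subseteq> range_fibre G (grng G \<gamma>)" using \<beta> bisection_subset[OF B] by (auto simp: range_fibre_iff)
      show "a \<alpha> * g (gcomp G (ginv G \<alpha>) \<gamma>) = 0" if "\<alpha> \<in> range_fibre G (grng G \<gamma>) - {\<beta>}" for \<alpha>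
        using that a[of \<alpha>] bisectionD(2)[OF B _ \<beta>(1), of \<alpha>] \<beta>(2) by (auto simp: range_fibre_iff)
    qed simp
    then show ?thesis by simp
  qed
  show "convolution G a g \<gamma> = 0" if "grng G \<gamma> \<notin> grng G ` B"
  proof -
    have "convolution G a g \<gamma> = (\<Sum>\<alpha>\<in>{}. a \<alpha> * g (gcomp G (ginv G \<alpha>) \<gamma>))"
    proof (rule convolution_eq_sum[OF \<gamma>])
      fix \<alpha> assume "\<alpha> \<in> range_fibre G (grng G \<gamma>) - {}"
      then have "\<alpha> \<notin> B" using that by (auto simp: range_fibre_iff) (metis image_eqI)
      then show "a \<alpha> * g (gcomp G (ginv G \<alpha>) \<gamma>) = 0" using a by simp
    qed auto
    then show ?thesis by simp
  qed
qed

lemma compact_product: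
  assumes K: "compactin T K" and L: "compactin T L"
  shows "compactin T {gcomp G \<alpha> \<beta> | \<alpha> \<beta>. \<alpha> \<in> K \<and> \<beta> \<in> L \<and> gsrc G \<alpha> = grng G \<beta>}" (is "compactin T ?C")
proof -
  let ?P = "prod_topology T T"
  have KL: "compactin ?P (K \<times> L)" using K L by (simp add: compactin_Times)
  have "closedin ?P {p \<in> topspace ?P. (gsrc G \<circ> fst) p = (grng G \<circ> snd) p}"
    by (intro closedin_continuous_maps_eq[OF hausdorff] continuous_map_compose[OF continuous_map_fst continuous_src]
        continuous_map_compose[OF continuous_map_snd continuous_rng])
  then have "compactin ?P ((K \<times> L) \<inter> {p \<in> topspace ?P. (gsrc G \<circ> fst) p = (grng G \<circ> snd) p})"
    using compact_Int_closedin[OF KL] by blast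
  then have "compactin (subtopology ?P (composable G)) ((K \<times> L) \<inter> {p \<in> topspace ?P. (gsrc G \<circ> fst) p = (grng G \<circ> snd) p})"
    by (rule compact_imp_compactin_subtopology) (auto simp: composable_def topspace_T)
  from image_compactin[OF this continuous_comp]
  have "compactin T ((\<lambda>(\<gamma>, \<delta>). gcomp G \<gamma> \<delta>) ` ((K \<times> L) \<inter> {p \<in> topspace ?P. (gsrc G \<circ> fst) p = (grng G \<circ> snd) p}))" .
  moreover have "(\<lambda>(\<gamma>, \<delta>). gcomp G \<gamma> \<delta>) ` ((K \<times> L) \<inter> {p \<in> topspace ?P. (gsrc G \<circ> fst) p = (grng G \<circ> snd) p}) = ?C"
  proof (intro equalityI subsetI)
    fix \<gamma> assume "\<gamma> \<in> ?C"
    then obtain \<alpha> \<beta> where "\<gamma> = gcomp G \<alpha> \<beta>" "\<alpha> \<in> K" "\<beta> \<in> L" "gsrc G \<alpha> = grng G \<beta>" by blast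
    then show "\<gamma> \<in> (\<lambda>(\<gamma>, \<delta>). gcomp G \<gamma> \<delta>) ` ((K \<times> L) \<inter> {p \<in> topspace ?P. (gsrc G \<circ> fst) p = (grng G \<circ> snd) p})"
      using compactin_subset_topspace[OF K] compactin_subset_topspace[OF L]
      by (intro image_eqI[of _ _ "(\<alpha>, \<beta>)"]) auto
  next
    fix \<gamma> assume "\<gamma> \<in> (\<lambda>(\<gamma>, \<delta>). gcomp G \<gamma> \<delta>) ` ((K \<times> L) \<inter> {p \<in> topspace ?P. (gsrc G \<circ> fst) p = (grng G \<circ> snd) p})"
    then obtain \<alpha> \<beta> where "\<gamma> = gcomp G \<alpha> \<beta>" "\<alpha> \<in> K" "\<beta> \<in> L" "gsrc G \<alpha> = grng G \<beta>" by auto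
    then show "\<gamma> \<in> ?C" by blast
  qed
  ultimately show ?thesis by simp
qed

lemma continuous_left_translate:
  assumes B: "bisection B"
  shows "\<exists>\<sigma>. (\<forall>\<beta>\<in>B. \<sigma> (grng G \<beta>) = \<beta>) \<and> openin T {\<gamma> \<in> arrows G. grng G \<gamma> \<in> grng G ` B} \<and>
    continuous_map (subtopology T {\<gamma> \<in> arrows G. grng G \<gamma> \<in> grng G ` B}) T (\<lambda>\<gamma>. \<sigma> (grng G \<gamma>)) \<and>
    continuous_map (subtopology T {\<gamma> \<in> arrows G. grng G \<gamma> \<in> grng G ` B}) T
       (\<lambda>\<gamma>. gcomp G (ginv G (\<sigma> (grng G \<gamma>))) \<gamma>)"
proof -
  let ?W = "{\<gamma> \<in> arrows G. grng G \<gamma> \<in> grng G ` B}"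
  obtain \<sigma> where \<sigma>: "continuous_map (subtopology T (grng G ` B)) (subtopology T B) \<sigma>" "\<And>\<beta>. \<beta> \<in> B \<Longrightarrow> \<sigma> (grng G \<beta>) = \<beta>"
    and oB: "openin T (grng G ` B)"
    using B unfolding bisection_def by blast
  have W: "openin T ?W"
    using openin_continuous_map_preimage[OF continuous_rng oB] by (simp add: topspace_T)
  let ?S = "subtopology T ?W"
  have r: "continuous_map ?S (subtopology T (grng G ` B)) (grng G)"
    using continuous_map_from_subtopology[OF continuous_rng] by (auto simp: continuous_map_in_subtopology)
  have c1: "continuous_map ?S T (\<lambda>\<gamma>. \<sigma> (grng G \<gamma>))"
    using continuous_map_compose[OF r \<sigma>(1)] by (auto simp: continuous_map_in_subtopology o_def)
  have c2: "continuous_map ?S T (\<lambda>\<gamma>. ginv G (\<sigma> (grng G \<gamma>)))"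
    using continuous_map_compose[OF c1 continuous_inv] by (simp add: o_def)
  have c3: "continuous_map ?S (prod_topology T T) (\<lambda>\<gamma>. (ginv G (\<sigma> (grng G \<gamma>)), \<gamma>))"
    by (intro continuous_map_pairedI c2) (simp add: continuous_map_from_subtopology continuous_map_id[unfolded id_def])
  have "continuous_map ?S (subtopology (prod_topology T T) (composable G)) (\<lambda>\<gamma>. (ginv G (\<sigma> (grng G \<gamma>)), \<gamma>))"
    unfolding continuous_map_in_subtopology
  proof (intro conjI c3 funcsetI)
    fix \<gamma> assume "\<gamma> \<in> topspace ?S"
    then obtain \<beta> where "\<beta> \<in> B" "grng G \<gamma> = grng G \<beta>" "\<gamma> \<in> arrows G" by auto
    then show "(ginv G (\<sigma> (grng G \<gamma>)), \<gamma>) \<in> composable G"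
      using \<sigma>(2) bisection_subset[OF B] by (auto simp: composable_def inv_closed src_inv)
  qed
  from continuous_map_compose[OF this continuous_comp]
  have "continuous_map ?S T (\<lambda>\<gamma>. gcomp G (ginv G (\<sigma> (grng G \<gamma>))) \<gamma>)" by (simp add: o_def)
  then show ?thesis using \<sigma>(2) W c1 by blast
qed

text \<open>
  Convolution by a function supported in a bisection \<open>B\<close> is a weighted translation along \<open>B\<close>,
  hence continuous where \<open>B\<close> acts; compactness of the supports allows extending by zero.
\<close>

lemma convolution_bisection_Cc:
  assumes B: "bisection B" and a: "continuous_map T euclidean a" "compactin T L" "L \<subseteq> B" "\<And>\<alpha>. \<alpha> \<notin> L \<Longrightarrow> a \<alpha> = 0"
    and g: "g \<in> Cc G"
  shows "convolution G a g \<in> Cc G"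
proof -
  obtain K where K: "compactin T K" "\<And>\<gamma>. \<gamma> \<notin> K \<Longrightarrow> g \<gamma> = 0" using CcE[OF g] by blast
  let ?W = "{\<gamma> \<in> arrows G. grng G \<gamma> \<in> grng G ` B}"
  obtain \<sigma> where \<sigma>: "\<And>\<beta>. \<beta> \<in> B \<Longrightarrow> \<sigma> (grng G \<beta>) = \<beta>" and W: "openin T ?W"
    and c: "continuous_map (subtopology T ?W) T (\<lambda>\<gamma>. \<sigma> (grng G \<gamma>))"
       "continuous_map (subtopology T ?W) T (\<lambda>\<gamma>. gcomp G (ginv G (\<sigma> (grng G \<gamma>))) \<gamma>)"
    using continuous_left_translate[OF B] by blast
  define C where "C = {gcomp G \<alpha> \<beta> | \<alpha> \<beta>. \<alpha> \<in> L \<and> \<beta> \<in> K \<and> gsrc G \<alpha> = grng G \<beta>}"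
  have C: "compactin T C" unfolding C_def by (rule compact_product[OF a(2) K(1)])
  have La: "L \<subseteq> arrows G" "K \<subseteq> arrows G"
    using compactin_subset_topspace[OF a(2)] compactin_subset_topspace[OF K(1)] by (auto simp: topspace_T)
  have aB: "\<And>\<alpha>. \<alpha> \<notin> B \<Longrightarrow> a \<alpha> = 0" using a(3,4) by blast
  have CW: "C \<subseteq> ?W"
  proof
    fix \<gamma> assume "\<gamma> \<in> C"
    then obtain \<alpha> \<beta> where "\<gamma> = gcomp G \<alpha> \<beta>" "\<alpha> \<in> L" "\<beta> \<in> K" "gsrc G \<alpha> = grng G \<beta>" by (auto simp: C_def)
    then show "\<gamma> \<in> ?W" using comp_arrow[of \<alpha> \<beta>] La a(3) by auto
  qed
  have zero: "convolution G a g \<gamma> = 0" if "\<gamma> \<notin> C" for \<gamma>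
  proof (rule ccontr)
    assume nz: "convolution G a g \<gamma> \<noteq> 0"
    then have \<gamma>: "\<gamma> \<in> arrows G" using convolution_outside by blast
    have "grng G \<gamma> \<in> grng G ` B"
      using convolution_bisection(2)[where a=a and g=g, OF B aB \<gamma>] nz by blast
    then obtain \<beta> where \<beta>: "\<beta> \<in> B" "grng G \<beta> = grng G \<gamma>" by (metis imageE)
    have "a \<beta> * g (gcomp G (ginv G \<beta>) \<gamma>) \<noteq> 0" using nz convolution_bisection(1)[where a=a and g=g, OF B aB \<gamma> \<beta>] by simp
    then have "\<beta> \<in> L" "gcomp G (ginv G \<beta>) \<gamma> \<in> K" using a(4) K(2) by auto
    moreover have "gcomp G \<beta> (gcomp G (ginv G \<beta>) \<gamma>) = \<gamma>" "gsrc G \<beta> = grng G (gcomp G (ginv G \<beta>) \<gamma>)"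
      using cancel_left[of \<beta> \<gamma>] inv_comp_arrow(3)[of \<beta> \<gamma>] \<beta> \<gamma> bisection_subset[OF B] by auto
    ultimately have "\<gamma> \<in> C"
      unfolding C_def by (intro CollectI exI[of _ \<beta>] exI[of _ "gcomp G (ginv G \<beta>) \<gamma>"]) simp
    then show False using that by blast
  qed
  have "continuous_map T euclidean (convolution G a g)"
  proof (rule continuous_map_extend_by_zero[OF _ W compactin_imp_closedin[OF hausdorff C] CW])
    have 1: "continuous_map (subtopology T ?W) euclidean (\<lambda>\<gamma>. a (\<sigma> (grng G \<gamma>)))"
      using continuous_map_compose[OF c(1) a(1)] by (simp add: o_def)
    have 2: "continuous_map (subtopology T ?W) euclidean (\<lambda>\<gamma>. g (gcomp G (ginv G (\<sigma> (grng G \<gamma>))) \<gamma>))"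
      using continuous_map_compose[OF c(2) Cc_continuous[OF g]] by (simp add: o_def)
    have "continuous_map (subtopology T ?W) euclidean (\<lambda>\<gamma>. a (\<sigma> (grng G \<gamma>)) * g (gcomp G (ginv G (\<sigma> (grng G \<gamma>))) \<gamma>))"
      using 1 2 unfolding continuous_map_euclidean_iff by (auto intro!: tendsto_intros)
    then show "continuous_map (subtopology T ?W) euclidean (convolution G a g)"
    proof (rule continuous_map_eq)
      fix \<gamma> assume "\<gamma> \<in> topspace (subtopology T ?W)"
      then obtain \<beta> where \<beta>: "\<beta> \<in> B" "grng G \<beta> = grng G \<gamma>" "\<gamma> \<in> arrows G" by auto
      then show "a (\<sigma> (grng G \<gamma>)) * g (gcomp G (ginv G (\<sigma> (grng G \<gamma>))) \<gamma>) = convolution G a g \<gamma>"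
        using convolution_bisection(1)[where a=a and g=g, OF B aB \<beta>(3,1,2)] \<sigma>[OF \<beta>(1)] by simp
    qed
  qed (use zero in auto)
  then show ?thesis by (rule CcI[OF _ C zero])
qed

lemma bisection_partition:
  assumes K: "compactin T K"
  shows "\<exists>F B \<phi> L. (\<forall>i\<in>F. bisection (B i)) \<and> partition_of_squares T K B F \<phi> L"
proof -
  have "\<exists>B. bisection B \<and> \<gamma> \<in> B" if "\<gamma> \<in> K" for \<gamma>
    using exists_bisection[of "topspace T" \<gamma>] compactin_subset_topspace[OF K] that by blast
  then have "\<forall>\<gamma>\<in>K. \<exists>B. bisection B \<and> \<gamma> \<in> B" by blast
  then obtain B where B: "\<And>\<gamma>. \<gamma> \<in> K \<Longrightarrow> bisection (B \<gamma>) \<and> \<gamma> \<in> B \<gamma>" unfolding bchoice_iff by blast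
  then have "openin T (B \<gamma>) \<and> \<gamma> \<in> B \<gamma>" if "\<gamma> \<in> K" for \<gamma>
    using B[OF that] by (simp add: bisection_def)
  from partition_of_unity_squares[OF locally_compact hausdorff K this]
  obtain F \<phi> L where P: "partition_of_squares T K B F \<phi> L" by blast
  then have "\<forall>i\<in>F. bisection (B i)" using B partition_of_squaresD(2)[OF P] by blast
  then show ?thesis using P by blast
qed

lemma convolution_Cc:
  assumes f: "f \<in> Cc G" and g: "g \<in> Cc G"
  shows "convolution G f g \<in> Cc G"
proof -
  obtain K where K: "compactin T K" "\<And>\<gamma>. \<gamma> \<notin> K \<Longrightarrow> f \<gamma> = 0" using CcE[OF f] by blast
  obtain F B \<phi> L where B: "\<And>i. i \<in> F \<Longrightarrow> bisection (B i)" and P: "partition_of_squares T K B F \<phi> L"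
    using bisection_partition[OF K(1)] by blast
  note P' = partition_of_squaresD[OF P]
  let ?f = "\<lambda>i \<gamma>. of_real ((\<phi> i \<gamma>)\<^sup>2) * f \<gamma>"
  have Cc: "?f i \<in> Cc G" if "i \<in> F" for i
  proof (rule Cc_mult[OF _ f])
    show "continuous_map T euclidean (\<lambda>\<gamma>. complex_of_real ((\<phi> i \<gamma>)\<^sup>2))"
      using P'(3)[OF that] unfolding continuous_map_euclidean_iff by (auto intro!: tendsto_intros)
  qed
  have "convolution G f g = convolution G (\<lambda>\<gamma>. \<Sum>i\<in>F. ?f i \<gamma>) g"
    by (rule arg_cong[of _ _ "\<lambda>f. convolution G f g"]) (rule partition_of_squares_split[OF P K(2)])
  also have "\<dots> = (\<lambda>\<gamma>. \<Sum>i\<in>F. convolution G (?f i) g \<gamma>)"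
    using convolution_sum_left[OF P'(1) Cc] by (intro ext) simp
  finally have "convolution G f g = (\<lambda>\<gamma>. \<Sum>i\<in>F. convolution G (?f i) g \<gamma>)" .
  moreover have "convolution G (?f i) g \<in> Cc G" if "i \<in> F" for i
    by (rule convolution_bisection_Cc[OF B[OF that] Cc_continuous[OF Cc[OF that]] P'(4)[OF that] P'(5)[OF that] _ g])
      (simp add: P'(6) that)
  ultimately show ?thesis by (simp add: Cc_sum)
qed

lemma involution_Cc:
  assumes f: "f \<in> Cc G"
  shows "involution G f \<in> Cc G"
proof -
  obtain K where K: "compactin T K" "\<And>\<gamma>. \<gamma> \<notin> K \<Longrightarrow> f \<gamma> = 0" using CcE[OF f] by blast
  show ?thesis
  proof (rule CcI[OF _ image_compactin[OF K(1) continuous_inv]])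
    have "continuous_map T euclidean (\<lambda>\<gamma>. f (ginv G \<gamma>))"
      using continuous_map_compose[OF continuous_inv Cc_continuous[OF f]] by (simp add: o_def)
    then have "continuous_map T euclidean (\<lambda>\<gamma>. cnj (f (ginv G \<gamma>)))"
      unfolding continuous_map_euclidean_iff by (auto intro!: tendsto_intros)
    then show "continuous_map T euclidean (involution G f)"
      by (rule continuous_map_eq) (simp add: involution_def topspace_T)
    show "involution G f \<gamma> = 0" if "\<gamma> \<notin> ginv G ` K" for \<gamma>
    proof (cases "\<gamma> \<in> arrows G")
      case True
      then have "ginv G \<gamma> \<notin> K" using that imageI[of "ginv G \<gamma>" K "ginv G"] inv_inv[OF True] by auto
      then show ?thesis using K(2) by (simp add: involution_def)
    qed (simp add: involution_def)
  qed
qed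

lemma involution_involution: "f \<in> Cc G \<Longrightarrow> involution G (involution G f) = f"
  by (auto simp: involution_def inv_closed inv_inv Cc_outside fun_eq_iff)

subsection \<open>Products with functions on the unit space and with bisections\<close>

lemma convolution_units_left:
  assumes k: "\<And>\<gamma>. \<gamma> \<notin> units G \<Longrightarrow> k \<gamma> = 0" and \<gamma>: "\<gamma> \<in> arrows G"
  shows "convolution G k g \<gamma> = k (grng G \<gamma>) * g \<gamma>"
proof -
  note u = rng_unit[OF \<gamma>]
  have "convolution G k g \<gamma> = (\<Sum>\<alpha>\<in>{grng G \<gamma>}. k \<alpha> * g (gcomp G (ginv G \<alpha>) \<gamma>))"
  proof (rule convolution_eq_sum[OF \<gamma>])
    show "{grng G \<gamma>} \<subseteq> range_fibre G (grng G \<gamma>)" using \<gamma> by (simp add: range_fibre_iff rng_closed rng_rng)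
    show "k \<alpha> * g (gcomp G (ginv G \<alpha>) \<gamma>) = 0" if "\<alpha> \<in> range_fibre G (grng G \<gamma>) - {grng G \<gamma>}" for \<alpha>
      using that k[of \<alpha>] unitD[of \<alpha>] by (auto simp: range_fibre_iff)
  qed simp
  then show ?thesis using \<gamma> u by (simp add: inv_unit rng_comp_id)
qed

text \<open>
  In terms of the source fibre, the convolution with an adjoint is a sum of the shape of an inner
  product.
\<close>

lemma star_convolution_eq_sum:
  assumes \<gamma>: "\<gamma> \<in> arrows G" and F: "finite F" "F \<subseteq> {\<delta> \<in> arrows G. gsrc G \<delta> = grng G \<gamma>}"
    and zero: "\<And>\<delta>. \<delta> \<in> arrows G \<Longrightarrow> gsrc G \<delta> = grng G \<gamma> \<Longrightarrow> \<delta> \<notin> F \<Longrightarrow> cnj (f \<delta>) * g (gcomp G \<delta> \<gamma>) = 0"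
  shows "convolution G (involution G f) g \<gamma> = (\<Sum>\<delta>\<in>F. cnj (f \<delta>) * g (gcomp G \<delta> \<gamma>))"
proof -
  have "convolution G (involution G f) g \<gamma>
      = (\<Sum>\<alpha>\<in>ginv G ` F. involution G f \<alpha> * g (gcomp G (ginv G \<alpha>) \<gamma>))"
  proof (rule convolution_eq_sum[OF \<gamma>])
    show "ginv G ` F \<subseteq> range_fibre G (grng G \<gamma>)" using F by (auto simp: range_fibre_iff inv_closed rng_inv)
    show "involution G f \<alpha> * g (gcomp G (ginv G \<alpha>) \<gamma>) = 0" if "\<alpha> \<in> range_fibre G (grng G \<gamma>) - ginv G ` F" for \<alpha>
    proof -
      have \<alpha>: "\<alpha> \<in> arrows G" "grng G \<alpha> = grng G \<gamma>" using that by (auto simp: range_fibre_iff)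
      have "ginv G \<alpha> \<notin> F" using that imageI[of "ginv G \<alpha>" F "ginv G"] inv_inv[OF \<alpha>(1)] by auto
      then have "cnj (f (ginv G \<alpha>)) * g (gcomp G (ginv G \<alpha>) \<gamma>) = 0"
        using \<alpha> by (intro zero) (auto simp: inv_closed src_inv)
      then show ?thesis using \<alpha> by (simp add: involution_def)
    qed
  qed (use F in simp)
  also have "\<dots> = (\<Sum>\<delta>\<in>F. cnj (f \<delta>) * g (gcomp G \<delta> \<gamma>))"
  proof (subst sum.reindex)
    have Fa: "\<delta> \<in> F \<Longrightarrow> \<delta> \<in> arrows G" for \<delta> using F by auto
    show "inj_on (ginv G) F" by (rule inj_on_inverseI[of _ "ginv G"]) (simp add: Fa inv_inv)
    show "sum ((\<lambda>\<alpha>. involution G f \<alpha> * g (gcomp G (ginv G \<alpha>) \<gamma>)) \<circ> ginv G) F = (\<Sum>\<delta>\<in>F. cnj (f \<delta>) * g (gcomp G \<delta> \<gamma>))"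
      by (intro sum.cong refl) (simp add: Fa involution_def inv_closed inv_inv)
  qed
  finally show ?thesis .
qed

text \<open>
  The products \<open>\<alpha>\<inverse>\<beta>\<close> with \<open>\<alpha>, \<beta>\<close> in a bisection are units, so \<open>a\<^sup>* * a\<close> is a function on the unit space.
\<close>

lemma star_convolution_bisection:
  assumes B: "bisection B" and a: "\<And>\<alpha>. \<alpha> \<notin> B \<Longrightarrow> a \<alpha> = 0"
  shows "\<gamma> \<notin> units G \<Longrightarrow> convolution G (involution G a) a \<gamma> = 0"
    and "\<beta> \<in> B \<Longrightarrow> convolution G (involution G a) a (gsrc G \<beta>) = of_real ((cmod (a \<beta>))\<^sup>2)"
    and "x \<in> units G \<Longrightarrow> x \<notin> gsrc G ` B \<Longrightarrow> convolution G (involution G a) a x = 0"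
proof -
  show "convolution G (involution G a) a \<gamma> = 0" if "\<gamma> \<notin> units G"
  proof (cases "\<gamma> \<in> arrows G")
    case \<gamma>: True
    have "convolution G (involution G a) a \<gamma> = (\<Sum>\<delta>\<in>{}. cnj (a \<delta>) * a (gcomp G \<delta> \<gamma>))"
    proof (rule star_convolution_eq_sum[OF \<gamma>])
      fix \<delta> assume \<delta>: "\<delta> \<in> arrows G" "gsrc G \<delta> = grng G \<gamma>"
      show "cnj (a \<delta>) * a (gcomp G \<delta> \<gamma>) = 0"
      proof (rule ccontr)
        assume "\<not> ?thesis"
        then have "\<delta> \<in> B" "gcomp G \<delta> \<gamma> \<in> B" using a by auto
        then have "gcomp G \<delta> \<gamma> = \<delta>" using bisectionD(2)[OF B, of "gcomp G \<delta> \<gamma>" \<delta>] comp_arrow[OF \<delta>(1) \<gamma> \<delta>(2)] by simp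
        then have "\<gamma> = gsrc G \<delta>" using comp_unique_left(1)[OF \<delta>(1) \<gamma> \<delta>(1) \<delta>(2)] inv_comp[OF \<delta>(1)] by simp
        then show False using that src_unit[OF \<delta>(1)] by simp
      qed
    qed auto
    then show ?thesis by simp
  qed (simp add: convolution_outside)
  show "convolution G (involution G a) a (gsrc G \<beta>) = of_real ((cmod (a \<beta>))\<^sup>2)" if \<beta>: "\<beta> \<in> B"
  proof -
    have \<beta>': "\<beta> \<in> arrows G" using bisection_subset[OF B] \<beta> by blast
    have "convolution G (involution G a) a (gsrc G \<beta>) = (\<Sum>\<delta>\<in>{\<beta>}. cnj (a \<delta>) * a (gcomp G \<delta> (gsrc G \<beta>)))"
    proof (rule star_convolution_eq_sum)
      fix \<delta> assume \<delta>: "\<delta> \<in> arrows G" "gsrc G \<delta> = grng G (gsrc G \<beta>)" "\<delta> \<notin> {\<beta>}"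
      then have "\<delta> \<notin> B" using bisectionD(1)[OF B _ \<beta>] rng_src[OF \<beta>'] by auto
      then show "cnj (a \<delta>) * a (gcomp G \<delta> (gsrc G \<beta>)) = 0" using a by simp
    qed (use \<beta>' in \<open>auto simp: src_closed rng_src\<close>)
    also have "\<dots> = of_real ((cmod (a \<beta>))\<^sup>2)"
      using comp_src[OF \<beta>'] complex_norm_square[of "a \<beta>"] by (simp add: mult.commute)
    finally show ?thesis .
  qed
  show "convolution G (involution G a) a x = 0" if x: "x \<in> units G" "x \<notin> gsrc G ` B"
  proof -
    have "convolution G (involution G a) a x = (\<Sum>\<delta>\<in>{}. cnj (a \<delta>) * a (gcomp G \<delta> x))"
    proof (rule star_convolution_eq_sum)
      fix \<delta> assume "\<delta> \<in> arrows G" "gsrc G \<delta> = grng G x"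
      then have "\<delta> \<notin> B" using x unitD[OF x(1)] by auto
      then show "cnj (a \<delta>) * a (gcomp G \<delta> x) = 0" using a by simp
    qed (use unitD[OF x(1)] in auto)
    then show ?thesis by simp
  qed
qed

lemma convolution_algebra_simps [simp]:
  "acar (convolution_algebra G) = Cc G" "aadd (convolution_algebra G) f g = (\<lambda>\<gamma>. f \<gamma> + g \<gamma>)"
  "ascale (convolution_algebra G) c f = (\<lambda>\<gamma>. c * f \<gamma>)" "amult (convolution_algebra G) = convolution G"
  "astar (convolution_algebra G) = involution G"
  by (simp_all add: convolution_algebra_def)

end

section \<open>Norm bounds for representations of the convolution algebra\<close>

context etale_groupoid
begin

abbreviation "CA \<equiv> convolution_algebra G"

lemma rep_norm_square:
  assumes \<pi>: "hilbert_representation CA I \<pi>" and f: "f \<in> Cc G" and v: "v \<in> ell2 I"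
  shows "(ell2_norm I (\<pi> f v))\<^sup>2 = Re (ell2_inner I v (\<pi> (convolution G (involution G f) f) v))"
proof -
  note R = hilbert_representationD[OF \<pi>, simplified]
  have fs: "involution G f \<in> Cc G" by (rule involution_Cc[OF f])
  have "ell2_inner I v (\<pi> (convolution G (involution G f) f) v) = ell2_inner I v (\<pi> (involution G f) (\<pi> f v))"
    by (simp add: R(4)[OF fs f v])
  also have "\<dots> = ell2_inner I (\<pi> (involution G (involution G f)) v) (\<pi> f v)"
    by (rule R(5)[OF fs v R(6)[OF f v], symmetric])
  also have "\<dots> = of_real ((ell2_norm I (\<pi> f v))\<^sup>2)"
    by (simp add: involution_involution[OF f] ell2_inner_self[OF R(6)[OF f v]])
  finally show ?thesis by simp
qed

lemma involution_units_real:
  assumes k: "\<And>\<gamma>. \<gamma> \<notin> units G \<Longrightarrow> k \<gamma> = 0" "\<And>\<gamma>. cnj (k \<gamma>) = k \<gamma>"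
  shows "involution G k = k"
proof
  fix \<gamma> show "involution G k \<gamma> = k \<gamma>"
  proof (cases "\<gamma> \<in> units G")
    case True
    then show ?thesis using unitD[OF True] k(2) by (simp add: involution_def inv_unit)
  next
    case False
    then have "\<gamma> \<in> arrows G \<Longrightarrow> ginv G \<gamma> \<notin> units G" using inv_unit[of "ginv G \<gamma>"] inv_inv[of \<gamma>] by auto
    then show ?thesis using False k(1) by (simp add: involution_def)
  qed
qed

text \<open>
  On functions supported in the unit space every representation is a contraction for the supremum
  norm. With \<open>k = M - sqrt (M\<^sup>2 - \<bar>h\<bar>\<^sup>2)\<close>, a function in \<open>C\<^sub>c(X)\<close>, the identity
  \<open>\<bar>h\<bar>\<^sup>2 = 2Mk - k\<^sup>2\<close> says that \<open>M\<^sup>2\<parallel>v\<parallel>\<^sup>2 - \<parallel>\<pi>(h)v\<parallel>\<^sup>2 = \<parallel>Mv - \<pi>(k)v\<parallel>\<^sup>2\<close>.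
\<close>

lemma rep_bound_units:
  assumes \<pi>: "hilbert_representation CA I \<pi>" and h: "h \<in> Cc G" "\<And>\<gamma>. \<gamma> \<notin> units G \<Longrightarrow> h \<gamma> = 0"
    and M: "\<And>\<gamma>. cmod (h \<gamma>) \<le> M" and v: "v \<in> ell2 I"
  shows "ell2_norm I (\<pi> h v) \<le> M * ell2_norm I v"
proof -
  note R = hilbert_representationD[OF \<pi>, simplified]
  have M0: "0 \<le> M" using M[of undefined] norm_ge_zero order_trans by blast
  define q where "q z = complex_of_real (M - sqrt (M\<^sup>2 - (cmod z)\<^sup>2))" for z
  define k where "k \<gamma> = q (h \<gamma>)" for \<gamma>
  have k: "k \<in> Cc G"
    unfolding k_def[abs_def] by (rule Cc_compose[OF _ _ h(1)]) (use M0 in \<open>auto simp: q_def intro!: continuous_intros\<close>)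
  have k0: "\<And>\<gamma>. \<gamma> \<notin> units G \<Longrightarrow> k \<gamma> = 0" using h(2) M0 by (simp add: k_def q_def)
  have kstar: "involution G k = k" by (rule involution_units_real) (use k0 in \<open>simp_all add: k_def q_def\<close>)
  have hstar0: "involution G h \<gamma> = 0" if "\<gamma> \<notin> units G" for \<gamma>
  proof (cases "\<gamma> \<in> arrows G")
    case True
    then have "ginv G \<gamma> \<notin> units G" using that inv_unit inv_inv by metis
    then show ?thesis using h(2) by (simp add: involution_def)
  qed (simp add: involution_def)
  have eq: "convolution G (involution G h) h = (\<lambda>\<gamma>. (2 * M) * k \<gamma> + (-1) * convolution G k k \<gamma>)"
  proof
    fix \<gamma>
    show "convolution G (involution G h) h \<gamma> = (2 * M) * k \<gamma> + (-1) * convolution G k k \<gamma>"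
    proof (cases "\<gamma> \<in> units G")
      case True
      note u = unitD[OF True]
      have "convolution G (involution G h) h \<gamma> = cnj (h \<gamma>) * h \<gamma>"
        using convolution_units_left[of "involution G h" \<gamma> h] hstar0 u
        by (simp add: involution_def inv_unit True)
      also have "\<dots> = of_real ((cmod (h \<gamma>))\<^sup>2)" using complex_norm_square[of "h \<gamma>"] by (simp add: mult.commute)
      also have "\<dots> = of_real (2 * M * (M - sqrt (M\<^sup>2 - (cmod (h \<gamma>))\<^sup>2)) - (M - sqrt (M\<^sup>2 - (cmod (h \<gamma>))\<^sup>2))\<^sup>2)"
      proof -
        have "(sqrt (M\<^sup>2 - (cmod (h \<gamma>))\<^sup>2))\<^sup>2 = M\<^sup>2 - (cmod (h \<gamma>))\<^sup>2"
          using M[of \<gamma>] by (intro real_sqrt_pow2) (simp add: power_mono)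
        then show ?thesis by (simp add: power2_eq_square algebra_simps)
      qed
      also have "\<dots> = (2 * M) * k \<gamma> + (-1) * (k \<gamma> * k \<gamma>)"
        by (simp add: k_def q_def power2_eq_square)
      finally show ?thesis using convolution_units_left[of k \<gamma> k] k0 u by simp
    next
      case False
      then show ?thesis
        using convolution_units_left[of k \<gamma> k] convolution_units_left[of "involution G h" \<gamma> h] k0 hstar0 h(2)
        by (cases "\<gamma> \<in> arrows G") (auto simp: convolution_outside)
    qed
  qed
  have kk: "convolution G k k \<in> Cc G" by (rule convolution_Cc[OF k k])
  have in2: "\<pi> k v \<in> ell2 I" "\<pi> (convolution G k k) v \<in> ell2 I" using R(6) k kk v by auto
  have "\<pi> (convolution G (involution G h) h) v = (\<lambda>i. (2 * M) * \<pi> k v i + (-1) * \<pi> (convolution G k k) v i)"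
    unfolding eq using R(2)[OF Cc_scale[OF k] Cc_scale[OF kk] v, of "2 * M" "-1"] R(3)[OF k v, of "2*M"] R(3)[OF kk v, of "-1"]
    by simp
  then have "ell2_inner I v (\<pi> (convolution G (involution G h) h) v)
     = (2 * M) * ell2_inner I v (\<pi> k v) + (-1) * ell2_inner I v (\<pi> (convolution G k k) v)"
    using ell2_inner_add_right[OF v ell2_scale[OF in2(1), of "2 * M"] ell2_scale[OF in2(2), of "-1"]]
    by (simp only: ell2_inner_scale_right)
  then have "(ell2_norm I (\<pi> h v))\<^sup>2 = 2 * M * Re (ell2_inner I v (\<pi> k v)) - (ell2_norm I (\<pi> k v))\<^sup>2"
    using rep_norm_square[OF \<pi> h(1) v] rep_norm_square[OF \<pi> k v] by (simp add: kstar)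
  moreover have "0 \<le> M\<^sup>2 * (ell2_norm I v)\<^sup>2 - 2 * M * Re (ell2_inner I v (\<pi> k v)) + (ell2_norm I (\<pi> k v))\<^sup>2"
  proof -
    have "(ell2_norm I (\<lambda>i. of_real M * v i + (-1) * \<pi> k v i))\<^sup>2
        = M\<^sup>2 * (ell2_norm I v)\<^sup>2 - 2 * M * Re (ell2_inner I v (\<pi> k v)) + (ell2_norm I (\<pi> k v))\<^sup>2"
      using ell2_norm_add_power2[OF ell2_scale[OF v, of "of_real M"] ell2_scale[OF in2(1), of "-1"]]
      by (simp only: ell2_inner_scale_right ell2_inner_scale_left ell2_norm_scale) (simp add: power_mult_distrib)
    then show ?thesis by (metis zero_le_power2)
  qed
  ultimately have "(ell2_norm I (\<pi> h v))\<^sup>2 \<le> (M * ell2_norm I v)\<^sup>2" by (simp add: power_mult_distrib)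
  then show ?thesis by (rule power2_le_imp_le) (simp add: M0)
qed

lemma star_convolution_bisection_units:
  assumes a: "a \<in> Cc G" and B: "bisection B" "\<And>\<gamma>. \<gamma> \<notin> B \<Longrightarrow> a \<gamma> = 0" and M: "\<And>\<gamma>. cmod (a \<gamma>) \<le> M"
  shows "cmod (convolution G (involution G a) a \<gamma>) \<le> M\<^sup>2"
proof (cases "\<gamma> \<in> gsrc G ` B")
  case True
  then obtain \<beta> where "\<beta> \<in> B" "\<gamma> = gsrc G \<beta>" by blast
  then show ?thesis
    using star_convolution_bisection(2)[where a=a, OF B] M[of \<beta>] by (simp add: norm_power power_mono)
next
  case False
  then have "convolution G (involution G a) a \<gamma> = 0"
    using star_convolution_bisection(1,3)[where a=a, OF B] by blast
  then show ?thesis by simp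
qed

text \<open>
  By the identity \<open>\<parallel>\<pi>(a)v\<parallel>\<^sup>2 = \<langle>v, \<pi>(a\<^sup>* * a)v\<rangle>\<close> the bound for functions on the unit space applies.
\<close>

lemma rep_bound_bisection:
  assumes \<pi>: "hilbert_representation CA I \<pi>" and a: "a \<in> Cc G" and B: "bisection B" "\<And>\<gamma>. \<gamma> \<notin> B \<Longrightarrow> a \<gamma> = 0"
    and M: "\<And>\<gamma>. cmod (a \<gamma>) \<le> M" and v: "v \<in> ell2 I"
  shows "ell2_norm I (\<pi> a v) \<le> M * ell2_norm I v"
proof -
  note R = hilbert_representationD[OF \<pi>, simplified]
  have M0: "0 \<le> M" using M[of undefined] norm_ge_zero order_trans by blast
  let ?h = "convolution G (involution G a) a"
  have h: "?h \<in> Cc G" by (intro convolution_Cc involution_Cc a)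
  have "(ell2_norm I (\<pi> a v))\<^sup>2 \<le> cmod (ell2_inner I v (\<pi> ?h v))"
    unfolding rep_norm_square[OF \<pi> a v] by (rule complex_Re_le_cmod)
  also have "\<dots> \<le> ell2_norm I v * ell2_norm I (\<pi> ?h v)"
    by (rule ell2_Cauchy_Schwarz[OF v R(6)[OF h v]])
  also have "\<dots> \<le> ell2_norm I v * (M\<^sup>2 * ell2_norm I v)"
    by (intro mult_left_mono rep_bound_units[OF \<pi> h _ _ v] star_convolution_bisection_units[OF a B M])
      (auto intro: star_convolution_bisection(1)[where a=a, OF B])
  also have "\<dots> = (M * ell2_norm I v)\<^sup>2" by (simp add: power2_eq_square)
  finally show ?thesis by (rule power2_le_imp_le) (simp add: M0)
qed

lemma rep_sum:
  assumes \<pi>: "hilbert_representation CA I \<pi>" and f: "\<And>i. i \<in> S \<Longrightarrow> f i \<in> Cc G" and v: "v \<in> ell2 I"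
  shows "\<pi> (\<lambda>\<gamma>. \<Sum>i\<in>S. f i \<gamma>) v = (\<lambda>j. \<Sum>i\<in>S. \<pi> (f i) v j)"
proof -
  note R = hilbert_representationD[OF \<pi>, simplified]
  have zero: "\<pi> (\<lambda>\<gamma>. 0) v = (\<lambda>j. 0)" using R(3)[OF Cc_zero v, of 0] by simp
  show ?thesis using f
  proof (induction S rule: infinite_finite_induct)
    case (insert x F)
    then show ?case
      using R(2)[of "f x" "\<lambda>\<gamma>. \<Sum>i\<in>F. f i \<gamma>" v] Cc_sum[of F f] v by simp
  qed (simp_all add: zero)
qed

text \<open>
  The constant \<open>N\<close> is the number of bisections needed to cover \<open>K\<close>. It is uniform in the functions
  supported in \<open>K\<close> and in the representations, so a uniformly small function with support in \<open>K\<close> is small in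
  every representation.
\<close>

lemma rep_bound_compact:
  assumes K: "compactin T K"
  shows "\<exists>N. \<forall>f\<in>Cc G. \<forall>M I \<pi>. \<forall>v\<in>ell2 I. (\<forall>\<gamma>. \<gamma> \<notin> K \<longrightarrow> f \<gamma> = 0) \<longrightarrow> (\<forall>\<gamma>. cmod (f \<gamma>) \<le> M) \<longrightarrow>
     hilbert_representation CA I \<pi> \<longrightarrow> ell2_norm I (\<pi> f v) \<le> real N * M * ell2_norm I v"
proof -
  obtain F B \<phi> L where B: "\<And>i. i \<in> F \<Longrightarrow> bisection (B i)" and P: "partition_of_squares T K B F \<phi> L"
    using bisection_partition[OF K(1)] by blast
  note P' = partition_of_squaresD[OF P]
  have "ell2_norm I (\<pi> f v) \<le> real (card F) * M * ell2_norm I v"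
    if f: "f \<in> Cc G" "\<forall>\<gamma>. \<gamma> \<notin> K \<longrightarrow> f \<gamma> = 0" and M: "\<forall>\<gamma>. cmod (f \<gamma>) \<le> M" and v: "v \<in> ell2 I"
      and \<pi>: "hilbert_representation CA I \<pi>" for f M I \<pi> v
  proof -
    note R = hilbert_representationD[OF \<pi>, simplified]
    let ?f = "\<lambda>i \<gamma>. of_real ((\<phi> i \<gamma>)\<^sup>2) * f \<gamma>"
    have Cc: "?f i \<in> Cc G" if "i \<in> F" for i
    proof (rule Cc_mult[OF _ f(1)])
      show "continuous_map T euclidean (\<lambda>\<gamma>. complex_of_real ((\<phi> i \<gamma>)\<^sup>2))"
        using P'(3)[OF that] unfolding continuous_map_euclidean_iff by (auto intro!: tendsto_intros)
    qed
    have "\<pi> f v = \<pi> (\<lambda>\<gamma>. \<Sum>i\<in>F. ?f i \<gamma>) v"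
      by (rule arg_cong[of _ _ "\<lambda>f. \<pi> f v"], rule partition_of_squares_split[OF P]) (use f(2) in blast)
    also have "\<dots> = (\<lambda>j. \<Sum>i\<in>F. \<pi> (?f i) v j)" by (rule rep_sum[OF \<pi> Cc v])
    finally have "ell2_norm I (\<pi> f v) \<le> (\<Sum>i\<in>F. ell2_norm I (\<pi> (?f i) v))"
      using ell2_norm_sum_le[of F "\<lambda>i. \<pi> (?f i) v" I] R(6)[OF Cc v] by simp
    also have "\<dots> \<le> (\<Sum>i\<in>F. M * ell2_norm I v)"
    proof (rule sum_mono)
      fix i assume i: "i \<in> F"
      show "ell2_norm I (\<pi> (?f i) v) \<le> M * ell2_norm I v"
      proof (rule rep_bound_bisection[OF \<pi> Cc[OF i] B[OF i] _ _ v])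
        show "?f i \<gamma> = 0" if "\<gamma> \<notin> B i" for \<gamma>
          using that P'(5)[OF i] P'(6)[OF i, of \<gamma>] by auto
        show "cmod (?f i \<gamma>) \<le> M" for \<gamma>
          using mult_mono[OF partition_of_squares_le_1(1)[OF P i, of \<gamma>] M[rule_format, of \<gamma>]] by (simp add: norm_mult norm_power)
      qed
    qed
    finally show ?thesis by simp
  qed
  then show ?thesis by (intro exI[of _ "card F"]) blast
qed

lemma bounded_star_algebra_convolution: "bounded_star_algebra CA"
proof
  fix f assume "f \<in> acar CA"
  then have f: "f \<in> Cc G" by simp
  obtain K where K: "compactin T K" "\<And>\<gamma>. \<gamma> \<notin> K \<Longrightarrow> f \<gamma> = 0" using CcE[OF f] by blast
  obtain M where M: "0 < M" "\<And>\<gamma>. cmod (f \<gamma>) \<le> M" using Cc_bounded[OF f] by blast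
  obtain N where N: "\<forall>f\<in>Cc G. \<forall>M I \<pi>. \<forall>v\<in>ell2 I. (\<forall>\<gamma>. \<gamma> \<notin> K \<longrightarrow> f \<gamma> = 0) \<longrightarrow> (\<forall>\<gamma>. cmod (f \<gamma>) \<le> M) \<longrightarrow>
     hilbert_representation CA I \<pi> \<longrightarrow> ell2_norm I (\<pi> f v) \<le> real N * M * ell2_norm I v"
    using rep_bound_compact[OF K(1)] by blast
  show "\<exists>C. \<forall>I \<pi>. \<forall>v\<in>ell2 I. hilbert_representation CA I \<pi> \<longrightarrow> ell2_norm I (\<pi> f v) \<le> C * ell2_norm I v"
    by (rule exI[of _ "real N * M"]) (use N f K(2) M(2) in blast)
qed (auto intro: Cc_add Cc_scale convolution_Cc involution_Cc)

sublocale CA: bounded_star_algebra CA by (rule bounded_star_algebra_convolution)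

section \<open>The regular representations\<close>

lemma source_fibre_quotients:
  assumes "\<gamma> \<in> arrows G" "\<delta> \<in> arrows G" "\<eta> \<in> arrows G" "gsrc G \<gamma> = x" "gsrc G \<delta> = x" "gsrc G \<eta> = x"
  shows "gcomp G (gcomp G \<gamma> (ginv G \<delta>)) (gcomp G \<delta> (ginv G \<eta>)) = gcomp G \<gamma> (ginv G \<eta>)"
    and "gcomp G (ginv G (gcomp G \<gamma> (ginv G \<delta>))) (gcomp G \<gamma> (ginv G \<eta>)) = gcomp G \<delta> (ginv G \<eta>)"
    and "ginv G (gcomp G \<gamma> (ginv G \<delta>)) = gcomp G \<delta> (ginv G \<gamma>)"
proof -
  note i = inv_closed src_inv rng_inv
  note q = comp_inv_arrow[OF assms(1,2)] comp_inv_arrow[OF assms(2,3)] comp_inv_arrow[OF assms(1,3)]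
  have "gcomp G (gcomp G \<gamma> (ginv G \<delta>)) (gcomp G \<delta> (ginv G \<eta>))
      = gcomp G \<gamma> (gcomp G (ginv G \<delta>) (gcomp G \<delta> (ginv G \<eta>)))"
    using comp_assoc'[of \<gamma> "ginv G \<delta>" "gcomp G \<delta> (ginv G \<eta>)"] assms q by (simp add: i)
  also have "gcomp G (ginv G \<delta>) (gcomp G \<delta> (ginv G \<eta>)) = ginv G \<eta>"
    using cancel_left'[of \<delta> "ginv G \<eta>"] assms by (simp add: i)
  finally show 1: "gcomp G (gcomp G \<gamma> (ginv G \<delta>)) (gcomp G \<delta> (ginv G \<eta>)) = gcomp G \<gamma> (ginv G \<eta>)" .
  show "gcomp G (ginv G (gcomp G \<gamma> (ginv G \<delta>))) (gcomp G \<gamma> (ginv G \<eta>)) = gcomp G \<delta> (ginv G \<eta>)"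
    using comp_unique_left(1)[OF _ _ _ _ 1] q assms by simp
  show "ginv G (gcomp G \<gamma> (ginv G \<delta>)) = gcomp G \<delta> (ginv G \<gamma>)"
    using inv_of_comp[of \<gamma> "ginv G \<delta>"] assms by (simp add: i inv_inv)
qed

lemma source_fibre_quotient_bij:
  assumes \<gamma>: "\<gamma> \<in> arrows G"
  shows "bij_betw (\<lambda>\<delta>. gcomp G \<gamma> (ginv G \<delta>)) {\<delta> \<in> arrows G. gsrc G \<delta> = gsrc G \<gamma>} (range_fibre G (grng G \<gamma>))"
proof (rule bij_betw_byWitness[where f' = "\<lambda>\<alpha>. gcomp G (ginv G \<alpha>) \<gamma>"])
  note i = inv_closed src_inv rng_inv
  show "\<forall>\<delta>\<in>{\<delta> \<in> arrows G. gsrc G \<delta> = gsrc G \<gamma>}. gcomp G (ginv G (gcomp G \<gamma> (ginv G \<delta>))) \<gamma> = \<delta>"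
  proof
    fix \<delta> assume "\<delta> \<in> {\<delta> \<in> arrows G. gsrc G \<delta> = gsrc G \<gamma>}"
    then show "gcomp G (ginv G (gcomp G \<gamma> (ginv G \<delta>))) \<gamma> = \<delta>"
      using source_fibre_quotients(3)[OF \<gamma> _ \<gamma> refl, of \<delta>] cancel_right[OF \<gamma>, of \<delta>] by simp
  qed
  show "\<forall>\<alpha>\<in>range_fibre G (grng G \<gamma>). gcomp G \<gamma> (ginv G (gcomp G (ginv G \<alpha>) \<gamma>)) = \<alpha>"
  proof
    fix \<alpha> assume "\<alpha> \<in> range_fibre G (grng G \<gamma>)"
    then have \<alpha>: "\<alpha> \<in> arrows G" "grng G \<alpha> = grng G \<gamma>" by (auto simp: range_fibre_iff)
    have "ginv G (gcomp G (ginv G \<alpha>) \<gamma>) = gcomp G (ginv G \<gamma>) \<alpha>"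
      using inv_of_comp[of "ginv G \<alpha>" \<gamma>] \<alpha> \<gamma> by (simp add: i inv_inv)
    then show "gcomp G \<gamma> (ginv G (gcomp G (ginv G \<alpha>) \<gamma>)) = \<alpha>"
      using cancel_left[OF \<gamma> \<alpha>(1)] \<alpha> by simp
  qed
  show "(\<lambda>\<delta>. gcomp G \<gamma> (ginv G \<delta>)) ` {\<delta> \<in> arrows G. gsrc G \<delta> = gsrc G \<gamma>} \<subseteq> range_fibre G (grng G \<gamma>)"
  proof (rule image_subsetI)
    fix \<delta> assume "\<delta> \<in> {\<delta> \<in> arrows G. gsrc G \<delta> = gsrc G \<gamma>}"
    then show "gcomp G \<gamma> (ginv G \<delta>) \<in> range_fibre G (grng G \<gamma>)"
      using comp_inv_arrow(1,3)[OF \<gamma>, of \<delta>] by (simp add: range_fibre_iff)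
  qed
  show "(\<lambda>\<alpha>. gcomp G (ginv G \<alpha>) \<gamma>) ` range_fibre G (grng G \<gamma>) \<subseteq> {\<delta> \<in> arrows G. gsrc G \<delta> = gsrc G \<gamma>}"
  proof (rule image_subsetI)
    fix \<alpha> assume "\<alpha> \<in> range_fibre G (grng G \<gamma>)"
    then show "gcomp G (ginv G \<alpha>) \<gamma> \<in> {\<delta> \<in> arrows G. gsrc G \<delta> = gsrc G \<gamma>}"
      using inv_comp_arrow(1,2)[OF _ \<gamma>, of \<alpha>] by (simp add: range_fibre_iff)
  qed
qed

lemma finite_card_by_injection:
  assumes "inj_on h A" "h ` A \<subseteq> B" "finite B \<and> card B \<le> N"
  shows "finite A \<and> card A \<le> N"
proof
  show "finite A" using assms(3) by (intro inj_on_finite[OF assms(1,2)]) simp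
  have "card A \<le> card B" using assms(3) by (intro card_inj_on_le[OF assms(1,2)]) simp
  then show "card A \<le> N" using assms(3) by simp
qed

text \<open>
  A basic open set on which the source map is injective contains at most one arrow of the fibre.
\<close>

lemma countable_source_fibre:
  "countable {\<gamma> \<in> arrows G. gsrc G \<gamma> = x}"
proof -
  obtain \<B> where "countable \<B> \<and> (\<forall>V\<in>\<B>. openin T V) \<and> (\<forall>U x. openin T U \<and> x \<in> U \<longrightarrow> (\<exists>V\<in>\<B>. x \<in> V \<and> V \<subseteq> U))"
    using second_countable unfolding second_countable_def by (elim exE) (rule that)
  then have \<B>: "countable \<B>" and base: "\<forall>U x. openin T U \<and> x \<in> U \<longrightarrow> (\<exists>V\<in>\<B>. x \<in> V \<and> V \<subseteq> U)" by simp_all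
  have "\<exists>V. V \<in> \<B> \<and> \<gamma> \<in> V \<and> inj_on (gsrc G) V" if \<gamma>: "\<gamma> \<in> arrows G" for \<gamma>
  proof -
    have "\<gamma> \<in> topspace T" using \<gamma> by (simp add: topspace_T)
    then obtain B where B: "bisection B" "\<gamma> \<in> B" using exists_bisection[OF openin_topspace] by blast
    have oB: "openin T B" "inj_on (gsrc G) B" using B(1) unfolding bisection_def by simp_all
    obtain V where V: "V \<in> \<B>" "\<gamma> \<in> V" "V \<subseteq> B" using base[rule_format, of B \<gamma>] oB(1) B(2) by blast
    then show ?thesis using inj_on_subset[OF oB(2) V(3)] by (intro exI[of _ V]) simp
  qed
  then have "\<forall>\<gamma>\<in>arrows G. \<exists>V. V \<in> \<B> \<and> \<gamma> \<in> V \<and> inj_on (gsrc G) V" by simp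
  then obtain V where "\<forall>\<gamma>\<in>arrows G. V \<gamma> \<in> \<B> \<and> \<gamma> \<in> V \<gamma> \<and> inj_on (gsrc G) (V \<gamma>)"
    unfolding bchoice_iff by (elim exE) (rule that)
  then have V: "V \<gamma> \<in> \<B>" "\<gamma> \<in> V \<gamma>" "inj_on (gsrc G) (V \<gamma>)" if "\<gamma> \<in> arrows G" for \<gamma> using that by simp_all
  show ?thesis
  proof (rule countable_image_inj_on)
    show "countable (V ` {\<gamma> \<in> arrows G. gsrc G \<gamma> = x})"
      by (rule countable_subset[OF _ \<B>]) (use V(1) in auto)
    show "inj_on V {\<gamma> \<in> arrows G. gsrc G \<gamma> = x}"
    proof (rule inj_onI)
      fix \<gamma> \<delta> assume \<section>: "\<gamma> \<in> {\<gamma> \<in> arrows G. gsrc G \<gamma> = x}" "\<delta> \<in> {\<gamma> \<in> arrows G. gsrc G \<gamma> = x}" "V \<gamma> = V \<delta>"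
      then have "\<gamma> \<in> V \<gamma>" "\<delta> \<in> V \<gamma>" "inj_on (gsrc G) (V \<gamma>)" using V(2,3)[of \<gamma>] V(2)[of \<delta>] by simp_all
      then show "\<gamma> = \<delta>" using \<section>(1,2) inj_onD[of "gsrc G" "V \<gamma>" \<gamma> \<delta>] by simp
    qed
  qed
qed

text \<open>
  The left regular representation on \<open>\<ell>\<^sup>2\<close> of the source fibre of \<open>x\<close>, with matrix entries
  \<open>f(\<gamma>\<delta>\<inverse>)\<close>; an enumeration of the fibre moves it to a set of natural numbers.
\<close>

lemma regular_representation:
  assumes x: "x \<in> units G"
  shows "\<exists>I \<pi>. hilbert_representation CA I \<pi> \<and> (\<exists>v\<in>ell2 I. \<forall>f\<in>Cc G. cmod (f x) \<le> ell2_norm I (\<pi> f v))"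
proof -
  let ?S = "{\<gamma> \<in> arrows G. gsrc G \<gamma> = x}"
  obtain e :: "'g \<Rightarrow> nat" where e: "inj_on e ?S" using countable_source_fibre unfolding countable_def by blast
  define I where "I = e ` ?S"
  define d where "d = inv_into ?S e"
  have bd: "bij_betw d I ?S" unfolding d_def I_def by (rule bij_betw_inv_into) (simp add: e bij_betw_def)
  have d: "d i \<in> arrows G" "gsrc G (d i) = x" if "i \<in> I" for i using bd that by (auto simp: bij_betw_def)
  have dinj: "d i = d j \<longleftrightarrow> i = j" if "i \<in> I" "j \<in> I" for i j using bd that by (auto simp: bij_betw_def inj_on_def)
  define M where "M f i j = f (gcomp G (d i) (ginv G (d j)))" for f :: "'g \<Rightarrow> complex" and i j
  have "hilbert_representation CA I (\<lambda>f. matrix_operator I (M f))"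
  proof (rule hilbert_representation_of_entries)
    fix f assume "f \<in> acar CA"
    then have f: "f \<in> Cc G" by simp
    obtain K where K: "compactin T K" "\<And>\<gamma>. \<gamma> \<notin> K \<Longrightarrow> f \<gamma> = 0" using CcE[OF f] by blast
    obtain C where C: "0 < C" "\<And>\<gamma>. cmod (f \<gamma>) \<le> C" using Cc_bounded[OF f] by blast
    obtain N where Nr: "\<forall>y. finite {\<gamma> \<in> K. grng G \<gamma> = y} \<and> card {\<gamma> \<in> K. grng G \<gamma> = y} \<le> N"
      and Ns: "\<forall>y. finite {\<gamma> \<in> K. gsrc G \<gamma> = y} \<and> card {\<gamma> \<in> K. gsrc G \<gamma> = y} \<le> N"
      using compact_fibres_finite[OF K(1)] by (elim exE conjE) (rule that)
    have row: "finite {j \<in> I. M f i j \<noteq> 0} \<and> card {j \<in> I. M f i j \<noteq> 0} \<le> N" if i: "i \<in> I" for i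
    proof -
      let ?h = "\<lambda>j. gcomp G (d i) (ginv G (d j))"
      have "inj_on ((\<lambda>\<delta>. gcomp G (d i) (ginv G \<delta>)) \<circ> d) {j \<in> I. M f i j \<noteq> 0}"
      proof (rule comp_inj_on)
        show "inj_on d {j \<in> I. M f i j \<noteq> 0}"
          by (rule inj_on_subset[OF bij_betw_imp_inj_on[OF bd]]) simp
        have "inj_on (\<lambda>\<delta>. gcomp G (d i) (ginv G \<delta>)) ?S"
          using bij_betw_imp_inj_on[OF source_fibre_quotient_bij[OF d(1)[OF i]]] d(2)[OF i] by simp
        then show "inj_on (\<lambda>\<delta>. gcomp G (d i) (ginv G \<delta>)) (d ` {j \<in> I. M f i j \<noteq> 0})"
          by (rule inj_on_subset) (use d in auto)
      qed
      then have "inj_on ?h {j \<in> I. M f i j \<noteq> 0}" by (simp add: o_def)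
      moreover have "?h ` {j \<in> I. M f i j \<noteq> 0} \<subseteq> {\<gamma> \<in> K. grng G \<gamma> = grng G (d i)}"
      proof (rule image_subsetI)
        fix j assume j: "j \<in> {j \<in> I. M f i j \<noteq> 0}"
        then have "?h j \<in> K" using K(2) unfolding M_def by blast
        then show "?h j \<in> {\<gamma> \<in> K. grng G \<gamma> = grng G (d i)}"
          using comp_inv_arrow(3)[OF d(1)[OF i] d(1)[of j]] d(2) i j by simp
      qed
      ultimately show ?thesis by (rule finite_card_by_injection) (use Nr in simp)
    qed
    have col: "finite {i \<in> I. M f i j \<noteq> 0} \<and> card {i \<in> I. M f i j \<noteq> 0} \<le> N" if j: "j \<in> I" for j
    proof -
      let ?h = "\<lambda>i. gcomp G (d i) (ginv G (d j))"
      have "inj_on ?h {i \<in> I. M f i j \<noteq> 0}"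
      proof (rule inj_onI)
        fix i k assume ik: "i \<in> {i \<in> I. M f i j \<noteq> 0}" "k \<in> {i \<in> I. M f i j \<noteq> 0}" and eq: "?h i = ?h k"
        have "d i = gcomp G (?h i) (d j)" "d k = gcomp G (?h k) (d j)"
          using cancel_right[OF d(1)[OF j] d(1)[of i]] cancel_right[OF d(1)[OF j] d(1)[of k]] ik j d by auto
        then have "d i = d k" using eq by simp
        then show "i = k" using dinj ik by simp
      qed
      moreover have "?h ` {i \<in> I. M f i j \<noteq> 0} \<subseteq> {\<gamma> \<in> K. gsrc G \<gamma> = grng G (d j)}"
      proof (rule image_subsetI)
        fix i assume i: "i \<in> {i \<in> I. M f i j \<noteq> 0}"
        then have "?h i \<in> K" using K(2) unfolding M_def by blast
        then show "?h i \<in> {\<gamma> \<in> K. gsrc G \<gamma> = grng G (d j)}"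
          using comp_inv_arrow(2)[OF d(1)[of i] d(1)[OF j]] d(2) i j by simp
      qed
      ultimately show ?thesis by (rule finite_card_by_injection) (use Ns in simp)
    qed
    have "row_col_finite I N C (M f)"
      unfolding row_col_finite_def using row col C(2) by (auto simp: M_def)
    then show "\<exists>N C. 0 \<le> C \<and> row_col_finite I N C (M f)" using C(1) by (meson less_imp_le)
  next
    fix f g i j assume "f \<in> acar CA" "g \<in> acar CA" and ij: "i \<in> I" "j \<in> I"
    note di = d[OF ij(1)] and dj = d[OF ij(2)]
    note q = comp_inv_arrow[OF di(1) dj(1)]
    let ?F = "\<lambda>\<alpha>. f \<alpha> * g (gcomp G (ginv G \<alpha>) (gcomp G (d i) (ginv G (d j))))"
    have "bij_betw ((\<lambda>\<delta>. gcomp G (d i) (ginv G \<delta>)) \<circ> d) I (range_fibre G (grng G (d i)))"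
      using source_fibre_quotient_bij[OF di(1)] bd di(2) by (intro bij_betw_trans) auto
    from infsum_reindex_bij_betw[OF this, of ?F]
    have "M (amult CA f g) i j = (\<Sum>\<^sub>\<infinity>k\<in>I. ?F (gcomp G (d i) (ginv G (d k))))"
      using q di dj by (simp add: M_def convolution_def)
    also have "\<dots> = (\<Sum>\<^sub>\<infinity>k\<in>I. M f i k * M g k j)"
      by (rule infsum_cong) (simp add: M_def source_fibre_quotients(2)[where x=x] d ij)
    finally show "M (amult CA f g) i j = (\<Sum>\<^sub>\<infinity>k\<in>I. M f i k * M g k j)" .
  next
    fix f i j assume "f \<in> acar CA" and ij: "i \<in> I" "j \<in> I"
    note di = d[OF ij(1)] and dj = d[OF ij(2)]
    show "M (astar CA f) i j = cnj (M f j i)"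
      using comp_inv_arrow(1)[OF di(1) dj(1)] source_fibre_quotients(3)[OF di(1) dj(1) di(1) di(2) dj(2) di(2)] di dj
      by (simp add: M_def involution_def)
  qed (auto simp: M_def)
  moreover have "\<exists>v\<in>ell2 I. \<forall>f\<in>Cc G. cmod (f x) \<le> ell2_norm I (matrix_operator I (M f) v)"
  proof -
    have "x \<in> ?S" using unitD[OF x] by simp
    then have "x \<in> d ` I" using bij_betw_imp_surj_on[OF bd] by simp
    then obtain i where i: "i \<in> I" "d i = x" by (metis imageE)
    let ?v = "\<lambda>j. if j = i then 1 else (0::complex)"
    have v: "?v \<in> ell2 I"
      using i summable_on_finite_support[of "{i}" I "\<lambda>j. (cmod (?v j))\<^sup>2"] by (auto simp: ell2_def)
    have "cmod (f x) \<le> ell2_norm I (matrix_operator I (M f) ?v)" if f: "f \<in> Cc G" for f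
    proof -
      let ?w = "matrix_operator I (M f) ?v"
      have w: "?w \<in> ell2 I"
        using hilbert_representationD(6)[OF \<open>hilbert_representation CA I (\<lambda>f. matrix_operator I (M f))\<close> _ v] f by simp
      have "?w i = (\<Sum>j\<in>{i}. M f i j * ?v j)"
        unfolding matrix_operator_def using i infsum_eq_sum_support[of "{i}" I "\<lambda>j. M f i j * ?v j"] by auto
      then have "?w i = f x" using i unitD[OF x] comp_src[of x] by (simp add: M_def inv_unit[OF x])
      moreover have "(cmod (?w i))\<^sup>2 \<le> (ell2_norm I ?w)\<^sup>2"
        unfolding ell2_norm_power2 using finite_sum_le_infsum[OF ell2_summable[OF w], of "{i}"] i by simp
      ultimately show ?thesis using power2_le_imp_le[OF _ ell2_norm_nonneg] by metis
    qed
    then show ?thesis using v by blast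
  qed
  ultimately show ?thesis by blast
qed

lemma universal_norm_pos:
  assumes f: "f \<in> Cc G" and x: "x \<in> units G" "f x \<noteq> 0"
  shows "0 < CA.unorm f"
proof -
  obtain I \<pi> v where \<pi>: "hilbert_representation CA I \<pi>" and v: "v \<in> ell2 I" "cmod (f x) \<le> ell2_norm I (\<pi> f v)"
    using regular_representation[OF x(1)] f by blast
  have "0 < cmod (f x)" using x(2) by simp
  also have "\<dots> \<le> CA.unorm f * ell2_norm I v"
    using CA.universal_norm_bound[OF \<pi> _ v(1), of f] f v(2) by simp
  finally have "0 < CA.unorm f * ell2_norm I v" .
  then show ?thesis using ell2_norm_nonneg[of I v] by (simp add: zero_less_mult_iff)
qed

end

section \<open>Residually finite-dimensional algebras have dense periodic points\<close>

lemma nontrivial_linear_relation: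
  fixes m :: "'t \<Rightarrow> 'i \<Rightarrow> complex"
  assumes "finite J" "finite S" "card J < card S"
  shows "\<exists>c. (\<exists>t\<in>S. c t \<noteq> 0) \<and> (\<forall>i\<in>J. (\<Sum>t\<in>S. c t * m t i) = 0)"
  using assms
proof (induction J arbitrary: S m rule: finite_induct)
  case empty
  then obtain t where "t \<in> S" by fastforce
  then show ?case by (intro exI[of _ "\<lambda>_. 1"]) auto
next
  case (insert i J)
  show ?case
  proof (cases "\<forall>t\<in>S. m t i = 0")
    case True
    have "card J < card S" using insert.prems insert.hyps by simp
    then obtain c where "\<exists>t\<in>S. c t \<noteq> 0" "\<forall>i\<in>J. (\<Sum>t\<in>S. c t * m t i) = 0"
      using insert.IH[OF insert.prems(1)] by blast
    then show ?thesis using True by (intro exI[of _ c]) auto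
  next
    case False
    then obtain s where s: "s \<in> S" "m s i \<noteq> 0" by blast
    let ?S = "S - {s}"
    have "card J < card ?S" using insert.prems insert.hyps s by simp
    then obtain c where c: "\<exists>t\<in>?S. c t \<noteq> 0"
      "\<forall>j\<in>J. (\<Sum>t\<in>?S. c t * (m t j - m t i / m s i * m s j)) = 0"
      using insert.IH[of ?S "\<lambda>t j. m t j - m t i / m s i * m s j"] insert.prems by blast
    define d where "d t = (if t = s then - (\<Sum>t\<in>?S. c t * m t i) / m s i else c t)" for t
    have sum: "(\<Sum>t\<in>S. d t * m t j) = (\<Sum>t\<in>?S. c t * (m t j - m t i / m s i * m s j))" for j
    proof -
      have "(\<Sum>t\<in>S. d t * m t j) = d s * m s j + (\<Sum>t\<in>?S. d t * m t j)"
        using insert.prems s by (simp add: sum.remove)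
      also have "(\<Sum>t\<in>?S. d t * m t j) = (\<Sum>t\<in>?S. c t * m t j)"
        by (intro sum.cong) (auto simp: d_def)
      also have "d s * m s j = - (\<Sum>t\<in>?S. c t * (m t i / m s i * m s j))"
        using s by (simp add: d_def sum_distrib_right sum_distrib_left sum_divide_distrib mult_ac sum_negf)
      finally show ?thesis by (simp add: right_diff_distrib sum_subtractf)
    qed
    have "(\<Sum>t\<in>?S. c t * (m t i - m t i / m s i * m s i)) = 0" using s by simp
    then have "\<forall>j\<in>insert i J. (\<Sum>t\<in>S. d t * m t j) = 0" using c(2) sum by auto
    moreover have "\<exists>t\<in>S. d t \<noteq> 0" using c(1) by (auto simp: d_def)
    ultimately show ?thesis by blast
  qed
qed

context etale_groupoid
begin

lemma Urysohn_Cc: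
  assumes "compactin T K" "openin T U" "K \<subseteq> U"
  shows "\<exists>f L. f \<in> Cc G \<and> (\<forall>\<gamma>\<in>K. f \<gamma> = (1::complex)) \<and> compactin T L \<and> L \<subseteq> U \<and> (\<forall>\<gamma>. \<gamma> \<notin> L \<longrightarrow> f \<gamma> = 0)"
proof -
  from Urysohn_compact_support[OF locally_compact hausdorff assms(1,3,2)]
  obtain f :: "'g \<Rightarrow> real" and L where f: "continuous_map T euclidean f \<and> (\<forall>\<gamma>. 0 \<le> f \<gamma> \<and> f \<gamma> \<le> 1) \<and>
    (\<forall>\<gamma>\<in>K. f \<gamma> = 1) \<and> compactin T L \<and> L \<subseteq> U \<and> (\<forall>\<gamma>. \<gamma> \<notin> L \<longrightarrow> f \<gamma> = 0)"
    by (elim exE) (rule that)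
  then have "f \<in> Cc G" by (intro CcI[of f L]) simp_all
  then have "(\<lambda>\<gamma>. complex_of_real (f \<gamma>)) \<in> Cc G" by (rule Cc_of_real)
  then show ?thesis
    using f by (intro exI[of _ "\<lambda>\<gamma>. complex_of_real (f \<gamma>)"] exI[of _ L]) simp
qed

lemma singleton_compact: "\<gamma> \<in> arrows G \<Longrightarrow> compactin T {\<gamma>}"
  by (simp add: topspace_T)

context
  fixes n :: nat and \<pi> :: "('g \<Rightarrow> complex) \<Rightarrow> complex mat"
  assumes \<pi>: "matrix_representation CA n \<pi>"
begin

lemma mrep_carrier: "f \<in> Cc G \<Longrightarrow> \<pi> f \<in> carrier_mat n n"
  and mrep_add: "f \<in> Cc G \<Longrightarrow> g \<in> Cc G \<Longrightarrow> \<pi> (\<lambda>\<gamma>. f \<gamma> + g \<gamma>) = \<pi> f + \<pi> g"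
  and mrep_scale: "f \<in> Cc G \<Longrightarrow> \<pi> (\<lambda>\<gamma>. c * f \<gamma>) = c \<cdot>\<^sub>m \<pi> f"
  and mrep_mult: "f \<in> Cc G \<Longrightarrow> g \<in> Cc G \<Longrightarrow> \<pi> (convolution G f g) = \<pi> f * \<pi> g"
  using \<pi> by (auto simp: matrix_representation_def)

lemma mrep_zero: "\<pi> (\<lambda>\<gamma>. 0) = 0\<^sub>m n n"
proof -
  have "\<pi> (\<lambda>\<gamma>. 0 * 0) = 0 \<cdot>\<^sub>m \<pi> (\<lambda>\<gamma>. 0)" by (rule mrep_scale[OF Cc_zero])
  then have "\<pi> (\<lambda>\<gamma>. 0) = 0 \<cdot>\<^sub>m \<pi> (\<lambda>\<gamma>. 0)" by simp
  also have "\<dots> = 0\<^sub>m n n" by (rule eq_matI) (use carrier_matD[OF mrep_carrier[OF Cc_zero]] in simp_all)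
  finally show ?thesis .
qed

lemma mrep_linear_combination:
  assumes "finite S" "\<And>t. t \<in> S \<Longrightarrow> h t \<in> Cc G" "i < n" "j < n"
  shows "\<pi> (\<lambda>\<gamma>. \<Sum>t\<in>S. c t * h t \<gamma>) $$ (i, j) = (\<Sum>t\<in>S. c t * \<pi> (h t) $$ (i, j))"
  using assms
proof (induction S rule: finite_induct)
  case empty
  then show ?case by (simp add: mrep_zero)
next
  case (insert t S)
  have 1: "(\<lambda>\<gamma>. c t * h t \<gamma>) \<in> Cc G" "(\<lambda>\<gamma>. \<Sum>t\<in>S. c t * h t \<gamma>) \<in> Cc G"
    using insert.prems by (simp_all add: Cc_scale Cc_sum)
  have "\<pi> (\<lambda>\<gamma>. \<Sum>t\<in>insert t S. c t * h t \<gamma>) = \<pi> (\<lambda>\<gamma>. c t * h t \<gamma> + (\<Sum>t\<in>S. c t * h t \<gamma>))"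
    using insert.hyps by simp
  also have "\<dots> = c t \<cdot>\<^sub>m \<pi> (h t) + \<pi> (\<lambda>\<gamma>. \<Sum>t\<in>S. c t * h t \<gamma>)"
    using mrep_add[OF 1] mrep_scale[of "h t"] insert.prems by simp
  finally show ?case
    using insert carrier_matD[OF mrep_carrier[OF 1(2)]] carrier_matD[OF mrep_carrier[of "h t"]] by simp
qed

lemma mrep_sum_zero:
  assumes "finite S" "\<And>t. t \<in> S \<Longrightarrow> h t \<in> Cc G" "\<And>t. t \<in> S \<Longrightarrow> \<pi> (h t) = 0\<^sub>m n n"
  shows "\<pi> (\<lambda>\<gamma>. \<Sum>t\<in>S. h t \<gamma>) = 0\<^sub>m n n"
proof (rule eq_matI)
  note c = carrier_matD[OF mrep_carrier[OF Cc_sum[of S h, OF assms(2)]]]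
  show "dim_row (\<pi> (\<lambda>\<gamma>. \<Sum>t\<in>S. h t \<gamma>)) = dim_row (0\<^sub>m n n)" "dim_col (\<pi> (\<lambda>\<gamma>. \<Sum>t\<in>S. h t \<gamma>)) = dim_col (0\<^sub>m n n)"
    using c by simp_all
  fix i j assume "i < dim_row (0\<^sub>m n n)" "j < dim_col (0\<^sub>m n n)"
  then show "\<pi> (\<lambda>\<gamma>. \<Sum>t\<in>S. h t \<gamma>) $$ (i, j) = 0\<^sub>m n n $$ (i, j)"
    using mrep_linear_combination[where c="\<lambda>_. 1" and i=i and j=j, OF assms(1,2)] assms(3) by simp
qed

text \<open>
  The spectrum of the restriction of \<open>\<pi>\<close> to \<open>C\<^sub>c(X)\<close>: the hull of the kernel.
\<close>

definition spectrum_on_units :: "'g set" where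
  "spectrum_on_units = {x \<in> units G. \<forall>h\<in>Cc G. (\<forall>\<gamma>. \<gamma> \<notin> units G \<longrightarrow> h \<gamma> = 0) \<longrightarrow> \<pi> h = 0\<^sub>m n n \<longrightarrow> h x = 0}"

lemma spectrum_on_unitsD:
  assumes "x \<in> spectrum_on_units" "h \<in> Cc G" "\<forall>\<gamma>. \<gamma> \<notin> units G \<longrightarrow> h \<gamma> = 0" "\<pi> h = 0\<^sub>m n n"
  shows "h x = 0"
proof -
  have "\<forall>h\<in>Cc G. (\<forall>\<gamma>. \<gamma> \<notin> units G \<longrightarrow> h \<gamma> = 0) \<longrightarrow> \<pi> h = 0\<^sub>m n n \<longrightarrow> h x = 0"
    using assms(1) by (simp add: spectrum_on_units_def)
  from this[rule_format, OF assms(2)] show ?thesis using assms(3,4) by simp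
qed

text \<open>
  Functions that separate finitely many points of the spectrum have linearly independent images, so
  there are at most \<open>n\<^sup>2\<close> points.
\<close>

lemma finite_spectrum: "finite spectrum_on_units"
proof (rule ccontr)
  assume "infinite spectrum_on_units"
  then obtain S where S: "finite S" "card S = n * n + 1" "S \<subseteq> spectrum_on_units"
    using infinite_arbitrarily_large by blast
  have Su: "S \<subseteq> units G" using S(3) by (auto simp: spectrum_on_units_def)
  have "\<exists>h. h \<in> Cc G \<and> h t = 1 \<and> (\<forall>\<gamma>. \<gamma> \<notin> units G - (S - {t}) \<longrightarrow> h \<gamma> = (0::complex))" if t: "t \<in> S" for t
  proof -
    have ta: "t \<in> arrows G" using t Su units_subset by auto
    have "closedin T (S - {t})"
      using S(1) Su units_subset by (intro closedin_Hausdorff_finite[OF hausdorff]) (auto simp: topspace_T)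
    then have "openin T (units G - (S - {t}))" by (intro openin_diff open_units)
    moreover have "{t} \<subseteq> units G - (S - {t})" using t Su by auto
    ultimately obtain h L where "h \<in> Cc G" "\<forall>\<gamma>\<in>{t}. h \<gamma> = (1::complex)" "L \<subseteq> units G - (S - {t})" "\<forall>\<gamma>. \<gamma> \<notin> L \<longrightarrow> h \<gamma> = 0"
      using Urysohn_Cc[OF singleton_compact[OF ta]] by blast
    then show ?thesis by (intro exI[of _ h]) auto
  qed
  then have "\<forall>t\<in>S. \<exists>h. h \<in> Cc G \<and> h t = 1 \<and> (\<forall>\<gamma>. \<gamma> \<notin> units G - (S - {t}) \<longrightarrow> h \<gamma> = (0::complex))" by simp
  then obtain h :: "'g \<Rightarrow> 'g \<Rightarrow> complex" where
    "\<forall>t\<in>S. h t \<in> Cc G \<and> h t t = 1 \<and> (\<forall>\<gamma>. \<gamma> \<notin> units G - (S - {t}) \<longrightarrow> h t \<gamma> = 0)"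
    unfolding bchoice_iff by (elim exE) (rule that)
  then have h: "h t \<in> Cc G" "h t t = 1" "\<gamma> \<notin> units G - (S - {t}) \<Longrightarrow> h t \<gamma> = 0" if "t \<in> S" for t \<gamma>
    using that by simp_all
  have "card ({..<n} \<times> {..<n}) < card S" using S by (simp add: card_cartesian_product)
  then obtain c where c: "\<exists>t\<in>S. c t \<noteq> 0" "\<forall>p\<in>{..<n}\<times>{..<n}. (\<Sum>t\<in>S. c t * \<pi> (h t) $$ p) = 0"
    using nontrivial_linear_relation[of "{..<n} \<times> {..<n}" S "\<lambda>t p. \<pi> (h t) $$ p"] S(1) by auto
  let ?g = "\<lambda>\<gamma>. \<Sum>t\<in>S. c t * h t \<gamma>"
  have g: "?g \<in> Cc G" by (intro Cc_sum Cc_scale h(1))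
  have "\<pi> ?g = 0\<^sub>m n n"
  proof (rule eq_matI)
    show "dim_row (\<pi> ?g) = dim_row (0\<^sub>m n n)" "dim_col (\<pi> ?g) = dim_col (0\<^sub>m n n)"
      using carrier_matD[OF mrep_carrier[OF g]] by simp_all
    fix i j assume "i < dim_row (0\<^sub>m n n)" "j < dim_col (0\<^sub>m n n)"
    then show "\<pi> ?g $$ (i, j) = 0\<^sub>m n n $$ (i, j)"
      using mrep_linear_combination[where c=c and i=i and j=j, OF S(1) h(1)] c(2) by simp
  qed
  moreover have "\<forall>\<gamma>. \<gamma> \<notin> units G \<longrightarrow> ?g \<gamma> = 0" using h(3) by (intro allI impI sum.neutral ballI) simp
  ultimately have g0: "?g t = 0" if "t \<in> S" for t
    using that S(3) by (intro spectrum_on_unitsD[where h="?g"] g) auto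
  have "?g t = c t" if t: "t \<in> S" for t
  proof -
    have "?g t = (\<Sum>s\<in>S. if s = t then c t else 0)"
      by (intro sum.cong refl) (use h(2)[OF t] h(3)[of _ t] t in auto)
    then show ?thesis using t S(1) by simp
  qed
  then show False using c(1) g0 by auto
qed

text \<open>
  The spectrum is invariant: a function \<open>\<xi>\<close> with \<open>\<xi>(\<gamma>) = 1\<close> supported in a bisection carries
  \<open>h\<close> in the kernel to \<open>\<xi>\<^sup>* h \<xi>\<close>, again in the kernel, whose value at the source of \<open>\<gamma>\<close> is the value of
  \<open>h\<close> at its range.
\<close>

lemma spectrum_invariant:
  assumes \<gamma>: "\<gamma> \<in> arrows G" and x: "gsrc G \<gamma> \<in> spectrum_on_units"
  shows "grng G \<gamma> \<in> spectrum_on_units"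
  unfolding spectrum_on_units_def
proof (intro CollectI conjI ballI impI)
  show "grng G \<gamma> \<in> units G" by (rule rng_unit[OF \<gamma>])
  fix h assume h: "h \<in> Cc G" and h0: "\<forall>\<gamma>. \<gamma> \<notin> units G \<longrightarrow> h \<gamma> = 0" and ker: "\<pi> h = 0\<^sub>m n n"
  obtain B where B: "bisection B" "\<gamma> \<in> B"
    using exists_bisection[OF openin_topspace, of \<gamma>] \<gamma> topspace_T by blast
  have oB: "openin T B" using B(1) by (simp add: bisection_def)
  obtain \<xi> L where \<xi>: "\<xi> \<in> Cc G" "\<forall>\<gamma>\<in>{\<gamma>}. \<xi> \<gamma> = (1::complex)" "L \<subseteq> B" "\<forall>\<gamma>. \<gamma> \<notin> L \<longrightarrow> \<xi> \<gamma> = 0"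
    using Urysohn_Cc[OF singleton_compact[OF \<gamma>] oB] B(2) by blast
  have \<xi>0: "\<xi> \<delta> = 0" if "\<delta> \<notin> B" for \<delta> using \<xi>(3,4) that by blast
  let ?k = "convolution G h \<xi>" let ?g = "convolution G (involution G \<xi>) ?k"
  have k: "?k \<in> Cc G" by (intro convolution_Cc h \<xi>(1))
  have xs: "involution G \<xi> \<in> Cc G" by (rule involution_Cc[OF \<xi>(1)])
  have g: "?g \<in> Cc G" by (intro convolution_Cc k xs)
  have keq: "?k \<delta> = h (grng G \<delta>) * \<xi> \<delta>" if "\<delta> \<in> arrows G" for \<delta>
    by (rule convolution_units_left[OF _ that]) (use h0 in blast)
  have "\<pi> ?g = \<pi> (involution G \<xi>) * (\<pi> h * \<pi> \<xi>)" by (simp add: mrep_mult xs k h \<xi>(1))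
  also have "\<dots> = 0\<^sub>m n n" using mrep_carrier[OF xs] mrep_carrier[OF \<xi>(1)] ker by simp
  finally have kerg: "\<pi> ?g = 0\<^sub>m n n" .
  have g0: "?g \<eta> = 0" if "\<eta> \<notin> units G" for \<eta>
  proof (cases "\<eta> \<in> arrows G")
    case \<eta>: True
    have "?g \<eta> = (\<Sum>\<delta>\<in>{}. cnj (\<xi> \<delta>) * ?k (gcomp G \<delta> \<eta>))"
    proof (rule star_convolution_eq_sum[OF \<eta>])
      fix \<delta> assume \<delta>: "\<delta> \<in> arrows G" "gsrc G \<delta> = grng G \<eta>"
      note c = comp_arrow[OF \<delta>(1) \<eta> \<delta>(2)]
      show "cnj (\<xi> \<delta>) * ?k (gcomp G \<delta> \<eta>) = 0"
      proof (rule ccontr)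
        assume "\<not> ?thesis"
        then have "\<delta> \<in> B" "gcomp G \<delta> \<eta> \<in> B" using \<xi>0 keq[OF c(1)] by auto
        then have "gcomp G \<delta> \<eta> = \<delta>" using bisectionD(2)[OF B(1), of "gcomp G \<delta> \<eta>" \<delta>] c by simp
        then have "\<eta> = gsrc G \<delta>" using comp_unique_left(1)[OF \<delta>(1) \<eta> \<delta>(1) \<delta>(2)] inv_comp[OF \<delta>(1)] by simp
        then show False using that src_unit[OF \<delta>(1)] by simp
      qed
    qed auto
    then show ?thesis by simp
  qed (simp add: convolution_outside)
  have "?g (gsrc G \<gamma>) = 0" by (rule spectrum_on_unitsD[OF x g _ kerg]) (simp add: g0)
  moreover have "?g (gsrc G \<gamma>) = (\<Sum>\<delta>\<in>{\<gamma>}. cnj (\<xi> \<delta>) * ?k (gcomp G \<delta> (gsrc G \<gamma>)))"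
  proof (rule star_convolution_eq_sum)
    show "gsrc G \<gamma> \<in> arrows G" by (rule src_closed[OF \<gamma>])
    show "{\<gamma>} \<subseteq> {\<delta> \<in> arrows G. gsrc G \<delta> = grng G (gsrc G \<gamma>)}" using \<gamma> by (simp add: rng_src)
    fix \<delta> assume \<delta>: "\<delta> \<in> arrows G" "gsrc G \<delta> = grng G (gsrc G \<gamma>)" "\<delta> \<notin> {\<gamma>}"
    then have "\<delta> \<notin> B" using bisectionD(1)[OF B(1) _ B(2), of \<delta>] rng_src[OF \<gamma>] by auto
    then show "cnj (\<xi> \<delta>) * ?k (gcomp G \<delta> (gsrc G \<gamma>)) = 0" using \<xi>0 by simp
  qed simp
  ultimately show "h (grng G \<gamma>) = 0" using keq[OF \<gamma>] \<xi>(2) comp_src[OF \<gamma>] by simp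
qed

lemma spectrum_periodic:
  assumes x: "x \<in> spectrum_on_units"
  shows "periodic G x"
proof -
  have "orbit G x \<subseteq> spectrum_on_units"
    using spectrum_invariant x by (auto simp: orbit_def)
  then show ?thesis
    using finite_subset[OF _ finite_spectrum] x by (auto simp: periodic_def spectrum_on_units_def)
qed

text \<open>
  The kernel contains every function supported off the spectrum: locally some function of the kernel
  does not vanish, and finitely many of them divide the given function.
\<close>

lemma vanishing_off_spectrum:
  assumes f: "f \<in> Cc G" "compactin T L" "\<And>\<gamma>. \<gamma> \<notin> L \<Longrightarrow> f \<gamma> = 0" "L \<subseteq> units G - spectrum_on_units"
  shows "\<pi> f = 0\<^sub>m n n"
proof -
  have "\<exists>h. h \<in> Cc G \<and> (\<forall>\<gamma>. \<gamma> \<notin> units G \<longrightarrow> h \<gamma> = 0) \<and> \<pi> h = 0\<^sub>m n n \<and> h y = 1" if y: "y \<in> L" for y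
  proof -
    have "y \<in> units G" "y \<notin> spectrum_on_units" using f(4) y by auto
    then have "\<exists>h. h \<in> Cc G \<and> (\<forall>\<gamma>. \<gamma> \<notin> units G \<longrightarrow> h \<gamma> = 0) \<and> \<pi> h = 0\<^sub>m n n \<and> h y \<noteq> 0"
      by (simp add: spectrum_on_units_def Bex_def)
    then obtain h where "h \<in> Cc G \<and> (\<forall>\<gamma>. \<gamma> \<notin> units G \<longrightarrow> h \<gamma> = 0) \<and> \<pi> h = 0\<^sub>m n n \<and> h y \<noteq> 0"
      by (elim exE) (rule that)
    then have h: "h \<in> Cc G" "\<forall>\<gamma>. \<gamma> \<notin> units G \<longrightarrow> h \<gamma> = 0" "\<pi> h = 0\<^sub>m n n" "h y \<noteq> 0" by simp_all
    have "\<pi> (\<lambda>\<gamma>. 1 / h y * h \<gamma>) = 0\<^sub>m n n"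
      unfolding mrep_scale[OF h(1)] h(3) by auto
    then show ?thesis using Cc_scale[OF h(1), of "1 / h y"] h(2,4)
      by (intro exI[of _ "\<lambda>\<gamma>. 1 / h y * h \<gamma>"]) simp
  qed
  then have "\<forall>y\<in>L. \<exists>h. h \<in> Cc G \<and> (\<forall>\<gamma>. \<gamma> \<notin> units G \<longrightarrow> h \<gamma> = 0) \<and> \<pi> h = 0\<^sub>m n n \<and> h y = 1" by simp
  then obtain h where "\<forall>y\<in>L. h y \<in> Cc G \<and> (\<forall>\<gamma>. \<gamma> \<notin> units G \<longrightarrow> h y \<gamma> = 0) \<and> \<pi> (h y) = 0\<^sub>m n n \<and> h y y = 1"
    unfolding bchoice_iff by (elim exE) (rule that)
  then have h: "h y \<in> Cc G" "\<gamma> \<notin> units G \<Longrightarrow> h y \<gamma> = 0" "\<pi> (h y) = 0\<^sub>m n n" "h y y = 1" if "y \<in> L" for y \<gamma>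
    using that by simp_all
  define W where "W y = {\<gamma> \<in> topspace T. h y \<gamma> \<in> - cball 0 (1/2)}" for y
  have W: "openin T (W y)" if "y \<in> L" for y
    unfolding W_def by (rule openin_continuous_map_preimage[OF Cc_continuous[OF h(1)[OF that]]]) auto
  have "y \<in> W y" if "y \<in> L" for y
    using that h(4)[OF that] compactin_subset_topspace[OF f(2)] by (auto simp: W_def)
  then have "(\<forall>U\<in>W ` L. openin T U) \<and> L \<subseteq> \<Union>(W ` L)" using W by blast
  then have "\<exists>\<F>. finite \<F> \<and> \<F> \<subseteq> W ` L \<and> L \<subseteq> \<Union>\<F>" using f(2) unfolding compactin_def by meson
  then obtain F where F: "finite F" "F \<subseteq> L" and cov: "L \<subseteq> \<Union>(W ` F)"
    by (metis finite_subset_image)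
  have hF: "h y \<in> Cc G" "\<gamma> \<notin> units G \<Longrightarrow> h y \<gamma> = 0" "\<pi> (h y) = 0\<^sub>m n n" if "y \<in> F" for y \<gamma>
    using h(1-3)[of y] F(2) that by auto
  define H where "H \<gamma> = (\<Sum>y\<in>F. (cmod (h y \<gamma>))\<^sup>2)" for \<gamma>
  have H: "H \<gamma> \<ge> 1/4" if "\<gamma> \<in> L" for \<gamma>
  proof -
    have "\<exists>y\<in>F. \<gamma> \<in> W y" using cov that by blast
    then obtain y where y: "y \<in> F" "cmod (h y \<gamma>) > 1/2" by (auto simp: W_def)
    have "1/4 \<le> (cmod (h y \<gamma>))\<^sup>2" using y power_mono[of "1/2" "cmod (h y \<gamma>)" 2] by (simp add: power_divide)
    also have "\<dots> \<le> H \<gamma>" unfolding H_def by (rule member_le_sum) (use y F in auto)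
    finally show ?thesis .
  qed
  \<comment> \<open>The maximum is \<open>H\<close> on the support of \<open>f\<close> and keeps the quotient continuous elsewhere.\<close>
  define q where "q y \<gamma> = (cnj (h y \<gamma>) / of_real (max (H \<gamma>) (1/4))) * f \<gamma>" for y \<gamma>
  have q: "q y \<in> Cc G" if "y \<in> F" for y
    unfolding q_def[abs_def]
  proof (rule Cc_mult[OF _ f(1)])
    have c: "continuous_map T euclidean (h y)" if "y \<in> F" for y by (rule Cc_continuous[OF hF(1)[OF that]])
    then show "continuous_map T euclidean (\<lambda>\<gamma>. cnj (h y \<gamma>) / of_real (max (H \<gamma>) (1/4)))"
      unfolding continuous_map_euclidean_iff H_def using that by (auto intro!: tendsto_intros)
  qed
  have qh: "convolution G (q y) (h y) \<in> Cc G" if "y \<in> F" for y by (intro convolution_Cc q hF that)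
  have "f = (\<lambda>\<gamma>. \<Sum>y\<in>F. convolution G (q y) (h y) \<gamma>)"
  proof
    fix \<gamma>
    have q0: "q y \<delta> = 0" if "\<delta> \<notin> units G" for y \<delta> using f(3,4) that by (auto simp: q_def)
    show "f \<gamma> = (\<Sum>y\<in>F. convolution G (q y) (h y) \<gamma>)"
    proof (cases "\<gamma> \<in> L")
      case True
      then have u: "\<gamma> \<in> units G" using f(4) by blast
      note u' = unitD[OF u]
      have "(\<Sum>y\<in>F. convolution G (q y) (h y) \<gamma>) = (\<Sum>y\<in>F. q y \<gamma> * h y \<gamma>)"
        using convolution_units_left[OF q0] u' by (intro sum.cong) auto
      also have "\<dots> = (\<Sum>y\<in>F. of_real ((cmod (h y \<gamma>))\<^sup>2) * (f \<gamma> / of_real (max (H \<gamma>) (1/4))))"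
      proof (rule sum.cong[OF refl])
        fix y
        have "q y \<gamma> * h y \<gamma> = (h y \<gamma> * cnj (h y \<gamma>)) * (f \<gamma> / of_real (max (H \<gamma>) (1/4)))"
          by (simp add: q_def)
        then show "q y \<gamma> * h y \<gamma> = of_real ((cmod (h y \<gamma>))\<^sup>2) * (f \<gamma> / of_real (max (H \<gamma>) (1/4)))"
          by (simp only: complex_norm_square)
      qed
      also have "\<dots> = of_real (H \<gamma>) * (f \<gamma> / of_real (max (H \<gamma>) (1/4)))"
        unfolding H_def of_real_sum sum_distrib_right ..
      also have "\<dots> = f \<gamma>"
      proof -
        have "max (H \<gamma>) (1/4) = H \<gamma>" "H \<gamma> \<noteq> 0" using H[OF True] by auto
        then show ?thesis by simp
      qed
      finally show ?thesis by simp
    next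
      case False
      have "convolution G (q y) (h y) \<gamma> = 0" if y: "y \<in> F" for y
      proof (cases "\<gamma> \<in> arrows G")
        case \<gamma>: True
        have "convolution G (q y) (h y) \<gamma> = q y (grng G \<gamma>) * h y \<gamma>" by (rule convolution_units_left[OF q0 \<gamma>])
        also have "\<dots> = 0"
        proof (cases "\<gamma> \<in> units G")
          case True
          then show ?thesis using unitD[OF True] f(3)[OF False] by (simp add: q_def)
        qed (use hF(2)[OF y] in simp)
        finally show ?thesis .
      qed (simp add: convolution_outside)
      then show ?thesis using f(3)[OF False] by simp
    qed
  qed
  moreover have "\<pi> (\<lambda>\<gamma>. \<Sum>y\<in>F. convolution G (q y) (h y) \<gamma>) = 0\<^sub>m n n"
  proof (rule mrep_sum_zero[OF F(1) qh])
    show "\<pi> (convolution G (q y) (h y)) = 0\<^sub>m n n" if "y \<in> F" for y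
      using mrep_mult[OF q[OF that] hF(1)[OF that]] hF(3)[OF that] mrep_carrier[OF q[OF that]] by simp
  qed
  ultimately show ?thesis by (simp only:)
qed

end

text \<open>
  A function supported off the periodic points is annihilated by all finite-dimensional
  representations, whereas its universal norm is positive.
\<close>

theorem dense_periodic_of_rfd:
  assumes rfd: "residually_finite_dimensional (full_cstar_algebra G)"
  shows "dense_in (unit_space G) {x \<in> units G. periodic G x}"
  unfolding dense_in_def
proof
  let ?P = "{x \<in> units G. periodic G x}"
  show "?P \<subseteq> topspace (unit_space G)" by (auto simp: topspace_unit_space)
  show "unit_space G closure_of ?P = topspace (unit_space G)"
  proof (rule ccontr)
    assume "\<not> ?thesis"
    then obtain x where x: "x \<in> units G" "x \<notin> unit_space G closure_of ?P"
      using closure_of_subset_topspace[of "unit_space G" ?P] topspace_unit_space by blast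
    have "\<not> (\<forall>U. x \<in> U \<and> openin (unit_space G) U \<longrightarrow> (\<exists>y. y \<in> ?P \<and> y \<in> U))"
    proof
      assume "\<forall>U. x \<in> U \<and> openin (unit_space G) U \<longrightarrow> (\<exists>y. y \<in> ?P \<and> y \<in> U)"
      with x(1) have "x \<in> unit_space G closure_of ?P"
        unfolding in_closure_of topspace_unit_space by (rule conjI)
      with x(2) show False by (rule notE)
    qed
    then have "\<exists>U. x \<in> U \<and> openin (unit_space G) U \<and> (\<forall>y. \<not> (y \<in> ?P \<and> y \<in> U))"
      by (simp only: not_all not_imp not_ex conj_assoc)
    then obtain U where "x \<in> U \<and> openin (unit_space G) U \<and> (\<forall>y. \<not> (y \<in> ?P \<and> y \<in> U))"
      by (elim exE) (rule that)
    then have U: "openin (unit_space G) U" "x \<in> U" "\<forall>y. \<not> (y \<in> ?P \<and> y \<in> U)" by simp_all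
    have oU: "openin T U" "U \<subseteq> units G"
      using U(1) openin_open_subtopology[OF open_units] unfolding unit_space_def by auto
    have "{x} \<subseteq> U" "x \<in> arrows G" using U x units_subset by auto
    then obtain f L where f: "f \<in> Cc G" "\<forall>\<gamma>\<in>{x}. f \<gamma> = (1::complex)" "compactin T L" "L \<subseteq> U" "\<forall>\<gamma>. \<gamma> \<notin> L \<longrightarrow> f \<gamma> = 0"
      using Urysohn_Cc[OF singleton_compact oU(1), of x] by blast
    have "0 < CA.unorm f" by (rule universal_norm_pos[OF f(1) x(1)]) (use f(2) in simp)
    then obtain n \<pi> where \<pi>: "matrix_representation CA n \<pi>" "\<pi> f \<noteq> 0\<^sub>m n n"
      using CA.residually_finite_dimensional_completionD[OF rfd[unfolded full_cstar_algebra_def], of f] f(1)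
      by auto
    have "L \<subseteq> units G - spectrum_on_units n \<pi>"
      using f(4) oU(2) U(3) spectrum_periodic[OF \<pi>(1)] by blast
    then show False using vanishing_off_spectrum[OF \<pi>(1) f(1,3)] f(5) \<pi>(2) by blast
  qed
qed

end

section \<open>Finite-dimensional representations on finite index sets\<close>

text \<open>
  The bound \<open>C\<close> for the norms of \<open>a\<close> in all finite-dimensional representations; the matrices act as
  operators on \<open>\<ell>\<^sup>2({..<n})\<close>.
\<close>

definition finite_dim_bound :: "('a, 'm) star_algebra_scheme \<Rightarrow> 'a \<Rightarrow> real \<Rightarrow> bool" where
  "finite_dim_bound A a C \<longleftrightarrow> (\<forall>n \<pi>. \<forall>v\<in>ell2 {..<n}. matrix_representation A n \<pi> \<longrightarrow>
     ell2_norm {..<n} (matrix_operator {..<n} (\<lambda>i j. \<pi> a $$ (i, j)) v) \<le> C * ell2_norm {..<n} v)"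

lemma finite_ell2: "finite I \<Longrightarrow> (\<And>i. i \<notin> I \<Longrightarrow> v i = 0) \<Longrightarrow> v \<in> ell2 I"
  by (simp add: ell2_def)

text \<open>
  In the polarised shape \<open>C/2 (\<parallel>v\<parallel>\<^sup>2 + \<parallel>w\<parallel>\<^sup>2)\<close> the bounds for several pairs of vectors add up, in contrast to
  the product \<open>C \<parallel>v\<parallel> \<parallel>w\<parallel>\<close>.
\<close>

lemma finite_index_form_bound:
  fixes M :: "'a \<Rightarrow> 'j \<Rightarrow> 'j \<Rightarrow> complex" and J :: "'j set"
  assumes J: "finite J"
    and add: "\<And>a b i j. a \<in> acar A \<Longrightarrow> b \<in> acar A \<Longrightarrow> i \<in> J \<Longrightarrow> j \<in> J \<Longrightarrow> M (aadd A a b) i j = M a i j + M b i j"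
    and scale: "\<And>a c i j. a \<in> acar A \<Longrightarrow> i \<in> J \<Longrightarrow> j \<in> J \<Longrightarrow> M (ascale A c a) i j = c * M a i j"
    and mult: "\<And>a b i j. a \<in> acar A \<Longrightarrow> b \<in> acar A \<Longrightarrow> i \<in> J \<Longrightarrow> j \<in> J \<Longrightarrow>
                 M (amult A a b) i j = (\<Sum>k\<in>J. M a i k * M b k j)"
    and star: "\<And>a i j. a \<in> acar A \<Longrightarrow> i \<in> J \<Longrightarrow> j \<in> J \<Longrightarrow> M (astar A a) i j = cnj (M a j i)"
    and star_closed: "\<And>a. a \<in> acar A \<Longrightarrow> astar A a \<in> acar A"
    and a: "a \<in> acar A" and C: "finite_dim_bound A a C" "0 \<le> C"
  shows "cmod (\<Sum>i\<in>J. \<Sum>j\<in>J. cnj (v i) * M a i j * w j) \<le> C / 2 * ((\<Sum>i\<in>J. (cmod (v i))\<^sup>2) + (\<Sum>j\<in>J. (cmod (w j))\<^sup>2))"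
proof -
  define n where "n = card J"
  obtain e where e: "bij_betw e {..<n} J"
    using ex_bij_betw_nat_finite[OF J] unfolding n_def lessThan_atLeast0 by blast
  have eJ: "e i \<in> J" if "i < n" for i using bij_betwE[OF e] that by simp
  define \<pi> where "\<pi> b = mat n n (\<lambda>(i, j). M b (e i) (e j))" for b
  have carr: "\<pi> b \<in> carrier_mat n n" for b by (simp add: \<pi>_def)
  have ent: "\<pi> b $$ (i, j) = M b (e i) (e j)" if "i < n" "j < n" for b i j using that by (simp add: \<pi>_def)
  have dims: "dim_row (\<pi> b) = n" "dim_col (\<pi> b) = n" for b by (simp_all add: \<pi>_def)
  have sumJ: "(\<Sum>k\<in>J. h k) = (\<Sum>k<n. h (e k))" for h :: "'j \<Rightarrow> complex"
    using sum.reindex_bij_betw[OF e, of h] by simp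
  have sumJr: "(\<Sum>k\<in>J. h k) = (\<Sum>k<n. h (e k))" for h :: "'j \<Rightarrow> real"
    using sum.reindex_bij_betw[OF e, of h] by simp
  have \<pi>: "matrix_representation A n \<pi>"
    unfolding matrix_representation_def
  proof (intro conjI ballI allI)
    fix a b c assume ab: "a \<in> acar A" "b \<in> acar A"
    show "\<pi> a \<in> carrier_mat n n" by (rule carr)
    show "\<pi> (aadd A a b) = \<pi> a + \<pi> b"
      by (rule eq_matI) (simp_all add: dims ent add ab eJ)
    show "\<pi> (ascale A c a) = c \<cdot>\<^sub>m \<pi> a"
      by (rule eq_matI) (simp_all add: dims ent scale ab eJ)
    show "\<pi> (amult A a b) = \<pi> a * \<pi> b"
    proof (rule eq_matI)
      fix i j assume "i < dim_row (\<pi> a * \<pi> b)" "j < dim_col (\<pi> a * \<pi> b)"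
      then have ij: "i < n" "j < n" by (simp_all add: dims)
      show "\<pi> (amult A a b) $$ (i, j) = (\<pi> a * \<pi> b) $$ (i, j)"
        unfolding mat_mult_index[OF carr carr ij] by (simp add: ij ent mult ab eJ sumJ)
    qed (simp_all add: dims)
    show "\<pi> (astar A a) = mat_adjoint (\<pi> a)"
    proof (rule eq_matI)
      note d = carrier_matD[OF mat_adjoint_carrier[OF carr[of a]]]
      show "dim_row (\<pi> (astar A a)) = dim_row (mat_adjoint (\<pi> a))" "dim_col (\<pi> (astar A a)) = dim_col (mat_adjoint (\<pi> a))"
        by (simp_all add: dims d)
      fix i j assume "i < dim_row (mat_adjoint (\<pi> a))" "j < dim_col (mat_adjoint (\<pi> a))"
      then have ij: "i < n" "j < n" by (simp_all add: d)
      show "\<pi> (astar A a) $$ (i, j) = mat_adjoint (\<pi> a) $$ (i, j)"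
        unfolding mat_adjoint_index[OF carr ij] by (simp add: ij ent star ab eJ)
    qed
  qed
  define v' where "v' i = (if i < n then v (e i) else 0)" for i
  define w' where "w' i = (if i < n then w (e i) else 0)" for i
  have v': "v' \<in> ell2 {..<n}" and w': "w' \<in> ell2 {..<n}" by (rule finite_ell2, simp, simp add: v'_def w'_def)+
  let ?T = "matrix_operator {..<n} (\<lambda>i j. \<pi> a $$ (i, j))"
  have T: "?T w' \<in> ell2 {..<n}" by (rule finite_ell2) (auto simp: matrix_operator_def)
  have nv: "(ell2_norm {..<n} v')\<^sup>2 = (\<Sum>i\<in>J. (cmod (v i))\<^sup>2)" and nw: "(ell2_norm {..<n} w')\<^sup>2 = (\<Sum>i\<in>J. (cmod (w i))\<^sup>2)"
    unfolding ell2_norm_power2 sumJr by (simp_all add: v'_def w'_def)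
  have "(\<Sum>i\<in>J. \<Sum>j\<in>J. cnj (v i) * M a i j * w j) = ell2_inner {..<n} v' (?T w')"
    unfolding sumJ ell2_inner_def
    by (simp add: matrix_operator_finite ent sum_distrib_left v'_def w'_def mult.assoc)
  also have "cmod \<dots> \<le> ell2_norm {..<n} v' * ell2_norm {..<n} (?T w')"
    by (rule ell2_Cauchy_Schwarz[OF v' T])
  also have "\<dots> \<le> ell2_norm {..<n} v' * (C * ell2_norm {..<n} w')"
    using C(1) \<pi> w' unfolding finite_dim_bound_def by (intro mult_left_mono) simp_all
  also have "\<dots> = C * (ell2_norm {..<n} v' * ell2_norm {..<n} w')" by simp
  also have "\<dots> \<le> C * (((ell2_norm {..<n} v')\<^sup>2 + (ell2_norm {..<n} w')\<^sup>2) / 2)"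
    using C(2) sum_squares_bound[of "ell2_norm {..<n} v'" "ell2_norm {..<n} w'"] by (intro mult_left_mono) simp_all
  finally show ?thesis by (simp add: nv nw)
qed

section \<open>Characters of maximally almost periodic isotropy groups\<close>

context etale_groupoid
begin

definition isotropy_arrows :: "'g \<Rightarrow> 'g set" where
  "isotropy_arrows x = {\<gamma> \<in> arrows G. gsrc G \<gamma> = x \<and> grng G \<gamma> = x}"

text \<open>
  Index sets are sets of natural numbers so that they can be enlarged without changing the type;
  unitarity is expressed through the inverse.
\<close>

definition unitary_rep :: "'g \<Rightarrow> nat set \<Rightarrow> ('g \<Rightarrow> nat \<Rightarrow> nat \<Rightarrow> complex) \<Rightarrow> bool" where
  "unitary_rep x J U \<longleftrightarrow> finite J \<and> J \<noteq> {} \<and>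
     (\<forall>g\<in>isotropy_arrows x. \<forall>h\<in>isotropy_arrows x. \<forall>i\<in>J. \<forall>j\<in>J. U (gcomp G g h) i j = (\<Sum>k\<in>J. U g i k * U h k j)) \<and>
     (\<forall>g\<in>isotropy_arrows x. \<forall>i\<in>J. \<forall>j\<in>J. U (ginv G g) i j = cnj (U g j i)) \<and>
     (\<forall>i\<in>J. \<forall>j\<in>J. U x i j = (if i = j then 1 else 0))"

lemma unitary_repD:
  assumes "unitary_rep x J U"
  shows "finite J" "J \<noteq> {}" "card J > 0"
    "g \<in> isotropy_arrows x \<Longrightarrow> h \<in> isotropy_arrows x \<Longrightarrow> i \<in> J \<Longrightarrow> j \<in> J \<Longrightarrow>
       U (gcomp G g h) i j = (\<Sum>k\<in>J. U g i k * U h k j)"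
    "g \<in> isotropy_arrows x \<Longrightarrow> i \<in> J \<Longrightarrow> j \<in> J \<Longrightarrow> U (ginv G g) i j = cnj (U g j i)"
    "i \<in> J \<Longrightarrow> j \<in> J \<Longrightarrow> U x i j = (if i = j then 1 else 0)"
  using assms by (auto simp: unitary_rep_def card_gt_0_iff)

definition character :: "nat set \<Rightarrow> ('g \<Rightarrow> nat \<Rightarrow> nat \<Rightarrow> complex) \<Rightarrow> 'g \<Rightarrow> complex" where
  "character J U g = (\<Sum>i\<in>J. U g i i) / of_nat (card J)"

lemma isotropy_closed:
  assumes "g \<in> isotropy_arrows x" "h \<in> isotropy_arrows x"
  shows "gcomp G g h \<in> isotropy_arrows x" "ginv G g \<in> isotropy_arrows x"
  using assms comp_arrow[of g h] by (auto simp: isotropy_arrows_def inv_closed src_inv rng_inv)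

lemma unit_isotropy: "x \<in> units G \<Longrightarrow> x \<in> isotropy_arrows x"
  using unitD by (simp add: isotropy_arrows_def)

lemma unitary_row_norm:
  assumes U: "unitary_rep x J U" and g: "g \<in> isotropy_arrows x" and i: "i \<in> J"
  shows "(\<Sum>k\<in>J. (cmod (U g i k))\<^sup>2) = 1"
proof -
  note D = unitary_repD[OF U]
  have gi: "ginv G g \<in> isotropy_arrows x" using isotropy_closed(2)[OF g g] .
  have "gcomp G g (ginv G g) = x" using g comp_inv[of g] by (simp add: isotropy_arrows_def)
  then have "(\<Sum>k\<in>J. U g i k * U (ginv G g) k i) = 1" using D(4)[OF g gi i i] D(6)[OF i i] by simp
  moreover have "(\<Sum>k\<in>J. U g i k * U (ginv G g) k i) = of_real (\<Sum>k\<in>J. (cmod (U g i k))\<^sup>2)"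
    unfolding of_real_sum by (intro sum.cong refl) (simp only: D(5)[OF g _ i] complex_norm_square)
  ultimately show ?thesis by (metis of_real_eq_1_iff)
qed

lemma unitary_entry_le_1:
  assumes U: "unitary_rep x J U" and g: "g \<in> isotropy_arrows x" and i: "i \<in> J" "j \<in> J"
  shows "cmod (U g i j) \<le> 1"
proof -
  have "(cmod (U g i j))\<^sup>2 \<le> (\<Sum>k\<in>J. (cmod (U g i k))\<^sup>2)"
    by (rule member_le_sum) (use i unitary_repD(1)[OF U] in auto)
  then show ?thesis using unitary_row_norm[OF U g i(1)] by (simp add: power_le_one_iff)
qed

lemma character_le_1:
  assumes U: "unitary_rep x J U" and g: "g \<in> isotropy_arrows x"
  shows "cmod (character J U g) \<le> 1"
proof -
  have "cmod (\<Sum>i\<in>J. U g i i) \<le> (\<Sum>i\<in>J. 1)"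
    by (rule sum_norm_le) (use unitary_entry_le_1[OF U g] in auto)
  then show ?thesis using unitary_repD(3)[OF U] by (simp add: character_def norm_divide)
qed

lemma character_unit: "unitary_rep x J U \<Longrightarrow> character J U x = 1"
  using unitary_repD(3,6)[of x J U] by (simp add: character_def)

text \<open>Tensor products multiply the normalised characters.\<close>

lemma unitary_rep_tensor:
  assumes U: "unitary_rep x J U" and V: "unitary_rep x K V"
  shows "\<exists>L W. unitary_rep x L W \<and> (\<forall>g. character L W g = character J U g * character K V g)"
proof -
  note DU = unitary_repD[OF U] and DV = unitary_repD[OF V]
  define L where "L = prod_encode ` (J \<times> K)"
  define W where "W g i j = U g (fst (prod_decode i)) (fst (prod_decode j)) * V g (snd (prod_decode i)) (snd (prod_decode j))" for g i j
  have inj: "inj_on prod_encode (J \<times> K)" by (rule inj_prod_encode)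
  have sumL: "(\<Sum>k\<in>L. h k) = (\<Sum>p\<in>J. \<Sum>q\<in>K. h (prod_encode (p, q)))" for h :: "nat \<Rightarrow> complex"
    unfolding L_def sum.reindex[OF inj] by (simp add: sum.cartesian_product split_beta)
  have LE: "fst (prod_decode i) \<in> J \<and> snd (prod_decode i) \<in> K" if "i \<in> L" for i using that by (auto simp: L_def)
  have "unitary_rep x L W"
    unfolding unitary_rep_def
  proof (intro conjI ballI)
    show "finite L" "L \<noteq> {}" using DU(1,2) DV(1,2) by (auto simp: L_def)
  next
    fix g h i j assume gh: "g \<in> isotropy_arrows x" "h \<in> isotropy_arrows x" and ij: "i \<in> L" "j \<in> L"
    note i = LE[OF ij(1)] and j = LE[OF ij(2)]
    show "W (gcomp G g h) i j = (\<Sum>k\<in>L. W g i k * W h k j)"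
      unfolding sumL using i j
      by (simp add: W_def DU(4)[OF gh] DV(4)[OF gh] sum_product mult_ac)
  next
    fix g i j assume g: "g \<in> isotropy_arrows x" and ij: "i \<in> L" "j \<in> L"
    show "W (ginv G g) i j = cnj (W g j i)"
      using LE[OF ij(1)] LE[OF ij(2)] by (simp add: W_def DU(5)[OF g] DV(5)[OF g])
  next
    fix i j assume ij: "i \<in> L" "j \<in> L"
    have "i = j \<longleftrightarrow> prod_decode i = prod_decode j" by simp
    then show "W x i j = (if i = j then 1 else 0)"
      using LE[OF ij(1)] LE[OF ij(2)] by (auto simp: W_def DU(6) DV(6) prod_eq_iff)
  qed
  moreover have "character L W g = character J U g * character K V g" for g
  proof -
    have "card L = card J * card K" unfolding L_def card_image[OF inj] by (simp add: card_cartesian_product)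
    then show ?thesis unfolding character_def sumL by (simp add: W_def sum_product)
  qed
  ultimately show ?thesis by blast
qed

lemma unitary_rep_plus_trivial:
  assumes U: "unitary_rep x J U"
  shows "\<exists>L W. unitary_rep x L W \<and> (\<forall>g. character L W g = (1 + (\<Sum>i\<in>J. U g i i)) / (1 + of_nat (card J)))"
proof -
  note DU = unitary_repD[OF U]
  define L where "L = insert 0 (Suc ` J)"
  define W where "W g i j = (if i = 0 \<or> j = 0 then (if i = j then 1 else 0) else U g (i - 1) (j - 1))" for g i j
  have sumL: "(\<Sum>k\<in>L. h k) = h 0 + (\<Sum>k\<in>J. h (Suc k))" for h :: "nat \<Rightarrow> complex"
    using DU(1) by (simp add: L_def sum.reindex)
  have "unitary_rep x L W"
    unfolding unitary_rep_def
  proof (intro conjI ballI)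
    show "finite L" "L \<noteq> {}" using DU(1) by (auto simp: L_def)
  next
    fix g h i j assume gh: "g \<in> isotropy_arrows x" "h \<in> isotropy_arrows x" and ij: "i \<in> L" "j \<in> L"
    show "W (gcomp G g h) i j = (\<Sum>k\<in>L. W g i k * W h k j)"
      unfolding sumL using ij by (auto simp: W_def L_def DU(4)[OF gh])
  next
    fix g i j assume g: "g \<in> isotropy_arrows x" and ij: "i \<in> L" "j \<in> L"
    show "W (ginv G g) i j = cnj (W g j i)"
      using ij by (auto simp: W_def L_def DU(5)[OF g])
  next
    fix i j assume ij: "i \<in> L" "j \<in> L"
    show "W x i j = (if i = j then 1 else 0)"
      using ij by (auto simp: W_def L_def DU(6) split: if_splits)
  qed
  moreover have "character L W g = (1 + (\<Sum>i\<in>J. U g i i)) / (1 + of_nat (card J))" for g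
  proof -
    have "card L = 1 + card J" using DU(1) by (simp add: L_def card_image)
    then show ?thesis unfolding character_def sumL by (simp add: W_def)
  qed
  ultimately show ?thesis by blast
qed

text \<open>
  A unitary \<open>U \<noteq> 1\<close> of size \<open>n\<close> has \<open>Re (tr U) < n\<close>, because \<open>2n - 2 Re (tr U)\<close> is the square of the
  Hilbert-Schmidt norm of \<open>U - 1\<close>. Adding a trivial summand turns this into a normalised trace of
  modulus below \<open>1\<close>.
\<close>

lemma unitary_rep_separating:
  assumes U: "unitary_rep x J U" and g: "g \<in> isotropy_arrows x"
    and ne: "i0 \<in> J" "j0 \<in> J" "U g i0 j0 \<noteq> (if i0 = j0 then 1 else 0)"
  shows "\<exists>L W. unitary_rep x L W \<and> cmod (character L W g) < 1"
proof -
  note DU = unitary_repD[OF U]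
  define n where "n = real (card J)"
  define t where "t = (\<Sum>i\<in>J. U g i i)"
  have tn: "cmod t \<le> n"
  proof -
    have "cmod t \<le> (\<Sum>i\<in>J. 1)" unfolding t_def by (rule sum_norm_le) (use unitary_entry_le_1[OF U g] in auto)
    then show ?thesis by (simp add: n_def)
  qed
  have "0 < (\<Sum>i\<in>J. \<Sum>j\<in>J. (cmod (U g i j - (if i = j then 1 else 0)))\<^sup>2)"
  proof (rule sum_pos2[OF DU(1) ne(1)])
    show "0 < (\<Sum>j\<in>J. (cmod (U g i0 j - (if i0 = j then 1 else 0)))\<^sup>2)"
      by (rule sum_pos2[OF DU(1) ne(2)]) (use ne(3) in auto)
  qed (auto intro: sum_nonneg)
  also have "\<dots> = (\<Sum>i\<in>J. (\<Sum>j\<in>J. (cmod (U g i j))\<^sup>2) + 1 - 2 * Re (U g i i))"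
  proof (rule sum.cong[OF refl])
    fix i assume i: "i \<in> J"
    have "(\<Sum>j\<in>J. (cmod (U g i j - (if i = j then 1 else 0)))\<^sup>2)
        = (\<Sum>j\<in>J. (cmod (U g i j))\<^sup>2 + (if i = j then 1 - 2 * Re (U g i i) else 0))"
    proof (intro sum.cong refl)
      have "(cmod (z - 1))\<^sup>2 = (cmod z)\<^sup>2 + (1 - 2 * Re z)" for z
        unfolding cmod_power2 by (simp add: power2_eq_square algebra_simps)
      then show "(cmod (U g i j - (if i = j then 1 else 0)))\<^sup>2
          = (cmod (U g i j))\<^sup>2 + (if i = j then 1 - 2 * Re (U g i i) else 0)" for j by auto
    qed
    also have "\<dots> = (\<Sum>j\<in>J. (cmod (U g i j))\<^sup>2) + 1 - 2 * Re (U g i i)"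
      unfolding sum.distrib using i DU(1) by simp
    finally show "(\<Sum>j\<in>J. (cmod (U g i j - (if i = j then 1 else 0)))\<^sup>2) = (\<Sum>j\<in>J. (cmod (U g i j))\<^sup>2) + 1 - 2 * Re (U g i i)" .
  qed
  also have "\<dots> = 2 * n - 2 * Re t"
    by (simp add: unitary_row_norm[OF U g] sum_subtractf n_def t_def sum_distrib_left)
  finally have Re: "Re t < n" by simp
  have "(cmod (1 + t))\<^sup>2 = 1 + 2 * Re t + (cmod t)\<^sup>2"
    unfolding cmod_power2 by (simp add: power2_eq_square algebra_simps)
  also have "\<dots> < 1 + 2 * n + n\<^sup>2" using Re power_mono[OF tn, of 2] by simp
  also have "\<dots> = (1 + n)\<^sup>2" by (simp add: power2_eq_square algebra_simps)
  finally have "cmod (1 + t) < 1 + n" by (rule power2_less_imp_less) (simp add: n_def)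
  moreover have "cmod (1 + of_nat (card J) :: complex) = 1 + n"
    unfolding n_def by (metis norm_of_nat of_nat_1 of_nat_add)
  ultimately have lt: "cmod ((1 + t) / (1 + of_nat (card J))) < 1"
    by (simp add: norm_divide n_def)
  obtain L W where "unitary_rep x L W" "\<forall>g. character L W g = (1 + (\<Sum>i\<in>J. U g i i)) / (1 + of_nat (card J))"
    using unitary_rep_plus_trivial[OF U] by blast
  then show ?thesis using lt unfolding t_def by (intro exI[of _ L] exI[of _ W]) simp
qed

lemma unitary_rep_of_hom:
  assumes x: "x \<in> units G" and \<rho>: "\<rho> \<in> hom (isotropy G x) (unitary_group n)" and n: "n > 0"
  shows "unitary_rep x {..<n} (\<lambda>g i j. \<rho> g $$ (i, j))"
proof -
  have car: "carrier (isotropy G x) = isotropy_arrows x" by (simp add: isotropy_def isotropy_arrows_def)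
  have \<rho>_car: "\<rho> g \<in> carrier_mat n n" "\<rho> g * mat_adjoint (\<rho> g) = 1\<^sub>m n" "mat_adjoint (\<rho> g) * \<rho> g = 1\<^sub>m n"
    if "g \<in> isotropy_arrows x" for g
    using \<rho> that by (auto simp: hom_def car unitary_group_def Pi_iff)
  have \<rho>_mult: "\<rho> (gcomp G g h) = \<rho> g * \<rho> h" if "g \<in> isotropy_arrows x" "h \<in> isotropy_arrows x" for g h
    using \<rho> that by (simp add: hom_def car unitary_group_def) (simp add: isotropy_def)
  have xi: "x \<in> isotropy_arrows x" by (rule unit_isotropy[OF x])
  have adj: "mat_adjoint (\<rho> g) \<in> carrier_mat n n" if "g \<in> isotropy_arrows x" for g
    by (rule mat_adjoint_carrier[OF \<rho>_car(1)[OF that]])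
  have one: "\<rho> x = 1\<^sub>m n"
  proof -
    have "gcomp G x x = x" using comp_src[of x] unitD[OF x] by simp
    then have "\<rho> x * \<rho> x = \<rho> x" using \<rho>_mult[OF xi xi] by simp
    then have "mat_adjoint (\<rho> x) * (\<rho> x * \<rho> x) = 1\<^sub>m n" using \<rho>_car(3)[OF xi] by simp
    moreover have "mat_adjoint (\<rho> x) * (\<rho> x * \<rho> x) = (mat_adjoint (\<rho> x) * \<rho> x) * \<rho> x"
      using assoc_mult_mat[OF adj[OF xi] \<rho>_car(1)[OF xi] \<rho>_car(1)[OF xi]] by simp
    ultimately show ?thesis using \<rho>_car(3)[OF xi] left_mult_one_mat[OF \<rho>_car(1)[OF xi]] by simp
  qed
  have inv: "\<rho> (ginv G g) = mat_adjoint (\<rho> g)" if g: "g \<in> isotropy_arrows x" for g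
  proof -
    have gi: "ginv G g \<in> isotropy_arrows x" using isotropy_closed(2)[OF g g] .
    have "gcomp G g (ginv G g) = x" using g comp_inv[of g] by (simp add: isotropy_arrows_def)
    then have "\<rho> g * \<rho> (ginv G g) = 1\<^sub>m n" using \<rho>_mult[OF g gi] one by simp
    then have "mat_adjoint (\<rho> g) * (\<rho> g * \<rho> (ginv G g)) = mat_adjoint (\<rho> g)"
      using right_mult_one_mat[OF adj[OF g]] by simp
    moreover have "mat_adjoint (\<rho> g) * (\<rho> g * \<rho> (ginv G g)) = (mat_adjoint (\<rho> g) * \<rho> g) * \<rho> (ginv G g)"
      using assoc_mult_mat[OF adj[OF g] \<rho>_car(1)[OF g] \<rho>_car(1)[OF gi]] by simp
    ultimately show ?thesis using \<rho>_car(3)[OF g] left_mult_one_mat[OF \<rho>_car(1)[OF gi]] by simp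
  qed
  show ?thesis
    unfolding unitary_rep_def
  proof (intro conjI ballI)
    fix g h i j assume gh: "g \<in> isotropy_arrows x" "h \<in> isotropy_arrows x" and ij: "i \<in> {..<n}" "j \<in> {..<n}"
    show "\<rho> (gcomp G g h) $$ (i, j) = (\<Sum>k<n. \<rho> g $$ (i, k) * \<rho> h $$ (k, j))"
      unfolding \<rho>_mult[OF gh] by (rule mat_mult_index) (use \<rho>_car(1) gh ij in auto)
  next
    fix g i j assume g: "g \<in> isotropy_arrows x" and ij: "i \<in> {..<n}" "j \<in> {..<n}"
    show "\<rho> (ginv G g) $$ (i, j) = cnj (\<rho> g $$ (j, i))"
      unfolding inv[OF g] by (rule mat_adjoint_index[OF \<rho>_car(1)[OF g]]) (use ij in auto)
  qed (use n one in auto)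
qed

lemma unitary_rep_trivial:
  "unitary_rep x {0} (\<lambda>g i j. 1)"
  by (simp add: unitary_rep_def)

text \<open>
  A separating representation gives a normalised character of modulus below \<open>1\<close> at \<open>g\<close>, and its tensor
  powers make it as small as desired.
\<close>

lemma small_character_single:
  assumes x: "x \<in> units G" and map: "maximally_almost_periodic (isotropy G x)"
    and g: "g \<in> isotropy_arrows x" "g \<noteq> x" and \<epsilon>: "0 < \<epsilon>"
  shows "\<exists>J U. unitary_rep x J U \<and> cmod (character J U g) \<le> \<epsilon>"
proof -
  have car: "carrier (isotropy G x) = isotropy_arrows x" by (simp add: isotropy_def isotropy_arrows_def)
  have xi: "x \<in> isotropy_arrows x" by (rule unit_isotropy[OF x])
  obtain n \<rho> where \<rho>: "\<rho> \<in> hom (isotropy G x) (unitary_group n)" "\<rho> g \<noteq> \<rho> x"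
    using map g xi unfolding maximally_almost_periodic_def car by meson
  have carr: "\<rho> h \<in> carrier_mat n n" if "h \<in> isotropy_arrows x" for h
    using \<rho>(1) that by (auto simp: hom_def car unitary_group_def)
  have d: "dim_row (\<rho> h) = n" "dim_col (\<rho> h) = n" if "h \<in> isotropy_arrows x" for h
    using carrier_matD[OF carr[OF that]] by simp_all
  have "\<exists>i<n. \<exists>j<n. \<rho> g $$ (i, j) \<noteq> \<rho> x $$ (i, j)"
  proof (rule ccontr)
    assume "\<not> ?thesis"
    then have "\<rho> g = \<rho> x" by (intro eq_matI) (simp_all add: d g xi)
    then show False using \<rho>(2) by simp
  qed
  then obtain i0 j0 where ij: "i0 < n" "j0 < n" "\<rho> g $$ (i0, j0) \<noteq> \<rho> x $$ (i0, j0)" by blast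
  have n: "n > 0" using ij by simp
  let ?U = "\<lambda>g i j. \<rho> g $$ (i, j)"
  have U: "unitary_rep x {..<n} ?U" by (rule unitary_rep_of_hom[OF x \<rho>(1) n])
  have "\<exists>L W. unitary_rep x L W \<and> cmod (character L W g) < 1"
    by (rule unitary_rep_separating[OF U g(1), of i0 j0]) (use ij unitary_repD(6)[OF U, of i0 j0] in auto)
  then obtain L W where W: "unitary_rep x L W" "cmod (character L W g) < 1" by blast
  have pow: "\<exists>J V. unitary_rep x J V \<and> character J V g = character L W g ^ k" for k
  proof (induction k)
    case 0
    then show ?case by (intro exI[of _ "{0}"] exI[of _ "\<lambda>g i j. 1"]) (simp add: unitary_rep_trivial character_def)
  next
    case (Suc k)
    then obtain J V where V: "unitary_rep x J V" "character J V g = character L W g ^ k" by blast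
    obtain J' V' where "unitary_rep x J' V'" "\<forall>g. character J' V' g = character L W g * character J V g"
      using unitary_rep_tensor[OF W(1) V(1)] by blast
    then show ?case using V(2) by (intro exI[of _ J'] exI[of _ V']) simp
  qed
  obtain k where "cmod (character L W g) ^ k < \<epsilon>" using real_arch_pow_inv[OF \<epsilon> W(2)] by blast
  then show ?thesis using pow[of k] by (metis less_imp_le norm_power)
qed

text \<open>
  For a maximally almost periodic isotropy group the point mass at the identity is a pointwise limit of
  normalised characters of finite-dimensional unitary representations.
\<close>

lemma small_characters:
  assumes x: "x \<in> units G" and map: "maximally_almost_periodic (isotropy G x)"
    and E: "finite E" "E \<subseteq> isotropy_arrows x - {x}" and \<epsilon>: "0 < \<epsilon>"
  shows "\<exists>J U. unitary_rep x J U \<and> (\<forall>g\<in>E. cmod (character J U g) \<le> \<epsilon>)"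
  using E
proof (induction E rule: finite_induct)
  case empty
  then show ?case using unitary_rep_trivial by blast
next
  case (insert g E)
  then obtain J U where U: "unitary_rep x J U" "\<forall>g\<in>E. cmod (character J U g) \<le> \<epsilon>" by auto
  obtain K V where V: "unitary_rep x K V" "cmod (character K V g) \<le> \<epsilon>"
    using small_character_single[OF x map _ _ \<epsilon>, of g] insert.prems by auto
  obtain L W where W: "unitary_rep x L W" "\<forall>g. character L W g = character J U g * character K V g"
    using unitary_rep_tensor[OF U(1) V(1)] by blast
  have "cmod (character L W h) \<le> \<epsilon>" if h: "h \<in> insert g E" for h
  proof -
    have hi: "h \<in> isotropy_arrows x" using h insert.prems by auto
    have "cmod (character J U h) \<le> \<epsilon> \<or> cmod (character K V h) \<le> \<epsilon>" using h U(2) V(2) by auto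
    then show ?thesis
      using character_le_1[OF U(1) hi] character_le_1[OF V(1) hi] W(2)
        mult_mono[of "cmod (character J U h)" \<epsilon> "cmod (character K V h)" 1]
        mult_mono[of "cmod (character J U h)" 1 "cmod (character K V h)" \<epsilon>] \<epsilon>
      by (auto simp: norm_mult)
  qed
  then show ?case using W(1) by blast
qed

end

section \<open>Representations induced from the isotropy of a periodic point\<close>

context etale_groupoid
begin

lemma orbit_iff: "y \<in> orbit G x \<longleftrightarrow> (\<exists>\<gamma>\<in>arrows G. gsrc G \<gamma> = x \<and> grng G \<gamma> = y)"
  using rng_unit by (auto simp: orbit_def)

lemma orbit_forward:
  assumes "\<alpha> \<in> arrows G" "gsrc G \<alpha> \<in> orbit G x"
  shows "grng G \<alpha> \<in> orbit G x"
proof -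
  obtain \<gamma> where \<gamma>: "\<gamma> \<in> arrows G" "gsrc G \<gamma> = x" "grng G \<gamma> = gsrc G \<alpha>"
    using assms(2) unfolding orbit_iff by auto
  show ?thesis
    unfolding orbit_iff using comp_arrow[OF assms(1) \<gamma>(1)] \<gamma> by (intro bexI[of _ "gcomp G \<alpha> \<gamma>"]) simp_all
qed

lemma orbit_backward:
  assumes "\<alpha> \<in> arrows G" "grng G \<alpha> \<in> orbit G x"
  shows "gsrc G \<alpha> \<in> orbit G x"
  using orbit_forward[of "ginv G \<alpha>" x] assms by (simp add: inv_closed src_inv rng_inv)

definition hom_set :: "'g \<Rightarrow> 'g \<Rightarrow> 'g set" where
  "hom_set y z = {\<alpha> \<in> arrows G. gsrc G \<alpha> = z \<and> grng G \<alpha> = y}"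

lemma finite_hom_support:
  assumes "f \<in> Cc G"
  shows "finite {\<alpha> \<in> hom_set y z. f \<alpha> \<noteq> 0}"
  by (rule finite_subset[OF _ finite_range_fibre_support[OF assms, of y]]) (auto simp: hom_set_def range_fibre_iff)

text \<open>
  Fix a finite-dimensional unitary representation \<open>U\<close> of the isotropy group of a point \<open>x\<close> with finite
  orbit. Connecting arrows \<open>c y\<close> from \<open>x\<close> to the points \<open>y\<close> of the orbit carry every arrow of the
  restricted groupoid to the isotropy group.
\<close>

context
  fixes x :: 'g and J :: "nat set" and U :: "'g \<Rightarrow> nat \<Rightarrow> nat \<Rightarrow> complex" and c :: "'g \<Rightarrow> 'g"
  assumes U: "unitary_rep x J U" and fin_orbit: "finite (orbit G x)"
    and c: "\<And>y. y \<in> orbit G x \<Longrightarrow> c y \<in> arrows G \<and> gsrc G (c y) = x \<and> grng G (c y) = y"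
begin

definition to_isotropy :: "'g \<Rightarrow> 'g" where
  "to_isotropy \<alpha> = gcomp G (ginv G (c (grng G \<alpha>))) (gcomp G \<alpha> (c (gsrc G \<alpha>)))"

definition translate :: "'g \<Rightarrow> 'g" where
  "translate \<delta> = gcomp G (ginv G (c (grng G \<delta>))) \<delta>"

lemma source_fibre_orbit: "\<delta> \<in> arrows G \<Longrightarrow> gsrc G \<delta> = x \<Longrightarrow> grng G \<delta> \<in> orbit G x"
  unfolding orbit_iff by blast

lemma translate_isotropy:
  assumes "\<delta> \<in> arrows G" "gsrc G \<delta> = x"
  shows "translate \<delta> \<in> isotropy_arrows x"
  using inv_comp_arrow[of "c (grng G \<delta>)" \<delta>] c[OF source_fibre_orbit[OF assms]] assms
  by (simp add: translate_def isotropy_arrows_def)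

lemma to_isotropy_eq_translate:
  assumes "\<alpha> \<in> arrows G" "gsrc G \<alpha> \<in> orbit G x"
  shows "to_isotropy \<alpha> = translate (gcomp G \<alpha> (c (gsrc G \<alpha>)))"
  using comp_arrow(3)[of \<alpha> "c (gsrc G \<alpha>)"] c[OF assms(2)] assms by (simp add: to_isotropy_def translate_def)

lemma to_isotropy_isotropy:
  assumes "\<alpha> \<in> arrows G" "gsrc G \<alpha> \<in> orbit G x"
  shows "to_isotropy \<alpha> \<in> isotropy_arrows x"
  unfolding to_isotropy_eq_translate[OF assms]
  using comp_arrow[of \<alpha> "c (gsrc G \<alpha>)"] c[OF assms(2)] assms by (intro translate_isotropy) simp_all

lemma translate_comp:
  assumes \<alpha>: "\<alpha> \<in> arrows G" and \<delta>: "\<delta> \<in> arrows G" "gsrc G \<delta> = x" "grng G \<delta> = gsrc G \<alpha>"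
  shows "gcomp G (to_isotropy \<alpha>) (translate \<delta>) = translate (gcomp G \<alpha> \<delta>)"
proof -
  note i = inv_closed src_inv rng_inv
  have s: "gsrc G \<alpha> \<in> orbit G x" using source_fibre_orbit[OF \<delta>(1,2)] \<delta>(3) by simp
  have r: "grng G \<alpha> \<in> orbit G x" by (rule orbit_forward[OF \<alpha> s])
  let ?p = "ginv G (c (grng G \<alpha>))" let ?m = "c (gsrc G \<alpha>)"
  have p: "?p \<in> arrows G" "gsrc G ?p = grng G \<alpha>" using c[OF r] by (simp_all add: i)
  have m: "?m \<in> arrows G" "gsrc G ?m = x" "grng G ?m = gsrc G \<alpha>" using c[OF s] by simp_all
  have am: "gcomp G \<alpha> ?m \<in> arrows G" "gsrc G (gcomp G \<alpha> ?m) = x" "grng G (gcomp G \<alpha> ?m) = grng G \<alpha>"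
    using comp_arrow[OF \<alpha> m(1)] m by simp_all
  have t: "translate \<delta> = gcomp G (ginv G ?m) \<delta>" by (simp add: translate_def \<delta>(3))
  have t': "translate \<delta> \<in> arrows G" "grng G (translate \<delta>) = x"
    using translate_isotropy[OF \<delta>(1,2)] by (simp_all add: isotropy_arrows_def)
  have "gcomp G (to_isotropy \<alpha>) (translate \<delta>) = gcomp G ?p (gcomp G (gcomp G \<alpha> ?m) (translate \<delta>))"
    unfolding to_isotropy_def by (rule comp_assoc'[OF p(1) am(1) t'(1)]) (simp_all add: p am t')
  also have "gcomp G (gcomp G \<alpha> ?m) (translate \<delta>) = gcomp G \<alpha> (gcomp G ?m (translate \<delta>))"
    by (rule comp_assoc'[OF \<alpha> m(1) t'(1)]) (simp_all add: m t')
  also have "gcomp G ?m (translate \<delta>) = \<delta>"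
    unfolding t by (rule cancel_left[OF m(1) \<delta>(1)]) (simp add: m \<delta>(3))
  finally show ?thesis
    unfolding translate_def using comp_arrow(3)[OF \<alpha> \<delta>(1)] \<delta>(3) by simp
qed

lemma to_isotropy_mult:
  assumes "\<alpha> \<in> arrows G" "\<beta> \<in> arrows G" "gsrc G \<alpha> = grng G \<beta>" "gsrc G \<beta> \<in> orbit G x"
  shows "to_isotropy (gcomp G \<alpha> \<beta>) = gcomp G (to_isotropy \<alpha>) (to_isotropy \<beta>)"
proof -
  note cb = c[OF assms(4)]
  note ab = comp_arrow[OF assms(1-3)]
  note bc = comp_arrow[of \<beta> "c (gsrc G \<beta>)"]
  have "to_isotropy (gcomp G \<alpha> \<beta>) = translate (gcomp G (gcomp G \<alpha> \<beta>) (c (gsrc G \<beta>)))"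
    using to_isotropy_eq_translate[OF ab(1)] ab assms(4) by simp
  also have "gcomp G (gcomp G \<alpha> \<beta>) (c (gsrc G \<beta>)) = gcomp G \<alpha> (gcomp G \<beta> (c (gsrc G \<beta>)))"
    by (rule comp_assoc') (use assms cb in simp_all)
  also have "translate \<dots> = gcomp G (to_isotropy \<alpha>) (translate (gcomp G \<beta> (c (gsrc G \<beta>))))"
    by (rule translate_comp[symmetric]) (use bc assms cb in simp_all)
  finally show ?thesis by (simp only: to_isotropy_eq_translate[OF assms(2,4)])
qed

lemma to_isotropy_inv:
  assumes "\<alpha> \<in> arrows G" "gsrc G \<alpha> \<in> orbit G x"
  shows "to_isotropy (ginv G \<alpha>) = ginv G (to_isotropy \<alpha>)"
proof -
  note i = inv_closed src_inv rng_inv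
  note s = c[OF assms(2)] and r = c[OF orbit_forward[OF assms]]
  let ?p = "c (grng G \<alpha>)" let ?m = "c (gsrc G \<alpha>)"
  note am = comp_arrow[of \<alpha> ?m]
  have "ginv G (to_isotropy \<alpha>) = gcomp G (ginv G (gcomp G \<alpha> ?m)) (ginv G (ginv G ?p))"
    unfolding to_isotropy_def by (rule inv_of_comp) (use am s r assms in \<open>simp_all add: i\<close>)
  also have "\<dots> = gcomp G (gcomp G (ginv G ?m) (ginv G \<alpha>)) ?p"
    using inv_of_comp[of \<alpha> ?m] s r assms by (simp add: inv_inv)
  also have "\<dots> = gcomp G (ginv G ?m) (gcomp G (ginv G \<alpha>) ?p)"
    by (rule comp_assoc') (use s r assms in \<open>simp_all add: i\<close>)
  finally show ?thesis using assms(1) by (simp add: to_isotropy_def i)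
qed

lemma translate_quotient:
  assumes "\<delta> \<in> arrows G" "gsrc G \<delta> = x" "\<eta> \<in> arrows G" "gsrc G \<eta> = x" "grng G \<delta> = grng G \<eta>"
  shows "gcomp G (ginv G (translate \<delta>)) (translate \<eta>) = gcomp G (ginv G \<delta>) \<eta>"
proof -
  note i = inv_closed src_inv rng_inv
  let ?c = "c (grng G \<eta>)"
  note ce = c[OF source_fibre_orbit[OF assms(3,4)]]
  have t: "translate \<eta> \<in> arrows G" "grng G (translate \<eta>) = x"
    using translate_isotropy[OF assms(3,4)] by (simp_all add: isotropy_arrows_def)
  have "ginv G (translate \<delta>) = gcomp G (ginv G \<delta>) ?c"
    unfolding translate_def using inv_of_comp[of "ginv G ?c" \<delta>] ce assms by (simp add: i inv_inv)
  then have "gcomp G (ginv G (translate \<delta>)) (translate \<eta>) = gcomp G (ginv G \<delta>) (gcomp G ?c (translate \<eta>))"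
    using comp_assoc'[of "ginv G \<delta>" ?c "translate \<eta>"] ce assms t by (simp add: i)
  also have "gcomp G ?c (translate \<eta>) = \<eta>"
    unfolding translate_def using cancel_left[of ?c \<eta>] ce assms by simp
  finally show ?thesis .
qed

text \<open>
  The matrix of \<open>f\<close> in the representation induced from \<open>U\<close>, on the space with basis \<open>orbit G x \<times> J\<close>.
\<close>

definition induced :: "('g \<Rightarrow> complex) \<Rightarrow> 'g \<times> nat \<Rightarrow> 'g \<times> nat \<Rightarrow> complex" where
  "induced f p q = (\<Sum>\<^sub>\<infinity>\<alpha>\<in>hom_set (fst p) (fst q). f \<alpha> * U (to_isotropy \<alpha>) (snd p) (snd q))"

lemma induced_eq_sum:
  assumes "finite F" "F \<subseteq> hom_set y z" "\<And>\<alpha>. \<alpha> \<in> hom_set y z - F \<Longrightarrow> f \<alpha> = 0"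
  shows "induced f (y, i) (z, j) = (\<Sum>\<alpha>\<in>F. f \<alpha> * U (to_isotropy \<alpha>) i j)"
  unfolding induced_def fst_conv snd_conv by (rule infsum_eq_sum_support[OF assms(1,2)]) (simp add: assms(3))

lemma induced_add:
  assumes f: "f \<in> Cc G" and g: "g \<in> Cc G"
  shows "induced (\<lambda>\<gamma>. f \<gamma> + g \<gamma>) (y, i) (z, j) = induced f (y, i) (z, j) + induced g (y, i) (z, j)"
proof -
  let ?F = "{\<alpha> \<in> hom_set y z. f \<alpha> \<noteq> 0} \<union> {\<alpha> \<in> hom_set y z. g \<alpha> \<noteq> 0}"
  have F: "finite ?F" "?F \<subseteq> hom_set y z" using finite_hom_support[OF f] finite_hom_support[OF g] by auto
  have "induced h (y, i) (z, j) = (\<Sum>\<alpha>\<in>?F. h \<alpha> * U (to_isotropy \<alpha>) i j)"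
    if "\<And>\<alpha>. \<alpha> \<in> hom_set y z - ?F \<Longrightarrow> h \<alpha> = 0" for h
    using that by (rule induced_eq_sum[OF F])
  then show ?thesis by (simp add: distrib_right sum.distrib)
qed

lemma induced_scale: "induced (\<lambda>\<gamma>. a * f \<gamma>) p q = a * induced f p q"
  unfolding induced_def by (simp add: mult.assoc infsum_cmult_right')

lemma induced_star:
  assumes f: "f \<in> Cc G" and y: "y \<in> orbit G x" and z: "z \<in> orbit G x" and ij: "i \<in> J" "j \<in> J"
  shows "induced (involution G f) (y, i) (z, j) = cnj (induced f (z, j) (y, i))"
proof -
  note iv = inv_closed src_inv rng_inv
  let ?F = "{\<alpha> \<in> hom_set z y. f \<alpha> \<noteq> 0}"
  have F: "finite ?F" by (rule finite_hom_support[OF f])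
  have Fa: "\<alpha> \<in> arrows G \<and> gsrc G \<alpha> = y \<and> grng G \<alpha> = z" if "\<alpha> \<in> ?F" for \<alpha> using that by (simp add: hom_set_def)
  have "induced (involution G f) (y, i) (z, j)
      = (\<Sum>\<alpha>\<in>ginv G ` ?F. involution G f \<alpha> * U (to_isotropy \<alpha>) i j)"
  proof (rule induced_eq_sum)
    show "ginv G ` ?F \<subseteq> hom_set y z" using Fa by (auto simp: hom_set_def iv)
    fix \<alpha> assume \<alpha>: "\<alpha> \<in> hom_set y z - ginv G ` ?F"
    then have a: "\<alpha> \<in> arrows G" "gsrc G \<alpha> = z" "grng G \<alpha> = y" by (auto simp: hom_set_def)
    have "ginv G \<alpha> \<notin> ?F" using \<alpha> imageI[of "ginv G \<alpha>" ?F "ginv G"] inv_inv[OF a(1)] by auto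
    then show "involution G f \<alpha> = 0" using a by (simp add: hom_set_def iv involution_def)
  qed (use F in simp)
  also have "\<dots> = (\<Sum>\<beta>\<in>?F. involution G f (ginv G \<beta>) * U (to_isotropy (ginv G \<beta>)) i j)"
    by (rule sum.reindex_cong[OF _ refl refl]) (rule inj_on_inverseI[of _ "ginv G"], simp add: Fa inv_inv)
  also have "\<dots> = (\<Sum>\<beta>\<in>?F. cnj (f \<beta> * U (to_isotropy \<beta>) j i))"
  proof (rule sum.cong[OF refl])
    fix \<beta> assume "\<beta> \<in> ?F"
    note b = Fa[OF this]
    have "U (to_isotropy (ginv G \<beta>)) i j = cnj (U (to_isotropy \<beta>) j i)"
      using to_isotropy_inv[of \<beta>] unitary_repD(5)[OF U to_isotropy_isotropy[of \<beta>] ij] b y by simp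
    then show "involution G f (ginv G \<beta>) * U (to_isotropy (ginv G \<beta>)) i j = cnj (f \<beta> * U (to_isotropy \<beta>) j i)"
      using b by (simp add: involution_def iv inv_inv)
  qed
  also have "\<dots> = cnj (induced f (z, j) (y, i))"
    by (subst induced_eq_sum[of ?F z y f j i]) (use F in auto)
  finally show ?thesis .
qed

text \<open>
  The source of the first factor of a product is a point of the orbit; summing over it corresponds to the summation
  over intermediate indices.
\<close>

lemma induced_mult:
  assumes f: "f \<in> Cc G" and g: "g \<in> Cc G" and y: "y \<in> orbit G x" and z: "z \<in> orbit G x" and ij: "i \<in> J" "j \<in> J"
  shows "induced (convolution G f g) (y, i) (z, j) = (\<Sum>q\<in>orbit G x \<times> J. induced f (y, i) q * induced g q (z, j))"
proof -
  note D = unitary_repD[OF U]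
  define A where "A = {\<alpha> \<in> range_fibre G y. f \<alpha> \<noteq> 0}"
  have A: "finite A" unfolding A_def by (rule finite_range_fibre_support[OF f])
  have Aa: "\<alpha> \<in> arrows G" "grng G \<alpha> = y" "gsrc G \<alpha> \<in> orbit G x" if "\<alpha> \<in> A" for \<alpha>
    using that orbit_backward[of \<alpha> x] y by (simp_all add: A_def range_fibre_iff)
  define B where "B w = {\<beta> \<in> hom_set w z. g \<beta> \<noteq> 0}" for w
  have B: "finite (B w)" for w unfolding B_def by (rule finite_hom_support[OF g])
  have Ba: "\<beta> \<in> arrows G" "gsrc G \<beta> = z" "grng G \<beta> = w" if "\<beta> \<in> B w" for \<beta> w
    using that by (simp_all add: B_def hom_set_def)
  define P where "P = (\<Union>\<alpha>\<in>A. gcomp G \<alpha> ` B (gsrc G \<alpha>))"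
  have P: "finite P" using A B by (simp add: P_def)
  have Pa: "\<gamma> \<in> arrows G \<and> gsrc G \<gamma> = z \<and> grng G \<gamma> = y" if "\<gamma> \<in> P" for \<gamma>
  proof -
    obtain \<alpha> \<beta> where "\<alpha> \<in> A" "\<beta> \<in> B (gsrc G \<alpha>)" "\<gamma> = gcomp G \<alpha> \<beta>" using \<open>\<gamma> \<in> P\<close> by (auto simp: P_def)
    then show ?thesis using comp_arrow[of \<alpha> \<beta>] Aa[of \<alpha>] Ba[of \<beta> "gsrc G \<alpha>"] by simp
  qed
  have conv: "convolution G f g \<gamma> = (\<Sum>\<alpha>\<in>A. f \<alpha> * g (gcomp G (ginv G \<alpha>) \<gamma>))" if "\<gamma> \<in> hom_set y z" for \<gamma>
    using convolution_support_sum[of \<gamma> f g] that f by (simp add: A_def hom_set_def)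
  have in_P: "\<gamma> \<in> P" if \<gamma>: "\<gamma> \<in> hom_set y z" and \<alpha>: "\<alpha> \<in> A" and nz: "g (gcomp G (ginv G \<alpha>) \<gamma>) \<noteq> 0" for \<gamma> \<alpha>
  proof -
    have \<gamma>': "\<gamma> \<in> arrows G" "gsrc G \<gamma> = z" "grng G \<gamma> = y" using \<gamma> by (simp_all add: hom_set_def)
    have "gcomp G (ginv G \<alpha>) \<gamma> \<in> B (gsrc G \<alpha>)"
      using inv_comp_arrow[of \<alpha> \<gamma>] Aa[OF \<alpha>] \<gamma>' nz by (simp add: B_def hom_set_def)
    moreover have "\<gamma> = gcomp G \<alpha> (gcomp G (ginv G \<alpha>) \<gamma>)" using cancel_left[of \<alpha> \<gamma>] Aa[OF \<alpha>] \<gamma>' by simp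
    ultimately show ?thesis unfolding P_def using \<alpha> by (intro UN_I[of \<alpha>] image_eqI)
  qed
  have inner: "(\<Sum>\<gamma>\<in>P. g (gcomp G (ginv G \<alpha>) \<gamma>) * U (to_isotropy \<gamma>) i j)
      = (\<Sum>k\<in>J. U (to_isotropy \<alpha>) i k * induced g (gsrc G \<alpha>, k) (z, j))" if \<alpha>: "\<alpha> \<in> A" for \<alpha>
  proof -
    note a = Aa[OF \<alpha>]
    have sub: "gcomp G \<alpha> ` B (gsrc G \<alpha>) \<subseteq> P" using \<alpha> by (auto simp: P_def)
    have canc: "gcomp G (ginv G \<alpha>) (gcomp G \<alpha> \<beta>) = \<beta>" if "\<beta> \<in> B (gsrc G \<alpha>)" for \<beta>
      using cancel_left'[of \<alpha> \<beta>] Ba[OF that] a by simp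
    have "(\<Sum>\<gamma>\<in>P. g (gcomp G (ginv G \<alpha>) \<gamma>) * U (to_isotropy \<gamma>) i j)
        = (\<Sum>\<gamma>\<in>gcomp G \<alpha> ` B (gsrc G \<alpha>). g (gcomp G (ginv G \<alpha>) \<gamma>) * U (to_isotropy \<gamma>) i j)"
    proof (rule sum.mono_neutral_right[OF P sub], rule ballI)
      fix \<gamma> assume \<gamma>: "\<gamma> \<in> P - gcomp G \<alpha> ` B (gsrc G \<alpha>)"
      have \<gamma>': "\<gamma> \<in> arrows G" "gsrc G \<gamma> = z" "grng G \<gamma> = y" using Pa[of \<gamma>] \<gamma> by simp_all
      have "gcomp G (ginv G \<alpha>) \<gamma> \<notin> B (gsrc G \<alpha>)"
        using \<gamma> imageI[of "gcomp G (ginv G \<alpha>) \<gamma>" "B (gsrc G \<alpha>)" "gcomp G \<alpha>"] cancel_left[of \<alpha> \<gamma>] a \<gamma>' by auto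
      then have "g (gcomp G (ginv G \<alpha>) \<gamma>) = 0"
        using inv_comp_arrow[of \<alpha> \<gamma>] a \<gamma>' by (simp add: B_def hom_set_def)
      then show "g (gcomp G (ginv G \<alpha>) \<gamma>) * U (to_isotropy \<gamma>) i j = 0" by simp
    qed
    also have "\<dots> = (\<Sum>\<beta>\<in>B (gsrc G \<alpha>). g \<beta> * U (to_isotropy (gcomp G \<alpha> \<beta>)) i j)"
      by (rule sum.reindex_cong[OF _ refl]) (use canc in \<open>auto intro: inj_on_inverseI[of _ "gcomp G (ginv G \<alpha>)"]\<close>)
    also have "\<dots> = (\<Sum>\<beta>\<in>B (gsrc G \<alpha>). \<Sum>k\<in>J. U (to_isotropy \<alpha>) i k * (g \<beta> * U (to_isotropy \<beta>) k j))"
    proof (rule sum.cong[OF refl])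
      fix \<beta> assume \<beta>: "\<beta> \<in> B (gsrc G \<alpha>)"
      note b = Ba[OF \<beta>]
      have "to_isotropy (gcomp G \<alpha> \<beta>) = gcomp G (to_isotropy \<alpha>) (to_isotropy \<beta>)"
        by (rule to_isotropy_mult) (use a b z in simp_all)
      moreover have "to_isotropy \<alpha> \<in> isotropy_arrows x" "to_isotropy \<beta> \<in> isotropy_arrows x"
        using to_isotropy_isotropy[of \<alpha>] to_isotropy_isotropy[of \<beta>] a b z by simp_all
      ultimately have "U (to_isotropy (gcomp G \<alpha> \<beta>)) i j = (\<Sum>k\<in>J. U (to_isotropy \<alpha>) i k * U (to_isotropy \<beta>) k j)"
        using D(4) ij by simp
      then show "g \<beta> * U (to_isotropy (gcomp G \<alpha> \<beta>)) i j = (\<Sum>k\<in>J. U (to_isotropy \<alpha>) i k * (g \<beta> * U (to_isotropy \<beta>) k j))"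
        by (simp add: sum_distrib_left mult.left_commute)
    qed
    also have "\<dots> = (\<Sum>k\<in>J. \<Sum>\<beta>\<in>B (gsrc G \<alpha>). U (to_isotropy \<alpha>) i k * (g \<beta> * U (to_isotropy \<beta>) k j))"
      by (rule sum.swap)
    also have "\<dots> = (\<Sum>k\<in>J. U (to_isotropy \<alpha>) i k * induced g (gsrc G \<alpha>, k) (z, j))"
    proof (rule sum.cong[OF refl])
      fix k
      have "induced g (gsrc G \<alpha>, k) (z, j) = (\<Sum>\<beta>\<in>B (gsrc G \<alpha>). g \<beta> * U (to_isotropy \<beta>) k j)"
        by (rule induced_eq_sum[OF B]) (auto simp: B_def)
      then show "(\<Sum>\<beta>\<in>B (gsrc G \<alpha>). U (to_isotropy \<alpha>) i k * (g \<beta> * U (to_isotropy \<beta>) k j))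
          = U (to_isotropy \<alpha>) i k * induced g (gsrc G \<alpha>, k) (z, j)"
        by (simp add: sum_distrib_left)
    qed
    finally show ?thesis .
  qed
  have "induced (convolution G f g) (y, i) (z, j) = (\<Sum>\<gamma>\<in>P. convolution G f g \<gamma> * U (to_isotropy \<gamma>) i j)"
  proof (rule induced_eq_sum[OF P])
    show Ps: "P \<subseteq> hom_set y z" using Pa by (auto simp: hom_set_def)
    fix \<gamma> assume \<gamma>: "\<gamma> \<in> hom_set y z - P"
    then have "g (gcomp G (ginv G \<alpha>) \<gamma>) = 0" if "\<alpha> \<in> A" for \<alpha> using in_P[of \<gamma> \<alpha>] that by auto
    then show "convolution G f g \<gamma> = 0" using conv[of \<gamma>] \<gamma> by simp
  qed
  also have "\<dots> = (\<Sum>\<gamma>\<in>P. \<Sum>\<alpha>\<in>A. f \<alpha> * (g (gcomp G (ginv G \<alpha>) \<gamma>) * U (to_isotropy \<gamma>) i j))"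
  proof (rule sum.cong[OF refl])
    fix \<gamma> assume "\<gamma> \<in> P"
    then have "\<gamma> \<in> hom_set y z" using Pa by (simp add: hom_set_def)
    then show "convolution G f g \<gamma> * U (to_isotropy \<gamma>) i j = (\<Sum>\<alpha>\<in>A. f \<alpha> * (g (gcomp G (ginv G \<alpha>) \<gamma>) * U (to_isotropy \<gamma>) i j))"
      by (simp add: conv sum_distrib_right mult.assoc)
  qed
  also have "\<dots> = (\<Sum>\<alpha>\<in>A. f \<alpha> * (\<Sum>\<gamma>\<in>P. g (gcomp G (ginv G \<alpha>) \<gamma>) * U (to_isotropy \<gamma>) i j))"
    unfolding sum_distrib_left by (rule sum.swap)
  also have "\<dots> = (\<Sum>\<alpha>\<in>A. \<Sum>k\<in>J. f \<alpha> * U (to_isotropy \<alpha>) i k * induced g (gsrc G \<alpha>, k) (z, j))"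
    by (intro sum.cong refl) (simp add: inner sum_distrib_left mult.assoc)
  also have "\<dots> = (\<Sum>w\<in>orbit G x. \<Sum>\<alpha>\<in>{\<alpha>\<in>A. gsrc G \<alpha> = w}. \<Sum>k\<in>J. f \<alpha> * U (to_isotropy \<alpha>) i k * induced g (gsrc G \<alpha>, k) (z, j))"
    by (rule sum.group[symmetric, OF A fin_orbit]) (use Aa(3) in auto)
  also have "\<dots> = (\<Sum>w\<in>orbit G x. \<Sum>k\<in>J. induced f (y, i) (w, k) * induced g (w, k) (z, j))"
  proof (rule sum.cong[OF refl])
    fix w
    have "induced f (y, i) (w, k) = (\<Sum>\<alpha>\<in>{\<alpha>\<in>A. gsrc G \<alpha> = w}. f \<alpha> * U (to_isotropy \<alpha>) i k)" for k
    proof (rule induced_eq_sum)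
      show "finite {\<alpha>\<in>A. gsrc G \<alpha> = w}" using A by simp
    qed (auto simp: A_def hom_set_def range_fibre_iff)
    then show "(\<Sum>\<alpha>\<in>{\<alpha>\<in>A. gsrc G \<alpha> = w}. \<Sum>k\<in>J. f \<alpha> * U (to_isotropy \<alpha>) i k * induced g (gsrc G \<alpha>, k) (z, j))
        = (\<Sum>k\<in>J. induced f (y, i) (w, k) * induced g (w, k) (z, j))"
      by (subst sum.swap) (auto simp: sum_distrib_right intro!: sum.cong)
  qed
  also have "\<dots> = (\<Sum>q\<in>orbit G x \<times> J. induced f (y, i) q * induced g q (z, j))"
    by (simp add: sum.cartesian_product split_beta)
  finally show ?thesis .
qed

lemma induced_form_bound:
  assumes f: "f \<in> Cc G" and C: "finite_dim_bound CA f C" "0 \<le> C"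
  shows "cmod (\<Sum>p\<in>orbit G x \<times> J. \<Sum>q\<in>orbit G x \<times> J. cnj (v p) * induced f p q * w q)
    \<le> C / 2 * ((\<Sum>p\<in>orbit G x \<times> J. (cmod (v p))\<^sup>2) + (\<Sum>q\<in>orbit G x \<times> J. (cmod (w q))\<^sup>2))"
proof (rule finite_index_form_bound[where A=CA and M=induced])
  show "finite (orbit G x \<times> J)" using fin_orbit unitary_repD(1)[OF U] by simp
  show "f \<in> acar CA" using f by simp
qed (auto simp: induced_add induced_scale induced_mult induced_star involution_Cc C)

lemma unitary_column_inner:
  assumes "\<delta> \<in> arrows G" "gsrc G \<delta> = x" "\<eta> \<in> arrows G" "gsrc G \<eta> = x" "grng G \<delta> = grng G \<eta>" and k: "k \<in> J"
  shows "(\<Sum>i\<in>J. cnj (U (translate \<delta>) i k) * U (translate \<eta>) i k) = U (gcomp G (ginv G \<delta>) \<eta>) k k"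
proof -
  note D = unitary_repD[OF U]
  have t: "translate \<delta> \<in> isotropy_arrows x" "translate \<eta> \<in> isotropy_arrows x"
    using translate_isotropy assms by auto
  have ti: "ginv G (translate \<delta>) \<in> isotropy_arrows x" by (rule isotropy_closed(2)[OF t(1) t(1)])
  have "U (gcomp G (ginv G \<delta>) \<eta>) k k = U (gcomp G (ginv G (translate \<delta>)) (translate \<eta>)) k k"
    by (simp only: translate_quotient[OF assms(1-5)])
  also have "\<dots> = (\<Sum>i\<in>J. cnj (U (translate \<delta>) i k) * U (translate \<eta>) i k)"
    unfolding D(4)[OF ti t(2) k k] by (intro sum.cong refl) (simp add: D(5)[OF t(1)] k)
  finally show ?thesis ..
qed

lemma fibre_sum:
  fixes g :: "'g \<Rightarrow> nat \<Rightarrow> complex"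
  assumes "finite F" "\<And>\<delta>. \<delta> \<in> F \<Longrightarrow> grng G \<delta> \<in> orbit G x"
  shows "(\<Sum>p\<in>orbit G x \<times> J. (\<Sum>\<delta>\<in>F. if grng G \<delta> = fst p then g \<delta> (snd p) else 0) * H p)
    = (\<Sum>\<delta>\<in>F. \<Sum>i\<in>J. g \<delta> i * H (grng G \<delta>, i))"
proof -
  have "(\<Sum>p\<in>orbit G x \<times> J. (\<Sum>\<delta>\<in>F. if grng G \<delta> = fst p then g \<delta> (snd p) else 0) * H p)
      = (\<Sum>\<delta>\<in>F. \<Sum>p\<in>orbit G x \<times> J. (if grng G \<delta> = fst p then g \<delta> (snd p) else 0) * H p)"
    unfolding sum_distrib_right by (rule sum.swap)
  also have "\<dots> = (\<Sum>\<delta>\<in>F. \<Sum>i\<in>J. g \<delta> i * H (grng G \<delta>, i))"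
  proof (rule sum.cong[OF refl])
    fix \<delta> assume \<delta>: "\<delta> \<in> F"
    have "(\<Sum>p\<in>orbit G x \<times> J. (if grng G \<delta> = fst p then g \<delta> (snd p) else 0) * H p)
        = (\<Sum>y\<in>orbit G x. \<Sum>i\<in>J. (if grng G \<delta> = y then g \<delta> i else 0) * H (y, i))"
      by (simp add: sum.cartesian_product split_beta)
    also have "\<dots> = (\<Sum>y\<in>orbit G x. if grng G \<delta> = y then \<Sum>i\<in>J. g \<delta> i * H (y, i) else 0)"
      by (intro sum.cong refl) auto
    also have "\<dots> = (\<Sum>i\<in>J. g \<delta> i * H (grng G \<delta>, i))"
      using assms(2)[OF \<delta>] fin_orbit by simp
    finally show "(\<Sum>p\<in>orbit G x \<times> J. (if grng G \<delta> = fst p then g \<delta> (snd p) else 0) * H p) = (\<Sum>i\<in>J. g \<delta> i * H (grng G \<delta>, i))" .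
  qed
  finally show ?thesis .
qed

text \<open>
  The vectors \<open>\<delta> \<otimes> U(\<delta>)\<close>, one for each \<open>\<delta>\<close> of the source fibre, are given by their columns. Summing over
  the columns turns matrix coefficients of the induced representation into traces.
\<close>

definition fibre_vector :: "'g set \<Rightarrow> ('g \<Rightarrow> complex) \<Rightarrow> nat \<Rightarrow> 'g \<times> nat \<Rightarrow> complex" where
  "fibre_vector F a k p = (\<Sum>\<delta>\<in>F. if grng G \<delta> = fst p then a \<delta> * U (translate \<delta>) (snd p) k else 0)"

lemma cnj_fibre_vector:
  "cnj (fibre_vector F a k p) = (\<Sum>\<delta>\<in>F. if grng G \<delta> = fst p then cnj (a \<delta> * U (translate \<delta>) (snd p) k) else 0)"
  unfolding fibre_vector_def cnj_sum by (intro sum.cong refl) auto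

lemma fibre_vector_norm:
  assumes F: "finite F" "F \<subseteq> {\<delta> \<in> arrows G. gsrc G \<delta> = x}"
  shows "(\<Sum>k\<in>J. complex_of_real (\<Sum>p\<in>orbit G x \<times> J. (cmod (fibre_vector F a k p))\<^sup>2))
    = of_nat (card J) * (\<Sum>\<delta>\<in>F. \<Sum>\<eta>\<in>F. if grng G \<delta> = grng G \<eta>
        then cnj (a \<delta>) * a \<eta> * character J U (gcomp G (ginv G \<delta>) \<eta>) else 0)"
proof -
  have Fa: "\<delta> \<in> arrows G" "gsrc G \<delta> = x" "grng G \<delta> \<in> orbit G x" if "\<delta> \<in> F" for \<delta>
    using F(2) that source_fibre_orbit[of \<delta>] by auto
  have N: "of_nat (card J) \<noteq> (0::complex)" using unitary_repD(3)[OF U] by simp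
  have "complex_of_real (\<Sum>p\<in>orbit G x \<times> J. (cmod (fibre_vector F a k p))\<^sup>2)
      = (\<Sum>\<delta>\<in>F. \<Sum>\<eta>\<in>F. if grng G \<delta> = grng G \<eta> then cnj (a \<delta>) * a \<eta> * U (gcomp G (ginv G \<delta>) \<eta>) k k else 0)"
    if k: "k \<in> J" for k
  proof -
    have "complex_of_real (\<Sum>p\<in>orbit G x \<times> J. (cmod (fibre_vector F a k p))\<^sup>2)
        = (\<Sum>p\<in>orbit G x \<times> J. cnj (fibre_vector F a k p) * fibre_vector F a k p)"
      unfolding of_real_sum by (intro sum.cong refl) (simp only: complex_norm_square mult.commute)
    also have "\<dots> = (\<Sum>\<delta>\<in>F. \<Sum>i\<in>J. cnj (a \<delta> * U (translate \<delta>) i k) * fibre_vector F a k (grng G \<delta>, i))"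
      unfolding cnj_fibre_vector by (rule fibre_sum[OF F(1) Fa(3)])
    also have "\<dots> = (\<Sum>\<delta>\<in>F. \<Sum>\<eta>\<in>F. if grng G \<delta> = grng G \<eta> then cnj (a \<delta>) * a \<eta> * U (gcomp G (ginv G \<delta>) \<eta>) k k else 0)"
    proof (rule sum.cong[OF refl])
      fix \<delta> assume \<delta>: "\<delta> \<in> F"
      have "(\<Sum>i\<in>J. cnj (a \<delta> * U (translate \<delta>) i k) * fibre_vector F a k (grng G \<delta>, i))
          = (\<Sum>i\<in>J. \<Sum>\<eta>\<in>F. if grng G \<delta> = grng G \<eta> then cnj (a \<delta>) * a \<eta> * (cnj (U (translate \<delta>) i k) * U (translate \<eta>) i k) else 0)"
        unfolding fibre_vector_def fst_conv snd_conv sum_distrib_left by (intro sum.cong refl) auto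
      also have "\<dots> = (\<Sum>\<eta>\<in>F. \<Sum>i\<in>J. if grng G \<delta> = grng G \<eta> then cnj (a \<delta>) * a \<eta> * (cnj (U (translate \<delta>) i k) * U (translate \<eta>) i k) else 0)"
        by (rule sum.swap)
      also have "\<dots> = (\<Sum>\<eta>\<in>F. if grng G \<delta> = grng G \<eta> then cnj (a \<delta>) * a \<eta> * U (gcomp G (ginv G \<delta>) \<eta>) k k else 0)"
      proof (rule sum.cong[OF refl])
        fix \<eta> assume \<eta>: "\<eta> \<in> F"
        show "(\<Sum>i\<in>J. if grng G \<delta> = grng G \<eta> then cnj (a \<delta>) * a \<eta> * (cnj (U (translate \<delta>) i k) * U (translate \<eta>) i k) else 0)
            = (if grng G \<delta> = grng G \<eta> then cnj (a \<delta>) * a \<eta> * U (gcomp G (ginv G \<delta>) \<eta>) k k else 0)"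
          using unitary_column_inner[OF Fa(1,2)[OF \<delta>] Fa(1,2)[OF \<eta>] _ k] by (simp flip: sum_distrib_left)
      qed
      finally show "(\<Sum>i\<in>J. cnj (a \<delta> * U (translate \<delta>) i k) * fibre_vector F a k (grng G \<delta>, i))
          = (\<Sum>\<eta>\<in>F. if grng G \<delta> = grng G \<eta> then cnj (a \<delta>) * a \<eta> * U (gcomp G (ginv G \<delta>) \<eta>) k k else 0)" .
    qed
    finally show ?thesis .
  qed
  then have "(\<Sum>k\<in>J. complex_of_real (\<Sum>p\<in>orbit G x \<times> J. (cmod (fibre_vector F a k p))\<^sup>2))
      = (\<Sum>k\<in>J. \<Sum>\<delta>\<in>F. \<Sum>\<eta>\<in>F. if grng G \<delta> = grng G \<eta> then cnj (a \<delta>) * a \<eta> * U (gcomp G (ginv G \<delta>) \<eta>) k k else 0)"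
    by (intro sum.cong refl)
  also have "\<dots> = (\<Sum>\<delta>\<in>F. \<Sum>\<eta>\<in>F. \<Sum>k\<in>J. if grng G \<delta> = grng G \<eta> then cnj (a \<delta>) * a \<eta> * U (gcomp G (ginv G \<delta>) \<eta>) k k else 0)"
    by (subst sum.swap, intro sum.cong refl, rule sum.swap)
  also have "\<dots> = (\<Sum>\<delta>\<in>F. \<Sum>\<eta>\<in>F. of_nat (card J) * (if grng G \<delta> = grng G \<eta>
        then cnj (a \<delta>) * a \<eta> * character J U (gcomp G (ginv G \<delta>) \<eta>) else 0))"
  proof (intro sum.cong refl)
    fix \<delta> \<eta>
    have "(\<Sum>k\<in>J. cnj (a \<delta>) * a \<eta> * U (gcomp G (ginv G \<delta>) \<eta>) k k)
        = cnj (a \<delta>) * a \<eta> * (of_nat (card J) * character J U (gcomp G (ginv G \<delta>) \<eta>))"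
      using N by (simp add: character_def flip: sum_distrib_left)
    then show "(\<Sum>k\<in>J. if grng G \<delta> = grng G \<eta> then cnj (a \<delta>) * a \<eta> * U (gcomp G (ginv G \<delta>) \<eta>) k k else 0)
        = of_nat (card J) * (if grng G \<delta> = grng G \<eta> then cnj (a \<delta>) * a \<eta> * character J U (gcomp G (ginv G \<delta>) \<eta>) else 0)"
      by (simp add: mult.left_commute)
  qed
  finally show ?thesis by (simp only: sum_distrib_left)
qed

lemma fibre_vector_form:
  assumes F: "finite F" "F \<subseteq> {\<delta> \<in> arrows G. gsrc G \<delta> = x}" and f: "f \<in> Cc G"
  shows "(\<Sum>k\<in>J. \<Sum>p\<in>orbit G x \<times> J. \<Sum>q\<in>orbit G x \<times> J. cnj (fibre_vector F a k p) * induced f p q * fibre_vector F b k q)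
    = of_nat (card J) * (\<Sum>\<delta>\<in>F. \<Sum>\<eta>\<in>F. cnj (a \<delta>) * b \<eta> *
        (\<Sum>\<alpha>\<in>{\<alpha> \<in> hom_set (grng G \<delta>) (grng G \<eta>). f \<alpha> \<noteq> 0}. f \<alpha> * character J U (gcomp G (ginv G \<delta>) (gcomp G \<alpha> \<eta>))))"
proof -
  note D = unitary_repD[OF U]
  have Fa: "\<delta> \<in> arrows G" "gsrc G \<delta> = x" "grng G \<delta> \<in> orbit G x" if "\<delta> \<in> F" for \<delta>
    using F(2) that source_fibre_orbit[of \<delta>] by auto
  have N: "of_nat (card J) \<noteq> (0::complex)" using D(3) by simp
  define S where "S \<delta> \<eta> = {\<alpha> \<in> hom_set (grng G \<delta>) (grng G \<eta>). f \<alpha> \<noteq> 0}" for \<delta> \<eta>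
  have S: "finite (S \<delta> \<eta>)" for \<delta> \<eta> unfolding S_def by (rule finite_hom_support[OF f])
  have col: "(\<Sum>j\<in>J. U (translate \<eta>) j k * induced f (grng G \<delta>, i) (grng G \<eta>, j))
      = (\<Sum>\<alpha>\<in>S \<delta> \<eta>. f \<alpha> * U (translate (gcomp G \<alpha> \<eta>)) i k)" if \<eta>: "\<eta> \<in> F" and ik: "i \<in> J" "k \<in> J" for \<delta> \<eta> i k
  proof -
    have "(\<Sum>j\<in>J. U (translate \<eta>) j k * induced f (grng G \<delta>, i) (grng G \<eta>, j))
        = (\<Sum>j\<in>J. \<Sum>\<alpha>\<in>S \<delta> \<eta>. f \<alpha> * (U (to_isotropy \<alpha>) i j * U (translate \<eta>) j k))"
    proof (rule sum.cong[OF refl])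
      fix j
      have "induced f (grng G \<delta>, i) (grng G \<eta>, j) = (\<Sum>\<alpha>\<in>S \<delta> \<eta>. f \<alpha> * U (to_isotropy \<alpha>) i j)"
        by (rule induced_eq_sum[OF S]) (auto simp: S_def)
      then show "U (translate \<eta>) j k * induced f (grng G \<delta>, i) (grng G \<eta>, j)
          = (\<Sum>\<alpha>\<in>S \<delta> \<eta>. f \<alpha> * (U (to_isotropy \<alpha>) i j * U (translate \<eta>) j k))"
        by (simp add: sum_distrib_left mult_ac)
    qed
    also have "\<dots> = (\<Sum>\<alpha>\<in>S \<delta> \<eta>. \<Sum>j\<in>J. f \<alpha> * (U (to_isotropy \<alpha>) i j * U (translate \<eta>) j k))" by (rule sum.swap)
    also have "\<dots> = (\<Sum>\<alpha>\<in>S \<delta> \<eta>. f \<alpha> * U (translate (gcomp G \<alpha> \<eta>)) i k)"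
    proof (rule sum.cong[OF refl])
      fix \<alpha> assume "\<alpha> \<in> S \<delta> \<eta>"
      then have \<alpha>: "\<alpha> \<in> arrows G" "gsrc G \<alpha> = grng G \<eta>" by (auto simp: S_def hom_set_def)
      have "to_isotropy \<alpha> \<in> isotropy_arrows x" using to_isotropy_isotropy[OF \<alpha>(1)] \<alpha>(2) Fa(3)[OF \<eta>] by simp
      then have "U (gcomp G (to_isotropy \<alpha>) (translate \<eta>)) i k = (\<Sum>j\<in>J. U (to_isotropy \<alpha>) i j * U (translate \<eta>) j k)"
        using D(4) translate_isotropy[OF Fa(1,2)[OF \<eta>]] ik by simp
      then show "(\<Sum>j\<in>J. f \<alpha> * (U (to_isotropy \<alpha>) i j * U (translate \<eta>) j k)) = f \<alpha> * U (translate (gcomp G \<alpha> \<eta>)) i k"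
        using translate_comp[OF \<alpha>(1) Fa(1,2)[OF \<eta>]] \<alpha>(2) by (simp add: sum_distrib_left)
    qed
    finally show ?thesis .
  qed
  have tr: "(\<Sum>i\<in>J. cnj (U (translate \<delta>) i k) * (\<Sum>\<alpha>\<in>S \<delta> \<eta>. f \<alpha> * U (translate (gcomp G \<alpha> \<eta>)) i k))
      = (\<Sum>\<alpha>\<in>S \<delta> \<eta>. f \<alpha> * U (gcomp G (ginv G \<delta>) (gcomp G \<alpha> \<eta>)) k k)" if \<delta>: "\<delta> \<in> F" and \<eta>: "\<eta> \<in> F" and k: "k \<in> J" for \<delta> \<eta> k
  proof -
    have "(\<Sum>i\<in>J. cnj (U (translate \<delta>) i k) * (\<Sum>\<alpha>\<in>S \<delta> \<eta>. f \<alpha> * U (translate (gcomp G \<alpha> \<eta>)) i k))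
       = (\<Sum>\<alpha>\<in>S \<delta> \<eta>. f \<alpha> * (\<Sum>i\<in>J. cnj (U (translate \<delta>) i k) * U (translate (gcomp G \<alpha> \<eta>)) i k))"
      unfolding sum_distrib_left by (subst sum.swap) (simp add: mult.left_commute)
    also have "\<dots> = (\<Sum>\<alpha>\<in>S \<delta> \<eta>. f \<alpha> * U (gcomp G (ginv G \<delta>) (gcomp G \<alpha> \<eta>)) k k)"
    proof (rule sum.cong[OF refl])
      fix \<alpha> assume "\<alpha> \<in> S \<delta> \<eta>"
      then have \<alpha>: "\<alpha> \<in> arrows G" "gsrc G \<alpha> = grng G \<eta>" "grng G \<alpha> = grng G \<delta>" by (auto simp: S_def hom_set_def)
      note ae = comp_arrow[OF \<alpha>(1) Fa(1)[OF \<eta>] \<alpha>(2)]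
      show "f \<alpha> * (\<Sum>i\<in>J. cnj (U (translate \<delta>) i k) * U (translate (gcomp G \<alpha> \<eta>)) i k) = f \<alpha> * U (gcomp G (ginv G \<delta>) (gcomp G \<alpha> \<eta>)) k k"
        using unitary_column_inner[OF Fa(1,2)[OF \<delta>] ae(1) _ _ k] ae \<alpha>(3) Fa(2)[OF \<eta>] by simp
    qed
    finally show ?thesis .
  qed
  have "(\<Sum>p\<in>orbit G x \<times> J. \<Sum>q\<in>orbit G x \<times> J. cnj (fibre_vector F a k p) * induced f p q * fibre_vector F b k q)
      = (\<Sum>\<delta>\<in>F. \<Sum>\<eta>\<in>F. cnj (a \<delta>) * b \<eta> * (\<Sum>\<alpha>\<in>S \<delta> \<eta>. f \<alpha> * U (gcomp G (ginv G \<delta>) (gcomp G \<alpha> \<eta>)) k k))"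
    if k: "k \<in> J" for k
  proof -
    have row: "(\<Sum>q\<in>orbit G x \<times> J. induced f p q * fibre_vector F b k q)
        = (\<Sum>\<eta>\<in>F. \<Sum>j\<in>J. b \<eta> * U (translate \<eta>) j k * induced f p (grng G \<eta>, j))" for p
      using fibre_sum[OF F(1) Fa(3), of "\<lambda>\<eta> j. b \<eta> * U (translate \<eta>) j k" "induced f p"]
      by (simp add: fibre_vector_def mult.commute)
    have "(\<Sum>p\<in>orbit G x \<times> J. \<Sum>q\<in>orbit G x \<times> J. cnj (fibre_vector F a k p) * induced f p q * fibre_vector F b k q)
        = (\<Sum>p\<in>orbit G x \<times> J. cnj (fibre_vector F a k p) * (\<Sum>q\<in>orbit G x \<times> J. induced f p q * fibre_vector F b k q))"
      by (simp add: sum_distrib_left mult.assoc)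
    also have "\<dots> = (\<Sum>\<delta>\<in>F. \<Sum>i\<in>J. cnj (a \<delta> * U (translate \<delta>) i k) *
        (\<Sum>\<eta>\<in>F. \<Sum>j\<in>J. b \<eta> * U (translate \<eta>) j k * induced f (grng G \<delta>, i) (grng G \<eta>, j)))"
      unfolding row cnj_fibre_vector by (rule fibre_sum[OF F(1) Fa(3)])
    also have "\<dots> = (\<Sum>\<delta>\<in>F. \<Sum>\<eta>\<in>F. cnj (a \<delta>) * b \<eta> * (\<Sum>i\<in>J. cnj (U (translate \<delta>) i k) *
        (\<Sum>\<alpha>\<in>S \<delta> \<eta>. f \<alpha> * U (translate (gcomp G \<alpha> \<eta>)) i k)))"
    proof (rule sum.cong[OF refl])
      fix \<delta> assume \<delta>: "\<delta> \<in> F"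
      have "(\<Sum>i\<in>J. cnj (a \<delta> * U (translate \<delta>) i k) *
          (\<Sum>\<eta>\<in>F. \<Sum>j\<in>J. b \<eta> * U (translate \<eta>) j k * induced f (grng G \<delta>, i) (grng G \<eta>, j)))
          = (\<Sum>i\<in>J. \<Sum>\<eta>\<in>F. cnj (a \<delta>) * b \<eta> * (cnj (U (translate \<delta>) i k) *
              (\<Sum>j\<in>J. U (translate \<eta>) j k * induced f (grng G \<delta>, i) (grng G \<eta>, j))))"
        by (simp add: sum_distrib_left mult_ac)
      also have "\<dots> = (\<Sum>\<eta>\<in>F. \<Sum>i\<in>J. cnj (a \<delta>) * b \<eta> * (cnj (U (translate \<delta>) i k) *
              (\<Sum>j\<in>J. U (translate \<eta>) j k * induced f (grng G \<delta>, i) (grng G \<eta>, j))))"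
        by (rule sum.swap)
      also have "\<dots> = (\<Sum>\<eta>\<in>F. cnj (a \<delta>) * b \<eta> * (\<Sum>i\<in>J. cnj (U (translate \<delta>) i k) *
        (\<Sum>\<alpha>\<in>S \<delta> \<eta>. f \<alpha> * U (translate (gcomp G \<alpha> \<eta>)) i k)))"
        unfolding sum_distrib_left[of "cnj (a \<delta>) * b _"] using k by (intro sum.cong refl) (simp add: col)
      finally show "(\<Sum>i\<in>J. cnj (a \<delta> * U (translate \<delta>) i k) *
          (\<Sum>\<eta>\<in>F. \<Sum>j\<in>J. b \<eta> * U (translate \<eta>) j k * induced f (grng G \<delta>, i) (grng G \<eta>, j)))
          = (\<Sum>\<eta>\<in>F. cnj (a \<delta>) * b \<eta> * (\<Sum>i\<in>J. cnj (U (translate \<delta>) i k) *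
        (\<Sum>\<alpha>\<in>S \<delta> \<eta>. f \<alpha> * U (translate (gcomp G \<alpha> \<eta>)) i k)))" .
    qed
    also have "\<dots> = (\<Sum>\<delta>\<in>F. \<Sum>\<eta>\<in>F. cnj (a \<delta>) * b \<eta> * (\<Sum>\<alpha>\<in>S \<delta> \<eta>. f \<alpha> * U (gcomp G (ginv G \<delta>) (gcomp G \<alpha> \<eta>)) k k))"
      by (intro sum.cong refl) (simp add: tr k)
    finally show ?thesis .
  qed
  then have "(\<Sum>k\<in>J. \<Sum>p\<in>orbit G x \<times> J. \<Sum>q\<in>orbit G x \<times> J. cnj (fibre_vector F a k p) * induced f p q * fibre_vector F b k q)
      = (\<Sum>k\<in>J. \<Sum>\<delta>\<in>F. \<Sum>\<eta>\<in>F. cnj (a \<delta>) * b \<eta> * (\<Sum>\<alpha>\<in>S \<delta> \<eta>. f \<alpha> * U (gcomp G (ginv G \<delta>) (gcomp G \<alpha> \<eta>)) k k))"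
    by (intro sum.cong refl)
  also have "\<dots> = (\<Sum>\<delta>\<in>F. \<Sum>\<eta>\<in>F. \<Sum>k\<in>J. cnj (a \<delta>) * b \<eta> * (\<Sum>\<alpha>\<in>S \<delta> \<eta>. f \<alpha> * U (gcomp G (ginv G \<delta>) (gcomp G \<alpha> \<eta>)) k k))"
    by (subst sum.swap, intro sum.cong refl, rule sum.swap)
  also have "\<dots> = (\<Sum>\<delta>\<in>F. \<Sum>\<eta>\<in>F. of_nat (card J) * (cnj (a \<delta>) * b \<eta> *
      (\<Sum>\<alpha>\<in>S \<delta> \<eta>. f \<alpha> * character J U (gcomp G (ginv G \<delta>) (gcomp G \<alpha> \<eta>)))))"
  proof (intro sum.cong refl)
    fix \<delta> \<eta>
    have "(\<Sum>k\<in>J. cnj (a \<delta>) * b \<eta> * (\<Sum>\<alpha>\<in>S \<delta> \<eta>. f \<alpha> * U (gcomp G (ginv G \<delta>) (gcomp G \<alpha> \<eta>)) k k))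
        = cnj (a \<delta>) * b \<eta> * (\<Sum>k\<in>J. \<Sum>\<alpha>\<in>S \<delta> \<eta>. f \<alpha> * U (gcomp G (ginv G \<delta>) (gcomp G \<alpha> \<eta>)) k k)"
      by (simp only: sum_distrib_left)
    also have "(\<Sum>k\<in>J. \<Sum>\<alpha>\<in>S \<delta> \<eta>. f \<alpha> * U (gcomp G (ginv G \<delta>) (gcomp G \<alpha> \<eta>)) k k)
        = (\<Sum>\<alpha>\<in>S \<delta> \<eta>. f \<alpha> * (\<Sum>k\<in>J. U (gcomp G (ginv G \<delta>) (gcomp G \<alpha> \<eta>)) k k))"
      by (subst sum.swap) (simp only: sum_distrib_left)
    also have "\<dots> = of_nat (card J) * (\<Sum>\<alpha>\<in>S \<delta> \<eta>. f \<alpha> * character J U (gcomp G (ginv G \<delta>) (gcomp G \<alpha> \<eta>)))"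
      unfolding sum_distrib_left[of "of_nat (card J)"] using N by (intro sum.cong refl) (simp add: character_def)
    finally show "(\<Sum>k\<in>J. cnj (a \<delta>) * b \<eta> * (\<Sum>\<alpha>\<in>S \<delta> \<eta>. f \<alpha> * U (gcomp G (ginv G \<delta>) (gcomp G \<alpha> \<eta>)) k k))
        = of_nat (card J) * (cnj (a \<delta>) * b \<eta> * (\<Sum>\<alpha>\<in>S \<delta> \<eta>. f \<alpha> * character J U (gcomp G (ginv G \<delta>) (gcomp G \<alpha> \<eta>))))"
      by (simp add: mult.left_commute)
  qed
  finally show ?thesis by (simp only: sum_distrib_left S_def)
qed

end

text \<open>
  Finite corners of the regular representation at a periodic point with maximally almost periodic
  isotropy are bounded by finite-dimensional representations. When the character of \<open>U\<close> approaches the point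
  mass at \<open>x\<close>, the vectors \<open>\<delta> \<otimes> U(\<delta>)\<close> become orthonormal for the normalised trace, and the coefficients of
  the induced representation at them tend to \<open>f(\<delta>\<eta>\<inverse>)\<close>.
\<close>

lemma regular_form_bound:
  assumes x: "x \<in> units G" "periodic G x" and map: "maximally_almost_periodic (isotropy G x)"
    and f: "f \<in> Cc G" and C: "finite_dim_bound CA f C" "0 \<le> C"
    and F: "finite F" "F \<subseteq> {\<delta> \<in> arrows G. gsrc G \<delta> = x}"
  shows "cmod (\<Sum>\<delta>\<in>F. \<Sum>\<eta>\<in>F. cnj (a \<delta>) * b \<eta> * f (gcomp G \<delta> (ginv G \<eta>)))
    \<le> C / 2 * ((\<Sum>\<delta>\<in>F. (cmod (a \<delta>))\<^sup>2) + (\<Sum>\<eta>\<in>F. (cmod (b \<eta>))\<^sup>2))"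
proof -
  have fin: "finite (orbit G x)" using x(2) by (simp add: periodic_def)
  have "\<forall>y\<in>orbit G x. \<exists>\<gamma>. \<gamma> \<in> arrows G \<and> gsrc G \<gamma> = x \<and> grng G \<gamma> = y" by (auto simp: orbit_iff)
  then obtain c where "\<forall>y\<in>orbit G x. c y \<in> arrows G \<and> gsrc G (c y) = x \<and> grng G (c y) = y"
    unfolding bchoice_iff by (elim exE) (rule that)
  then have c: "\<And>y. y \<in> orbit G x \<Longrightarrow> c y \<in> arrows G \<and> gsrc G (c y) = x \<and> grng G (c y) = y" by simp
  have Fa: "\<delta> \<in> arrows G" "gsrc G \<delta> = x" if "\<delta> \<in> F" for \<delta> using F(2) that by auto
  define S where "S \<delta> \<eta> = {\<alpha> \<in> hom_set (grng G \<delta>) (grng G \<eta>). f \<alpha> \<noteq> 0}" for \<delta> \<eta>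
  have S: "finite (S \<delta> \<eta>)" for \<delta> \<eta> unfolding S_def by (rule finite_hom_support[OF f])
  have Sa: "\<alpha> \<in> arrows G" "gsrc G \<alpha> = grng G \<eta>" "grng G \<alpha> = grng G \<delta>" if "\<alpha> \<in> S \<delta> \<eta>" for \<alpha> \<delta> \<eta>
    using that by (simp_all add: S_def hom_set_def)
  \<comment> \<open>The elements of the isotropy group, other than \<open>x\<close>, at which the character of \<open>U\<close> occurs below.\<close>
  define E where "E = ((\<Union>\<delta>\<in>F. \<Union>\<eta>\<in>F. (\<lambda>\<alpha>. gcomp G (ginv G \<delta>) (gcomp G \<alpha> \<eta>)) ` S \<delta> \<eta>)
      \<union> (\<Union>\<delta>\<in>F. (\<lambda>\<eta>. gcomp G (ginv G \<delta>) \<eta>) ` {\<eta>\<in>F. grng G \<delta> = grng G \<eta>})) - {x}"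
  have E: "finite E" unfolding E_def using F(1) S by simp
  have iso1: "gcomp G (ginv G \<delta>) \<eta> \<in> isotropy_arrows x"
    if "\<delta> \<in> F" "\<eta> \<in> arrows G" "gsrc G \<eta> = x" "grng G \<delta> = grng G \<eta>" for \<delta> \<eta>
    using inv_comp_arrow[OF Fa(1)[OF that(1)] that(2,4)] that Fa by (simp add: isotropy_arrows_def)
  have ae: "gcomp G \<alpha> \<eta> \<in> arrows G" "gsrc G (gcomp G \<alpha> \<eta>) = x" "grng G (gcomp G \<alpha> \<eta>) = grng G \<delta>"
    if "\<alpha> \<in> S \<delta> \<eta>" "\<eta> \<in> F" for \<alpha> \<delta> \<eta>
    using comp_arrow[OF Sa(1)[OF that(1)] Fa(1)[OF that(2)] Sa(2)[OF that(1)]] Sa(3)[OF that(1)] Fa(2)[OF that(2)] by simp_all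
  have Esub: "E \<subseteq> isotropy_arrows x - {x}"
  proof
    fix g assume g: "g \<in> E"
    then consider (1) \<delta> \<eta> \<alpha> where "\<delta> \<in> F" "\<eta> \<in> F" "\<alpha> \<in> S \<delta> \<eta>" "g = gcomp G (ginv G \<delta>) (gcomp G \<alpha> \<eta>)"
      | (2) \<delta> \<eta> where "\<delta> \<in> F" "\<eta> \<in> F" "grng G \<delta> = grng G \<eta>" "g = gcomp G (ginv G \<delta>) \<eta>"
      unfolding E_def by blast
    then show "g \<in> isotropy_arrows x - {x}"
    proof cases
      case 1
      then show ?thesis using iso1[OF 1(1) ae(1,2)[OF 1(3,2)]] ae(3)[OF 1(3,2)] g by (simp add: E_def)
    next
      case 2
      then show ?thesis using iso1[OF 2(1) Fa[OF 2(2)] 2(3)] g by (simp add: E_def)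
    qed
  qed
  \<comment> \<open>The constant \<open>K\<close> collects what multiplies the error \<open>\<epsilon>\<close> of the characters.\<close>
  define X where "X = (\<Sum>\<delta>\<in>F. \<Sum>\<eta>\<in>F. cnj (a \<delta>) * b \<eta> * f (gcomp G \<delta> (ginv G \<eta>)))"
  define R where "R = C / 2 * ((\<Sum>\<delta>\<in>F. (cmod (a \<delta>))\<^sup>2) + (\<Sum>\<eta>\<in>F. (cmod (b \<eta>))\<^sup>2))"
  define K1 where "K1 = (\<Sum>\<delta>\<in>F. \<Sum>\<eta>\<in>F. cmod (a \<delta>) * cmod (b \<eta>) * (\<Sum>\<alpha>\<in>S \<delta> \<eta>. cmod (f \<alpha>)))"
  define K2 where "K2 a = (\<Sum>\<delta>\<in>F. \<Sum>\<eta>\<in>F. cmod (a \<delta>) * cmod (a \<eta>))" for a :: "'g \<Rightarrow> complex"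
  define K where "K = K1 + C / 2 * (K2 a + K2 b)"
  have K0: "0 \<le> K"
    unfolding K_def K1_def K2_def using C(2) by (intro add_nonneg_nonneg mult_nonneg_nonneg sum_nonneg) auto
  have main: "cmod X \<le> R + \<epsilon> * K" if \<epsilon>: "0 < \<epsilon>" for \<epsilon>
  proof -
    obtain J U where U: "unitary_rep x J U" and small: "\<forall>g\<in>E. cmod (character J U g) \<le> \<epsilon>"
      using small_characters[OF x(1) map E Esub \<epsilon>] by blast
    note D = unitary_repD[OF U]
    define N where "N = real (card J)"
    have N: "N > 0" using D(3) by (simp add: N_def)
    let ?\<chi> = "character J U"
    let ?P = "orbit G x \<times> J"
    define v where "v = fibre_vector U c F a"
    define w where "w = fibre_vector U c F b"
    define Y where "Y a = (\<Sum>\<delta>\<in>F. \<Sum>\<eta>\<in>F. if grng G \<delta> = grng G \<eta> then cnj (a \<delta>) * a \<eta> * ?\<chi> (gcomp G (ginv G \<delta>) \<eta>) else 0)"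
      for a :: "'g \<Rightarrow> complex"
    define X' where "X' = (\<Sum>\<delta>\<in>F. \<Sum>\<eta>\<in>F. cnj (a \<delta>) * b \<eta> * (\<Sum>\<alpha>\<in>S \<delta> \<eta>. f \<alpha> * ?\<chi> (gcomp G (ginv G \<delta>) (gcomp G \<alpha> \<eta>))))"
    \<comment> \<open>After division by the dimension \<open>N\<close>, the Gram matrix \<open>Y\<close> and the form \<open>X'\<close> tend to their regular counterparts.\<close>
    have nrm: "(\<Sum>k\<in>J. \<Sum>p\<in>?P. (cmod (fibre_vector U c F a k p))\<^sup>2) = N * Re (Y a)" for a
    proof -
      have "complex_of_real (\<Sum>k\<in>J. \<Sum>p\<in>?P. (cmod (fibre_vector U c F a k p))\<^sup>2) = of_nat (card J) * Y a"
        using fibre_vector_norm[OF U fin c F, of a] unfolding Y_def by simp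
      then have "Re (complex_of_real (\<Sum>k\<in>J. \<Sum>p\<in>?P. (cmod (fibre_vector U c F a k p))\<^sup>2)) = Re (of_nat (card J) * Y a)"
        by (rule arg_cong)
      then show ?thesis by (simp add: N_def del: of_real_sum)
    qed
    have YR: "Re (Y a) \<le> (\<Sum>\<delta>\<in>F. (cmod (a \<delta>))\<^sup>2) + \<epsilon> * K2 a" for a
    proof -
      have "Y a - of_real (\<Sum>\<delta>\<in>F. (cmod (a \<delta>))\<^sup>2)
          = (\<Sum>\<delta>\<in>F. \<Sum>\<eta>\<in>F. (if grng G \<delta> = grng G \<eta> then cnj (a \<delta>) * a \<eta> * ?\<chi> (gcomp G (ginv G \<delta>) \<eta>) else 0)
              - (if \<eta> = \<delta> then cnj (a \<delta>) * a \<delta> else 0))"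
      proof -
        have "of_real (\<Sum>\<delta>\<in>F. (cmod (a \<delta>))\<^sup>2) = (\<Sum>\<delta>\<in>F. \<Sum>\<eta>\<in>F. if \<eta> = \<delta> then cnj (a \<delta>) * a \<delta> else 0)"
          unfolding of_real_sum using F(1)
          by (intro sum.cong refl) (simp only: complex_norm_square sum.delta if_True mult.commute)
        then show ?thesis unfolding Y_def sum_subtractf by (simp only:)
      qed
      also have "cmod \<dots> \<le> (\<Sum>\<delta>\<in>F. \<Sum>\<eta>\<in>F. \<epsilon> * (cmod (a \<delta>) * cmod (a \<eta>)))"
      proof (intro sum_norm_le)
        fix \<delta> \<eta> assume de: "\<delta> \<in> F" "\<eta> \<in> F"
        show "cmod ((if grng G \<delta> = grng G \<eta> then cnj (a \<delta>) * a \<eta> * ?\<chi> (gcomp G (ginv G \<delta>) \<eta>) else 0)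
              - (if \<eta> = \<delta> then cnj (a \<delta>) * a \<delta> else 0)) \<le> \<epsilon> * (cmod (a \<delta>) * cmod (a \<eta>))"
        proof (cases "\<eta> = \<delta>")
          case True
          then show ?thesis using inv_comp[OF Fa(1)[OF de(1)]] Fa(2)[OF de(1)] character_unit[OF U] \<epsilon> by simp
        next
          case False
          show ?thesis
          proof (cases "grng G \<delta> = grng G \<eta>")
            case r: True
            have "gcomp G (ginv G \<delta>) \<eta> \<noteq> x"
            proof
              assume "gcomp G (ginv G \<delta>) \<eta> = x"
              then have "\<eta> = gcomp G \<delta> x" using cancel_left[OF Fa(1)[OF de(1)] Fa(1)[OF de(2)] r] by simp
              then show False using False comp_src[OF Fa(1)[OF de(1)]] Fa(2)[OF de(1)] by simp
            qed
            then have "gcomp G (ginv G \<delta>) \<eta> \<in> E" using de r by (auto simp: E_def)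
            then have "cmod (?\<chi> (gcomp G (ginv G \<delta>) \<eta>)) \<le> \<epsilon>" using small by blast
            then have "cmod (a \<delta>) * cmod (a \<eta>) * cmod (?\<chi> (gcomp G (ginv G \<delta>) \<eta>)) \<le> cmod (a \<delta>) * cmod (a \<eta>) * \<epsilon>"
              by (intro mult_left_mono) auto
            then show ?thesis using False r by (simp add: norm_mult mult.commute)
          qed (use False \<epsilon> in simp)
        qed
      qed
      also have "\<dots> = \<epsilon> * K2 a" by (simp add: K2_def sum_distrib_left)
      finally have "cmod (Y a - of_real (\<Sum>\<delta>\<in>F. (cmod (a \<delta>))\<^sup>2)) \<le> \<epsilon> * K2 a" .
      then have "Re (Y a - of_real (\<Sum>\<delta>\<in>F. (cmod (a \<delta>))\<^sup>2)) \<le> \<epsilon> * K2 a"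
        using complex_Re_le_cmod order_trans by blast
      then show ?thesis by simp
    qed
    have XX': "cmod (X - X') \<le> \<epsilon> * K1"
    proof -
      have "X - X' = (\<Sum>\<delta>\<in>F. \<Sum>\<eta>\<in>F. cnj (a \<delta>) * b \<eta> * (f (gcomp G \<delta> (ginv G \<eta>)) -
          (\<Sum>\<alpha>\<in>S \<delta> \<eta>. f \<alpha> * ?\<chi> (gcomp G (ginv G \<delta>) (gcomp G \<alpha> \<eta>)))))"
        unfolding X_def X'_def sum_subtractf[symmetric] right_diff_distrib ..
      also have "cmod \<dots> \<le> (\<Sum>\<delta>\<in>F. \<Sum>\<eta>\<in>F. \<epsilon> * (cmod (a \<delta>) * cmod (b \<eta>) * (\<Sum>\<alpha>\<in>S \<delta> \<eta>. cmod (f \<alpha>))))"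
      proof (intro sum_norm_le)
        fix \<delta> \<eta> assume de: "\<delta> \<in> F" "\<eta> \<in> F"
        let ?\<beta> = "gcomp G \<delta> (ginv G \<eta>)"
        have xx: "gsrc G \<delta> = gsrc G \<eta>" using Fa(2) de by simp
        note \<beta> = comp_inv_arrow[OF Fa(1)[OF de(1)] Fa(1)[OF de(2)] xx]
        have "f ?\<beta> = (\<Sum>\<alpha>\<in>S \<delta> \<eta>. if \<alpha> = ?\<beta> then f \<alpha> else 0)"
        proof (cases "f ?\<beta> = 0")
          case True
          then have "(\<Sum>\<alpha>\<in>S \<delta> \<eta>. if \<alpha> = ?\<beta> then f \<alpha> else 0) = 0" by (intro sum.neutral) auto
          then show ?thesis using True by simp
        next
          case False
          then have "?\<beta> \<in> S \<delta> \<eta>" using \<beta> by (simp add: S_def hom_set_def)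
          then show ?thesis using S by simp
        qed
        then have "f ?\<beta> - (\<Sum>\<alpha>\<in>S \<delta> \<eta>. f \<alpha> * ?\<chi> (gcomp G (ginv G \<delta>) (gcomp G \<alpha> \<eta>)))
            = (\<Sum>\<alpha>\<in>S \<delta> \<eta>. (if \<alpha> = ?\<beta> then f \<alpha> else 0) - f \<alpha> * ?\<chi> (gcomp G (ginv G \<delta>) (gcomp G \<alpha> \<eta>)))"
          by (simp add: sum_subtractf)
        also have "cmod \<dots> \<le> (\<Sum>\<alpha>\<in>S \<delta> \<eta>. \<epsilon> * cmod (f \<alpha>))"
        proof (rule sum_norm_le)
          fix \<alpha> assume \<alpha>: "\<alpha> \<in> S \<delta> \<eta>"
          note a = Sa[OF \<alpha>]
          show "cmod ((if \<alpha> = ?\<beta> then f \<alpha> else 0) - f \<alpha> * ?\<chi> (gcomp G (ginv G \<delta>) (gcomp G \<alpha> \<eta>))) \<le> \<epsilon> * cmod (f \<alpha>)"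
          proof (cases "\<alpha> = ?\<beta>")
            case True
            have "gcomp G \<alpha> \<eta> = \<delta>" using cancel_right[OF Fa(1)[OF de(2)] Fa(1)[OF de(1)]] xx True by simp
            then have "gcomp G (ginv G \<delta>) (gcomp G \<alpha> \<eta>) = x" using inv_comp[OF Fa(1)[OF de(1)]] Fa(2)[OF de(1)] by simp
            then show ?thesis using True character_unit[OF U] \<epsilon> by simp
          next
            case False
            have "gcomp G (ginv G \<delta>) (gcomp G \<alpha> \<eta>) \<noteq> x"
            proof
              assume "gcomp G (ginv G \<delta>) (gcomp G \<alpha> \<eta>) = x"
              then have "gcomp G \<alpha> \<eta> = gcomp G \<delta> x"
                using cancel_left[OF Fa(1)[OF de(1)] ae(1)[OF \<alpha> de(2)]] ae(3)[OF \<alpha> de(2)] by simp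
              then have "gcomp G \<alpha> \<eta> = \<delta>" using comp_src[OF Fa(1)[OF de(1)]] Fa(2)[OF de(1)] by simp
              then show False using comp_unique_left(2)[OF a(1) Fa(1)[OF de(2)] Fa(1)[OF de(1)] a(2)] False by simp
            qed
            then have "gcomp G (ginv G \<delta>) (gcomp G \<alpha> \<eta>) \<in> E" using de \<alpha> unfolding E_def by blast
            then have "cmod (?\<chi> (gcomp G (ginv G \<delta>) (gcomp G \<alpha> \<eta>))) \<le> \<epsilon>" using small by blast
            then have "cmod (f \<alpha>) * cmod (?\<chi> (gcomp G (ginv G \<delta>) (gcomp G \<alpha> \<eta>))) \<le> cmod (f \<alpha>) * \<epsilon>"
              by (intro mult_left_mono) auto
            then show ?thesis using False by (simp add: norm_mult mult.commute)
          qed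
        qed
        finally have le: "cmod (f ?\<beta> - (\<Sum>\<alpha>\<in>S \<delta> \<eta>. f \<alpha> * ?\<chi> (gcomp G (ginv G \<delta>) (gcomp G \<alpha> \<eta>)))) \<le> \<epsilon> * (\<Sum>\<alpha>\<in>S \<delta> \<eta>. cmod (f \<alpha>))"
          by (simp add: sum_distrib_left)
        have "cmod (a \<delta>) * cmod (b \<eta>) * cmod (f ?\<beta> - (\<Sum>\<alpha>\<in>S \<delta> \<eta>. f \<alpha> * ?\<chi> (gcomp G (ginv G \<delta>) (gcomp G \<alpha> \<eta>))))
            \<le> cmod (a \<delta>) * cmod (b \<eta>) * (\<epsilon> * (\<Sum>\<alpha>\<in>S \<delta> \<eta>. cmod (f \<alpha>)))"
          by (intro mult_left_mono le) auto
        then show "cmod (cnj (a \<delta>) * b \<eta> * (f ?\<beta> - (\<Sum>\<alpha>\<in>S \<delta> \<eta>. f \<alpha> * ?\<chi> (gcomp G (ginv G \<delta>) (gcomp G \<alpha> \<eta>)))))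
            \<le> \<epsilon> * (cmod (a \<delta>) * cmod (b \<eta>) * (\<Sum>\<alpha>\<in>S \<delta> \<eta>. cmod (f \<alpha>)))"
          by (simp only: norm_mult complex_mod_cnj mult.assoc mult.left_commute)
      qed
      also have "\<dots> = \<epsilon> * K1" by (simp add: K1_def sum_distrib_left)
      finally show ?thesis .
    qed
    have "N * cmod X' = cmod (\<Sum>k\<in>J. \<Sum>p\<in>?P. \<Sum>q\<in>?P. cnj (v k p) * induced U c f p q * w k q)"
      using fibre_vector_form[OF U fin c F f, of a b] unfolding v_def w_def X'_def S_def
      by (simp only: norm_mult norm_of_nat N_def)
    also have "\<dots> \<le> (\<Sum>k\<in>J. C / 2 * ((\<Sum>p\<in>?P. (cmod (v k p))\<^sup>2) + (\<Sum>p\<in>?P. (cmod (w k p))\<^sup>2)))"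
      by (intro sum_norm_le induced_form_bound[OF U fin c f C])
    also have "\<dots> = C / 2 * (N * Re (Y a) + N * Re (Y b))"
      unfolding nrm[symmetric] v_def w_def by (simp only: sum_distrib_left[symmetric] sum.distrib)
    also have "\<dots> = N * (C / 2 * (Re (Y a) + Re (Y b)))" by (simp add: algebra_simps)
    finally have "cmod X' \<le> C / 2 * (Re (Y a) + Re (Y b))" using N by simp
    also have "\<dots> \<le> C / 2 * (((\<Sum>\<delta>\<in>F. (cmod (a \<delta>))\<^sup>2) + \<epsilon> * K2 a) + ((\<Sum>\<delta>\<in>F. (cmod (b \<delta>))\<^sup>2) + \<epsilon> * K2 b))"
      using C(2) YR[of a] YR[of b] by (intro mult_left_mono add_mono) auto
    also have "\<dots> = R + \<epsilon> * (C / 2 * (K2 a + K2 b))"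
      unfolding R_def distrib_left distrib_right by (simp add: mult.left_commute)
    finally have "cmod X' \<le> R + \<epsilon> * (C / 2 * (K2 a + K2 b))" .
    then show ?thesis
      using XX' norm_triangle_ineq[of "X - X'" X'] by (simp add: K_def algebra_simps)
  qed
  have "cmod X \<le> R"
  proof (rule field_le_epsilon)
    fix e :: real assume e: "0 < e"
    have "cmod X \<le> R + e / (K + 1) * K" using K0 e by (intro main) simp
    also have "e / (K + 1) * K \<le> e" using K0 e by (simp add: field_simps)
    finally show "cmod X \<le> R + e" by simp
  qed
  then show ?thesis by (simp add: X_def R_def)
qed

end

section \<open>Norm estimates from amenability\<close>

lemma has_sum_finite_sum:
  fixes f :: "'i \<Rightarrow> 'a \<Rightarrow> 'b::topological_comm_monoid_add"
  assumes "\<And>i. i \<in> F \<Longrightarrow> (f i has_sum s i) A"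
  shows "((\<lambda>m. \<Sum>i\<in>F. f i m) has_sum (\<Sum>i\<in>F. s i)) A"
  using assms by (induction F rule: infinite_finite_induct) (auto intro!: has_sum_add)

text \<open>
  The amplification of a scalar matrix has the norm of the matrix: the bound for scalars is
  summed over the coordinates of the Hilbert space.
\<close>

lemma ell2_form_bound:
  fixes \<kappa> :: "'i \<Rightarrow> 'i \<Rightarrow> complex"
  assumes \<kappa>: "\<And>s t. cmod (\<Sum>i\<in>F. \<Sum>j\<in>F. cnj (s i) * \<kappa> i j * t j) \<le> C / 2 * ((\<Sum>i\<in>F. (cmod (s i))\<^sup>2) + (\<Sum>j\<in>F. (cmod (t j))\<^sup>2))"
    and W: "\<And>i. i \<in> F \<Longrightarrow> W i \<in> ell2 I" and V: "\<And>j. j \<in> F \<Longrightarrow> V j \<in> ell2 I" and F: "finite F"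
  shows "cmod (\<Sum>i\<in>F. \<Sum>j\<in>F. \<kappa> i j * ell2_inner I (W i) (V j))
     \<le> C / 2 * ((\<Sum>i\<in>F. (ell2_norm I (W i))\<^sup>2) + (\<Sum>j\<in>F. (ell2_norm I (V j))\<^sup>2))"
proof -
  let ?g = "\<lambda>m. \<Sum>i\<in>F. \<Sum>j\<in>F. cnj (W i m) * \<kappa> i j * V j m"
  let ?b = "\<lambda>m. C / 2 * ((\<Sum>i\<in>F. (cmod (W i m))\<^sup>2) + (\<Sum>j\<in>F. (cmod (V j m))\<^sup>2))"
  have hs: "((\<lambda>m. \<Sum>i\<in>F. (cmod (X i m))\<^sup>2) has_sum (\<Sum>i\<in>F. (ell2_norm I (X i))\<^sup>2)) I"
    if "\<And>i. i \<in> F \<Longrightarrow> X i \<in> ell2 I" for X :: "'i \<Rightarrow> nat \<Rightarrow> complex"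
    unfolding ell2_norm_power2 by (intro has_sum_finite_sum has_sum_infsum ell2_summable that)
  have b: "(?b has_sum C / 2 * ((\<Sum>i\<in>F. (ell2_norm I (W i))\<^sup>2) + (\<Sum>j\<in>F. (ell2_norm I (V j))\<^sup>2))) I"
    by (intro has_sum_cmult_right has_sum_add hs W V)
  have g: "(?g has_sum (\<Sum>i\<in>F. \<Sum>j\<in>F. \<kappa> i j * ell2_inner I (W i) (V j))) I"
  proof (intro has_sum_finite_sum)
    fix i j assume "i \<in> F" "j \<in> F"
    then have "((\<lambda>m. cnj (W i m) * V j m) has_sum ell2_inner I (W i) (V j)) I"
      unfolding ell2_inner_def by (intro has_sum_infsum ell2_summable_inner W V)
    then have "((\<lambda>m. \<kappa> i j * (cnj (W i m) * V j m)) has_sum \<kappa> i j * ell2_inner I (W i) (V j)) I"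
      by (rule has_sum_cmult_right)
    then show "((\<lambda>m. cnj (W i m) * \<kappa> i j * V j m) has_sum \<kappa> i j * ell2_inner I (W i) (V j)) I"
      by (simp add: mult_ac)
  qed
  have le: "cmod (?g m) \<le> ?b m" for m by (rule \<kappa>)
  have "(\<lambda>m. cmod (?g m)) summable_on I"
    by (rule summable_on_comparison_test[OF has_sum_imp_summable[OF b]]) (use le in auto)
  then have "cmod (infsum ?g I) \<le> (\<Sum>\<^sub>\<infinity>m\<in>I. cmod (?g m))"
    by (rule norm_infsum_bound)
  also have "\<dots> \<le> infsum ?b I"
    by (rule infsum_mono[OF \<open>(\<lambda>m. cmod (?g m)) summable_on I\<close> has_sum_imp_summable[OF b]]) (rule le)
  finally show ?thesis unfolding infsumI[OF g] infsumI[OF b] .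
qed

context etale_groupoid
begin

lemma convolution_units:
  assumes k: "\<And>\<gamma>. \<gamma> \<notin> units G \<Longrightarrow> k \<gamma> = 0" "\<And>\<gamma>. \<gamma> \<notin> units G \<Longrightarrow> h \<gamma> = 0"
  shows "convolution G k h \<gamma> = k \<gamma> * h \<gamma>"
proof (cases "\<gamma> \<in> arrows G")
  case \<gamma>: True
  have "convolution G k h \<gamma> = k (grng G \<gamma>) * h \<gamma>" by (rule convolution_units_left[OF k(1) \<gamma>])
  then show ?thesis using unitD[of \<gamma>] k(2)[of \<gamma>] by (cases "\<gamma> \<in> units G") auto
next
  case False
  then have "\<gamma> \<notin> units G" using units_subset by blast
  then show ?thesis using k by (simp add: convolution_outside[OF False])
qed

text \<open>
  The operator \<open>v \<mapsto> (\<pi>(b\<^sub>i)v)\<^sub>i\<close> has squared norm \<open>\<parallel>\<pi>(\<Sum>\<^sub>i b\<^sub>i\<^sup>* * b\<^sub>i)\<parallel>\<close>, which is at most the supremum norm when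
  the sum is a function on the unit space.
\<close>

lemma row_bound:
  assumes \<pi>: "hilbert_representation CA I \<pi>" and b: "\<And>i. i \<in> S \<Longrightarrow> b i \<in> Cc G" and v: "v \<in> ell2 I"
    and E0: "\<And>\<gamma>. \<gamma> \<notin> units G \<Longrightarrow> (\<Sum>i\<in>S. convolution G (involution G (b i)) (b i) \<gamma>) = 0"
    and E: "\<And>\<gamma>. cmod (\<Sum>i\<in>S. convolution G (involution G (b i)) (b i) \<gamma>) \<le> c"
  shows "(\<Sum>i\<in>S. (ell2_norm I (\<pi> (b i) v))\<^sup>2) \<le> c * (ell2_norm I v)\<^sup>2"
proof -
  note R = hilbert_representationD[OF \<pi>, simplified]
  let ?e = "\<lambda>i. convolution G (involution G (b i)) (b i)"
  let ?E = "\<lambda>\<gamma>. \<Sum>i\<in>S. ?e i \<gamma>"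
  have e: "?e i \<in> Cc G" if "i \<in> S" for i using that by (intro convolution_Cc involution_Cc b)
  have EC: "?E \<in> Cc G" by (rule Cc_sum[OF e])
  have "(\<Sum>i\<in>S. (ell2_norm I (\<pi> (b i) v))\<^sup>2) = (\<Sum>i\<in>S. Re (ell2_inner I v (\<pi> (?e i) v)))"
    by (rule sum.cong[OF refl]) (rule rep_norm_square[OF \<pi> b v])
  also have "\<dots> = Re (\<Sum>i\<in>S. ell2_inner I v (\<pi> (?e i) v))" by simp
  also have "(\<Sum>i\<in>S. ell2_inner I v (\<pi> (?e i) v)) = ell2_inner I v (\<lambda>m. \<Sum>i\<in>S. \<pi> (?e i) v m)"
    by (rule ell2_inner_sum_right[symmetric, OF v]) (intro R(6) e v)
  also have "(\<lambda>m. \<Sum>i\<in>S. \<pi> (?e i) v m) = \<pi> ?E v" by (rule rep_sum[symmetric, OF \<pi> e v])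
  also have "Re (ell2_inner I v (\<pi> ?E v)) \<le> cmod (ell2_inner I v (\<pi> ?E v))" by (rule complex_Re_le_cmod)
  also have "\<dots> \<le> ell2_norm I v * ell2_norm I (\<pi> ?E v)" by (rule ell2_Cauchy_Schwarz[OF v R(6)[OF EC v]])
  also have "\<dots> \<le> ell2_norm I v * (c * ell2_norm I v)"
    by (rule mult_left_mono[OF rep_bound_units[OF \<pi> EC E0 E v] ell2_norm_nonneg])
  finally show ?thesis by (simp add: power2_eq_square mult_ac)
qed

lemma dense_in_meets:
  assumes D: "dense_in (unit_space G) D" and V: "openin T V" "V \<subseteq> units G" "y \<in> V"
  shows "\<exists>d. d \<in> D \<and> d \<in> V"
proof -
  have "y \<in> unit_space G closure_of D" using D V(2,3) unfolding dense_in_def topspace_unit_space by auto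
  then have "\<forall>U. y \<in> U \<and> openin (unit_space G) U \<longrightarrow> (\<exists>d. d \<in> D \<and> d \<in> U)" unfolding in_closure_of by (rule conjunct2)
  from this[rule_format, of V] show ?thesis
    using V unfolding unit_space_def openin_open_subtopology[OF open_units] by simp
qed

text \<open>
  Finitely many functions on the unit space are uniformly close to combinations of squares
  of a partition with values sampled at points of a dense set.
\<close>

lemma dense_sampling:
  assumes D: "dense_in (unit_space G) D" and S: "finite S" and k: "\<And>s. s \<in> S \<Longrightarrow> k s \<in> Cc G"
    and k0: "\<And>s \<gamma>. s \<in> S \<Longrightarrow> \<gamma> \<notin> units G \<Longrightarrow> k s \<gamma> = (0::complex)" and \<epsilon>: "0 < \<epsilon>"
  shows "\<exists>F (\<psi> :: 'g \<Rightarrow> 'g \<Rightarrow> real) d. finite F \<and>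
    (\<forall>l\<in>F. (\<lambda>\<gamma>. complex_of_real (\<psi> l \<gamma>)) \<in> Cc G \<and> (\<forall>\<gamma>. \<gamma> \<notin> units G \<longrightarrow> \<psi> l \<gamma> = 0) \<and> d l \<in> D) \<and>
    (\<forall>\<gamma>. (\<Sum>l\<in>F. (\<psi> l \<gamma>)\<^sup>2) \<le> 1) \<and>
    (\<forall>s\<in>S. \<forall>\<gamma>. cmod (k s \<gamma> - (\<Sum>l\<in>F. of_real ((\<psi> l \<gamma>)\<^sup>2) * k s (d l))) \<le> \<epsilon>)"
proof -
  have "\<forall>s\<in>S. \<exists>K. compactin T K \<and> (\<forall>\<gamma>. \<gamma> \<notin> K \<longrightarrow> k s \<gamma> = 0)"
  proof
    fix s assume "s \<in> S"
    obtain K where "compactin T K" "\<And>\<gamma>. \<gamma> \<notin> K \<Longrightarrow> k s \<gamma> = 0" using CcE[OF k[OF \<open>s \<in> S\<close>]] by metis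
    then show "\<exists>K. compactin T K \<and> (\<forall>\<gamma>. \<gamma> \<notin> K \<longrightarrow> k s \<gamma> = 0)" by (intro exI[of _ K]) simp
  qed
  then obtain Ks where "\<forall>s\<in>S. compactin T (Ks s) \<and> (\<forall>\<gamma>. \<gamma> \<notin> Ks s \<longrightarrow> k s \<gamma> = 0)"
    unfolding bchoice_iff by (elim exE) (rule that)
  then have Ks: "\<And>s. s \<in> S \<Longrightarrow> compactin T (Ks s)" "\<And>s \<gamma>. s \<in> S \<Longrightarrow> \<gamma> \<notin> Ks s \<Longrightarrow> k s \<gamma> = 0" by simp_all
  define K where "K = (\<Union>s\<in>S. Ks s) \<inter> units G"
  have "compactin T (\<Union>s\<in>S. Ks s)" by (rule compactin_Union) (use S Ks(1) in auto)
  then have K: "compactin T K" unfolding K_def by (rule compact_Int_closedin[OF _ closed_units])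
  have k_off: "k s \<gamma> = 0" if "s \<in> S" "\<gamma> \<notin> K" for s \<gamma> using that Ks(2)[of s \<gamma>] k0[of s \<gamma>] by (auto simp: K_def)
  define V where "V y = units G \<inter> {z \<in> topspace T. \<forall>s\<in>S. k s z \<in> ball (k s y) (\<epsilon> / 2)}" for y
  have open_ball: "openin T {z \<in> topspace T. \<forall>s\<in>S'. k s z \<in> ball (k s y) (\<epsilon> / 2)}" if "finite S'" "S' \<subseteq> S" for y S'
    using that
  proof (induction S' rule: finite_induct)
    case (insert s S')
    have "openin T {z \<in> topspace T. k s z \<in> ball (k s y) (\<epsilon> / 2)}"
      by (rule openin_continuous_map_preimage[OF Cc_continuous[OF k]]) (use insert.prems in auto)
    moreover have "openin T {z \<in> topspace T. \<forall>s\<in>S'. k s z \<in> ball (k s y) (\<epsilon> / 2)}" using insert by simp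
    ultimately have "openin T ({z \<in> topspace T. k s z \<in> ball (k s y) (\<epsilon> / 2)}
        \<inter> {z \<in> topspace T. \<forall>s\<in>S'. k s z \<in> ball (k s y) (\<epsilon> / 2)})" by (rule openin_Int)
    moreover have "{z \<in> topspace T. k s z \<in> ball (k s y) (\<epsilon> / 2)}
        \<inter> {z \<in> topspace T. \<forall>s\<in>S'. k s z \<in> ball (k s y) (\<epsilon> / 2)}
      = {z \<in> topspace T. \<forall>s\<in>insert s S'. k s z \<in> ball (k s y) (\<epsilon> / 2)}" by auto
    ultimately show ?case by (simp only:)
  qed simp
  have V: "openin T (V y) \<and> y \<in> V y" if "y \<in> K" for y
    using openin_Int[OF open_units open_ball[OF S order_refl, of y]] that \<epsilon> units_subset
    by (auto simp: V_def K_def topspace_T)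
  from partition_of_unity_squares[OF locally_compact hausdorff K V]
  obtain F \<psi> L where P: "partition_of_squares T K V F \<psi> L" by blast
  note P' = partition_of_squaresD[OF P]
  have "\<forall>l\<in>F. \<exists>d. d \<in> D \<and> d \<in> V l"
  proof
    fix l assume "l \<in> F"
    then have "l \<in> K" using P'(2) by blast
    then show "\<exists>d. d \<in> D \<and> d \<in> V l" using V[of l] by (intro dense_in_meets[OF D, of _ l]) (auto simp: V_def)
  qed
  then obtain d where "\<forall>l\<in>F. d l \<in> D \<and> d l \<in> V l" unfolding bchoice_iff by (elim exE) (rule that)
  then have d: "\<And>l. l \<in> F \<Longrightarrow> d l \<in> D" "\<And>l. l \<in> F \<Longrightarrow> d l \<in> V l" by simp_all
  have in_V: "\<gamma> \<in> V l" if "l \<in> F" "\<psi> l \<gamma> \<noteq> 0" for l \<gamma> using P'(5)[OF that(1)] P'(6)[OF that(1), of \<gamma>] that(2) by blast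
  have approx: "cmod (k s \<gamma> - (\<Sum>l\<in>F. of_real ((\<psi> l \<gamma>)\<^sup>2) * k s (d l))) \<le> \<epsilon>" if s: "s \<in> S" for s \<gamma>
  proof -
    have "k s \<gamma> = (\<Sum>l\<in>F. of_real ((\<psi> l \<gamma>)\<^sup>2) * k s \<gamma>)"
      using fun_cong[OF partition_of_squares_split[OF P, of "k s"], of \<gamma>] k_off[OF s] by simp
    then have "cmod (k s \<gamma> - (\<Sum>l\<in>F. of_real ((\<psi> l \<gamma>)\<^sup>2) * k s (d l)))
        = cmod (\<Sum>l\<in>F. of_real ((\<psi> l \<gamma>)\<^sup>2) * (k s \<gamma> - k s (d l)))"
      by (simp add: right_diff_distrib sum_subtractf)
    also have "\<dots> \<le> (\<Sum>l\<in>F. (\<psi> l \<gamma>)\<^sup>2 * \<epsilon>)"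
    proof (rule sum_norm_le)
      fix l assume l: "l \<in> F"
      show "cmod (of_real ((\<psi> l \<gamma>)\<^sup>2) * (k s \<gamma> - k s (d l))) \<le> (\<psi> l \<gamma>)\<^sup>2 * \<epsilon>"
      proof (cases "\<psi> l \<gamma> = 0")
        case False
        have "dist (k s l) (k s \<gamma>) < \<epsilon> / 2" "dist (k s l) (k s (d l)) < \<epsilon> / 2"
          using in_V[OF l False] d(2)[OF l] s by (auto simp: V_def)
        then have "dist (k s \<gamma>) (k s (d l)) \<le> \<epsilon>"
          using dist_triangle3[of "k s \<gamma>" "k s (d l)" "k s l"] by linarith
        then show ?thesis by (simp add: norm_mult norm_power dist_norm mult_left_mono)
      qed simp
    qed
    also have "\<dots> \<le> 1 * \<epsilon>" unfolding sum_distrib_right[symmetric] using P'(9)[of \<gamma>] \<epsilon> by (intro mult_right_mono) auto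
    finally show ?thesis by simp
  qed
  have "(\<lambda>\<gamma>. complex_of_real (\<psi> l \<gamma>)) \<in> Cc G" if l: "l \<in> F" for l
    by (intro Cc_of_real CcI[OF P'(3)[OF l] P'(4)[OF l] P'(6)[OF l]])
  moreover have "\<psi> l \<gamma> = 0" if "l \<in> F" "\<gamma> \<notin> units G" for l \<gamma> using in_V[OF that(1), of \<gamma>] that(2) by (auto simp: V_def)
  ultimately show ?thesis
    using P'(1,9) d(1) approx by (intro exI[of _ F] exI[of _ \<psi>] exI[of _ d]) simp
qed

lemma convolution_source_sum:
  assumes \<delta>: "\<delta> \<in> arrows G" and Q: "finite Q" "Q \<subseteq> {\<eta> \<in> arrows G. gsrc G \<eta> = gsrc G \<delta>}"
    and zero: "\<And>\<eta>. \<eta> \<in> arrows G \<Longrightarrow> gsrc G \<eta> = gsrc G \<delta> \<Longrightarrow> \<eta> \<notin> Q \<Longrightarrow> g \<eta> = 0"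
  shows "convolution G f g \<delta> = (\<Sum>\<eta>\<in>Q. f (gcomp G \<delta> (ginv G \<eta>)) * g \<eta>)"
proof -
  have "convolution G f g \<delta> = (\<Sum>\<^sub>\<infinity>\<eta>\<in>{\<eta> \<in> arrows G. gsrc G \<eta> = gsrc G \<delta>}.
      f (gcomp G \<delta> (ginv G \<eta>)) * g (gcomp G (ginv G (gcomp G \<delta> (ginv G \<eta>))) \<delta>))"
    using infsum_reindex_bij_betw[OF source_fibre_quotient_bij[OF \<delta>], of "\<lambda>\<alpha>. f \<alpha> * g (gcomp G (ginv G \<alpha>) \<delta>)"] \<delta>
    by (simp add: convolution_def)
  also have "\<dots> = (\<Sum>\<^sub>\<infinity>\<eta>\<in>{\<eta> \<in> arrows G. gsrc G \<eta> = gsrc G \<delta>}. f (gcomp G \<delta> (ginv G \<eta>)) * g \<eta>)"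
  proof (rule infsum_cong)
    fix \<eta> assume "\<eta> \<in> {\<eta> \<in> arrows G. gsrc G \<eta> = gsrc G \<delta>}"
    then show "f (gcomp G \<delta> (ginv G \<eta>)) * g (gcomp G (ginv G (gcomp G \<delta> (ginv G \<eta>))) \<delta>) = f (gcomp G \<delta> (ginv G \<eta>)) * g \<eta>"
      using source_fibre_quotients(3)[OF \<delta> _ \<delta> refl, of \<eta>] cancel_right[OF \<delta>, of \<eta>] by simp
  qed
  also have "\<dots> = (\<Sum>\<eta>\<in>Q. f (gcomp G \<delta> (ginv G \<eta>)) * g \<eta>)"
    by (rule infsum_eq_sum_support[OF Q]) (use zero in simp)
  finally show ?thesis .
qed

text \<open>
  The coefficient \<open>\<gamma> \<mapsto> \<langle>\<lambda>\<^sub>\<gamma> \<xi>, \<xi>\<rangle>\<close> of the left regular representation, that is, the convolution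
  \<open>\<xi> * \<xi>\<^sup>*\<close>; such functions are of positive type.
\<close>

definition coefficient :: "('g \<Rightarrow> real) \<Rightarrow> 'g \<Rightarrow> real" where
  "coefficient \<xi> \<gamma> = (\<Sum>\<beta>\<in>{\<beta> \<in> range_fibre G (grng G \<gamma>). \<xi> \<beta> \<noteq> 0}. \<xi> \<beta> * \<xi> (gcomp G (ginv G \<gamma>) \<beta>))"

context
  fixes f :: "'g \<Rightarrow> complex" and K :: "'g set" and F :: "'g set" and B L :: "'g \<Rightarrow> 'g set" and \<phi> :: "'g \<Rightarrow> 'g \<Rightarrow> real"
  assumes f: "f \<in> Cc G" and B: "\<And>i. i \<in> F \<Longrightarrow> bisection (B i)" and P: "partition_of_squares T K B F \<phi> L"
begin

definition bump :: "'g \<Rightarrow> 'g \<Rightarrow> complex" where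
  "bump i \<gamma> = of_real (\<phi> i \<gamma>)"

text \<open>
  The matrix entries of the compression of \<open>f\<close> by the partition, as functions on the unit space.
\<close>

definition corner :: "'g \<Rightarrow> 'g \<Rightarrow> 'g \<Rightarrow> complex" where
  "corner i j = on_units (convolution G (involution G (bump i)) (convolution G f (bump j)))"

lemma bump_Cc: "i \<in> F \<Longrightarrow> bump i \<in> Cc G"
proof -
  assume i: "i \<in> F"
  note D = partition_of_squaresD[OF P]
  have "\<phi> i \<in> Cc G" by (rule CcI[OF D(3)[OF i] D(4)[OF i] D(6)[OF i]])
  then show ?thesis unfolding bump_def[abs_def] by (rule Cc_of_real)
qed

lemma bump_bisection: "i \<in> F \<Longrightarrow> \<gamma> \<notin> B i \<Longrightarrow> bump i \<gamma> = 0"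
  using partition_of_squaresD(5,6)[OF P] by (auto simp: bump_def)

lemma corner_Cc: "i \<in> F \<Longrightarrow> j \<in> F \<Longrightarrow> corner i j \<in> Cc G"
  unfolding corner_def by (intro on_units_Cc convolution_Cc involution_Cc bump_Cc f)

lemma corner_units: "\<gamma> \<notin> units G \<Longrightarrow> corner i j \<gamma> = 0"
  by (simp add: corner_def on_units_def)

lemma corner_eq_sum:
  assumes x: "x \<in> units G" and i: "i \<in> F" "j \<in> F" and Q: "finite Q" "Q \<subseteq> {\<delta> \<in> arrows G. gsrc G \<delta> = x}"
    and zero: "\<And>\<delta> l. \<delta> \<in> arrows G \<Longrightarrow> gsrc G \<delta> = x \<Longrightarrow> \<delta> \<notin> Q \<Longrightarrow> l \<in> {i, j} \<Longrightarrow> bump l \<delta> = 0"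
  shows "corner i j x = (\<Sum>\<delta>\<in>Q. \<Sum>\<eta>\<in>Q. bump i \<delta> * f (gcomp G \<delta> (ginv G \<eta>)) * bump j \<eta>)"
proof -
  note u = unitD[OF x]
  have "corner i j x = (\<Sum>\<delta>\<in>Q. cnj (bump i \<delta>) * convolution G f (bump j) (gcomp G \<delta> x))"
    unfolding corner_def on_units_def using x
    by (simp, intro star_convolution_eq_sum) (use u Q zero in auto)
  also have "\<dots> = (\<Sum>\<delta>\<in>Q. \<Sum>\<eta>\<in>Q. bump i \<delta> * f (gcomp G \<delta> (ginv G \<eta>)) * bump j \<eta>)"
  proof (rule sum.cong[OF refl])
    fix \<delta> assume "\<delta> \<in> Q"
    then have \<delta>: "\<delta> \<in> arrows G" "gsrc G \<delta> = x" using Q by auto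
    have "gcomp G \<delta> x = \<delta>" using comp_src[OF \<delta>(1)] \<delta>(2) by simp
    moreover have "convolution G f (bump j) \<delta> = (\<Sum>\<eta>\<in>Q. f (gcomp G \<delta> (ginv G \<eta>)) * bump j \<eta>)"
      by (rule convolution_source_sum[OF \<delta>(1) Q(1)]) (use Q(2) \<delta>(2) zero in auto)
    moreover have "cnj (bump i \<delta>) = bump i \<delta>" by (simp add: bump_def)
    ultimately show "cnj (bump i \<delta>) * convolution G f (bump j) (gcomp G \<delta> x) = (\<Sum>\<eta>\<in>Q. bump i \<delta> * f (gcomp G \<delta> (ginv G \<eta>)) * bump j \<eta>)"
      by (simp add: sum_distrib_left mult.assoc)
  qed
  finally show ?thesis .
qed

lemma bump_same_source:
  assumes "i \<in> F" "\<alpha> \<in> arrows G" "\<delta> \<in> arrows G" "gsrc G \<alpha> = gsrc G \<delta>" "bump i \<alpha> \<noteq> 0" "bump i \<delta> \<noteq> 0"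
  shows "\<alpha> = \<delta>"
  using bisectionD(1)[OF B[OF assms(1)], of \<alpha> \<delta>] bump_bisection[OF assms(1)] assms by blast

text \<open>
  The function \<open>bump i\<close> is supported in a bisection, so at most one arrow with source \<open>x\<close> contributes on either
  side, and the corner at \<open>x\<close> is a single value of \<open>f\<close> with weights.
\<close>

lemma corner_entry:
  assumes i: "i \<in> F" "j \<in> F" and \<alpha>: "\<alpha> \<in> arrows G" "gsrc G \<alpha> = x" and \<delta>: "\<delta> \<in> arrows G" "gsrc G \<delta> = x"
  shows "bump i \<alpha> * corner i j x * bump j \<delta> = (bump i \<alpha>)\<^sup>2 * f (gcomp G \<alpha> (ginv G \<delta>)) * (bump j \<delta>)\<^sup>2"
proof (cases "bump i \<alpha> = 0 \<or> bump j \<delta> = 0")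
  case False
  have x: "x \<in> units G" using src_unit[OF \<alpha>(1)] \<alpha>(2) by simp
  have zi: "bump i \<eta> = 0" if "\<eta> \<in> arrows G" "gsrc G \<eta> = x" "\<eta> \<noteq> \<alpha>" for \<eta>
  proof (rule ccontr)
    assume "bump i \<eta> \<noteq> 0"
    then have "\<alpha> = \<eta>" using False \<alpha>(2) that(2) by (intro bump_same_source[OF i(1) \<alpha>(1) that(1)]) simp_all
    then show False using that(3) by simp
  qed
  have zj: "bump j \<eta> = 0" if "\<eta> \<in> arrows G" "gsrc G \<eta> = x" "\<eta> \<noteq> \<delta>" for \<eta>
  proof (rule ccontr)
    assume "bump j \<eta> \<noteq> 0"
    then have "\<delta> = \<eta>" using False \<delta>(2) that(2) by (intro bump_same_source[OF i(2) \<delta>(1) that(1)]) simp_all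
    then show False using that(3) by simp
  qed
  have "corner i j x = (\<Sum>\<eta>\<in>{\<alpha>, \<delta>}. \<Sum>\<zeta>\<in>{\<alpha>, \<delta>}. bump i \<eta> * f (gcomp G \<eta> (ginv G \<zeta>)) * bump j \<zeta>)"
  proof (rule corner_eq_sum[OF x i])
    show "{\<alpha>, \<delta>} \<subseteq> {\<delta> \<in> arrows G. gsrc G \<delta> = x}" using \<alpha> \<delta> by simp
    show "bump l \<eta> = 0" if "\<eta> \<in> arrows G" "gsrc G \<eta> = x" "\<eta> \<notin> {\<alpha>, \<delta>}" "l \<in> {i, j}" for \<eta> l
      using zi[OF that(1,2)] zj[OF that(1,2)] that(3,4) by blast
  qed simp
  also have "\<dots> = bump i \<alpha> * f (gcomp G \<alpha> (ginv G \<delta>)) * bump j \<delta>"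
  proof (cases "\<alpha> = \<delta>")
    case False
    then show ?thesis using zi[OF \<delta>] zj[OF \<alpha>] by simp
  qed simp
  finally show ?thesis by (simp add: power2_eq_square)
qed auto

text \<open>
  The matrix of the corners at \<open>x\<close> is the compression of the regular representation of \<open>f\<close> by the
  map \<open>s \<mapsto> u s\<close> into \<open>\<ell>\<^sup>2\<close> of the source fibre, with \<open>(u s) \<delta> = \<Sum>\<^sub>i bump i \<delta> * s i\<close>. This is a
  contraction: the squares of the bumps have sum at most \<open>1\<close>, and each bump is nonzero at no more than one arrow
  of the fibre.
\<close>

lemma corner_form_bound:
  assumes x: "x \<in> units G" "periodic G x" "maximally_almost_periodic (isotropy G x)"
    and C: "finite_dim_bound CA f C" "0 \<le> C"
  shows "cmod (\<Sum>i\<in>F. \<Sum>j\<in>F. cnj (s i) * corner i j x * t j) \<le> C / 2 * ((\<Sum>i\<in>F. (cmod (s i))\<^sup>2) + (\<Sum>j\<in>F. (cmod (t j))\<^sup>2))"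
proof -
  note D = partition_of_squaresD[OF P]
  define Q where "Q = (\<Union>i\<in>F. {\<delta> \<in> arrows G. gsrc G \<delta> = x \<and> bump i \<delta> \<noteq> 0})"
  have Q: "finite Q" "Q \<subseteq> {\<delta> \<in> arrows G. gsrc G \<delta> = x}"
    unfolding Q_def using D(1) finite_source_fibre_support[OF bump_Cc] by auto
  define u where "u s \<delta> = (\<Sum>i\<in>F. bump i \<delta> * s i)" for s \<delta>
  have norm_u: "(\<Sum>\<delta>\<in>Q. (cmod (u s \<delta>))\<^sup>2) \<le> (\<Sum>i\<in>F. (cmod (s i))\<^sup>2)" for s
  proof -
    have "(\<Sum>\<delta>\<in>Q. (cmod (u s \<delta>))\<^sup>2) \<le> (\<Sum>\<delta>\<in>Q. \<Sum>i\<in>F. if bump i \<delta> \<noteq> 0 then (cmod (s i))\<^sup>2 else 0)"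
    proof (rule sum_mono)
      fix \<delta>
      have "cmod (u s \<delta>) \<le> (\<Sum>i\<in>F. \<phi> i \<delta> * (if bump i \<delta> \<noteq> 0 then cmod (s i) else 0))"
        unfolding u_def by (rule sum_norm_le) (use D(7) in \<open>auto simp: bump_def norm_mult\<close>)
      then have "(cmod (u s \<delta>))\<^sup>2 \<le> (\<Sum>i\<in>F. \<phi> i \<delta> * (if bump i \<delta> \<noteq> 0 then cmod (s i) else 0))\<^sup>2"
        by (simp add: power_mono)
      also have "\<dots> \<le> (\<Sum>i\<in>F. (\<phi> i \<delta>)\<^sup>2) * (\<Sum>i\<in>F. (if bump i \<delta> \<noteq> 0 then cmod (s i) else 0)\<^sup>2)"
        by (rule Cauchy_Schwarz_ineq_sum)
      also have "\<dots> \<le> 1 * (\<Sum>i\<in>F. (if bump i \<delta> \<noteq> 0 then cmod (s i) else 0)\<^sup>2)"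
        by (rule mult_right_mono[OF D(9)]) (auto intro: sum_nonneg)
      also have "\<dots> = (\<Sum>i\<in>F. if bump i \<delta> \<noteq> 0 then (cmod (s i))\<^sup>2 else 0)"
        unfolding mult_1 by (intro sum.cong refl) simp
      finally show "(cmod (u s \<delta>))\<^sup>2 \<le> (\<Sum>i\<in>F. if bump i \<delta> \<noteq> 0 then (cmod (s i))\<^sup>2 else 0)" .
    qed
    also have "\<dots> = (\<Sum>i\<in>F. \<Sum>\<delta>\<in>Q. if bump i \<delta> \<noteq> 0 then (cmod (s i))\<^sup>2 else 0)" by (rule sum.swap)
    also have "\<dots> \<le> (\<Sum>i\<in>F. (cmod (s i))\<^sup>2)"
    proof (rule sum_mono)
      fix i assume i: "i \<in> F"
      have "finite {\<delta> \<in> Q. bump i \<delta> \<noteq> 0}" using Q(1) by simp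
      moreover have "\<forall>\<alpha>\<in>{\<delta> \<in> Q. bump i \<delta> \<noteq> 0}. \<forall>\<delta>\<in>{\<delta> \<in> Q. bump i \<delta> \<noteq> 0}. \<alpha> = \<delta>"
      proof (intro ballI)
        fix \<alpha> \<delta> assume "\<alpha> \<in> {\<delta> \<in> Q. bump i \<delta> \<noteq> 0}" "\<delta> \<in> {\<delta> \<in> Q. bump i \<delta> \<noteq> 0}"
        then show "\<alpha> = \<delta>" using Q(2) bump_same_source[OF i, of \<alpha> \<delta>] by blast
      qed
      ultimately have "card {\<delta> \<in> Q. bump i \<delta> \<noteq> 0} \<le> 1" by (simp add: card_le_Suc0_iff_eq)
      then have "real (card {\<delta> \<in> Q. bump i \<delta> \<noteq> 0}) * (cmod (s i))\<^sup>2 \<le> 1 * (cmod (s i))\<^sup>2"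
        by (intro mult_right_mono) auto
      then show "(\<Sum>\<delta>\<in>Q. if bump i \<delta> \<noteq> 0 then (cmod (s i))\<^sup>2 else 0) \<le> (cmod (s i))\<^sup>2"
        using Q(1) by (simp add: sum.inter_filter[symmetric])
    qed
    finally show ?thesis .
  qed
  have "(\<Sum>i\<in>F. \<Sum>j\<in>F. cnj (s i) * corner i j x * t j)
      = (\<Sum>i\<in>F. \<Sum>j\<in>F. \<Sum>\<delta>\<in>Q. \<Sum>\<eta>\<in>Q. (cnj (s i) * bump i \<delta>) * f (gcomp G \<delta> (ginv G \<eta>)) * (bump j \<eta> * t j))"
  proof (intro sum.cong refl)
    fix i j assume ij: "i \<in> F" "j \<in> F"
    have "corner i j x = (\<Sum>\<delta>\<in>Q. \<Sum>\<eta>\<in>Q. bump i \<delta> * f (gcomp G \<delta> (ginv G \<eta>)) * bump j \<eta>)"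
      by (rule corner_eq_sum[OF x(1) ij Q]) (use ij in \<open>auto simp: Q_def\<close>)
    then show "cnj (s i) * corner i j x * t j
        = (\<Sum>\<delta>\<in>Q. \<Sum>\<eta>\<in>Q. (cnj (s i) * bump i \<delta>) * f (gcomp G \<delta> (ginv G \<eta>)) * (bump j \<eta> * t j))"
      by (simp add: sum_distrib_left sum_distrib_right mult.assoc)
  qed
  also have "\<dots> = (\<Sum>i\<in>F. \<Sum>\<delta>\<in>Q. \<Sum>\<eta>\<in>Q. \<Sum>j\<in>F. (cnj (s i) * bump i \<delta>) * f (gcomp G \<delta> (ginv G \<eta>)) * (bump j \<eta> * t j))"
  proof (rule sum.cong[OF refl])
    fix i
    have "(\<Sum>j\<in>F. \<Sum>\<delta>\<in>Q. \<Sum>\<eta>\<in>Q. (cnj (s i) * bump i \<delta>) * f (gcomp G \<delta> (ginv G \<eta>)) * (bump j \<eta> * t j))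
        = (\<Sum>\<delta>\<in>Q. \<Sum>j\<in>F. \<Sum>\<eta>\<in>Q. (cnj (s i) * bump i \<delta>) * f (gcomp G \<delta> (ginv G \<eta>)) * (bump j \<eta> * t j))"
      by (rule sum.swap)
    also have "\<dots> = (\<Sum>\<delta>\<in>Q. \<Sum>\<eta>\<in>Q. \<Sum>j\<in>F. (cnj (s i) * bump i \<delta>) * f (gcomp G \<delta> (ginv G \<eta>)) * (bump j \<eta> * t j))"
      by (rule sum.cong[OF refl]) (rule sum.swap)
    finally show "(\<Sum>j\<in>F. \<Sum>\<delta>\<in>Q. \<Sum>\<eta>\<in>Q. (cnj (s i) * bump i \<delta>) * f (gcomp G \<delta> (ginv G \<eta>)) * (bump j \<eta> * t j))
        = (\<Sum>\<delta>\<in>Q. \<Sum>\<eta>\<in>Q. \<Sum>j\<in>F. (cnj (s i) * bump i \<delta>) * f (gcomp G \<delta> (ginv G \<eta>)) * (bump j \<eta> * t j))" .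
  qed
  also have "\<dots> = (\<Sum>\<delta>\<in>Q. \<Sum>i\<in>F. \<Sum>\<eta>\<in>Q. \<Sum>j\<in>F. (cnj (s i) * bump i \<delta>) * f (gcomp G \<delta> (ginv G \<eta>)) * (bump j \<eta> * t j))"
    by (rule sum.swap)
  also have "\<dots> = (\<Sum>\<delta>\<in>Q. \<Sum>\<eta>\<in>Q. cnj (u s \<delta>) * u t \<eta> * f (gcomp G \<delta> (ginv G \<eta>)))"
  proof (rule sum.cong[OF refl])
    fix \<delta>
    have cu: "cnj (u s \<delta>) = (\<Sum>i\<in>F. cnj (s i) * bump i \<delta>)"
      unfolding u_def cnj_sum by (intro sum.cong refl) (simp add: bump_def)
    have "(\<Sum>i\<in>F. \<Sum>\<eta>\<in>Q. \<Sum>j\<in>F. (cnj (s i) * bump i \<delta>) * f (gcomp G \<delta> (ginv G \<eta>)) * (bump j \<eta> * t j))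
        = (\<Sum>\<eta>\<in>Q. \<Sum>i\<in>F. (cnj (s i) * bump i \<delta>) * f (gcomp G \<delta> (ginv G \<eta>)) * u t \<eta>)"
      unfolding u_def sum_distrib_left by (rule sum.swap)
    also have "\<dots> = (\<Sum>\<eta>\<in>Q. cnj (u s \<delta>) * u t \<eta> * f (gcomp G \<delta> (ginv G \<eta>)))"
      unfolding cu sum_distrib_right by (simp only: mult_ac)
    finally show "(\<Sum>i\<in>F. \<Sum>\<eta>\<in>Q. \<Sum>j\<in>F. (cnj (s i) * bump i \<delta>) * f (gcomp G \<delta> (ginv G \<eta>)) * (bump j \<eta> * t j))
        = (\<Sum>\<eta>\<in>Q. cnj (u s \<delta>) * u t \<eta> * f (gcomp G \<delta> (ginv G \<eta>)))" .
  qed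
  also have "cmod \<dots> \<le> C / 2 * ((\<Sum>\<delta>\<in>Q. (cmod (u s \<delta>))\<^sup>2) + (\<Sum>\<eta>\<in>Q. (cmod (u t \<eta>))\<^sup>2))"
    by (rule regular_form_bound[OF x f C Q])
  also have "\<dots> \<le> C / 2 * ((\<Sum>i\<in>F. (cmod (s i))\<^sup>2) + (\<Sum>j\<in>F. (cmod (t j))\<^sup>2))"
    using C(2) norm_u[of s] norm_u[of t] by (intro mult_left_mono add_mono) auto
  finally show ?thesis .
qed

context
  fixes \<xi> :: "'g \<Rightarrow> real" and c :: real
  assumes \<xi>: "\<xi> \<in> Cc G" "\<And>\<gamma>. 0 \<le> \<xi> \<gamma>" "\<And>\<gamma>. \<gamma> \<notin> K \<Longrightarrow> \<xi> \<gamma> = 0"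
    and c: "\<And>x Q. finite Q \<Longrightarrow> Q \<subseteq> range_fibre G x \<Longrightarrow> (\<Sum>\<beta>\<in>Q. (\<xi> \<beta>)\<^sup>2) \<le> c"
begin

definition piece :: "'g \<Rightarrow> 'g \<Rightarrow> complex" where
  "piece i \<gamma> = of_real (\<xi> \<gamma>) * bump i \<gamma>"

lemma piece_Cc: "i \<in> F \<Longrightarrow> piece i \<in> Cc G"
  unfolding piece_def[abs_def] by (intro Cc_mult Cc_continuous[OF Cc_of_real[OF \<xi>(1)]] bump_Cc)

lemma c_nonneg: "0 \<le> c"
  using c[of "{}" undefined] by simp

lemma bump_sum_squares: "\<xi> \<gamma> \<noteq> 0 \<Longrightarrow> (\<Sum>i\<in>F. (bump i \<gamma>)\<^sup>2) = 1"
proof -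
  assume "\<xi> \<gamma> \<noteq> 0"
  then have "\<gamma> \<in> K" using \<xi>(3) by blast
  then have "complex_of_real (\<Sum>i\<in>F. (\<phi> i \<gamma>)\<^sup>2) = 1" using partition_of_squaresD(8)[OF P] by simp
  then show ?thesis by (simp add: bump_def)
qed

text \<open>
  The pointwise product of \<open>f\<close> with the positive type function \<open>\<xi> * \<xi>\<^sup>*\<close> factors through the matrix of
  corners. At \<open>\<gamma>\<close> the convolution on the right is a sum over \<open>\<gamma> = \<alpha> \<delta>\<inverse>\<close>, to which the corner
  contributes \<open>f(\<alpha> \<delta>\<inverse>) = f(\<gamma>)\<close>; the bumps enter through their squares, which add up to \<open>1\<close>.
\<close>

lemma product_factorisation:
  "(\<lambda>\<gamma>. of_real (coefficient \<xi> \<gamma>) * f \<gamma>)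
    = (\<lambda>\<gamma>. \<Sum>i\<in>F. \<Sum>j\<in>F. convolution G (piece i) (convolution G (corner i j) (involution G (piece j))) \<gamma>)"
proof
  fix \<gamma>
  show "of_real (coefficient \<xi> \<gamma>) * f \<gamma>
    = (\<Sum>i\<in>F. \<Sum>j\<in>F. convolution G (piece i) (convolution G (corner i j) (involution G (piece j))) \<gamma>)"
  proof (cases "\<gamma> \<in> arrows G")
    case False
    then show ?thesis using Cc_outside[OF f] by (simp add: convolution_outside)
  next
    case \<gamma>: True
    note iv = inv_closed src_inv rng_inv
    define Q where "Q = {\<beta> \<in> range_fibre G (grng G \<gamma>). \<xi> \<beta> \<noteq> 0}"
    have Q: "finite Q" "Q \<subseteq> range_fibre G (grng G \<gamma>)" unfolding Q_def using finite_range_fibre_support[OF \<xi>(1)] by auto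
    let ?d = "\<lambda>\<alpha>. gcomp G (ginv G \<gamma>) \<alpha>"
    have Qa: "\<alpha> \<in> arrows G" "grng G \<alpha> = grng G \<gamma>" "\<xi> \<alpha> \<noteq> 0" if "\<alpha> \<in> Q" for \<alpha>
      using that by (simp_all add: Q_def range_fibre_iff)
    have d: "?d \<alpha> \<in> arrows G" "gsrc G (?d \<alpha>) = gsrc G \<alpha>" if "\<alpha> \<in> Q" for \<alpha>
      using inv_comp_arrow[OF \<gamma> Qa(1)[OF that]] Qa(2)[OF that] by simp_all
    have summand: "convolution G (piece i) (convolution G (corner i j) (involution G (piece j))) \<gamma>
        = (\<Sum>\<alpha>\<in>Q. of_real (\<xi> \<alpha> * \<xi> (?d \<alpha>)) * f \<gamma> * ((bump i \<alpha>)\<^sup>2 * (bump j (?d \<alpha>))\<^sup>2))" if ij: "i \<in> F" "j \<in> F" for i j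
    proof -
      have "convolution G (piece i) (convolution G (corner i j) (involution G (piece j))) \<gamma>
          = (\<Sum>\<alpha>\<in>Q. piece i \<alpha> * convolution G (corner i j) (involution G (piece j)) (gcomp G (ginv G \<alpha>) \<gamma>))"
        by (rule convolution_eq_sum[OF \<gamma> Q]) (auto simp: Q_def piece_def)
      also have "\<dots> = (\<Sum>\<alpha>\<in>Q. of_real (\<xi> \<alpha> * \<xi> (?d \<alpha>)) * f \<gamma> * ((bump i \<alpha>)\<^sup>2 * (bump j (?d \<alpha>))\<^sup>2))"
      proof (rule sum.cong[OF refl])
        fix \<alpha> assume \<alpha>: "\<alpha> \<in> Q"
        let ?e = "gcomp G (ginv G \<alpha>) \<gamma>"
        have e: "?e \<in> arrows G" "grng G ?e = gsrc G \<alpha>" using inv_comp_arrow[OF Qa(1)[OF \<alpha>] \<gamma>] Qa(2)[OF \<alpha>] by simp_all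
        have einv: "ginv G ?e = ?d \<alpha>"
          using inv_of_comp[of "ginv G \<alpha>" \<gamma>] Qa[OF \<alpha>] \<gamma> by (simp add: iv inv_inv)
        have "convolution G (corner i j) (involution G (piece j)) ?e = corner i j (gsrc G \<alpha>) * involution G (piece j) ?e"
          using convolution_units_left[of "corner i j" ?e "involution G (piece j)"] corner_units e by simp
        also have "involution G (piece j) ?e = of_real (\<xi> (?d \<alpha>)) * bump j (?d \<alpha>)"
          using e(1) einv by (simp add: involution_def piece_def bump_def)
        finally have ce: "convolution G (corner i j) (involution G (piece j)) ?e
            = corner i j (gsrc G \<alpha>) * (of_real (\<xi> (?d \<alpha>)) * bump j (?d \<alpha>))" .
        have "piece i \<alpha> * convolution G (corner i j) (involution G (piece j)) ?e
            = of_real (\<xi> \<alpha> * \<xi> (?d \<alpha>)) * (bump i \<alpha> * corner i j (gsrc G \<alpha>) * bump j (?d \<alpha>))"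
          unfolding ce piece_def[of i \<alpha>] by simp
        also have "bump i \<alpha> * corner i j (gsrc G \<alpha>) * bump j (?d \<alpha>)
            = (bump i \<alpha>)\<^sup>2 * f (gcomp G \<alpha> (ginv G (?d \<alpha>))) * (bump j (?d \<alpha>))\<^sup>2"
          by (rule corner_entry[OF ij Qa(1)[OF \<alpha>] refl d[OF \<alpha>]])
        also have "ginv G (?d \<alpha>) = ?e" using inv_of_comp[of "ginv G \<gamma>" \<alpha>] Qa[OF \<alpha>] \<gamma> by (simp add: iv inv_inv)
        also have "gcomp G \<alpha> ?e = \<gamma>" using cancel_left[OF Qa(1)[OF \<alpha>] \<gamma>] Qa(2)[OF \<alpha>] by simp
        finally show "piece i \<alpha> * convolution G (corner i j) (involution G (piece j)) ?e
            = of_real (\<xi> \<alpha> * \<xi> (?d \<alpha>)) * f \<gamma> * ((bump i \<alpha>)\<^sup>2 * (bump j (?d \<alpha>))\<^sup>2)" by (simp add: mult_ac)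
      qed
      finally show ?thesis .
    qed
    have "(\<Sum>i\<in>F. \<Sum>j\<in>F. convolution G (piece i) (convolution G (corner i j) (involution G (piece j))) \<gamma>)
        = (\<Sum>i\<in>F. \<Sum>j\<in>F. \<Sum>\<alpha>\<in>Q. of_real (\<xi> \<alpha> * \<xi> (?d \<alpha>)) * f \<gamma> * ((bump i \<alpha>)\<^sup>2 * (bump j (?d \<alpha>))\<^sup>2))"
      by (intro sum.cong refl) (simp add: summand)
    also have "\<dots> = (\<Sum>i\<in>F. \<Sum>\<alpha>\<in>Q. \<Sum>j\<in>F. of_real (\<xi> \<alpha> * \<xi> (?d \<alpha>)) * f \<gamma> * ((bump i \<alpha>)\<^sup>2 * (bump j (?d \<alpha>))\<^sup>2))"
      by (rule sum.cong[OF refl]) (rule sum.swap)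
    also have "\<dots> = (\<Sum>\<alpha>\<in>Q. \<Sum>i\<in>F. \<Sum>j\<in>F. of_real (\<xi> \<alpha> * \<xi> (?d \<alpha>)) * f \<gamma> * ((bump i \<alpha>)\<^sup>2 * (bump j (?d \<alpha>))\<^sup>2))"
      by (rule sum.swap)
    also have "\<dots> = (\<Sum>\<alpha>\<in>Q. of_real (\<xi> \<alpha> * \<xi> (?d \<alpha>)) * f \<gamma>)"
    proof (rule sum.cong[OF refl])
      fix \<alpha> assume \<alpha>: "\<alpha> \<in> Q"
      have "(\<Sum>i\<in>F. \<Sum>j\<in>F. of_real (\<xi> \<alpha> * \<xi> (?d \<alpha>)) * f \<gamma> * ((bump i \<alpha>)\<^sup>2 * (bump j (?d \<alpha>))\<^sup>2))
          = of_real (\<xi> \<alpha> * \<xi> (?d \<alpha>)) * f \<gamma> * ((\<Sum>i\<in>F. (bump i \<alpha>)\<^sup>2) * (\<Sum>j\<in>F. (bump j (?d \<alpha>))\<^sup>2))"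
        by (subst sum_product) (simp only: sum_distrib_left)
      then show "(\<Sum>i\<in>F. \<Sum>j\<in>F. of_real (\<xi> \<alpha> * \<xi> (?d \<alpha>)) * f \<gamma> * ((bump i \<alpha>)\<^sup>2 * (bump j (?d \<alpha>))\<^sup>2))
          = of_real (\<xi> \<alpha> * \<xi> (?d \<alpha>)) * f \<gamma>"
        using bump_sum_squares[OF Qa(3)[OF \<alpha>]] bump_sum_squares[of "?d \<alpha>"] by (cases "\<xi> (?d \<alpha>) = 0") simp_all
    qed
    also have "\<dots> = of_real (coefficient \<xi> \<gamma>) * f \<gamma>"
      by (simp add: coefficient_def Q_def sum_distrib_right)
    finally show ?thesis ..
  qed
qed

text \<open>
  The sum of the \<open>p\<^sub>i * p\<^sub>i\<^sup>*\<close> over the pieces \<open>p\<^sub>i\<close> is the function on the unit space that sends \<open>x\<close> to the sum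
  of the \<open>\<xi>(\<beta>)\<^sup>2\<close> over the range fibre of \<open>x\<close>.
\<close>

lemma piece_row_bound:
  assumes \<pi>: "hilbert_representation CA I \<pi>" and v: "v \<in> ell2 I" "ell2_norm I v \<le> 1"
  shows "(\<Sum>i\<in>F. (ell2_norm I (\<pi> (involution G (piece i)) v))\<^sup>2) \<le> c"
proof -
  let ?e = "\<lambda>i. convolution G (piece i) (involution G (piece i))"
  have e: "?e i \<in> Cc G" if "i \<in> F" for i using that by (intro convolution_Cc involution_Cc piece_Cc)
  let ?E = "\<lambda>\<gamma>. \<Sum>i\<in>F. ?e i \<gamma>"
  have E: "?E \<in> Cc G" by (rule Cc_sum[OF e])
  have piece_B: "piece i \<gamma> = 0" if "i \<in> F" "\<gamma> \<notin> B i" for i \<gamma> using bump_bisection[OF that] by (simp add: piece_def)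
  have e0: "?e i \<gamma> = 0" if i: "i \<in> F" and \<gamma>: "\<gamma> \<notin> units G" for i \<gamma>
  proof (cases "\<gamma> \<in> arrows G \<and> grng G \<gamma> \<in> grng G ` B i")
    case False
    then show ?thesis
    proof (cases "\<gamma> \<in> arrows G")
      case ga: True
      then have "grng G \<gamma> \<notin> grng G ` B i" using False by simp
      then show ?thesis by (intro convolution_bisection(2)[OF B[OF i] _ ga]) (simp_all add: piece_B i)
    qed (rule convolution_outside)
  next
    case True
    then have ga: "\<gamma> \<in> arrows G" and "grng G \<gamma> \<in> grng G ` B i" by simp_all
    then obtain \<beta> where "\<beta> \<in> B i" "grng G \<gamma> = grng G \<beta>" by (elim imageE) (rule that)
    then have \<beta>: "\<beta> \<in> B i" "grng G \<beta> = grng G \<gamma>" by simp_all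
    have ba: "\<beta> \<in> arrows G" by (rule subsetD[OF bisection_subset[OF B[OF i]] \<beta>(1)])
    let ?\<delta> = "gcomp G (ginv G \<beta>) \<gamma>"
    note ib = inv_comp_arrow[OF ba ga \<beta>(2)]
    have id: "ginv G ?\<delta> \<in> arrows G" "gsrc G (ginv G ?\<delta>) = gsrc G \<beta>" using ib by (simp_all add: inv_closed src_inv)
    have "ginv G ?\<delta> \<notin> B i"
    proof
      assume "ginv G ?\<delta> \<in> B i"
      then have "ginv G ?\<delta> = \<beta>" by (rule bisectionD(1)[OF B[OF i] _ \<beta>(1) id(2)])
      then have "?\<delta> = ginv G \<beta>" using inv_inv[OF ib(1)] by simp
      then have "gcomp G \<beta> ?\<delta> = grng G \<beta>" using comp_inv[OF ba] by simp
      then have "\<gamma> = grng G \<beta>" using cancel_left[OF ba ga \<beta>(2)] by simp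
      then show False using \<gamma> rng_unit[OF ba] by simp
    qed
    then have "involution G (piece i) ?\<delta> = 0" using ib(1) piece_B[OF i] by (simp add: involution_def)
    then show ?thesis
      using convolution_bisection(1)[where a="piece i" and g="involution G (piece i)", OF B[OF i] piece_B[OF i] ga \<beta>] by simp
  qed
  have Ebound: "cmod (?E \<gamma>) \<le> c" for \<gamma>
  proof (cases "\<gamma> \<in> units G")
    case False
    then show ?thesis using e0 c_nonneg by simp
  next
    case x: True
    note u = unitD[OF x]
    define Q where "Q = {\<beta> \<in> range_fibre G (grng G \<gamma>). \<xi> \<beta> \<noteq> 0}"
    have Q: "finite Q" "Q \<subseteq> range_fibre G (grng G \<gamma>)" unfolding Q_def using finite_range_fibre_support[OF \<xi>(1)] by auto
    have "?e i \<gamma> = (\<Sum>\<alpha>\<in>Q. of_real ((\<xi> \<alpha>)\<^sup>2) * (bump i \<alpha>)\<^sup>2)" if i: "i \<in> F" for i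
    proof -
      have "?e i \<gamma> = (\<Sum>\<alpha>\<in>Q. piece i \<alpha> * involution G (piece i) (gcomp G (ginv G \<alpha>) \<gamma>))"
        by (rule convolution_eq_sum[OF _ Q]) (use u in \<open>auto simp: Q_def piece_def\<close>)
      also have "\<dots> = (\<Sum>\<alpha>\<in>Q. of_real ((\<xi> \<alpha>)\<^sup>2) * (bump i \<alpha>)\<^sup>2)"
      proof (rule sum.cong[OF refl])
        fix \<alpha> assume "\<alpha> \<in> Q"
        then have \<alpha>: "\<alpha> \<in> arrows G" "grng G \<alpha> = \<gamma>" using Q(2) u by (auto simp: range_fibre_iff)
        have "gcomp G (ginv G \<alpha>) \<gamma> = ginv G \<alpha>"
          using comp_src[of "ginv G \<alpha>"] \<alpha> by (simp add: inv_closed src_inv)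
        then show "piece i \<alpha> * involution G (piece i) (gcomp G (ginv G \<alpha>) \<gamma>) = of_real ((\<xi> \<alpha>)\<^sup>2) * (bump i \<alpha>)\<^sup>2"
          using \<alpha> by (simp add: involution_def inv_closed inv_inv piece_def bump_def power2_eq_square)
      qed
      finally show ?thesis .
    qed
    then have "?E \<gamma> = (\<Sum>i\<in>F. \<Sum>\<alpha>\<in>Q. of_real ((\<xi> \<alpha>)\<^sup>2) * (bump i \<alpha>)\<^sup>2)"
      by (intro sum.cong refl)
    also have "\<dots> = (\<Sum>\<alpha>\<in>Q. \<Sum>i\<in>F. of_real ((\<xi> \<alpha>)\<^sup>2) * (bump i \<alpha>)\<^sup>2)"
      by (rule sum.swap)
    also have "\<dots> = (\<Sum>\<alpha>\<in>Q. of_real ((\<xi> \<alpha>)\<^sup>2))"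
      unfolding sum_distrib_left[symmetric] by (intro sum.cong refl) (simp add: bump_sum_squares Q_def)
    finally have "?E \<gamma> = of_real (\<Sum>\<alpha>\<in>Q. (\<xi> \<alpha>)\<^sup>2)" by simp
    then have "cmod (?E \<gamma>) = \<bar>\<Sum>\<alpha>\<in>Q. (\<xi> \<alpha>)\<^sup>2\<bar>" by (simp only: norm_of_real)
    then show ?thesis using c[OF Q] by (simp add: sum_nonneg)
  qed
  have "(\<Sum>i\<in>F. (ell2_norm I (\<pi> (involution G (piece i)) v))\<^sup>2) \<le> c * (ell2_norm I v)\<^sup>2"
  proof (rule row_bound[OF \<pi> involution_Cc[OF piece_Cc] v(1)])
    have eq: "(\<Sum>i\<in>F. convolution G (involution G (involution G (piece i))) (involution G (piece i)) \<gamma>) = ?E \<gamma>" for \<gamma>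
      by (rule sum.cong[OF refl]) (simp add: involution_involution piece_Cc)
    show "(\<Sum>i\<in>F. convolution G (involution G (involution G (piece i))) (involution G (piece i)) \<gamma>) = 0" if "\<gamma> \<notin> units G" for \<gamma>
      unfolding eq using e0 that by simp
    show "cmod (\<Sum>i\<in>F. convolution G (involution G (involution G (piece i))) (involution G (piece i)) \<gamma>) \<le> c" for \<gamma>
      unfolding eq by (rule Ebound)
  qed
  also have "\<dots> \<le> c * 1"
    using v(2) c_nonneg by (intro mult_left_mono) (simp_all add: power_le_one_iff)
  finally show ?thesis by simp
qed

text \<open>
  After sampling the corners at points of \<open>D\<close>, each term of the partition sees a single matrix of
  corners, which is bounded by the finite-dimensional representations.
\<close>

lemma compressed_product_bound:
  assumes D: "dense_in (unit_space G) D"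
      "\<And>x. x \<in> D \<Longrightarrow> x \<in> units G \<and> periodic G x \<and> maximally_almost_periodic (isotropy G x)"
    and C: "finite_dim_bound CA f C" "0 \<le> C" and \<pi>: "hilbert_representation CA I \<pi>"
    and v: "v \<in> ell2 I" "ell2_norm I v \<le> 1" and w: "w \<in> ell2 I" "ell2_norm I w \<le> 1"
  shows "cmod (ell2_inner I w (\<pi> (\<lambda>\<gamma>. of_real (coefficient \<xi> \<gamma>) * f \<gamma>) v)) \<le> C * c"
proof -
  note R = hilbert_representationD[OF \<pi>, simplified]
  note PD = partition_of_squaresD[OF P]
  let ?g = "\<lambda>\<gamma>. of_real (coefficient \<xi> \<gamma>) * f \<gamma>"
  let ?s = "\<lambda>i. involution G (piece i)"
  define W where "W i = \<pi> (?s i) w" for i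
  define V where "V i = \<pi> (?s i) v" for i
  have s: "?s i \<in> Cc G" if "i \<in> F" for i by (rule involution_Cc[OF piece_Cc[OF that]])
  have WV: "W i \<in> ell2 I" "V i \<in> ell2 I" if "i \<in> F" for i
    using R(6)[OF s[OF that] w(1)] R(6)[OF s[OF that] v(1)] by (simp_all add: W_def V_def)
  have Wsum: "(\<Sum>i\<in>F. (ell2_norm I (W i))\<^sup>2) \<le> c" and Vsum: "(\<Sum>i\<in>F. (ell2_norm I (V i))\<^sup>2) \<le> c"
    unfolding W_def V_def using piece_row_bound[OF \<pi> w] piece_row_bound[OF \<pi> v] by simp_all
  have nWV: "ell2_norm I (W i) * ell2_norm I (V j) \<le> c" if ij: "i \<in> F" "j \<in> F" for i j
  proof -
    have "(ell2_norm I (W i))\<^sup>2 \<le> (\<Sum>i\<in>F. (ell2_norm I (W i))\<^sup>2)" "(ell2_norm I (V j))\<^sup>2 \<le> (\<Sum>i\<in>F. (ell2_norm I (V i))\<^sup>2)"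
      using ij PD(1) by (intro member_le_sum; simp)+
    then show ?thesis
      using Wsum Vsum sum_squares_bound[of "ell2_norm I (W i)" "ell2_norm I (V j)"] by linarith
  qed
  let ?t = "\<lambda>i j. convolution G (piece i) (convolution G (corner i j) (?s j))"
  have kj: "convolution G (corner i j) (?s j) \<in> Cc G" and tij: "?t i j \<in> Cc G" if "i \<in> F" "j \<in> F" for i j
    using that by (intro convolution_Cc piece_Cc corner_Cc s; simp)+
  have "\<pi> ?g v = (\<lambda>m. \<Sum>i\<in>F. \<Sum>j\<in>F. \<pi> (?t i j) v m)"
  proof -
    have "\<pi> ?g v = (\<lambda>m. \<Sum>i\<in>F. \<pi> (\<lambda>\<gamma>. \<Sum>j\<in>F. ?t i j \<gamma>) v m)"
      unfolding product_factorisation by (rule rep_sum[OF \<pi> _ v(1)]) (intro Cc_sum tij)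
    also have "\<dots> = (\<lambda>m. \<Sum>i\<in>F. \<Sum>j\<in>F. \<pi> (?t i j) v m)"
    proof
      fix m
      show "(\<Sum>i\<in>F. \<pi> (\<lambda>\<gamma>. \<Sum>j\<in>F. ?t i j \<gamma>) v m) = (\<Sum>i\<in>F. \<Sum>j\<in>F. \<pi> (?t i j) v m)"
        by (rule sum.cong[OF refl]) (simp add: rep_sum[OF \<pi> tij v(1)])
    qed
    finally show ?thesis .
  qed
  then have "ell2_inner I w (\<pi> ?g v) = (\<Sum>i\<in>F. ell2_inner I w (\<lambda>m. \<Sum>j\<in>F. \<pi> (?t i j) v m))"
    using R(6)[OF tij v(1)] by (simp add: ell2_inner_sum_right[OF w(1)] ell2_sum)
  also have "\<dots> = (\<Sum>i\<in>F. \<Sum>j\<in>F. ell2_inner I w (\<pi> (?t i j) v))"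
    by (rule sum.cong[OF refl]) (simp add: ell2_inner_sum_right[OF w(1)] R(6)[OF tij v(1)])
  also have "\<dots> = (\<Sum>i\<in>F. \<Sum>j\<in>F. ell2_inner I (W i) (\<pi> (corner i j) (V j)))"
  proof (intro sum.cong refl)
    fix i j assume ij: "i \<in> F" "j \<in> F"
    have "\<pi> (?t i j) v = \<pi> (piece i) (\<pi> (corner i j) (V j))"
      using R(4)[OF piece_Cc[OF ij(1)] kj[OF ij] v(1)] R(4)[OF corner_Cc[OF ij] s[OF ij(2)] v(1)] by (simp add: V_def)
    then show "ell2_inner I w (\<pi> (?t i j) v) = ell2_inner I (W i) (\<pi> (corner i j) (V j))"
      using R(5)[OF piece_Cc[OF ij(1)] w(1) R(6)[OF corner_Cc[OF ij] WV(2)[OF ij(2)]]] by (simp add: W_def)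
  qed
  finally have expand: "ell2_inner I w (\<pi> ?g v) = (\<Sum>i\<in>F. \<Sum>j\<in>F. ell2_inner I (W i) (\<pi> (corner i j) (V j)))" .
  \<comment> \<open>The corners are replaced by their samples at points \<open>d l\<close> of \<open>D\<close>, up to \<open>\<epsilon>\<close> in supremum norm.\<close>
  have approx: "cmod (\<Sum>i\<in>F. \<Sum>j\<in>F. ell2_inner I (W i) (\<pi> (corner i j) (V j))) \<le> C * c + \<epsilon> * (real (card F) * (real (card F) * c))"
    if \<epsilon>: "0 < \<epsilon>" for \<epsilon>
  proof -
    have fin: "finite (F \<times> F)" using PD(1) by simp
    have "\<exists>F' (\<psi> :: 'g \<Rightarrow> 'g \<Rightarrow> real) d. finite F' \<and>
      (\<forall>l\<in>F'. (\<lambda>\<gamma>. complex_of_real (\<psi> l \<gamma>)) \<in> Cc G \<and> (\<forall>\<gamma>. \<gamma> \<notin> units G \<longrightarrow> \<psi> l \<gamma> = 0) \<and> d l \<in> D) \<and>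
      (\<forall>\<gamma>. (\<Sum>l\<in>F'. (\<psi> l \<gamma>)\<^sup>2) \<le> 1) \<and>
      (\<forall>s\<in>F \<times> F. \<forall>\<gamma>. cmod (corner (fst s) (snd s) \<gamma> - (\<Sum>l\<in>F'. of_real ((\<psi> l \<gamma>)\<^sup>2) * corner (fst s) (snd s) (d l))) \<le> \<epsilon>)"
      by (rule dense_sampling[OF D(1) fin _ _ \<epsilon>]) (auto simp: corner_Cc corner_units)
    then obtain F' and \<psi> :: "'g \<Rightarrow> 'g \<Rightarrow> real" and d where "finite F' \<and>
      (\<forall>l\<in>F'. (\<lambda>\<gamma>. complex_of_real (\<psi> l \<gamma>)) \<in> Cc G \<and> (\<forall>\<gamma>. \<gamma> \<notin> units G \<longrightarrow> \<psi> l \<gamma> = 0) \<and> d l \<in> D) \<and>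
      (\<forall>\<gamma>. (\<Sum>l\<in>F'. (\<psi> l \<gamma>)\<^sup>2) \<le> 1) \<and>
      (\<forall>s\<in>F \<times> F. \<forall>\<gamma>. cmod (corner (fst s) (snd s) \<gamma> - (\<Sum>l\<in>F'. of_real ((\<psi> l \<gamma>)\<^sup>2) * corner (fst s) (snd s) (d l))) \<le> \<epsilon>)"
      by (elim exE) (rule that)
    then have F': "finite F'" and \<psi>C: "\<And>l. l \<in> F' \<Longrightarrow> (\<lambda>\<gamma>. complex_of_real (\<psi> l \<gamma>)) \<in> Cc G"
      and \<psi>0: "\<And>l \<gamma>. l \<in> F' \<Longrightarrow> \<gamma> \<notin> units G \<Longrightarrow> \<psi> l \<gamma> = 0" and dD: "\<And>l. l \<in> F' \<Longrightarrow> d l \<in> D"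
      and \<psi>1: "\<And>\<gamma>. (\<Sum>l\<in>F'. (\<psi> l \<gamma>)\<^sup>2) \<le> 1"
      and close: "\<And>i j \<gamma>. i \<in> F \<Longrightarrow> j \<in> F \<Longrightarrow>
        cmod (corner i j \<gamma> - (\<Sum>l\<in>F'. of_real ((\<psi> l \<gamma>)\<^sup>2) * corner i j (d l))) \<le> \<epsilon>"
      by (simp_all add: Ball_def)
    define p where "p l \<gamma> = complex_of_real (\<psi> l \<gamma>)" for l \<gamma>
    have p: "p l \<in> Cc G" "involution G (p l) = p l" if "l \<in> F'" for l
      using \<psi>C[OF that] \<psi>0[OF that] by (auto simp: p_def[abs_def] intro!: involution_units_real)
    have pp: "convolution G (p l) (p l) \<gamma> = of_real ((\<psi> l \<gamma>)\<^sup>2)" if "l \<in> F'" for l \<gamma>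
      using convolution_units[of "p l" "p l" \<gamma>] \<psi>0[OF that] by (simp add: p_def power2_eq_square)
    have ppC: "convolution G (p l) (p l) \<in> Cc G" if "l \<in> F'" for l by (intro convolution_Cc p that)
    have pin: "\<pi> (p l) u \<in> ell2 I" if "l \<in> F'" "u \<in> ell2 I" for l u by (rule R(6)[OF p(1)[OF that(1)] that(2)])
    have prow: "(\<Sum>l\<in>F'. (ell2_norm I (\<pi> (p l) u))\<^sup>2) \<le> (ell2_norm I u)\<^sup>2" if u: "u \<in> ell2 I" for u
    proof -
      have eq: "(\<Sum>l\<in>F'. convolution G (involution G (p l)) (p l) \<gamma>) = of_real (\<Sum>l\<in>F'. (\<psi> l \<gamma>)\<^sup>2)" for \<gamma>
        unfolding of_real_sum by (rule sum.cong[OF refl]) (simp only: p(2) pp)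
      have "(\<Sum>l\<in>F'. (ell2_norm I (\<pi> (p l) u))\<^sup>2) \<le> 1 * (ell2_norm I u)\<^sup>2"
      proof (rule row_bound[OF \<pi> p(1) u])
        show "(\<Sum>l\<in>F'. convolution G (involution G (p l)) (p l) \<gamma>) = 0" if "\<gamma> \<notin> units G" for \<gamma>
          unfolding eq using \<psi>0 that by simp
        have "\<bar>\<Sum>l\<in>F'. (\<psi> l \<gamma>)\<^sup>2\<bar> \<le> 1" for \<gamma> using \<psi>1[of \<gamma>] by (simp add: sum_nonneg)
        then show "cmod (\<Sum>l\<in>F'. convolution G (involution G (p l)) (p l) \<gamma>) \<le> 1" for \<gamma>
          unfolding eq norm_of_real .
      qed
      then show ?thesis by simp
    qed
    let ?\<kappa> = "\<lambda>i j \<gamma>. \<Sum>l\<in>F'. corner i j (d l) * convolution G (p l) (p l) \<gamma>"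
    have \<kappa>C: "?\<kappa> i j \<in> Cc G" for i j by (intro Cc_sum Cc_scale ppC)
    have split: "ell2_inner I (W i) (\<pi> (corner i j) (V j))
        = ell2_inner I (W i) (\<pi> (\<lambda>\<gamma>. corner i j \<gamma> + (-1) * ?\<kappa> i j \<gamma>) (V j))
          + (\<Sum>l\<in>F'. corner i j (d l) * ell2_inner I (\<pi> (p l) (W i)) (\<pi> (p l) (V j)))" if ij: "i \<in> F" "j \<in> F" for i j
    proof -
      note kC = corner_Cc[OF ij]
      have mC: "(\<lambda>\<gamma>. corner i j \<gamma> + (-1) * ?\<kappa> i j \<gamma>) \<in> Cc G" by (intro Cc_add kC Cc_scale \<kappa>C)
      note Vj = WV(2)[OF ij(2)] and Wi = WV(1)[OF ij(1)]
      have "corner i j = (\<lambda>\<gamma>. (corner i j \<gamma> + (-1) * ?\<kappa> i j \<gamma>) + ?\<kappa> i j \<gamma>)" by simp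
      then have "\<pi> (corner i j) (V j) = \<pi> (\<lambda>\<gamma>. (corner i j \<gamma> + (-1) * ?\<kappa> i j \<gamma>) + ?\<kappa> i j \<gamma>) (V j)" by (rule arg_cong)
      also have "\<dots> = (\<lambda>m. \<pi> (\<lambda>\<gamma>. corner i j \<gamma> + (-1) * ?\<kappa> i j \<gamma>) (V j) m + \<pi> (?\<kappa> i j) (V j) m)"
        by (rule R(2)[OF mC \<kappa>C Vj])
      finally have "ell2_inner I (W i) (\<pi> (corner i j) (V j))
          = ell2_inner I (W i) (\<pi> (\<lambda>\<gamma>. corner i j \<gamma> + (-1) * ?\<kappa> i j \<gamma>) (V j)) + ell2_inner I (W i) (\<pi> (?\<kappa> i j) (V j))"
        using ell2_inner_add_right[OF Wi R(6)[OF mC Vj] R(6)[OF \<kappa>C Vj]] by (simp only:)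
      also have "ell2_inner I (W i) (\<pi> (?\<kappa> i j) (V j))
          = (\<Sum>l\<in>F'. corner i j (d l) * ell2_inner I (\<pi> (p l) (W i)) (\<pi> (p l) (V j)))"
      proof -
        have "\<pi> (?\<kappa> i j) (V j) = (\<lambda>m. \<Sum>l\<in>F'. \<pi> (\<lambda>\<gamma>. corner i j (d l) * convolution G (p l) (p l) \<gamma>) (V j) m)"
          by (rule rep_sum[OF \<pi> Cc_scale[OF ppC] Vj])
        also have "\<dots> = (\<lambda>m. \<Sum>l\<in>F'. corner i j (d l) * \<pi> (p l) (\<pi> (p l) (V j)) m)"
          by (intro ext sum.cong refl) (simp add: R(3)[OF ppC Vj] R(4)[OF p(1) p(1) Vj])
        finally have "ell2_inner I (W i) (\<pi> (?\<kappa> i j) (V j))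
            = (\<Sum>l\<in>F'. ell2_inner I (W i) (\<lambda>m. corner i j (d l) * \<pi> (p l) (\<pi> (p l) (V j)) m))"
          by (simp only:) (rule ell2_inner_sum_right[OF Wi], intro ell2_scale pin Vj)
        also have "\<dots> = (\<Sum>l\<in>F'. corner i j (d l) * ell2_inner I (\<pi> (p l) (W i)) (\<pi> (p l) (V j)))"
        proof (rule sum.cong[OF refl])
          fix l assume l: "l \<in> F'"
          show "ell2_inner I (W i) (\<lambda>m. corner i j (d l) * \<pi> (p l) (\<pi> (p l) (V j)) m)
              = corner i j (d l) * ell2_inner I (\<pi> (p l) (W i)) (\<pi> (p l) (V j))"
            using R(5)[OF p(1)[OF l] Wi pin[OF l Vj]] by (simp only: ell2_inner_scale_right p(2)[OF l])
        qed
        finally show ?thesis .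
      qed
      finally show ?thesis .
    qed
    have small: "cmod (ell2_inner I (W i) (\<pi> (\<lambda>\<gamma>. corner i j \<gamma> + (-1) * ?\<kappa> i j \<gamma>) (V j))) \<le> \<epsilon> * c" if ij: "i \<in> F" "j \<in> F" for i j
    proof -
      have mC: "(\<lambda>\<gamma>. corner i j \<gamma> + (-1) * ?\<kappa> i j \<gamma>) \<in> Cc G" by (intro Cc_add corner_Cc ij Cc_scale \<kappa>C)
      note Vj = WV(2)[OF ij(2)] and Wi = WV(1)[OF ij(1)]
      have \<kappa>eq: "?\<kappa> i j \<gamma> = (\<Sum>l\<in>F'. of_real ((\<psi> l \<gamma>)\<^sup>2) * corner i j (d l))" for \<gamma>
        by (rule sum.cong[OF refl]) (simp only: pp mult.commute)
      have "ell2_norm I (\<pi> (\<lambda>\<gamma>. corner i j \<gamma> + (-1) * ?\<kappa> i j \<gamma>) (V j)) \<le> \<epsilon> * ell2_norm I (V j)"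
      proof (rule rep_bound_units[OF \<pi> mC _ _ Vj])
        show "corner i j \<gamma> + (-1) * ?\<kappa> i j \<gamma> = 0" if "\<gamma> \<notin> units G" for \<gamma>
          unfolding \<kappa>eq using corner_units[OF that] \<psi>0[OF _ that] by simp
        show "cmod (corner i j \<gamma> + (-1) * ?\<kappa> i j \<gamma>) \<le> \<epsilon>" for \<gamma>
          unfolding \<kappa>eq using close[OF ij, of \<gamma>] by simp
      qed
      then have "ell2_norm I (W i) * ell2_norm I (\<pi> (\<lambda>\<gamma>. corner i j \<gamma> + (-1) * ?\<kappa> i j \<gamma>) (V j))
          \<le> ell2_norm I (W i) * (\<epsilon> * ell2_norm I (V j))" by (rule mult_left_mono) simp
      also have "\<dots> = \<epsilon> * (ell2_norm I (W i) * ell2_norm I (V j))" by simp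
      also have "\<dots> \<le> \<epsilon> * c" using \<epsilon> nWV[OF ij] by (intro mult_left_mono) auto
      finally show ?thesis using ell2_Cauchy_Schwarz[OF Wi R(6)[OF mC Vj]] by linarith
    qed
    \<comment> \<open>At a fixed \<open>l\<close> the corners are scalars, and the bound at the point \<open>d l\<close> applies.\<close>
    have level: "cmod (\<Sum>i\<in>F. \<Sum>j\<in>F. corner i j (d l) * ell2_inner I (\<pi> (p l) (W i)) (\<pi> (p l) (V j)))
        \<le> C / 2 * ((\<Sum>i\<in>F. (ell2_norm I (\<pi> (p l) (W i)))\<^sup>2) + (\<Sum>j\<in>F. (ell2_norm I (\<pi> (p l) (V j)))\<^sup>2))" if l: "l \<in> F'" for l
    proof (rule ell2_form_bound)
      note x = D(2)[OF dD[OF l]]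
      show "cmod (\<Sum>i\<in>F. \<Sum>j\<in>F. cnj (s i) * corner i j (d l) * t j)
          \<le> C / 2 * ((\<Sum>i\<in>F. (cmod (s i))\<^sup>2) + (\<Sum>j\<in>F. (cmod (t j))\<^sup>2))" for s t
        using x by (intro corner_form_bound C) simp_all
    qed (use pin[OF l] WV PD(1) in auto)
    have "(\<Sum>i\<in>F. \<Sum>j\<in>F. ell2_inner I (W i) (\<pi> (corner i j) (V j)))
        = (\<Sum>i\<in>F. \<Sum>j\<in>F. ell2_inner I (W i) (\<pi> (\<lambda>\<gamma>. corner i j \<gamma> + (-1) * ?\<kappa> i j \<gamma>) (V j)))
          + (\<Sum>i\<in>F. \<Sum>j\<in>F. \<Sum>l\<in>F'. corner i j (d l) * ell2_inner I (\<pi> (p l) (W i)) (\<pi> (p l) (V j)))"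
      unfolding sum.distrib[symmetric] by (intro sum.cong refl split)
    also have "(\<Sum>i\<in>F. \<Sum>j\<in>F. \<Sum>l\<in>F'. corner i j (d l) * ell2_inner I (\<pi> (p l) (W i)) (\<pi> (p l) (V j)))
        = (\<Sum>i\<in>F. \<Sum>l\<in>F'. \<Sum>j\<in>F. corner i j (d l) * ell2_inner I (\<pi> (p l) (W i)) (\<pi> (p l) (V j)))"
      by (rule sum.cong[OF refl]) (rule sum.swap)
    also have "\<dots> = (\<Sum>l\<in>F'. \<Sum>i\<in>F. \<Sum>j\<in>F. corner i j (d l) * ell2_inner I (\<pi> (p l) (W i)) (\<pi> (p l) (V j)))"
      by (rule sum.swap)
    finally have "cmod (\<Sum>i\<in>F. \<Sum>j\<in>F. ell2_inner I (W i) (\<pi> (corner i j) (V j)))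
        \<le> cmod (\<Sum>i\<in>F. \<Sum>j\<in>F. ell2_inner I (W i) (\<pi> (\<lambda>\<gamma>. corner i j \<gamma> + (-1) * ?\<kappa> i j \<gamma>) (V j)))
          + cmod (\<Sum>l\<in>F'. \<Sum>i\<in>F. \<Sum>j\<in>F. corner i j (d l) * ell2_inner I (\<pi> (p l) (W i)) (\<pi> (p l) (V j)))"
      by (simp only: norm_triangle_ineq)
    also have "\<dots> \<le> (\<Sum>i\<in>F. \<Sum>j\<in>F. \<epsilon> * c)
        + (\<Sum>l\<in>F'. C / 2 * ((\<Sum>i\<in>F. (ell2_norm I (\<pi> (p l) (W i)))\<^sup>2) + (\<Sum>j\<in>F. (ell2_norm I (\<pi> (p l) (V j)))\<^sup>2)))"
      by (rule add_mono) (rule sum_norm_le, rule sum_norm_le, rule small, assumption, assumption, rule sum_norm_le, rule level, assumption)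
    also have "(\<Sum>l\<in>F'. C / 2 * ((\<Sum>i\<in>F. (ell2_norm I (\<pi> (p l) (W i)))\<^sup>2) + (\<Sum>j\<in>F. (ell2_norm I (\<pi> (p l) (V j)))\<^sup>2)))
        = C / 2 * ((\<Sum>i\<in>F. \<Sum>l\<in>F'. (ell2_norm I (\<pi> (p l) (W i)))\<^sup>2) + (\<Sum>j\<in>F. \<Sum>l\<in>F'. (ell2_norm I (\<pi> (p l) (V j)))\<^sup>2))"
      unfolding sum_distrib_left[symmetric] sum.distrib
      by (intro arg_cong2[where f="(*)"] arg_cong2[where f="(+)"] refl) (rule sum.swap)+
    also have "(\<Sum>i\<in>F. \<Sum>j\<in>F. \<epsilon> * c)
        + C / 2 * ((\<Sum>i\<in>F. \<Sum>l\<in>F'. (ell2_norm I (\<pi> (p l) (W i)))\<^sup>2) + (\<Sum>j\<in>F. \<Sum>l\<in>F'. (ell2_norm I (\<pi> (p l) (V j)))\<^sup>2))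
        \<le> (\<Sum>i\<in>F. \<Sum>j\<in>F. \<epsilon> * c) + C / 2 * (c + c)"
    proof (intro add_left_mono mult_left_mono add_mono)
      show "(\<Sum>i\<in>F. \<Sum>l\<in>F'. (ell2_norm I (\<pi> (p l) (W i)))\<^sup>2) \<le> c"
        by (rule order_trans[OF sum_mono Wsum]) (rule prow[OF WV(1)])
      show "(\<Sum>j\<in>F. \<Sum>l\<in>F'. (ell2_norm I (\<pi> (p l) (V j)))\<^sup>2) \<le> c"
        by (rule order_trans[OF sum_mono Vsum]) (rule prow[OF WV(2)])
    qed (use C(2) in simp)
    also have "(\<Sum>i\<in>F. \<Sum>j\<in>F. \<epsilon> * c) + C / 2 * (c + c) = C * c + \<epsilon> * (real (card F) * (real (card F) * c))"
      by (simp add: mult_ac)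
    finally show ?thesis .
  qed
  show ?thesis
    unfolding expand
  proof (rule field_le_epsilon)
    fix e :: real assume e: "0 < e"
    let ?N = "real (card F) * (real (card F) * c)"
    have N: "0 \<le> ?N" using c_nonneg by simp
    have "cmod (\<Sum>i\<in>F. \<Sum>j\<in>F. ell2_inner I (W i) (\<pi> (corner i j) (V j))) \<le> C * c + e / (?N + 1) * ?N"
      using N e by (intro approx) simp
    also have "e / (?N + 1) * ?N \<le> e" using N e by (simp add: field_simps)
    finally show "cmod (\<Sum>i\<in>F. \<Sum>j\<in>F. ell2_inner I (W i) (\<pi> (corner i j) (V j))) \<le> C * c + e" by simp
  qed
qed

lemma compressed_product_Cc: "(\<lambda>\<gamma>. of_real (coefficient \<xi> \<gamma>) * f \<gamma>) \<in> Cc G"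
  unfolding product_factorisation
  by (intro Cc_sum convolution_Cc involution_Cc piece_Cc corner_Cc)

end

end

text \<open>
  Square roots turn asymptotic invariance in \<open>\<ell>\<^sup>1\<close> into asymptotic invariance in \<open>\<ell>\<^sup>2\<close>: for
  \<open>p, q \<ge> 0\<close> one has \<open>\<bar>p q - p\<^sup>2\<bar> \<le> \<bar>q\<^sup>2 - p\<^sup>2\<bar>\<close>. The cutoff \<open>\<kappa>\<close> on the unit space is needed because
  amenability controls the sums over the range fibres on compact sets of units only.
\<close>

lemma amenable_weight:
  assumes am: "topologically_amenable G" and K: "compactin T K" and \<epsilon>: "0 < \<epsilon>"
  shows "\<exists>\<xi>. \<xi> \<in> Cc G \<and> (\<forall>\<gamma>. 0 \<le> \<xi> \<gamma>) \<and>
    (\<forall>x Q. finite Q \<longrightarrow> Q \<subseteq> range_fibre G x \<longrightarrow> (\<Sum>\<beta>\<in>Q. (\<xi> \<beta>)\<^sup>2) \<le> 1 + \<epsilon>) \<and>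
    (\<forall>\<alpha>\<in>K. \<bar>coefficient \<xi> \<alpha> - 1\<bar> \<le> \<epsilon>)"
proof -
  have Ka: "K \<subseteq> arrows G" using compactin_subset_topspace[OF K] by (simp add: topspace_T)
  let ?X = "grng G ` K \<union> gsrc G ` K"
  have X: "compactin T ?X" by (intro compactin_Un image_compactin[OF K] continuous_rng continuous_src)
  have "?X \<subseteq> units G" using Ka rng_unit src_unit by auto
  from Urysohn_compact_support[OF locally_compact hausdorff X this open_units]
  obtain \<kappa> :: "'g \<Rightarrow> real" and M where \<kappa>: "continuous_map T euclidean \<kappa> \<and> (\<forall>x. 0 \<le> \<kappa> x \<and> \<kappa> x \<le> 1) \<and>
      (\<forall>x\<in>?X. \<kappa> x = 1) \<and> compactin T M \<and> M \<subseteq> units G \<and> (\<forall>x. x \<notin> M \<longrightarrow> \<kappa> x = 0)"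
    by (elim exE) (rule that)
  then have M: "compactin (unit_space G) M" by (simp add: unit_space_def compactin_subtopology)
  from am[unfolded topologically_amenable_def, rule_format, of M K "\<epsilon> / 2"] M K \<epsilon>
  obtain g where g: "g \<in> Cc G" "\<forall>\<gamma>. 0 \<le> (g \<gamma> :: real)"
      "\<forall>x\<in>M. \<bar>(\<Sum>\<^sub>\<infinity>\<gamma>\<in>range_fibre G x. g \<gamma>) - 1\<bar> < \<epsilon> / 2"
      "\<forall>\<alpha>\<in>K. (\<Sum>\<^sub>\<infinity>\<gamma>\<in>range_fibre G (grng G \<alpha>). \<bar>g (gcomp G (ginv G \<alpha>) \<gamma>) - g \<gamma>\<bar>) < \<epsilon> / 2"
    by auto
  define \<xi> where "\<xi> \<gamma> = \<kappa> (grng G \<gamma>) * sqrt (g \<gamma>)" for \<gamma>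
  have "continuous_map T euclidean (\<kappa> \<circ> grng G)"
    using \<kappa> continuous_map_compose[OF continuous_rng] by blast
  moreover have "(\<lambda>\<gamma>. sqrt (g \<gamma>)) \<in> Cc G" by (rule Cc_compose[OF _ _ g(1)]) (auto intro: continuous_intros)
  ultimately have \<xi>C: "\<xi> \<in> Cc G" unfolding \<xi>_def[abs_def] using Cc_mult[of "\<kappa> \<circ> grng G"] by simp
  have sums: "(\<Sum>\<beta>\<in>Q. (\<xi> \<beta>)\<^sup>2) \<le> 1 + \<epsilon>" if Q: "finite Q" "Q \<subseteq> range_fibre G x" for x Q
  proof -
    have "(\<Sum>\<beta>\<in>Q. (\<xi> \<beta>)\<^sup>2) = (\<Sum>\<beta>\<in>Q. (\<kappa> x)\<^sup>2 * g \<beta>)"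
      by (rule sum.cong[OF refl]) (use Q(2) g(2) in \<open>auto simp: \<xi>_def range_fibre_iff power_mult_distrib\<close>)
    also have "\<dots> = (\<kappa> x)\<^sup>2 * (\<Sum>\<beta>\<in>Q. g \<beta>)" by (simp add: sum_distrib_left)
    also have "\<dots> \<le> 1 + \<epsilon>"
    proof (cases "x \<in> M")
      case True
      let ?S = "Q \<union> {\<beta> \<in> range_fibre G x. g \<beta> \<noteq> 0}"
      have S: "finite ?S" using Q(1) finite_range_fibre_support[OF g(1)] by simp
      have "(\<Sum>\<^sub>\<infinity>\<beta>\<in>range_fibre G x. g \<beta>) = (\<Sum>\<beta>\<in>?S. g \<beta>)"
        by (rule infsum_eq_sum_support[OF S]) (use Q(2) in auto)
      moreover have "(\<Sum>\<beta>\<in>Q. g \<beta>) \<le> (\<Sum>\<beta>\<in>?S. g \<beta>)" by (rule sum_mono2[OF S]) (use g(2) in auto)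
      moreover have "\<bar>(\<Sum>\<^sub>\<infinity>\<beta>\<in>range_fibre G x. g \<beta>) - 1\<bar> < \<epsilon> / 2" using g(3) True by blast
      ultimately have "(\<Sum>\<beta>\<in>Q. g \<beta>) \<le> 1 + \<epsilon>" using \<epsilon> by linarith
      moreover have "0 \<le> (\<Sum>\<beta>\<in>Q. g \<beta>)" using g(2) by (simp add: sum_nonneg)
      moreover have "(\<kappa> x)\<^sup>2 \<le> 1" using \<kappa> by (simp add: power_le_one_iff)
      ultimately have "(\<kappa> x)\<^sup>2 * (\<Sum>\<beta>\<in>Q. g \<beta>) \<le> 1 * (1 + \<epsilon>)" by (intro mult_mono) auto
      then show ?thesis by simp
    next
      case False
      then show ?thesis using \<kappa> \<epsilon> by simp
    qed
    finally show ?thesis .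
  qed
  have near: "\<bar>coefficient \<xi> \<alpha> - 1\<bar> \<le> \<epsilon>" if \<alpha>K: "\<alpha> \<in> K" for \<alpha>
  proof -
    have \<alpha>: "\<alpha> \<in> arrows G" using \<alpha>K Ka by blast
    let ?R = "range_fibre G (grng G \<alpha>)" and ?t = "\<lambda>\<beta>. gcomp G (ginv G \<alpha>) \<beta>"
    have \<kappa>1: "\<kappa> (grng G \<alpha>) = 1" "\<kappa> (gsrc G \<alpha>) = 1" using \<kappa> \<alpha>K by auto
    then have "grng G \<alpha> \<in> M" using \<kappa> by (metis zero_neq_one)
    then have total: "\<bar>(\<Sum>\<^sub>\<infinity>\<gamma>\<in>?R. g \<gamma>) - 1\<bar> < \<epsilon> / 2" using g(3) by blast
    have t: "?t \<beta> \<in> arrows G \<and> grng G (?t \<beta>) = gsrc G \<alpha>" if "\<beta> \<in> ?R" for \<beta>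
      using inv_comp_arrow[OF \<alpha>, of \<beta>] that by (simp add: range_fibre_iff)
    have "inj_on ?t ?R"
      by (rule inj_on_inverseI[of _ "gcomp G \<alpha>"]) (use cancel_left[OF \<alpha>] in \<open>simp add: range_fibre_iff\<close>)
    then have "inj_on ?t {\<beta> \<in> ?R. g (?t \<beta>) \<noteq> 0}" by (rule inj_on_subset) auto
    then have "finite {\<beta> \<in> ?R. g (?t \<beta>) \<noteq> 0}"
      by (rule inj_on_finite[OF _ _ finite_range_fibre_support[OF g(1), of "gsrc G \<alpha>"]])
        (use t in \<open>auto simp: range_fibre_iff\<close>)
    then have S: "finite ({\<beta> \<in> ?R. g \<beta> \<noteq> 0} \<union> {\<beta> \<in> ?R. g (?t \<beta>) \<noteq> 0})" (is "finite ?S")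
      using finite_range_fibre_support[OF g(1)] by simp
    have \<xi>R: "\<xi> \<beta> = sqrt (g \<beta>) \<and> \<xi> (?t \<beta>) = sqrt (g (?t \<beta>))" if "\<beta> \<in> ?R" for \<beta>
      using that t[OF that] \<kappa>1 by (simp add: \<xi>_def range_fibre_iff)
    have "coefficient \<xi> \<alpha> = (\<Sum>\<beta>\<in>?S. \<xi> \<beta> * \<xi> (?t \<beta>))"
      unfolding coefficient_def by (rule sum.mono_neutral_left[OF S]) (use \<xi>R in auto)
    also have "\<dots> = (\<Sum>\<beta>\<in>?S. sqrt (g \<beta>) * sqrt (g (?t \<beta>)))"
      by (rule sum.cong[OF refl]) (use \<xi>R in auto)
    finally have coeff: "coefficient \<xi> \<alpha> - (\<Sum>\<beta>\<in>?S. g \<beta>) = (\<Sum>\<beta>\<in>?S. sqrt (g \<beta>) * sqrt (g (?t \<beta>)) - g \<beta>)"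
      by (simp add: sum_subtractf)
    have "\<bar>\<Sum>\<beta>\<in>?S. sqrt (g \<beta>) * sqrt (g (?t \<beta>)) - g \<beta>\<bar> \<le> (\<Sum>\<beta>\<in>?S. \<bar>g (?t \<beta>) - g \<beta>\<bar>)"
    proof (rule order_trans[OF sum_abs sum_mono])
      fix \<beta>
      define p q where "p = sqrt (g \<beta>)" and "q = sqrt (g (?t \<beta>))"
      have pq: "0 \<le> p" "0 \<le> q" "g \<beta> = p * p" "g (?t \<beta>) = q * q" using g(2) by (simp_all add: p_def q_def)
      have "\<bar>p * q - p * p\<bar> = p * \<bar>q - p\<bar>" using pq(1) by (simp add: abs_mult flip: right_diff_distrib)
      also have "\<dots> \<le> (q + p) * \<bar>q - p\<bar>" using pq by (intro mult_right_mono) auto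
      also have "\<dots> = \<bar>(q + p) * (q - p)\<bar>" using pq by (simp add: abs_mult)
      also have "(q + p) * (q - p) = q * q - p * p" by (simp add: algebra_simps)
      finally show "\<bar>sqrt (g \<beta>) * sqrt (g (?t \<beta>)) - g \<beta>\<bar> \<le> \<bar>g (?t \<beta>) - g \<beta>\<bar>"
        by (simp add: pq(3,4) real_sqrt_mult_self pq(1,2) abs_of_nonneg)
    qed
    also have "\<dots> = (\<Sum>\<^sub>\<infinity>\<gamma>\<in>?R. \<bar>g (?t \<gamma>) - g \<gamma>\<bar>)"
      by (rule infsum_eq_sum_support[symmetric, OF S]) auto
    also have "\<dots> < \<epsilon> / 2" using g(4) \<alpha>K by blast
    finally have "\<bar>coefficient \<xi> \<alpha> - (\<Sum>\<beta>\<in>?S. g \<beta>)\<bar> < \<epsilon> / 2" unfolding coeff .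
    moreover have "(\<Sum>\<^sub>\<infinity>\<gamma>\<in>?R. g \<gamma>) = (\<Sum>\<beta>\<in>?S. g \<beta>)" by (rule infsum_eq_sum_support[OF S]) auto
    ultimately show ?thesis using total by linarith
  qed
  have "\<forall>\<gamma>. 0 \<le> \<xi> \<gamma>" using \<kappa> g(2) by (simp add: \<xi>_def)
  then show ?thesis using \<xi>C sums near by (intro exI[of _ \<xi>]) blast
qed

text \<open>
  In an arbitrary representation, \<open>f\<close> is split into its product with the coefficient of an
  amenable weight, which is controlled by the finite-dimensional representations, and a
  remainder that is uniformly small on the support of \<open>f\<close>.
\<close>

lemma norm_by_finite_dim:
  assumes am: "topologically_amenable G"
    and D: "dense_in (unit_space G) {x \<in> units G. periodic G x \<and> maximally_almost_periodic (isotropy G x)}"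
    and f: "f \<in> Cc G" and C: "finite_dim_bound CA f C" "0 \<le> C"
  shows "CA.unorm f \<le> C"
proof (rule CA.universal_norm_le)
  fix I \<pi> v assume \<pi>: "hilbert_representation CA I \<pi>" and v: "v \<in> ell2 I" "ell2_norm I v \<le> 1"
  note R = hilbert_representationD[OF \<pi>, simplified]
  obtain K where K: "compactin T K" "\<And>\<gamma>. \<gamma> \<notin> K \<Longrightarrow> f \<gamma> = 0" using CcE[OF f] by blast
  obtain M where M: "0 < M" "\<And>\<gamma>. cmod (f \<gamma>) \<le> M" using Cc_bounded[OF f] by blast
  obtain N where N: "\<forall>f\<in>Cc G. \<forall>M I \<pi>. \<forall>v\<in>ell2 I. (\<forall>\<gamma>. \<gamma> \<notin> K \<longrightarrow> f \<gamma> = 0) \<longrightarrow> (\<forall>\<gamma>. cmod (f \<gamma>) \<le> M) \<longrightarrow>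
     hilbert_representation CA I \<pi> \<longrightarrow> ell2_norm I (\<pi> f v) \<le> real N * M * ell2_norm I v"
    using rep_bound_compact[OF K(1)] by (elim exE) (rule that)
  show "ell2_norm I (\<pi> f v) \<le> C"
  proof (rule ell2_norm_le_by_duality[OF R(6)[OF f v(1)] C(2)], rule field_le_epsilon)
    fix w and e :: real assume w: "w \<in> ell2 I" "ell2_norm I w \<le> 1" and e: "0 < e"
    \<comment> \<open>The errors add up to \<open>\<epsilon> (C + N M)\<close>; the summand \<open>1\<close> excludes division by \<open>0\<close>.\<close>
    define \<epsilon> where "\<epsilon> = e / (C + real N * M + 1)"
    have pos: "0 < C + real N * M + 1" using C(2) M(1) by (simp add: add_nonneg_pos)
    have \<epsilon>: "0 < \<epsilon>" unfolding \<epsilon>_def using e pos by (rule divide_pos_pos)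
    have "\<epsilon> * (C + real N * M + 1) = e" using pos by (simp add: \<epsilon>_def)
    then have small: "\<epsilon> * C + \<epsilon> * (real N * M) \<le> e" using \<epsilon> by (simp add: algebra_simps)
    obtain \<xi> where \<xi>: "\<xi> \<in> Cc G \<and> (\<forall>\<gamma>. 0 \<le> \<xi> \<gamma>) \<and>
        (\<forall>x Q. finite Q \<longrightarrow> Q \<subseteq> range_fibre G x \<longrightarrow> (\<Sum>\<beta>\<in>Q. (\<xi> \<beta>)\<^sup>2) \<le> 1 + \<epsilon>) \<and>
        (\<forall>\<alpha>\<in>K. \<bar>coefficient \<xi> \<alpha> - 1\<bar> \<le> \<epsilon>)"
      using amenable_weight[OF am K(1) \<epsilon>] by (elim exE) (rule that)
    then have \<xi>C: "\<xi> \<in> Cc G" and \<xi>0: "\<And>\<gamma>. 0 \<le> \<xi> \<gamma>"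
      and \<xi>s: "\<And>x Q. finite Q \<Longrightarrow> Q \<subseteq> range_fibre G x \<Longrightarrow> (\<Sum>\<beta>\<in>Q. (\<xi> \<beta>)\<^sup>2) \<le> 1 + \<epsilon>"
      and \<xi>1: "\<And>\<alpha>. \<alpha> \<in> K \<Longrightarrow> \<bar>coefficient \<xi> \<alpha> - 1\<bar> \<le> \<epsilon>" by simp_all
    obtain L where L: "compactin T L" "\<And>\<gamma>. \<gamma> \<notin> L \<Longrightarrow> \<xi> \<gamma> = 0" using CcE[OF \<xi>C] by blast
    obtain F B \<phi> L' where "(\<forall>i\<in>F. bisection (B i)) \<and> partition_of_squares T L B F \<phi> L'"
      using bisection_partition[OF L(1)] by (elim exE) (rule that)
    then have B: "\<And>i. i \<in> F \<Longrightarrow> bisection (B i)" and P: "partition_of_squares T L B F \<phi> L'" by simp_all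
    define g where "g \<gamma> = of_real (coefficient \<xi> \<gamma>) * f \<gamma>" for \<gamma>
    have gC: "g \<in> Cc G" unfolding g_def[abs_def] by (rule compressed_product_Cc[OF f B P \<xi>C \<xi>0 L(2) \<xi>s])
    have g_bound: "cmod (ell2_inner I w (\<pi> g v)) \<le> C * (1 + \<epsilon>)"
      unfolding g_def[abs_def]
      by (rule compressed_product_bound[OF f B P \<xi>C \<xi>0 L(2) \<xi>s D _ C \<pi> v w]) simp_all
    let ?d = "\<lambda>\<gamma>. f \<gamma> + (-1) * g \<gamma>"
    have dC: "?d \<in> Cc G" by (intro Cc_add f Cc_scale gC)
    have d0: "\<forall>\<gamma>. \<gamma> \<notin> K \<longrightarrow> ?d \<gamma> = 0" by (simp add: g_def K(2))
    have dM: "\<forall>\<gamma>. cmod (?d \<gamma>) \<le> \<epsilon> * M"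
    proof
      fix \<gamma>
      show "cmod (?d \<gamma>) \<le> \<epsilon> * M"
      proof (cases "\<gamma> \<in> K")
        case True
        have "?d \<gamma> = of_real (1 - coefficient \<xi> \<gamma>) * f \<gamma>" by (simp add: g_def algebra_simps)
        then have "cmod (?d \<gamma>) = \<bar>coefficient \<xi> \<gamma> - 1\<bar> * cmod (f \<gamma>)"
          by (simp only: norm_mult norm_of_real abs_minus_commute)
        also have "\<dots> \<le> \<epsilon> * M" using \<xi>1[OF True] M(2) \<epsilon> by (intro mult_mono) auto
        finally show ?thesis .
      next
        case False
        then have "?d \<gamma> = 0" using d0 by blast
        then show ?thesis using \<epsilon> M(1) by simp
      qed
    qed
    have "ell2_norm I (\<pi> ?d v) \<le> real N * (\<epsilon> * M) * ell2_norm I v"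
      by (rule N[rule_format, OF dC v(1) _ _ \<pi>]) (use d0 dM in simp_all)
    also have "\<dots> \<le> real N * (\<epsilon> * M) * 1" using v(2) \<epsilon> M(1) by (intro mult_left_mono) auto
    finally have dn: "ell2_norm I (\<pi> ?d v) \<le> \<epsilon> * (real N * M)" by (simp add: mult_ac)
    have "cmod (ell2_inner I w (\<pi> ?d v)) \<le> ell2_norm I w * ell2_norm I (\<pi> ?d v)"
      by (rule ell2_Cauchy_Schwarz[OF w(1) R(6)[OF dC v(1)]])
    also have "\<dots> \<le> 1 * ell2_norm I (\<pi> ?d v)" by (intro mult_right_mono w(2)) simp
    also have "\<dots> \<le> \<epsilon> * (real N * M)" using dn by simp
    finally have d_bound: "cmod (ell2_inner I w (\<pi> ?d v)) \<le> \<epsilon> * (real N * M)" .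
    have "f = (\<lambda>\<gamma>. ?d \<gamma> + g \<gamma>)" by (simp add: fun_eq_iff)
    then have "\<pi> f v = \<pi> (\<lambda>\<gamma>. ?d \<gamma> + g \<gamma>) v" by (rule arg_cong)
    also have "\<dots> = (\<lambda>i. \<pi> ?d v i + \<pi> g v i)" by (rule R(2)[OF dC gC v(1)])
    finally have "\<pi> f v = (\<lambda>i. \<pi> ?d v i + \<pi> g v i)" .
    then have "ell2_inner I w (\<pi> f v) = ell2_inner I w (\<pi> ?d v) + ell2_inner I w (\<pi> g v)"
      by (simp only: ell2_inner_add_right[OF w(1) R(6)[OF dC v(1)] R(6)[OF gC v(1)]])
    then have "cmod (ell2_inner I w (\<pi> f v)) \<le> cmod (ell2_inner I w (\<pi> ?d v)) + cmod (ell2_inner I w (\<pi> g v))"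
      by (simp only: norm_triangle_ineq)
    also have "\<dots> \<le> \<epsilon> * (real N * M) + C * (1 + \<epsilon>)" by (rule add_mono[OF d_bound g_bound])
    also have "\<dots> \<le> C + e" using small by (simp add: algebra_simps)
    finally show "cmod (ell2_inner I w (\<pi> f v)) \<le> C + e" .
  qed
qed

lemma rfd_of_dense_map:
  assumes "topologically_amenable G"
    and "dense_in (unit_space G) {x \<in> units G. periodic G x \<and> maximally_almost_periodic (isotropy G x)}"
  shows "residually_finite_dimensional (full_cstar_algebra G)"
  unfolding full_cstar_algebra_def
proof (rule CA.residually_finite_dimensional_completionI)
  fix f C assume "f \<in> acar CA" "0 \<le> C"
    and "\<And>n \<pi> v. matrix_representation CA n \<pi> \<Longrightarrow> v \<in> ell2 {..<n} \<Longrightarrow>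
      ell2_norm {..<n} (matrix_operator {..<n} (\<lambda>i j. \<pi> f $$ (i, j)) v) \<le> C * ell2_norm {..<n} v"
  then show "CA.unorm f \<le> C"
    by (intro norm_by_finite_dim[OF assms]) (simp_all add: finite_dim_bound_def)
qed

end

theorem theoremC:
  fixes G :: "'g groupoid"
  assumes "etale_groupoid G"
    and "topologically_amenable G"
  shows "(residually_finite_dimensional (full_cstar_algebra G) \<longrightarrow>
            dense_in (unit_space G) {x \<in> units G. periodic G x}) \<and>
         (dense_in (unit_space G)
              {x \<in> units G. periodic G x \<and> maximally_almost_periodic (isotropy G x)} \<longrightarrow>
            residually_finite_dimensional (full_cstar_algebra G))"
proof -
  interpret etale_groupoid G by fact
  show ?thesis using dense_periodic_of_rfd rfd_of_dense_map[OF assms(2)] by blast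
qed

end
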